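(* Let $X\subset\mathbb P^n$ be a curve whose restriction to the torus $T$ is the complete intersection of hypersurfaces $X_1,\dots,X_{n-1}\subset T$, $X_i=V(f_i)$. Assume that $X_1,\dots,X_{n-1}$ form a tropical complete intersection, and that for every $i$ and every codimension one cell of $\operatorname{Trop}(X_i)$, $f_i$ has exactly three terms of minimal valuation at points tropicalizing to its relative interior. Fix an edge $E$ of $\operatorname{Trop}(X)$. Suppose that for each $J\subset\{0,\dots,n\}$ of size $2$, either $\langle E\rangle\cap\langle\overline J\rangle=\{0\}$ or $\langle\operatorname{Trop}(X)\rangle\subset\langle\overline J\rangle$. Let $L\subset(\mathbb K^{n+1})^*$ be the row span of $\mathbf v$ (viewed as an $(n-1)\times(n+1)$ matrix with entries in $\mathbb K$) and $L^\perp\subset\mathbb K^{n+1}$ its orthogonal complement. Then the contribution of $E$ to $\operatorname{Trop}(X^* )$ consists of $$-E+\operatorname{Trop}(\mathbb P(L)),$$ and the contribution of $E$ to $\operatorname{Trop}(\tau(X))$ consists of $$E+\operatorname{Trop}(\mathbb P(L^\perp)).$$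
   Context: $\mathbb K$ is an algebraically closed field of characteristic zero with a nontrivial non-Archimedean valuation $\operatorname{val}:\mathbb K\to\mathbb R\cup\{\infty\}$, $\operatorname{val}(0)=\infty$, with $\operatorname{val}(m)=0$ for nonzero integers $m$. $T\subset\mathbb P^n$ is the torus where all coordinates are nonzero, $M=\{w\in\mathbb Z^{n+1}:\sum w_i=0\}$ its character lattice, $\mathbb T^n=\mathbb R^{n+1}/\mathbb R(1,\dots,1)$ with $e_0,\dots,e_n$ the images of the standard basis; $(\mathbb T^n)^*=\mathbb R^{n+1}/\mathbb R(1,\dots,1)$ is the analogous space for $(\mathbb P^n)^*$, identified coordinatewise with $\mathbb T^n$. $\operatorname{Trop}$ is coordinatewise valuation, and $\operatorname{Trop}(Y)$ is the closure of the image of the part of $Y$ in the torus. $\overline J=\{0,\dots,n\}\setminus J$; $\langle J\rangle=\operatorname{span}\{e_i:i\in J\}$; for a subset $S\subset\mathbb T^n$ such as $E$ or $\operatorname{Trop}(X)$, $\langle S\rangle$ is the linear span of all differences of elements of $S$. Sums of sets are Minkowski sums. Cells of $\operatorname{Trop}(X_i)$ are determined by which terms of $f_i$ have minimal valuation. Tropical complete intersection: for all cells $E_i\subset\operatorname{Trop}(X_i)$, $\bigcap E_i$ is empty or of codimension $\sum\operatorname{codim}E_i$; then $\operatorname{Trop}(X)=\bigcap\operatorname{Trop}(X_i)$, with cells the intersections of cells. For the edge $E$, each $f_i$ is multiplied by a monomial so that it has exactly two terms of minimal valuation on the relative interior of $E$, namely $1$ and $c_{i\mathbf v_i}x^{\mathbf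 v_i}$ with $\mathbf v_i\in M$, both of valuation $0$; $\mathbf v=(\mathbf v_1,\dots,\mathbf v_{n-1})$ is the matrix with rows $\mathbf v_i$. $\mathcal G(X)\subset\operatorname{Gr}(2,n+1)$ is the closure of the image of the Gauss map $P\mapsto T_PX$; $\tau(X)$ is the closure of the union of tangent lines at smooth points of $X$, and $X^*\subset(\mathbb P^n)^*$ the closure of the set of hyperplanes containing a tangent line at a smooth point of $X$. Let $\mathcal J$ be the set of $J$, $|J|=2$, with $p_J\equiv0$ on $\mathcal G(X)$. A tropical tangent to $\alpha\in\operatorname{Trop}(X)$ is $\beta=(\operatorname{val}p_J(T_PX))_{J\notin\mathcal J}$ for a smooth $P\in X$ with $\operatorname{Trop}(P)=\alpha$. The contribution of $\alpha$ to $\operatorname{Trop}(X^* )$ is the set of $\gamma\in(\mathbb T^n)^*$ such that for some tropical tangent $\beta$ to $\alpha$ and every $j$, the minimum of $\beta_{ij}+\gamma_i$ over $i\ne j$, $\{i,j\}\notin\mathcal J$, is attained at least twice. The contribution of $\alpha$ to $\operatorname{Trop}(\tau(X))$ is the set of $x\in\mathbb T^n$ such that for some tropical tangent $\beta$ to $\alpha$ and all distinct $i,j,k$ the minimum of $\beta_{ij}+x_k,\ \beta_{ik}+x_j,\ \beta_{jk}+x_i$ (terms with index in $\mathcal J$ omitted) is attained at least twice (no condition if all three terms are omitted). The contribution of the edge $E$ is the closure of the union of the contributions of the points in its relative interior. *)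

theory Defs
  imports "HOL-Analysis.Analysis" "HOL-Library.Poly_Mapping" "HOL-Computational_Algebra.Polynomial"
begin

text \<open>
  Conventions. The coordinates \<open>0, \<dots>, n\<close> are indexed by a finite type \<open>'n\<close> with \<open>n + 1\<close> elements.

  \<^item> A subset of projective space is represented by the set of all homogeneous coordinate vectors
    of its points: a set of nonzero vectors, stable under nonzero scalars.
  \<^item> A subset of \<open>\<real>\<^sup>n\<^sup>+\<^sup>1 / \<real>(1,\<dots>,1)\<close> is represented by its preimage in \<open>real ^ 'n\<close>. The quotient map is
    open, so closures and relative interiors correspond, codimensions agree, and dimensions in
    \<open>real ^ 'n\<close> are larger by one. The zero subspace of the quotient corresponds to \<open>span {1}\<close>,
    where \<open>1\<close> is the vector with all entries 1.
  \<^item> Laurent polynomials are finitely supported maps from exponent vectors to coefficients.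
    Polynomials are the Laurent polynomials with nonnegative exponents.
\<close>

section \<open>Valuations\<close>

definition nonarch_valuation :: "('k::field \<Rightarrow> ereal) \<Rightarrow> bool" where
  "nonarch_valuation val \<longleftrightarrow>
     (\<forall>x. val x \<noteq> -\<infinity>) \<and> (\<forall>x. val x = \<infinity> \<longleftrightarrow> x = 0) \<and>
     (\<forall>x y. val (x * y) = val x + val y) \<and>
     (\<forall>x y. min (val x) (val y) \<le> val (x + y)) \<and>
     (\<exists>x. x \<noteq> 0 \<and> val x \<noteq> 0) \<and>
     (\<forall>m::int. m \<noteq> 0 \<longrightarrow> val (of_int m) = 0)"

section \<open>Laurent polynomials and projective varieties\<close>

type_synonym ('n, 'k) laurent = "(int ^ 'n) \<Rightarrow>\<^sub>0 'k"

definition leval :: "('n::finite, 'k::field) laurent \<Rightarrow> 'k ^ 'n \<Rightarrow> 'k" where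
  "leval p x = (\<Sum>u\<in>Poly_Mapping.keys p. Poly_Mapping.lookup p u * (\<Prod>i\<in>UNIV. x $ i powi (u $ i)))"

definition lderiv :: "'n::finite \<Rightarrow> ('n, 'k::field) laurent \<Rightarrow> ('n, 'k) laurent" where
  "lderiv i p = (\<Sum>u\<in>Poly_Mapping.keys p.
     Poly_Mapping.single (u - axis i 1) (of_int (u $ i) * Poly_Mapping.lookup p u))"

definition homogeneous_poly :: "('n::finite, 'k::field) laurent \<Rightarrow> bool" where
  "homogeneous_poly p \<longleftrightarrow>
     (\<exists>d. \<forall>u\<in>Poly_Mapping.keys p. (\<forall>i. 0 \<le> u $ i) \<and> (\<Sum>i\<in>UNIV. u $ i) = d)"

definition proj_closed :: "('k::field ^ 'n::finite) set \<Rightarrow> bool" where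
  "proj_closed Z \<longleftrightarrow>
     (\<exists>S. (\<forall>p\<in>S. homogeneous_poly p) \<and> Z = {x. x \<noteq> 0 \<and> (\<forall>p\<in>S. leval p x = 0)})"

definition zariski_closure :: "('k::field ^ 'n::finite) set \<Rightarrow> ('k ^ 'n) set" where
  "zariski_closure S = \<Inter>{Z. proj_closed Z \<and> S \<subseteq> Z}"

definition proj_irreducible :: "('k::field ^ 'n::finite) set \<Rightarrow> bool" where
  "proj_irreducible Z \<longleftrightarrow> proj_closed Z \<and> Z \<noteq> {} \<and>
     (\<forall>A B. proj_closed A \<and> proj_closed B \<and> Z \<subseteq> A \<union> B \<longrightarrow> Z \<subseteq> A \<or> Z \<subseteq> B)"

definition proj_components :: "('k::field ^ 'n::finite) set \<Rightarrow> ('k ^ 'n) set set" where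
  "proj_components X = {C. proj_irreducible C \<and> C \<subseteq> X \<and>
     (\<forall>D. proj_irreducible D \<and> D \<subseteq> X \<and> C \<subseteq> D \<longrightarrow> D = C)}"

definition proj_dim :: "('k::field ^ 'n::finite) set \<Rightarrow> enat" where
  "proj_dim X = Sup {enat r | r. \<exists>Z :: nat \<Rightarrow> ('k ^ 'n) set.
     (\<forall>j\<le>r. proj_irreducible (Z j) \<and> Z j \<subseteq> X) \<and> (\<forall>j<r. Z j \<subset> Z (Suc j))}"

definition proj_curve :: "('k::field ^ 'n::finite) set \<Rightarrow> bool" where
  "proj_curve X \<longleftrightarrow> proj_closed X \<and> X \<noteq> {} \<and> (\<forall>C\<in>proj_components X. proj_dim C = 1)"

text \<open>The cone over the projective tangent space, cut out by the differentials of the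
  homogeneous ideal of \<open>X\<close>.\<close>

definition tangent_space :: "('k::field ^ 'n::finite) set \<Rightarrow> 'k ^ 'n \<Rightarrow> ('k ^ 'n) set" where
  "tangent_space X P = {y. \<forall>p. homogeneous_poly p \<and> (\<forall>x\<in>X. leval p x = 0) \<longrightarrow>
     (\<Sum>i\<in>UNIV. leval (lderiv i p) P * y $ i) = 0}"

text \<open>A point of a curve is smooth if its projective tangent space is a line, that is, if the cone
  over it has dimension two.\<close>

definition curve_smooth_point :: "('k::field ^ 'n::finite) set \<Rightarrow> 'k ^ 'n \<Rightarrow> bool" where
  "curve_smooth_point X P \<longleftrightarrow> P \<in> X \<and> vec.dim (tangent_space X P) = 2"

definition is_basis2 :: "'k::field ^ 'n \<Rightarrow> 'k ^ 'n \<Rightarrow> ('k ^ 'n) set \<Rightarrow> bool" where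
  "is_basis2 a b W \<longleftrightarrow> a \<noteq> b \<and> vec.independent {a, b} \<and> vec.span {a, b} = W"

definition pluecker :: "'k::field ^ 'n \<Rightarrow> 'k ^ 'n \<Rightarrow> 'k ^ ('n \<times> 'n)" where
  "pluecker a b = (\<chi> ij. a $ fst ij * b $ snd ij - a $ snd ij * b $ fst ij)"

definition gauss_variety :: "('k::field ^ 'n::finite) set \<Rightarrow> ('k ^ ('n \<times> 'n)) set" where
  "gauss_variety X = zariski_closure
     {pluecker a b | a b. \<exists>P. curve_smooth_point X P \<and> is_basis2 a b (tangent_space X P)}"

definition vanishing_pairs :: "('k::field ^ 'n::finite) set \<Rightarrow> 'n set set" where
  "vanishing_pairs X = {J. \<exists>i j. i \<noteq> j \<and> J = {i, j} \<and> (\<forall>p\<in>gauss_variety X. p $ (i, j) = 0)}"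

section \<open>Subvarieties of the torus\<close>

definition torus :: "('k::field ^ 'n) set" where
  "torus = {x. \<forall>i. x $ i \<noteq> 0}"

definition char_lattice :: "(int ^ 'n::finite) set" where
  "char_lattice = {u. (\<Sum>i\<in>UNIV. u $ i) = 0}"

definition torus_functions :: "('n::finite, 'k::field) laurent set" where
  "torus_functions = {p. Poly_Mapping.keys p \<subseteq> char_lattice}"

definition torus_zeros :: "('n::finite, 'k::field) laurent \<Rightarrow> ('k ^ 'n) set" where
  "torus_zeros p = {x \<in> torus. leval p x = 0}"

definition torus_hypersurface_eq :: "('n::finite, 'k::field) laurent \<Rightarrow> bool" where
  "torus_hypersurface_eq p \<longleftrightarrow> p \<in> torus_functions \<and> p \<noteq> 0 \<and> torus_zeros p \<noteq> {}"

text \<open>The ideal of \<open>Y\<close> in the coordinate ring of the torus is generated by the equations. The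
  condition that their number is the codimension of \<open>Y\<close> is imposed where this is used.\<close>

definition torus_complete_intersection ::
    "'i set \<Rightarrow> ('i \<Rightarrow> ('n::finite, 'k::field) laurent) \<Rightarrow> ('k ^ 'n) set \<Rightarrow> bool" where
  "torus_complete_intersection I f Y \<longleftrightarrow>
     Y = torus \<inter> (\<Inter>i\<in>I. torus_zeros (f i)) \<and>
     (\<forall>h\<in>torus_functions. (\<forall>x\<in>Y. leval h x = 0) \<longrightarrow>
        (\<exists>q. (\<forall>i\<in>I. q i \<in> torus_functions) \<and> h = (\<Sum>i\<in>I. q i * f i)))"

section \<open>Tropicalization\<close>

definition trop_pt :: "('k::field \<Rightarrow> ereal) \<Rightarrow> 'k ^ 'n \<Rightarrow> real ^ 'n" where
  "trop_pt val x = (\<chi> i. real_of_ereal (val (x $ i)))"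

definition trop :: "('k::field \<Rightarrow> ereal) \<Rightarrow> ('k ^ 'n::finite) set \<Rightarrow> (real ^ 'n) set" where
  "trop val Y = closure {trop_pt val x + c *\<^sub>R 1 | x c. x \<in> Y \<inter> torus}"

definition term_val ::
    "('k::field \<Rightarrow> ereal) \<Rightarrow> ('n::finite, 'k) laurent \<Rightarrow> real ^ 'n \<Rightarrow> int ^ 'n \<Rightarrow> real" where
  "term_val val p w u =
     real_of_ereal (val (Poly_Mapping.lookup p u)) + (\<Sum>i\<in>UNIV. real_of_int (u $ i) * w $ i)"

definition min_terms ::
    "('k::field \<Rightarrow> ereal) \<Rightarrow> ('n::finite, 'k) laurent \<Rightarrow> real ^ 'n \<Rightarrow> (int ^ 'n) set" where
  "min_terms val p w = {u \<in> Poly_Mapping.keys p.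
     \<forall>u'\<in>Poly_Mapping.keys p. term_val val p w u \<le> term_val val p w u'}"

text \<open>Closed cells: the terms that are minimal at a given point of the tropical hypersurface
  remain minimal.\<close>

definition trop_cells ::
    "('k::field \<Rightarrow> ereal) \<Rightarrow> ('n::finite, 'k) laurent \<Rightarrow> (real ^ 'n) set set" where
  "trop_cells val p =
     {{w'. min_terms val p w \<subseteq> min_terms val p w'} | w. w \<in> trop val (torus_zeros p)}"

definition codim :: "(real ^ 'n::finite) set \<Rightarrow> int" where
  "codim S = int CARD('n) - aff_dim S"

definition tropical_complete_intersection ::
    "('k::field \<Rightarrow> ereal) \<Rightarrow> 'i set \<Rightarrow> ('i \<Rightarrow> ('n::finite, 'k) laurent) \<Rightarrow> bool" where
  "tropical_complete_intersection val I f \<longleftrightarrow>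
     (\<forall>C. (\<forall>i\<in>I. C i \<in> trop_cells val (f i)) \<longrightarrow>
        (\<Inter>i\<in>I. C i) = {} \<or> codim (\<Inter>i\<in>I. C i) = (\<Sum>i\<in>I. codim (C i)))"

text \<open>Codimension one is relative to the tropical hypersurface, which itself has codimension one.\<close>

definition trop_codim_one_cells ::
    "('k::field \<Rightarrow> ereal) \<Rightarrow> ('n::finite, 'k) laurent \<Rightarrow> (real ^ 'n) set set" where
  "trop_codim_one_cells val p = {C \<in> trop_cells val p. codim C = 2}"

definition trop_ci_cells ::
    "('k::field \<Rightarrow> ereal) \<Rightarrow> 'i set \<Rightarrow> ('i \<Rightarrow> ('n::finite, 'k) laurent) \<Rightarrow> (real ^ 'n) set set" where
  "trop_ci_cells val I f =
     {\<Inter>i\<in>I. C i | C. (\<forall>i\<in>I. C i \<in> trop_cells val (f i)) \<and> (\<Inter>i\<in>I. C i) \<noteq> {}}"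

text \<open>The cell has dimension one in the quotient by \<open>\<real>(1,\<dots>,1)\<close>.\<close>

definition trop_ci_edges ::
    "('k::field \<Rightarrow> ereal) \<Rightarrow> 'i set \<Rightarrow> ('i \<Rightarrow> ('n::finite, 'k) laurent) \<Rightarrow> (real ^ 'n) set set" where
  "trop_ci_edges val I f = {E \<in> trop_ci_cells val I f. aff_dim E = 2}"

text \<open>After multiplication with a suitable monomial, the terms of \<open>p\<close> that are minimal on the
  relative interior of \<open>E\<close> are \<open>1\<close> and \<open>c x\<^sup>v\<close>. Since the constant term \<open>1\<close> has valuation 0
  everywhere, so has the other minimal term on the relative interior of \<open>E\<close>.\<close>

definition edge_exponent ::
    "('k::field \<Rightarrow> ereal) \<Rightarrow> ('n::finite, 'k) laurent \<Rightarrow> (real ^ 'n) set \<Rightarrow> int ^ 'n \<Rightarrow> bool" where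
  "edge_exponent val p E v \<longleftrightarrow> v \<noteq> 0 \<and>
     (\<exists>a u. a \<noteq> 0 \<and> u \<in> char_lattice \<and>
        Poly_Mapping.lookup (Poly_Mapping.single u a * p) 0 = 1 \<and>
        (\<forall>w\<in>rel_interior E. min_terms val (Poly_Mapping.single u a * p) w = {0, v}))"

definition direction_span :: "(real ^ 'n::finite) set \<Rightarrow> (real ^ 'n) set" where
  "direction_span S = span ({a - b | a b. a \<in> S \<and> b \<in> S} \<union> {1})"

definition coord_span :: "'n::finite set \<Rightarrow> (real ^ 'n) set" where
  "coord_span J = span ((\<lambda>i. axis i 1) ` J \<union> {1})"

definition row_span :: "'i set \<Rightarrow> ('i \<Rightarrow> int ^ 'n::finite) \<Rightarrow> ('k::field ^ 'n) set" where
  "row_span I v = vec.span ((\<lambda>i. \<chi> j. of_int (v i $ j)) ` I)"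

definition orth_compl :: "('k::field ^ 'n::finite) set \<Rightarrow> ('k ^ 'n) set" where
  "orth_compl L = {x. \<forall>l\<in>L. (\<Sum>j\<in>UNIV. l $ j * x $ j) = 0}"

definition projectivization :: "('k::field ^ 'n::finite) set \<Rightarrow> ('k ^ 'n) set" where
  "projectivization W = W - {0}"

section \<open>Tropical tangents and contributions\<close>

definition min_attained_twice :: "'a set \<Rightarrow> ('a \<Rightarrow> ereal) \<Rightarrow> bool" where
  "min_attained_twice A g \<longleftrightarrow>
     (\<exists>a\<in>A. \<exists>b\<in>A. a \<noteq> b \<and> g a = g b \<and> (\<forall>c\<in>A. g a \<le> g c))"

text \<open>The Pluecker coordinates and the point \<open>\<alpha>\<close> are taken up to a common scalar and up to
  \<open>\<real>(1,\<dots>,1)\<close> respectively. The entries of \<open>\<beta>\<close> outside the pairs considered are irrelevant.\<close>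

definition tropical_tangent ::
    "('k::field \<Rightarrow> ereal) \<Rightarrow> ('k ^ 'n::finite) set \<Rightarrow> real ^ 'n \<Rightarrow> ('n set \<Rightarrow> ereal) \<Rightarrow> bool" where
  "tropical_tangent val X \<alpha> \<beta> \<longleftrightarrow>
     (\<exists>P a b c. curve_smooth_point X P \<and> P \<in> torus \<and> trop_pt val P = \<alpha> + c *\<^sub>R 1 \<and>
        is_basis2 a b (tangent_space X P) \<and>
        (\<forall>i j. i \<noteq> j \<and> {i, j} \<notin> vanishing_pairs X \<longrightarrow> \<beta> {i, j} = val (pluecker a b $ (i, j))))"

definition dual_contribution ::
    "('k::field \<Rightarrow> ereal) \<Rightarrow> ('k ^ 'n::finite) set \<Rightarrow> real ^ 'n \<Rightarrow> (real ^ 'n) set" where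
  "dual_contribution val X \<alpha> = {\<gamma>. \<exists>\<beta>. tropical_tangent val X \<alpha> \<beta> \<and>
     (\<forall>j. min_attained_twice {i. i \<noteq> j \<and> {i, j} \<notin> vanishing_pairs X}
            (\<lambda>i. \<beta> {i, j} + ereal (\<gamma> $ i)))}"

text \<open>The term of the triple \<open>{i, j, k}\<close> belonging to \<open>k\<close> is \<open>\<beta>\<^sub>i\<^sub>j + x\<^sub>k\<close>. There is no condition if all
  terms are omitted; in keeping with this, and with the usual convention for tropical vanishing,
  there is none either if all remaining terms are infinite.\<close>

definition tangent_contribution ::
    "('k::field \<Rightarrow> ereal) \<Rightarrow> ('k ^ 'n::finite) set \<Rightarrow> real ^ 'n \<Rightarrow> (real ^ 'n) set" where
  "tangent_contribution val X \<alpha> = {x. \<exists>\<beta>. tropical_tangent val X \<alpha> \<beta> \<and>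
     (\<forall>T. card T = 3 \<longrightarrow>
        (let A = {k \<in> T. T - {k} \<notin> vanishing_pairs X}; g = (\<lambda>k. \<beta> (T - {k}) + ereal (x $ k))
         in (\<forall>k\<in>A. g k = \<infinity>) \<or> min_attained_twice A g))}"

definition edge_dual_contribution ::
    "('k::field \<Rightarrow> ereal) \<Rightarrow> ('k ^ 'n::finite) set \<Rightarrow> (real ^ 'n) set \<Rightarrow> (real ^ 'n) set" where
  "edge_dual_contribution val X E = closure (\<Union>\<alpha>\<in>rel_interior E. dual_contribution val X \<alpha>)"

definition edge_tangent_contribution ::
    "('k::field \<Rightarrow> ereal) \<Rightarrow> ('k ^ 'n::finite) set \<Rightarrow> (real ^ 'n) set \<Rightarrow> (real ^ 'n) set" where
  "edge_tangent_contribution val X E = closure (\<Union>\<alpha>\<in>rel_interior E. tangent_contribution val X \<alpha>)"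

end

theory Submission
  imports Defs
begin

text \<open>Choose an integer vector \<open>w\<close> such that \<open>1\<close> and \<open>w\<close> span \<open>L\<^sup>\<bottom>\<close>; then \<open>w\<close> is also the direction of \<open>E\<close>.
  Over the relative interior of \<open>E\<close>, every equation is \<open>1 + c\<^sub>i x\<^bsup>v\<^sub>i\<^esup>\<close> plus terms of positive valuation, and
  an integral dual basis of the \<open>v\<^sub>i\<close> turns the system into a contraction. A sequence of approximate
  zeros need not converge, as the field is not complete; its limit is taken as a homomorphism from the
  ring of Laurent polynomials to the completion, whose kernel is a prime ideal, and is approximated by
  homomorphisms to the field itself, extended one generator at a time. Thus the points of \<open>E\<close> that lift
  to \<open>X\<close> are dense.

  At such a point \<open>P\<close> over \<open>\<alpha>\<close> the logarithmic derivatives of the equations are, up to units, small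
  perturbations of the \<open>v\<^sub>i\<close>, so the tangent line is spanned by \<open>P\<close> and \<open>(P\<^sub>i \<eta>\<^sub>i)\<^sub>i\<close> where \<open>\<eta>\<close> reduces
  to \<open>w\<close>. The Pluecker coordinate \<open>P\<^sub>i P\<^sub>j (\<eta>\<^sub>j - \<eta>\<^sub>i)\<close> has valuation \<open>\<alpha>\<^sub>i + \<alpha>\<^sub>j\<close> if \<open>w\<^sub>i \<noteq> w\<^sub>j\<close>. If
  \<open>w\<^sub>i = w\<^sub>j\<close>, the hypothesis on \<open>{i, j}\<close> forces \<open>x\<^sub>i / x\<^sub>j\<close> to have constant valuation on \<open>X\<close>, hence to
  take finitely many values, and the coordinate vanishes. So the contributions of \<open>\<alpha>\<close> are \<open>- \<alpha>\<close> and \<open>\<alpha>\<close> plus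
  the tropical linear spaces that are cut out by the circuits of \<open>L\<close> and \<open>L\<^sup>\<bottom>\<close>.\<close>

section \<open>Valued fields\<close>

text \<open>Residue fields never appear. Since nonzero integers have valuation 0, distinct integers
  stay at distance 1; this separates different slopes \<open>w $ i\<close>, makes division by
  integers harmless and supplies infinitely many generic coefficients. The \<open>v i\<close> need
  not span a saturated lattice, so a dual basis exists only up to a positive integer factor
  \<open>D\<close>. The perturbed system then reads \<open>1 - u^D + small = 0\<close> in each
  unknown, and Newton steps contract because \<open>D\<close> has valuation 0. The value group is
  divisible, hence dense, but may be smaller than the reals, so only a dense set of points of E
  lifts and the stated sets arise as closures. That these sets are closed is not automatic for sums
  of unbounded sets; it follows by eliminating the single parameter along E. When two slopes agree,
  reduction says only that the Pluecker coordinate is small: its valuation might be any larger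
  number and vary with the point, and this is the obstacle that the assumption on pairs
  removes.\<close>

locale valued_field =
  fixes val :: "'k::{alg_closed_field, field_char_0} \<Rightarrow> ereal"
  assumes nonarch: "nonarch_valuation val"
begin

definition vl :: "'k \<Rightarrow> real" where
  "vl x = real_of_ereal (val x)"

text \<open>The multiplicative absolute value of the valuation. The case 0 is separate because
  \<open>vl 0\<close> is the default value 0 of \<open>real_of_ereal\<close> at infinity. Estimates
  go through \<open>absv\<close>, exact valuations through \<open>vl\<close>.\<close>

definition absv :: "'k \<Rightarrow> real" where
  "absv x = (if x = 0 then 0 else exp (- vl x))"

lemma val_0 [simp]: "val 0 = \<infinity>"
  using nonarch by (simp add: nonarch_valuation_def)

lemma val_eq_infinity_iff [simp]: "val x = \<infinity> \<longleftrightarrow> x = 0"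
  using nonarch by (simp add: nonarch_valuation_def)

lemma val_vl: "x \<noteq> 0 \<Longrightarrow> val x = ereal (vl x)"
  using nonarch unfolding vl_def nonarch_valuation_def
  by (metis ereal_real' abs_eq_infinity_cases)

lemma vl_mult: "x \<noteq> 0 \<Longrightarrow> y \<noteq> 0 \<Longrightarrow> vl (x * y) = vl x + vl y"
  using nonarch val_vl[of x] val_vl[of y] val_vl[of "x * y"] unfolding nonarch_valuation_def
  by (metis ereal.inject mult_eq_0_iff plus_ereal.simps(1))

lemma vl_add: "x \<noteq> 0 \<Longrightarrow> y \<noteq> 0 \<Longrightarrow> x + y \<noteq> 0 \<Longrightarrow> min (vl x) (vl y) \<le> vl (x + y)"
proof -
  assume "x \<noteq> 0" "y \<noteq> 0" "x + y \<noteq> 0"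
  moreover have "min (val x) (val y) \<le> val (x + y)"
    using nonarch unfolding nonarch_valuation_def by blast
  ultimately show ?thesis by (simp add: val_vl min_def split: if_splits)
qed

lemma vl_of_int [simp]: "vl (of_int m) = 0"
  using nonarch unfolding nonarch_valuation_def vl_def by (cases "m = 0") auto

lemma vl_1 [simp]: "vl 1 = 0"
  using vl_of_int[of 1] by simp

lemma absv_0 [simp]: "absv 0 = 0"
  by (simp add: absv_def)

lemma absv_eq_0_iff [simp]: "absv x = 0 \<longleftrightarrow> x = 0"
  by (simp add: absv_def)

lemma absv_nonneg [simp]: "0 \<le> absv x"
  by (simp add: absv_def)

lemma absv_pos_iff [simp]: "0 < absv x \<longleftrightarrow> x \<noteq> 0"
  by (simp add: absv_def)

lemma absv_mult: "absv (x * y) = absv x * absv y"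
  by (auto simp: absv_def vl_mult exp_add [symmetric])

lemma absv_1 [simp]: "absv 1 = 1"
  by (simp add: absv_def)

lemma absv_of_int: "m \<noteq> 0 \<Longrightarrow> absv (of_int m) = 1"
  by (simp add: absv_def)

lemma absv_of_int_le: "absv (of_int m) \<le> 1"
  by (simp add: absv_def)

lemma absv_minus [simp]: "absv (- x) = absv x"
  using absv_mult[of "of_int (-1)" x] absv_of_int[of "-1"] by simp

lemma absv_add: "absv (x + y) \<le> max (absv x) (absv y)"
proof (cases "x = 0 \<or> y = 0 \<or> x + y = 0")
  case False
  then show ?thesis using vl_add[of x y] by (auto simp: absv_def min_def le_max_iff_disj split: if_splits)
qed (auto simp: le_max_iff_disj)

lemma absv_add_le: "absv x \<le> c \<Longrightarrow> absv y \<le> c \<Longrightarrow> absv (x + y) \<le> c"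
  using absv_add[of x y] by simp

lemma absv_add_less: "absv x < c \<Longrightarrow> absv y < c \<Longrightarrow> absv (x + y) < c"
  using absv_add[of x y] by simp

lemma absv_diff: "absv (x - y) \<le> max (absv x) (absv y)"
  using absv_add[of x "- y"] by simp

lemma absv_diff_le: "absv x \<le> c \<Longrightarrow> absv y \<le> c \<Longrightarrow> absv (x - y) \<le> c"
  using absv_diff[of x y] by simp

lemma absv_diff_less: "absv x < c \<Longrightarrow> absv y < c \<Longrightarrow> absv (x - y) < c"
  using absv_diff[of x y] by simp

lemma absv_commute: "absv (x - y) = absv (y - x)"
  using absv_minus[of "x - y"] by (simp del: absv_minus)

text \<open>Triangles of an ultrametric are isosceles. Approximation therefore reaches absolute
  values exactly, which is why approximate zeros and exact ones can have the same
  tropicalization.\<close>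

lemma absv_eqI: "absv (x - y) < absv y \<Longrightarrow> absv x = absv y"
proof -
  assume *: "absv (x - y) < absv y"
  have "absv x \<le> max (absv (x - y)) (absv y)" using absv_add[of "x - y" y] by simp
  moreover have "absv y \<le> max (absv (x - y)) (absv x)" using absv_diff[of "x" "x - y"]
    by (simp add: max.commute)
  ultimately show ?thesis using * by auto
qed

lemma absv_add_eq: "absv x < absv y \<Longrightarrow> absv (x + y) = absv y"
  using absv_eqI[of "x + y" y] by simp

lemma absv_sum_le: "0 \<le> c \<Longrightarrow> (\<And>i. i \<in> A \<Longrightarrow> absv (g i) \<le> c) \<Longrightarrow> absv (\<Sum>i\<in>A. g i) \<le> c"
  by (induction A rule: infinite_finite_induct) (auto intro: absv_add_le)

lemma absv_sum_less: "0 < c \<Longrightarrow> (\<And>i. i \<in> A \<Longrightarrow> absv (g i) < c) \<Longrightarrow> absv (\<Sum>i\<in>A. g i) < c"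
  by (induction A rule: infinite_finite_induct) (auto intro: absv_add_less)

lemma absv_power: "absv (x ^ n) = absv x ^ n"
  by (induction n) (auto simp: absv_mult)

lemma absv_prod: "absv (\<Prod>i\<in>A. g i) = (\<Prod>i\<in>A. absv (g i))"
  by (induction A rule: infinite_finite_induct) (auto simp: absv_mult)

lemma absv_inverse: "absv (inverse x) = inverse (absv x)"
  by (cases "x = 0") (use absv_mult[of x "inverse x"] in \<open>auto simp: field_simps\<close>)

lemma absv_divide: "absv (x / y) = absv x / absv y"
  by (simp add: divide_inverse absv_mult absv_inverse)

lemma absv_powi: "absv (x powi n) = absv x powi n"
  by (cases "n \<ge> 0") (auto simp: power_int_def absv_power absv_inverse)

lemma vl_absv: "x \<noteq> 0 \<Longrightarrow> vl x = - ln (absv x)"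
  by (simp add: absv_def)

lemma vl_eq_iff_absv: "x \<noteq> 0 \<Longrightarrow> y \<noteq> 0 \<Longrightarrow> vl x = vl y \<longleftrightarrow> absv x = absv y"
  by (simp add: absv_def)

lemma vl_inverse: "x \<noteq> 0 \<Longrightarrow> vl (inverse x) = - vl x"
  using vl_mult[of x "inverse x"] by simp

lemma vl_power: "x \<noteq> 0 \<Longrightarrow> vl (x ^ n) = of_nat n * vl x"
  by (induction n) (auto simp: vl_mult algebra_simps)

lemma vl_powi: "x \<noteq> 0 \<Longrightarrow> vl (x powi n) = of_int n * vl x"
  by (cases "n \<ge> 0") (auto simp: power_int_def vl_power vl_inverse power_inverse [symmetric])

lemma vl_prod: "(\<And>i. i \<in> A \<Longrightarrow> g i \<noteq> 0) \<Longrightarrow> vl (\<Prod>i\<in>A. g i) = (\<Sum>i\<in>A. vl (g i))"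
  by (induction A rule: infinite_finite_induct) (auto simp: vl_mult)

lemma ex_root:
  fixes x :: 'k
  assumes "n > 0"
  shows "\<exists>y. y ^ n = x"
proof -
  have "degree (monom 1 n + [:- x:]) = n"
    using assms degree_add_eq_left[of "[:- x:]" "monom 1 n"] by (simp add: degree_monom_eq)
  then obtain y where "poly (monom 1 n + [:- x:]) y = 0"
    using alg_closed_imp_poly_has_root[of "monom 1 n + [:- x:]"] assms by auto
  then show ?thesis by (intro exI[of _ y]) (auto simp: poly_monom)
qed

text \<open>Roots divide the valuation of an element, so the nontrivial value group of an
  algebraically closed field is dense.\<close>

lemma ex_vl_small:
  assumes "e > 0"
  shows "\<exists>x. x \<noteq> 0 \<and> 0 < vl x \<and> vl x < e"
proof -
  obtain y where y: "y \<noteq> 0" "val y \<noteq> 0"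
    using nonarch unfolding nonarch_valuation_def by blast
  then have "vl y \<noteq> 0" using val_vl[of y] by (auto simp: zero_ereal_def)
  define z where "z = (if vl y > 0 then y else inverse y)"
  have z: "z \<noteq> 0" "vl z > 0" using y \<open>vl y \<noteq> 0\<close> by (auto simp: z_def vl_inverse)
  obtain m :: nat where m: "vl z / e < real m" using reals_Archimedean2 by blast
  then have "m > 0" using z assms by (auto intro: ccontr simp: field_simps)
  then obtain x where x: "x ^ m = z" using ex_root by blast
  then have "x \<noteq> 0" using z \<open>m > 0\<close> by auto
  then have "real m * vl x = vl z" using x vl_power by metis
  moreover have "vl z < real m * e" using m assms by (simp add: field_simps)
  ultimately have "0 < vl x" "vl x < e" using z \<open>m > 0\<close>
    by (metis mult_pos_pos of_nat_0_less_iff zero_less_mult_pos)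
      (metis \<open>m > 0\<close> \<open>real m * vl x = vl z\<close> \<open>vl z < real m * e\<close> mult_less_cancel_left_pos of_nat_0_less_iff)
  then show ?thesis using \<open>x \<noteq> 0\<close> by blast
qed

text \<open>Up to the leading coefficient, \<open>poly p a\<close> is the product of the differences
  of \<open>a\<close> to the roots, and each factor is at least the distance to the nearest root.
  This continuity of roots keeps extended homomorphisms close to the limit.\<close>

lemma root_near:
  assumes "degree p > 0"
  shows "\<exists>r. poly p r = 0 \<and> absv (a - r) ^ degree p \<le> absv (poly p a) / absv (lead_coeff p)"
proof -
  have "p \<noteq> 0" using assms by auto
  then obtain A where A: "size A = degree p" "p = smult (lead_coeff p) (\<Prod>x\<in>#A. [:-x, 1:])"
    using alg_closed_imp_factorization by blast
  have ne: "A \<noteq> {#}" using A(1) assms by auto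
  have *: "\<exists>r\<in>#A. absv (a - r) ^ size A \<le> absv (\<Prod>x\<in>#A. a - x)" if "A \<noteq> {#}" for A :: "'k multiset"
    using that
  proof (induction A)
    case empty
    then show ?case by auto
  next
    case (add x A)
    show ?case
    proof (cases "A = {#}")
      case True
      then show ?thesis by auto
    next
    case False
    with add obtain r where r: "r \<in># A" "absv (a - r) ^ size A \<le> absv (\<Prod>x\<in>#A. a - x)" by blast
    show ?thesis
    proof (cases "absv (a - r) \<le> absv (a - x)")
      case True
      then have "absv (a - r) ^ Suc (size A) \<le> absv (a - x) * absv (\<Prod>x\<in>#A. a - x)"
        using r by (auto intro!: mult_mono)
      then show ?thesis using r by (intro bexI[of _ r]) (auto simp: absv_mult)
    next
      case False
      then have "absv (a - x) ^ size A \<le> absv (a - r) ^ size A" by (auto intro!: power_mono)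
      then have "absv (a - x) ^ Suc (size A) \<le> absv (a - x) * absv (\<Prod>x\<in>#A. a - x)"
        using r by (auto intro!: mult_left_mono)
      then show ?thesis by (intro bexI[of _ x]) (auto simp: absv_mult)
    qed
    qed
  qed
  from *[OF ne] obtain r where r: "r \<in># A" "absv (a - r) ^ size A \<le> absv (\<Prod>x\<in>#A. a - x)" by blast
  have ev: "poly p b = lead_coeff p * (\<Prod>x\<in>#A. b - x)" for b
    by (subst A(2)) (simp add: poly_prod_mset multiset.map_comp o_def)
  have "(\<Prod>x\<in>#A. r - x) = 0" using r(1) by (auto simp: prod_mset_zero_iff)
  then have "poly p r = 0" using ev[of r] by simp
  moreover have "absv (poly p a) / absv (lead_coeff p) = absv (\<Prod>x\<in>#A. a - x)"
    using ev[of a] \<open>p \<noteq> 0\<close> by (simp add: absv_mult)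
  ultimately show ?thesis using r A(1) by metis
qed

end

section \<open>Extending ring homomorphisms into algebraically closed fields\<close>

definition subring :: "'r::comm_ring_1 set \<Rightarrow> bool" where
  "subring A \<longleftrightarrow> 0 \<in> A \<and> 1 \<in> A \<and> (\<forall>a\<in>A. \<forall>b\<in>A. a + b \<in> A \<and> a * b \<in> A) \<and> (\<forall>a\<in>A. - a \<in> A)"

definition prime_ideal :: "'r::comm_ring_1 set \<Rightarrow> bool" where
  "prime_ideal p \<longleftrightarrow> 0 \<in> p \<and> 1 \<notin> p \<and> (\<forall>a\<in>p. \<forall>b\<in>p. a + b \<in> p) \<and> (\<forall>a\<in>p. \<forall>b. b * a \<in> p) \<and>
     (\<forall>a b. a * b \<in> p \<longrightarrow> a \<in> p \<or> b \<in> p)"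

definition poly_over :: "'r::comm_ring_1 set \<Rightarrow> 'r poly \<Rightarrow> bool" where
  "poly_over A q \<longleftrightarrow> (\<forall>i. coeff q i \<in> A)"

definition adjoin :: "'r::comm_ring_1 set \<Rightarrow> 'r \<Rightarrow> 'r set" where
  "adjoin A x = {poly q x | q. poly_over A q}"

text \<open>A homomorphism on \<open>A / (A \<inter> p)\<close>, written as a function on the whole
  ring that is arbitrary outside \<open>A\<close>. This avoids quotient rings and lets
  \<open>A\<close> grow while \<open>p\<close> stays fixed.\<close>

definition hom_mod :: "'r::comm_ring_1 set \<Rightarrow> 'r set \<Rightarrow> ('r \<Rightarrow> 'k::field) \<Rightarrow> bool" where
  "hom_mod A p \<phi> \<longleftrightarrow> \<phi> 0 = 0 \<and> \<phi> 1 = 1 \<and> (\<forall>a\<in>A. \<forall>b\<in>A. \<phi> (a + b) = \<phi> a + \<phi> b \<and> \<phi> (a * b) = \<phi> a * \<phi> b) \<and>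
     (\<forall>a\<in>A \<inter> p. \<phi> a = 0)"

lemma subringD:
  assumes "subring A"
  shows "0 \<in> A" "1 \<in> A" "a \<in> A \<Longrightarrow> b \<in> A \<Longrightarrow> a + b \<in> A" "a \<in> A \<Longrightarrow> b \<in> A \<Longrightarrow> a * b \<in> A"
    "a \<in> A \<Longrightarrow> - a \<in> A" "a \<in> A \<Longrightarrow> b \<in> A \<Longrightarrow> a - b \<in> A"
  using assms unfolding subring_def by (auto simp: diff_conv_add_uminus simp del: add_uminus_conv_diff)

lemma subring_sum: "subring A \<Longrightarrow> (\<And>i. i \<in> I \<Longrightarrow> g i \<in> A) \<Longrightarrow> sum g I \<in> A"
  by (induction I rule: infinite_finite_induct) (auto simp: subringD)

lemma subring_power: "subring A \<Longrightarrow> a \<in> A \<Longrightarrow> a ^ n \<in> A"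
  by (induction n) (auto simp: subringD)

lemma prime_idealD:
  assumes "prime_ideal p"
  shows "0 \<in> p" "1 \<notin> p" "a \<in> p \<Longrightarrow> b \<in> p \<Longrightarrow> a + b \<in> p" "a \<in> p \<Longrightarrow> b * a \<in> p" "a \<in> p \<Longrightarrow> a * b \<in> p"
    "a * b \<in> p \<Longrightarrow> a \<in> p \<or> b \<in> p" "a \<in> p \<Longrightarrow> - a \<in> p" "a \<in> p \<Longrightarrow> b \<in> p \<Longrightarrow> a - b \<in> p"
proof -
  show "- a \<in> p" if "a \<in> p" for a
    using assms that unfolding prime_ideal_def by (metis mult_minus1)
  then show "a - b \<in> p" if "a \<in> p" "b \<in> p"
    using assms that unfolding prime_ideal_def by (metis add_uminus_conv_diff)
  show "a * b \<in> p" if "a \<in> p"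
    using assms that unfolding prime_ideal_def by (metis mult.commute)
qed (use assms in \<open>auto simp: prime_ideal_def\<close>)

lemma prime_ideal_power: "prime_ideal p \<Longrightarrow> a ^ n \<in> p \<Longrightarrow> a \<in> p"
  by (induction n) (auto dest: prime_idealD(2,6))

lemma prime_ideal_add_cancel: "prime_ideal p \<Longrightarrow> b \<in> p \<Longrightarrow> a + b \<in> p \<longleftrightarrow> a \<in> p"
  by (metis add_diff_cancel_right' prime_idealD(3,8))

lemma prime_ideal_sum: "prime_ideal p \<Longrightarrow> (\<And>i. i \<in> I \<Longrightarrow> g i \<in> p) \<Longrightarrow> sum g I \<in> p"
  by (induction I rule: infinite_finite_induct) (auto simp: prime_idealD)

lemma all_nat_split: "(\<forall>i. P (i::nat)) \<longleftrightarrow> P 0 \<and> (\<forall>i. P (Suc i))"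
proof safe
  fix i assume "P 0" "\<forall>i. P (Suc i)"
  then show "P i" by (cases i) auto
qed auto

lemma poly_over_simps:
  assumes "subring A"
  shows "poly_over A 0" "poly_over A 1" "poly_over A q \<Longrightarrow> poly_over A r \<Longrightarrow> poly_over A (q + r)"
    "poly_over A q \<Longrightarrow> poly_over A r \<Longrightarrow> poly_over A (q - r)"
    "poly_over A q \<Longrightarrow> poly_over A (- q)"
    "poly_over A q \<Longrightarrow> poly_over A r \<Longrightarrow> poly_over A (q * r)"
    "a \<in> A \<Longrightarrow> poly_over A (monom a m)" "a \<in> A \<Longrightarrow> poly_over A q \<Longrightarrow> poly_over A (smult a q)"
    "poly_over A (pCons a q) \<longleftrightarrow> a \<in> A \<and> poly_over A q"
proof -
  note [simp] = subringD[OF assms] poly_over_def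
  show "poly_over A (pCons a q) \<longleftrightarrow> a \<in> A \<and> poly_over A q"
    unfolding poly_over_def by (subst all_nat_split) simp
  show "poly_over A 0" "poly_over A 1" by (simp_all add: coeff_1)
  show "poly_over A q \<Longrightarrow> poly_over A r \<Longrightarrow> poly_over A (q * r)"
    by (simp add: coeff_mult subring_sum[OF assms])
qed (simp_all add: poly_over_def subringD[OF assms])

lemma subring_adjoin:
  assumes "subring A"
  shows "subring (adjoin A x)" "A \<subseteq> adjoin A x" "x \<in> adjoin A x"
proof -
  note [simp] = poly_over_simps[OF assms] subringD[OF assms]
  have "0 \<in> adjoin A x" "1 \<in> adjoin A x" unfolding adjoin_def
    by (rule CollectI, rule exI[of _ 0], simp) (rule CollectI, rule exI[of _ 1], simp)
  moreover have "a + b \<in> adjoin A x" "a * b \<in> adjoin A x" "- a \<in> adjoin A x"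
    if "a \<in> adjoin A x" "b \<in> adjoin A x" for a b
  proof -
    obtain q r where qr: "a = poly q x" "b = poly r x" "poly_over A q" "poly_over A r"
      using \<open>a \<in> adjoin A x\<close> \<open>b \<in> adjoin A x\<close> unfolding adjoin_def by blast
    show "a + b \<in> adjoin A x" unfolding adjoin_def using qr by (intro CollectI exI[of _ "q + r"]) simp
    show "a * b \<in> adjoin A x" unfolding adjoin_def using qr by (intro CollectI exI[of _ "q * r"]) simp
    show "- a \<in> adjoin A x" unfolding adjoin_def using qr by (intro CollectI exI[of _ "- q"]) simp
  qed
  ultimately show "subring (adjoin A x)" by (simp add: subring_def)
  show "A \<subseteq> adjoin A x"
  proof
    fix a assume "a \<in> A"
    then show "a \<in> adjoin A x" unfolding adjoin_def by (intro CollectI exI[of _ "[:a:]"]) simp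
  qed
  show "x \<in> adjoin A x" unfolding adjoin_def
    by (intro CollectI exI[of _ "[:0, 1:]"]) simp
qed

lemma poly_in_adjoin: "poly_over A q \<Longrightarrow> poly q x \<in> adjoin A x"
  unfolding adjoin_def by blast

lemma hom_modD:
  assumes "hom_mod A p \<phi>"
  shows "\<phi> 0 = 0" "\<phi> 1 = 1" "a \<in> A \<Longrightarrow> b \<in> A \<Longrightarrow> \<phi> (a + b) = \<phi> a + \<phi> b"
    "a \<in> A \<Longrightarrow> b \<in> A \<Longrightarrow> \<phi> (a * b) = \<phi> a * \<phi> b" "a \<in> A \<Longrightarrow> a \<in> p \<Longrightarrow> \<phi> a = 0"
  using assms unfolding hom_mod_def by auto

lemma hom_mod_minus: "subring A \<Longrightarrow> hom_mod A p \<phi> \<Longrightarrow> a \<in> A \<Longrightarrow> \<phi> (- a) = - \<phi> a"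
  using hom_modD(3)[of A p \<phi> a "- a"] by (simp add: subringD hom_modD(1) eq_neg_iff_add_eq_0 add.commute)

lemma hom_mod_diff: "subring A \<Longrightarrow> hom_mod A p \<phi> \<Longrightarrow> a \<in> A \<Longrightarrow> b \<in> A \<Longrightarrow> \<phi> (a - b) = \<phi> a - \<phi> b"
  using hom_modD(3)[of A p \<phi> a "- b"] by (simp add: subringD hom_mod_minus)

lemma hom_mod_sum: "subring A \<Longrightarrow> hom_mod A p \<phi> \<Longrightarrow> (\<And>i. i \<in> I \<Longrightarrow> g i \<in> A) \<Longrightarrow> \<phi> (sum g I) = (\<Sum>i\<in>I. \<phi> (g i))"
  by (induction I rule: infinite_finite_induct) (auto simp: hom_modD(1,3) subring_sum)

lemma map_poly_hom_mod:
  fixes \<phi> :: "'r::comm_ring_1 \<Rightarrow> 'k::field"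
  assumes "subring A" "hom_mod A p \<phi>"
  shows "poly_over A q \<Longrightarrow> poly_over A r \<Longrightarrow> map_poly \<phi> (q + r) = map_poly \<phi> q + map_poly \<phi> r"
    "poly_over A q \<Longrightarrow> poly_over A r \<Longrightarrow> map_poly \<phi> (q - r) = map_poly \<phi> q - map_poly \<phi> r"
    "poly_over A q \<Longrightarrow> poly_over A r \<Longrightarrow> map_poly \<phi> (q * r) = map_poly \<phi> q * map_poly \<phi> r"
    "a \<in> A \<Longrightarrow> poly_over A q \<Longrightarrow> map_poly \<phi> (smult a q) = smult (\<phi> a) (map_poly \<phi> q)"
    "map_poly \<phi> (monom a n) = monom (\<phi> a) n"
    "map_poly \<phi> (pCons a q) = pCons (\<phi> a) (map_poly \<phi> q)"
    "map_poly \<phi> 1 = 1"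
proof -
  note 0 = hom_modD(1)[OF assms(2)]
  show "poly_over A q \<Longrightarrow> poly_over A r \<Longrightarrow> map_poly \<phi> (q + r) = map_poly \<phi> q + map_poly \<phi> r"
    by (rule poly_eqI) (auto simp: coeff_map_poly 0 poly_over_def hom_modD(3)[OF assms(2)])
  show "poly_over A q \<Longrightarrow> poly_over A r \<Longrightarrow> map_poly \<phi> (q - r) = map_poly \<phi> q - map_poly \<phi> r"
    by (rule poly_eqI) (auto simp: coeff_map_poly 0 poly_over_def hom_mod_diff[OF assms])
  show "poly_over A q \<Longrightarrow> poly_over A r \<Longrightarrow> map_poly \<phi> (q * r) = map_poly \<phi> q * map_poly \<phi> r"
    by (rule poly_eqI)
      (auto simp: coeff_map_poly 0 poly_over_def coeff_mult hom_mod_sum[OF assms]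
        hom_modD(4)[OF assms(2)] subringD[OF assms(1)])
  show "a \<in> A \<Longrightarrow> poly_over A q \<Longrightarrow> map_poly \<phi> (smult a q) = smult (\<phi> a) (map_poly \<phi> q)"
    by (rule poly_eqI) (auto simp: coeff_map_poly 0 poly_over_def hom_modD(4)[OF assms(2)])
  show "map_poly \<phi> (monom a n) = monom (\<phi> a) n"
    by (rule poly_eqI) (auto simp: coeff_map_poly 0)
  show "map_poly \<phi> (pCons a q) = pCons (\<phi> a) (map_poly \<phi> q)"
    by (rule poly_eqI) (auto simp: coeff_map_poly 0 coeff_pCons split: nat.splits)
  show "map_poly \<phi> 1 = 1"
    by (rule poly_eqI) (auto simp: coeff_map_poly 0 hom_modD(2)[OF assms(2)] coeff_1)
qed

text \<open>Sending \<open>x\<close> to \<open>c\<close> is well defined as soon as every relation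
  of \<open>x\<close> modulo \<open>p\<close> becomes a relation of \<open>c\<close>, because two
  polynomials with the same value at \<open>x\<close> differ by such a relation.\<close>

lemma hom_mod_extend:
  fixes \<phi> :: "'r::comm_ring_1 \<Rightarrow> 'k::field"
  assumes A: "subring A" and p: "prime_ideal p" and \<phi>: "hom_mod A p \<phi>"
    and rel: "\<And>q. poly_over A q \<Longrightarrow> poly q x \<in> p \<Longrightarrow> poly (map_poly \<phi> q) c = 0"
  shows "\<exists>\<phi>'. hom_mod (adjoin A x) p \<phi>' \<and>
    (\<forall>q. poly_over A q \<longrightarrow> \<phi>' (poly q x) = poly (map_poly \<phi> q) c) \<and> (\<forall>a\<in>A. \<phi>' a = \<phi> a)"
proof -
  define rep where "rep y = (SOME q. poly_over A q \<and> poly q x = y)" for y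
  define \<phi>' where "\<phi>' y = poly (map_poly \<phi> (rep y)) c" for y
  note [simp] = poly_over_simps[OF A] subringD[OF A] map_poly_hom_mod[OF A \<phi>]
  have *: "\<phi>' (poly q x) = poly (map_poly \<phi> q) c" if "poly_over A q" for q
  proof -
    have r: "poly_over A (rep (poly q x))" "poly (rep (poly q x)) x = poly q x"
      unfolding rep_def using someI[of "\<lambda>r. poly_over A r \<and> poly r x = poly q x" q] that by auto
    then have "poly (map_poly \<phi> (rep (poly q x) - q)) c = 0"
      using that prime_idealD(1)[OF p] by (intro rel) auto
    then show ?thesis using r that by (simp add: \<phi>'_def)
  qed
  have a: "\<phi>' a = \<phi> a" if "a \<in> A" for a
    using *[of "[:a:]"] that by simp
  have "hom_mod (adjoin A x) p \<phi>'"
    unfolding hom_mod_def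
  proof (intro conjI ballI)
    show "\<phi>' 0 = 0" "\<phi>' 1 = 1" using a[of 0] a[of 1] hom_modD(1,2)[OF \<phi>] by auto
    fix y z assume "y \<in> adjoin A x" "z \<in> adjoin A x"
    then obtain q r where qr: "y = poly q x" "z = poly r x" "poly_over A q" "poly_over A r"
      unfolding adjoin_def by blast
    show "\<phi>' (y + z) = \<phi>' y + \<phi>' z"
      using *[of "q + r"] *[of q] *[of r] qr by simp
    show "\<phi>' (y * z) = \<phi>' y * \<phi>' z"
      using *[of "q * r"] *[of q] *[of r] qr by simp
  next
    fix y assume "y \<in> adjoin A x \<inter> p"
    then show "\<phi>' y = 0" unfolding adjoin_def using * rel by auto
  qed
  then show ?thesis using * a by blast
qed

section \<open>Transcendental and algebraic generators modulo a prime ideal\<close>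

definition transcendental_mod :: "'r::comm_ring_1 set \<Rightarrow> 'r set \<Rightarrow> 'r \<Rightarrow> bool" where
  "transcendental_mod A p x \<longleftrightarrow> (\<forall>q. poly_over A q \<and> poly q x \<in> p \<longrightarrow> (\<forall>i. coeff q i \<in> p))"

text \<open>A minimal polynomial over the fraction field of \<open>A / (A \<inter> p)\<close> with
  denominators cleared. It need not be monic, so homomorphisms that kill its leading coefficient
  have to be excluded wherever it is used.\<close>

definition min_poly_mod :: "'r::comm_ring_1 set \<Rightarrow> 'r set \<Rightarrow> 'r \<Rightarrow> 'r poly \<Rightarrow> bool" where
  "min_poly_mod A p x G \<longleftrightarrow> poly_over A G \<and> poly G x \<in> p \<and> lead_coeff G \<notin> p \<and>
     (\<forall>q. poly_over A q \<and> poly q x \<in> p \<and> degree q < degree G \<longrightarrow> (\<forall>i. coeff q i \<in> p))"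

lemma poly_split_lead: "poly q x = poly (q - monom (lead_coeff q) (degree q)) x + lead_coeff q * x ^ degree q"
  for q :: "'a::comm_ring_1 poly"
  by (simp add: poly_monom)

lemma degree_drop_lead:
  fixes q :: "'a::comm_ring_1 poly"
  assumes "degree q > 0"
  shows "degree (q - monom (lead_coeff q) (degree q)) < degree q"
proof (intro degree_lessI)
  show "q - monom (lead_coeff q) (degree q) \<noteq> 0 \<or> 0 < degree q" using assms by blast
  show "\<forall>k\<ge>degree q. coeff (q - monom (lead_coeff q) (degree q)) k = 0"
    by (auto simp: coeff_eq_0)
qed

lemma degree_cancel_lead:
  fixes q G :: "'a::comm_ring_1 poly"
  assumes "degree G \<le> degree q" "0 < degree q"
  shows "degree (smult (lead_coeff G) q - monom (lead_coeff q) (degree q - degree G) * G) < degree q"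
    (is "degree ?r < _")
proof (rule degree_lessI)
  show "?r \<noteq> 0 \<or> 0 < degree q" using assms by blast
  show "\<forall>k\<ge>degree q. coeff ?r k = 0"
  proof (intro allI impI)
    fix k assume k: "degree q \<le> k"
    show "coeff ?r k = 0"
    proof (cases "k = degree q")
      case True
      then show ?thesis using assms by (simp add: coeff_monom_mult)
    next
      case False
      with k have "k > degree q" by simp
      then show ?thesis using assms by (auto simp: coeff_monom_mult coeff_eq_0)
    qed
  qed
qed

text \<open>Once leading terms with coefficients in \<open>p\<close> are dropped, a nontrivial
  relation of least degree is a minimal polynomial.\<close>

lemma transcendental_or_min_poly:
  assumes A: "subring A" and p: "prime_ideal p"
  shows "transcendental_mod A p x \<or> (\<exists>G. min_poly_mod A p x G)"
proof (rule disjCI)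
  note [simp] = poly_over_simps[OF A] subringD[OF A]
  assume none: "\<not> (\<exists>G. min_poly_mod A p x G)"
  have "\<forall>i. coeff q i \<in> p" if "poly_over A q" "poly q x \<in> p" for q
    using that
  proof (induction "degree q" arbitrary: q rule: less_induct)
    case less
    show ?case
    proof (cases "lead_coeff q \<in> p")
      case True
      show ?thesis
      proof (cases "degree q = 0")
        case True
        then obtain a where "q = [:a:]" by (rule degree_eq_zeroE)
        then show ?thesis using less.prems prime_idealD(1)[OF p] by (auto simp: coeff_pCons split: nat.splits)
      next
        case False
        let ?r = "q - monom (lead_coeff q) (degree q)"
        have "poly ?r x \<in> p"
          using less.prems(2) poly_split_lead[of q x] True
          by (metis prime_idealD(5)[OF p] prime_ideal_add_cancel[OF p])
        moreover have "poly_over A ?r" using less.prems(1) by (simp add: poly_over_def)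
        moreover have "degree ?r < degree q" using False degree_drop_lead by blast
        ultimately have "\<forall>i. coeff ?r i \<in> p" using less.hyps by blast
        then show ?thesis using True by (metis coeff_diff coeff_monom diff_zero)
      qed
    next
      case False
      \<comment> \<open>The induction hypothesis for smaller degrees is the minimality clause for
        \<open>q\<close>.\<close>
      then have "min_poly_mod A p x q" unfolding min_poly_mod_def using less by blast
      then show ?thesis using none by blast
    qed
  qed
  then show "transcendental_mod A p x" unfolding transcendental_mod_def by blast
qed

lemma transcendental_relations:
  fixes \<phi> :: "'r::comm_ring_1 \<Rightarrow> 'k::field"
  assumes "hom_mod A p \<phi>" "transcendental_mod A p x" "poly_over A q" "poly q x \<in> p"
  shows "poly (map_poly \<phi> q) c = 0"
proof -
  have "map_poly \<phi> q = 0"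
    using assms by (intro poly_eqI)
      (auto simp: coeff_map_poly hom_modD(1) transcendental_mod_def poly_over_def intro: hom_modD(5))
  then show ?thesis by simp
qed

text \<open>Multiplying a relation by the leading coefficient of \<open>G\<close> and subtracting a
  multiple of \<open>G\<close> lowers its degree. As \<open>\<phi>\<close> does not kill that
  coefficient, nothing is lost, and relations shorter than \<open>G\<close> are trivial.\<close>

lemma min_poly_relations:
  fixes \<phi> :: "'r::comm_ring_1 \<Rightarrow> 'k::field"
  assumes A: "subring A" and p: "prime_ideal p" and \<phi>: "hom_mod A p \<phi>" and G: "min_poly_mod A p x G"
    and c: "\<phi> (lead_coeff G) \<noteq> 0" "poly (map_poly \<phi> G) c = 0"
    and q: "poly_over A q" "poly q x \<in> p"
  shows "poly (map_poly \<phi> q) c = 0"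
  using q
proof (induction "degree q" arbitrary: q rule: less_induct)
  case less
  note [simp] = poly_over_simps[OF A] subringD[OF A] map_poly_hom_mod[OF A \<phi>]
  have GA: "poly_over A G" "poly G x \<in> p" using G unfolding min_poly_mod_def by auto
  have lA: "lead_coeff q \<in> A" "lead_coeff G \<in> A" using less.prems GA unfolding poly_over_def by auto
  show ?case
  proof (cases "degree q < degree G")
    case True
    then have "\<forall>i. coeff q i \<in> p" using G less.prems unfolding min_poly_mod_def by blast
    then have "map_poly \<phi> q = 0"
      using less.prems by (intro poly_eqI)
       (auto simp: coeff_map_poly hom_modD(1)[OF \<phi>] poly_over_def intro: hom_modD(5)[OF \<phi>])
    then show ?thesis by simp
  next
    case False
    define r where "r = smult (lead_coeff G) q - monom (lead_coeff q) (degree q - degree G) * G"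
    have rA: "poly_over A r" unfolding r_def using less.prems GA lA by simp
    have eq: "\<phi> (lead_coeff G) * poly (map_poly \<phi> q) c = poly (map_poly \<phi> r) c"
      unfolding r_def using less.prems GA lA c by (simp add: poly_monom)
    have rp: "poly r x \<in> p" unfolding r_def using less.prems GA
      by (simp add: prime_idealD[OF p])
    show ?thesis
    proof (cases "degree q = 0")
      case True
      then have "degree G = 0" using False by simp
      then obtain g where "G = [:g:]" by (rule degree_eq_zeroE)
      then show ?thesis using GA(2) G unfolding min_poly_mod_def by simp
    next
      case dq: False
      have "degree r < degree q"
        unfolding r_def using False dq by (intro degree_cancel_lead) auto
      then have "poly (map_poly \<phi> r) c = 0" using less.hyps rA rp by blast
      then show ?thesis using eq c by simp
    qed
  qed
qed


text \<open>Division with remainder when the leading coefficient cannot be inverted. The bound on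
  \<open>degree s\<close> later puts the quotient within reach of the minimality of
  \<open>G\<close>.\<close>

lemma pseudo_division:
  assumes A: "subring A"
    and "poly_over A g" "poly_over A q" "0 < degree q"
  shows "\<exists>k s r. poly_over A s \<and> poly_over A r \<and> smult (lead_coeff q ^ k) g = s * q + r \<and>
    degree r < degree q \<and> degree s \<le> degree g - degree q"
  using assms(2)
proof (induction "degree g" arbitrary: g rule: less_induct)
  case less
  note [simp] = poly_over_simps[OF A] subringD[OF A]
  note q = assms(3,4)
  show ?case
  proof (cases "degree g < degree q")
    case True
    then show ?thesis using less.prems
      by (intro exI[of _ 0] exI[of _ g] conjI) auto
  next
    case False
    let ?m = "monom (lead_coeff g) (degree g - degree q)"
    let ?g = "smult (lead_coeff q) g - ?m * q"
    have lA: "lead_coeff q \<in> A" "lead_coeff g \<in> A" using less.prems q unfolding poly_over_def by auto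
    have d: "degree ?g < degree g" using False q by (intro degree_cancel_lead) auto
    have "poly_over A ?g" using lA q less.prems by simp
    then obtain k s r where ksr: "poly_over A s" "poly_over A r" "smult (lead_coeff q ^ k) ?g = s * q + r"
      "degree r < degree q" "degree s \<le> degree ?g - degree q"
      using less.hyps d by blast
    let ?s = "s + smult (lead_coeff q ^ k) ?m"
    have "smult (lead_coeff q ^ Suc k) g = smult (lead_coeff q ^ k) (?g + ?m * q)"
      by (simp only: diff_add_cancel smult_smult power_Suc2)
    also have "\<dots> = (s * q + r) + smult (lead_coeff q ^ k) (?m * q)" by (simp only: smult_add_right ksr(3))
    also have "\<dots> = ?s * q + r" by (simp add: algebra_simps)
    finally have "smult (lead_coeff q ^ Suc k) g = ?s * q + r" .
    moreover have "poly_over A ?s" using ksr lA subring_power[OF A] by simp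
    moreover have "degree ?s \<le> degree g - degree q"
    proof (rule degree_add_le)
      show "degree s \<le> degree g - degree q" using ksr(5) d by linarith
      show "degree (smult (lead_coeff q ^ k) ?m) \<le> degree g - degree q"
        by (meson degree_monom_le degree_smult_le le_trans)
    qed
    ultimately show ?thesis using ksr by blast
  qed
qed

text \<open>Over the fraction fields a nonzero element of an algebraic extension is invertible;
  \<open>r\<close> is a denominator of its inverse. The Euclidean algorithm with \<open>G\<close>
  produces \<open>W\<close> and \<open>r\<close>.\<close>

lemma algebraic_divides:
  assumes A: "subring A" and p: "prime_ideal p" and G: "min_poly_mod A p x G"
    and q: "poly_over A q" "poly q x \<notin> p"
  shows "\<exists>r\<in>A. \<exists>W\<in>adjoin A x. r \<notin> p \<and> poly q x * W - r \<in> p"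
  using q
proof (induction "degree q" arbitrary: q rule: less_induct)
  case less
  note [simp] = poly_over_simps[OF A] subringD[OF A] subringD[OF subring_adjoin(1)[OF A]]
  note pD = prime_idealD[OF p]
  have AW: "a \<in> adjoin A x" if "a \<in> A" for a using subring_adjoin(2)[OF A] that by blast
  have GA: "poly_over A G" "poly G x \<in> p" "lead_coeff G \<notin> p" using G unfolding min_poly_mod_def by auto
  have Gmin: "\<forall>i. coeff q i \<in> p" if "poly_over A q" "poly q x \<in> p" "degree q < degree G" for q
    using that G unfolding min_poly_mod_def by blast
  have dG: "degree G > 0"
  proof (rule ccontr)
    assume "\<not> degree G > 0"
    then have "degree G = 0" by simp
    then obtain g where "G = [:g:]" by (rule degree_eq_zeroE)
    then show False using GA by simp
  qed
  have lA: "lead_coeff q \<in> A" "lead_coeff G \<in> A" using less.prems GA unfolding poly_over_def by auto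
  consider "degree q = 0" | "degree q > 0" "lead_coeff q \<in> p"
    | "degree q > 0" "lead_coeff q \<notin> p" "degree q \<ge> degree G"
    | "degree q > 0" "lead_coeff q \<notin> p" "degree q < degree G" by linarith
  then show ?case
  proof cases
    case 1
    then obtain a where "q = [:a:]" by (rule degree_eq_zeroE)
    then show ?thesis using less.prems pD(1) AW[of 1]
      by (intro bexI[of _ a] bexI[of _ 1]) auto
  next
    case 2
    let ?r = "q - monom (lead_coeff q) (degree q)"
    have l: "lead_coeff q * x ^ degree q \<in> p" using pD(5) 2 by blast
    have "poly ?r x \<notin> p" using less.prems(2) poly_split_lead[of q x] prime_ideal_add_cancel[OF p l] by metis
    moreover have "degree ?r < degree q" using degree_drop_lead 2 by blast
    moreover have "poly_over A ?r" using less.prems lA by simp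
    ultimately obtain r W where rW: "r \<in> A" "W \<in> adjoin A x" "r \<notin> p" "poly ?r x * W - r \<in> p"
      using less.hyps by blast
    have "poly q x * W - r = (poly ?r x * W - r) + lead_coeff q * x ^ degree q * W"
      by (subst poly_split_lead[of q x]) (simp add: algebra_simps)
    then have "poly q x * W - r \<in> p" using rW(4) l pD(3,5) by metis
    then show ?thesis using rW by blast
  next
    case 3
    let ?r = "smult (lead_coeff G) q - monom (lead_coeff q) (degree q - degree G) * G"
    have rp: "poly ?r x - lead_coeff G * poly q x \<in> p" using GA(2) pD by simp
    have "lead_coeff G * poly q x \<notin> p" using pD(6) GA less.prems by blast
    moreover have "poly ?r x = lead_coeff G * poly q x + (poly ?r x - lead_coeff G * poly q x)" by simp
    ultimately have "poly ?r x \<notin> p" using prime_ideal_add_cancel[OF p rp] by metis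
    moreover have "degree ?r < degree q" using degree_cancel_lead 3 by blast
    moreover have "poly_over A ?r" using less.prems lA GA by simp
    ultimately obtain r W where rW: "r \<in> A" "W \<in> adjoin A x" "r \<notin> p" "poly ?r x * W - r \<in> p"
      using less.hyps by blast
    have "poly q x * (lead_coeff G * W) - r = (poly ?r x * W - r) - (poly ?r x - lead_coeff G * poly q x) * W"
      by (simp add: algebra_simps)
    then have "poly q x * (lead_coeff G * W) - r \<in> p" using rW(4) rp pD(5,8) by metis
    moreover have "lead_coeff G * W \<in> adjoin A x" using rW AW lA by simp
    ultimately show ?thesis using rW by blast
  next
    case 4
    obtain k s r where ksr: "poly_over A s" "poly_over A r" "smult (lead_coeff q ^ k) G = s * q + r"
      "degree r < degree q" "degree s \<le> degree G - degree q"
      using pseudo_division[OF A GA(1) less.prems(1) 4(1)] by blast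
    have eq: "lead_coeff q ^ k * poly G x = poly s x * poly q x + poly r x"
      using arg_cong[OF ksr(3), of "\<lambda>g. poly g x"] by simp
    then have e: "poly s x * poly q x + poly r x \<in> p" using GA pD by metis
    \<comment> \<open>Otherwise \<open>poly s x\<close> would lie in \<open>p\<close>, by minimality
      of \<open>G\<close> so would all coefficients of \<open>s\<close>, and comparing coefficients
      in degree \<open>degree G\<close> would put the leading coefficient of \<open>G\<close> into
      \<open>p\<close>.\<close>
    have "poly r x \<notin> p"
    proof
      assume "poly r x \<in> p"
      then have "poly s x * poly q x \<in> p" using e prime_ideal_add_cancel[OF p] by blast
      then have "poly s x \<in> p" using pD(6) less.prems by blast
      then have s: "coeff s i \<in> p" for i using Gmin[of s] ksr 4 by simp
      have "lead_coeff q ^ k * lead_coeff G = coeff (s * q + r) (degree G)"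
        by (subst ksr(3) [symmetric]) simp
      also have "\<dots> = coeff (s * q) (degree G)" using ksr 4 by (simp add: coeff_eq_0)
      also have "\<dots> \<in> p" unfolding coeff_mult by (intro prime_ideal_sum[OF p] pD(5) s)
      finally show False using GA 4 pD(6) prime_ideal_power[OF p] by blast
    qed
    then obtain r' W where rW: "r' \<in> A" "W \<in> adjoin A x" "r' \<notin> p" "poly r x * W - r' \<in> p"
      using less.hyps ksr by blast
    have "poly q x * (- (poly s x * W)) - r' = (poly r x * W - r') - (poly s x * poly q x + poly r x) * W"
      by (simp add: algebra_simps)
    then have "poly q x * (- (poly s x * W)) - r' \<in> p" using rW(4) e pD(5,8) by metis
    moreover have "- (poly s x * W) \<in> adjoin A x" using rW poly_in_adjoin[OF ksr(1)] by simp
    ultimately show ?thesis using rW by blast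
  qed
qed

lemma min_poly_mod_root:
  fixes \<phi> :: "'r::comm_ring_1 \<Rightarrow> 'k::alg_closed_field"
  assumes p: "prime_ideal p" and G: "min_poly_mod A p x G" and \<phi>: "hom_mod A p \<phi>" and "\<phi> (lead_coeff G) \<noteq> 0"
  shows "degree (map_poly \<phi> G) = degree G" "degree G > 0"
proof -
  show "degree (map_poly \<phi> G) = degree G"
  proof (rule antisym)
    show "degree (map_poly \<phi> G) \<le> degree G" by (rule map_poly_degree_leq)
    show "degree G \<le> degree (map_poly \<phi> G)"
      by (rule le_degree) (use assms(4) in \<open>simp add: coeff_map_poly hom_modD(1)[OF \<phi>]\<close>)
  qed
  show "degree G > 0"
  proof (rule ccontr)
    assume "\<not> degree G > 0"
    then have "degree G = 0" by simp
    then obtain g where "G = [:g:]" by (rule degree_eq_zeroE)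
    then show False using G unfolding min_poly_mod_def by simp
  qed
qed

text \<open>Chevalley's argument for one generator: nonvanishing at \<open>b\<close> can be secured
  by nonvanishing at a single \<open>a\<close> in \<open>A\<close>. If \<open>x\<close> is
  transcendental, \<open>a\<close> is a coefficient of \<open>b\<close>, and the value of
  \<open>x\<close> avoids finitely many roots. If it is algebraic, \<open>a\<close> is the leading
  coefficient of \<open>G\<close> times the element divided by \<open>b\<close>.\<close>

lemma hom_mod_extend_nonzero:
  assumes A: "subring A" and p: "prime_ideal p" and b: "b \<in> adjoin A x" "b \<notin> p"
  shows "\<exists>a\<in>A. a \<notin> p \<and> (\<forall>\<phi> :: 'r::comm_ring_1 \<Rightarrow> 'k::{alg_closed_field, field_char_0}.
    hom_mod A p \<phi> \<and> \<phi> a \<noteq> 0 \<longrightarrow>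
      (\<exists>\<phi>'. hom_mod (adjoin A x) p \<phi>' \<and> \<phi>' b \<noteq> 0 \<and> (\<forall>a\<in>A. \<phi>' a = \<phi> a)))"
proof -
  obtain q where q: "poly_over A q" "b = poly q x" using b unfolding adjoin_def by blast
  note [simp] = poly_over_simps[OF A] subringD[OF A]
  note adj = subring_adjoin[OF A]
  from transcendental_or_min_poly[OF A p] show ?thesis
  proof
    assume t: "transcendental_mod A p x"
    obtain i where i: "coeff q i \<notin> p"
    proof (rule ccontr)
      assume "\<not> thesis"
      then have "poly q x \<in> p" using that unfolding poly_altdef
        by (intro prime_ideal_sum[OF p] prime_idealD(5)[OF p]) blast
      then show False using b q by simp
    qed
    show ?thesis
    proof (intro bexI[of _ "coeff q i"] conjI allI impI)
      show "coeff q i \<in> A" "coeff q i \<notin> p" using i q by (auto simp: poly_over_def)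
      fix \<phi> :: "'r \<Rightarrow> 'k"
      assume \<phi>: "hom_mod A p \<phi> \<and> \<phi> (coeff q i) \<noteq> 0"
      then have "coeff (map_poly \<phi> q) i \<noteq> 0" by (auto simp: coeff_map_poly hom_modD(1))
      then have "map_poly \<phi> q \<noteq> 0" by auto
      then have "finite {c. poly (map_poly \<phi> q) c = 0}" by (rule poly_roots_finite)
      then obtain c where "c \<notin> {c. poly (map_poly \<phi> q) c = 0}"
        using ex_new_if_finite infinite_UNIV_char_0 by blast
      moreover obtain \<phi>' where "hom_mod (adjoin A x) p \<phi>'"
        "\<And>q. poly_over A q \<Longrightarrow> \<phi>' (poly q x) = poly (map_poly \<phi> q) c"
        "\<And>a. a \<in> A \<Longrightarrow> \<phi>' a = \<phi> a"
        using hom_mod_extend[where x = x and c = c, OF A p conjunct1[OF \<phi>] transcendental_relations[OF conjunct1[OF \<phi>] t]]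
        by blast
      ultimately show "\<exists>\<phi>'. hom_mod (adjoin A x) p \<phi>' \<and> \<phi>' b \<noteq> 0 \<and> (\<forall>a\<in>A. \<phi>' a = \<phi> a)"
        using q by auto
    qed
  next
    assume "\<exists>G. min_poly_mod A p x G"
    then obtain G where G: "min_poly_mod A p x G" by blast
    obtain r W where rW: "r \<in> A" "W \<in> adjoin A x" "r \<notin> p" "b * W - r \<in> p"
      using algebraic_divides[OF A p G q(1)] b q by blast
    have lG: "lead_coeff G \<in> A" "lead_coeff G \<notin> p" using G unfolding min_poly_mod_def poly_over_def by auto
    show ?thesis
    proof (intro bexI[of _ "lead_coeff G * r"] conjI allI impI)
      show "lead_coeff G * r \<notin> p" using rW lG prime_idealD(6)[OF p] by blast
      show "lead_coeff G * r \<in> A" using rW lG by simp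
      fix \<phi> :: "'r \<Rightarrow> 'k"
      assume "hom_mod A p \<phi> \<and> \<phi> (lead_coeff G * r) \<noteq> 0"
      then have \<phi>: "hom_mod A p \<phi>" "\<phi> (lead_coeff G) \<noteq> 0" "\<phi> r \<noteq> 0"
        using rW lG by (auto simp: hom_modD(4))
      obtain c where c: "poly (map_poly \<phi> G) c = 0"
        using alg_closed_imp_poly_has_root[of "map_poly \<phi> G"] min_poly_mod_root[OF p G \<phi>(1,2)] by auto
      obtain \<phi>' where \<phi>': "hom_mod (adjoin A x) p \<phi>'" "\<And>a. a \<in> A \<Longrightarrow> \<phi>' a = \<phi> a"
        using hom_mod_extend[where x = x and c = c, OF A p \<phi>(1) min_poly_relations[OF A p \<phi>(1) G \<phi>(2) c]]
        by blast
      have r: "r \<in> adjoin A x" using adj(2) rW by blast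
      have "b * W - r \<in> adjoin A x" using rW b r by (simp add: subringD[OF adj(1)])
      then have "\<phi>' (b * W - r) = 0" using rW(4) by (rule hom_modD(5)[OF \<phi>'(1)])
      then have "\<phi>' b * \<phi>' W = \<phi>' r"
        using hom_mod_diff[OF adj(1) \<phi>'(1)] hom_modD(4)[OF \<phi>'(1)] subringD(4)[OF adj(1)] b rW r by simp
      then have "\<phi>' b \<noteq> 0" using \<phi>'(2)[OF rW(1)] \<phi>(3) by auto
      then show "\<exists>\<phi>'. hom_mod (adjoin A x) p \<phi>' \<and> \<phi>' b \<noteq> 0 \<and> (\<forall>a\<in>A. \<phi>' a = \<phi> a)"
        using \<phi>' by auto
    qed
  qed
qed

section \<open>Adjoining finitely many generators\<close>

primrec adjoin_list :: "'r::comm_ring_1 set \<Rightarrow> 'r list \<Rightarrow> 'r set" where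
  "adjoin_list A [] = A"
| "adjoin_list A (x # xs) = adjoin_list (adjoin A x) xs"

lemma subring_adjoin_list:
  "subring A \<Longrightarrow> subring (adjoin_list A xs) \<and> A \<subseteq> adjoin_list A xs \<and> set xs \<subseteq> adjoin_list A xs"
proof (induction xs arbitrary: A)
  case (Cons x xs)
  note adj = subring_adjoin[OF Cons.prems, of x]
  have "subring (adjoin_list (adjoin A x) xs)" "adjoin A x \<subseteq> adjoin_list (adjoin A x) xs"
    "set xs \<subseteq> adjoin_list (adjoin A x) xs"
    using Cons.IH[OF adj(1)] by simp_all
  moreover have "x \<in> adjoin_list (adjoin A x) xs" using calculation(2) adj(3) by (rule subsetD)
  ultimately show ?case using adj(2) by simp
qed simp

text \<open>Nonvanishing at \<open>b\<close> is pulled back through the generators from the last to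
  the first; homomorphisms are then extended in the opposite order.\<close>

lemma hom_mod_extend_list:
  assumes "subring A" "prime_ideal p" "b \<in> adjoin_list A xs" "b \<notin> p"
  shows "\<exists>a\<in>A. a \<notin> p \<and> (\<forall>\<phi> :: 'r::comm_ring_1 \<Rightarrow> 'k::{alg_closed_field, field_char_0}.
    hom_mod A p \<phi> \<and> \<phi> a \<noteq> 0 \<longrightarrow>
      (\<exists>\<phi>'. hom_mod (adjoin_list A xs) p \<phi>' \<and> \<phi>' b \<noteq> 0 \<and> (\<forall>a\<in>A. \<phi>' a = \<phi> a)))"
  using assms
proof (induction xs arbitrary: A b)
  case Nil
  then show ?case by (intro bexI[of _ b]) auto
next
  case (Cons x xs)
  note adj = subring_adjoin[OF Cons.prems(1), of x]
  obtain a1 where a1: "a1 \<in> adjoin A x" "a1 \<notin> p" "\<And>\<phi> :: 'r \<Rightarrow> 'k. hom_mod (adjoin A x) p \<phi> \<Longrightarrow> \<phi> a1 \<noteq> 0 \<Longrightarrow>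
      \<exists>\<phi>'. hom_mod (adjoin_list (adjoin A x) xs) p \<phi>' \<and> \<phi>' b \<noteq> 0 \<and> (\<forall>a\<in>adjoin A x. \<phi>' a = \<phi> a)"
    using Cons.IH[OF adj(1) Cons.prems(2), of b] Cons.prems by auto
  obtain a where a: "a \<in> A" "a \<notin> p" "\<And>\<phi> :: 'r \<Rightarrow> 'k. hom_mod A p \<phi> \<Longrightarrow> \<phi> a \<noteq> 0 \<Longrightarrow>
      \<exists>\<phi>'. hom_mod (adjoin A x) p \<phi>' \<and> \<phi>' a1 \<noteq> 0 \<and> (\<forall>a\<in>A. \<phi>' a = \<phi> a)"
    using hom_mod_extend_nonzero[OF Cons.prems(1,2) a1(1,2)] by blast
  show ?case
  proof (intro bexI[of _ a] conjI allI impI)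
    fix \<phi> :: "'r \<Rightarrow> 'k" assume "hom_mod A p \<phi> \<and> \<phi> a \<noteq> 0"
    then obtain \<phi>1 where 1: "hom_mod (adjoin A x) p \<phi>1" "\<phi>1 a1 \<noteq> 0" "\<forall>a\<in>A. \<phi>1 a = \<phi> a" using a(3) by blast
    then obtain \<phi>2 where 2: "hom_mod (adjoin_list (adjoin A x) xs) p \<phi>2" "\<phi>2 b \<noteq> 0" "\<forall>a\<in>adjoin A x. \<phi>2 a = \<phi>1 a"
      using a1(3) by blast
    have "\<forall>a\<in>A. \<phi>2 a = \<phi> a" using 1(3) 2(3) adj(2) by auto
    then show "\<exists>\<phi>'. hom_mod (adjoin_list A (x # xs)) p \<phi>' \<and> \<phi>' b \<noteq> 0 \<and> (\<forall>a\<in>A. \<phi>' a = \<phi> a)"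
      using 2 by auto
  qed (use a in auto)
qed

section \<open>Limits of Cauchy sequences of homomorphisms\<close>

locale cauchy_homs = valued_field val for val :: "'k::{alg_closed_field, field_char_0} \<Rightarrow> ereal" +
  fixes e :: "nat \<Rightarrow> 'r::comm_ring_1 \<Rightarrow> 'k"
  assumes e_add: "e k (a + b) = e k a + e k b" and e_mult: "e k (a * b) = e k a * e k b" and e_1: "e k 1 = 1"
    and Cauchy_e: "\<epsilon> > 0 \<Longrightarrow> \<exists>N. \<forall>k\<ge>N. \<forall>l\<ge>N. absv (e k a - e l a) < \<epsilon>"
begin

text \<open>Here \<open>c\<close> approximates the limit of \<open>e k a\<close>. Working only with
  such approximations avoids constructing the completion; \<open>null\<close> below is the kernel of
  the limit.\<close>

definition near :: "real \<Rightarrow> 'k \<Rightarrow> 'r \<Rightarrow> bool" where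
  "near \<epsilon> c a \<longleftrightarrow> (\<forall>\<^sub>F k in sequentially. absv (c - e k a) < \<epsilon>)"

definition null :: "'r set" where
  "null = {a. \<forall>\<epsilon>>0. near \<epsilon> 0 a}"

lemma e_0 [simp]: "e k 0 = 0"
  using e_add[of k 0 0] by simp

lemma near_mono: "near \<epsilon> c a \<Longrightarrow> \<epsilon> \<le> \<delta> \<Longrightarrow> near \<delta> c a"
  unfolding near_def by (erule eventually_mono) auto

lemma near_add: "near \<epsilon> c a \<Longrightarrow> near \<epsilon> d b \<Longrightarrow> near \<epsilon> (c + d) (a + b)"
proof -
  assume n: "near \<epsilon> c a" "near \<epsilon> d b"
  have "absv (c + d - e k (a + b)) < \<epsilon>" if "absv (c - e k a) < \<epsilon>" "absv (d - e k b) < \<epsilon>" for k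
    using absv_add_less[OF that] by (simp add: e_add algebra_simps)
  then show ?thesis using n unfolding near_def by (auto elim: eventually_elim2)
qed

lemma near_shift: "near \<epsilon> c a \<Longrightarrow> absv (d - c) < \<epsilon> \<Longrightarrow> near \<epsilon> d a"
proof -
  assume n: "near \<epsilon> c a" and d: "absv (d - c) < \<epsilon>"
  have "absv (d - e k a) < \<epsilon>" if "absv (c - e k a) < \<epsilon>" for k
    using absv_add_less[OF d that] by simp
  then show ?thesis using n unfolding near_def by (auto elim: eventually_mono)
qed

lemma near_e:
  assumes "\<epsilon> > 0"
  shows "\<exists>k. near \<epsilon> (e k a) a"
proof -
  obtain N where "\<forall>k\<ge>N. \<forall>l\<ge>N. absv (e k a - e l a) < \<epsilon>" using Cauchy_e assms by blast
  then show ?thesis unfolding near_def eventually_sequentially by blast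
qed

lemma ex_near: "\<epsilon> > 0 \<Longrightarrow> \<exists>c. near \<epsilon> c a"
  using near_e by blast

lemma bounded_e: "\<exists>B>0. \<forall>\<^sub>F k in sequentially. absv (e k a) \<le> B"
proof -
  obtain c where c: "near 1 c a" using ex_near[of 1] by auto
  have "\<forall>\<^sub>F k in sequentially. absv (e k a) \<le> absv c + 1"
    using c unfolding near_def
  proof (rule eventually_mono)
    fix k assume "absv (c - e k a) < 1"
    then show "absv (e k a) \<le> absv c + 1" using absv_diff[of c "c - e k a"]
      by (smt (verit) absv_nonneg add_diff_cancel_left' diff_add_cancel)
  qed
  then show ?thesis by (intro exI[of _ "absv c + 1"]) (auto simp: add_nonneg_pos)
qed

lemma near_mult:
  assumes "\<epsilon> > 0"
  shows "\<exists>\<delta>>0. \<forall>c d. near \<delta> c a \<longrightarrow> near \<delta> d b \<longrightarrow> near \<epsilon> (c * d) (a * b)"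
proof -
  obtain B where B: "B > 0" "\<forall>\<^sub>F k in sequentially. absv (e k a) \<le> B" using bounded_e by blast
  obtain C where C: "C > 0" "\<forall>\<^sub>F k in sequentially. absv (e k b) \<le> C" using bounded_e by blast
  \<comment> \<open>The cap 1 keeps \<open>absv c\<close> below \<open>B + C + 1\<close>. The other
    bound makes both summands of \<open>c * (d - b) + (c - a) * b\<close> smaller than
    \<open>\<epsilon>\<close>, with \<open>a\<close> and \<open>b\<close> read as their values under
    \<open>e k\<close>.\<close>
  define \<delta> where "\<delta> = min 1 (\<epsilon> / (B + C + 1))"
  have "\<delta> \<le> \<epsilon> / (B + C + 1)" unfolding \<delta>_def by simp
  then have \<delta>3: "\<delta> * (B + C + 1) \<le> \<epsilon>" using B C by (simp add: pos_le_divide_eq)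
  have \<delta>: "\<delta> > 0" "\<delta> \<le> 1" using assms B C by (auto simp: \<delta>_def)
  note \<delta> = \<delta> \<delta>3
  show ?thesis
  proof (intro exI[of _ \<delta>] conjI allI impI)
    fix c d assume "near \<delta> c a" "near \<delta> d b"
    then have "\<forall>\<^sub>F k in sequentially. absv (c - e k a) < \<delta> \<and> absv (d - e k b) < \<delta> \<and> absv (e k a) \<le> B \<and> absv (e k b) \<le> C"
      using B C by (auto simp: near_def eventually_conj_iff)
    then show "near \<epsilon> (c * d) (a * b)" unfolding near_def
    proof (rule eventually_mono)
      fix k assume k: "absv (c - e k a) < \<delta> \<and> absv (d - e k b) < \<delta> \<and> absv (e k a) \<le> B \<and> absv (e k b) \<le> C"
      have "absv c \<le> max (absv (c - e k a)) (absv (e k a))" using absv_add[of "c - e k a" "e k a"] by simp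
      then have c: "absv c < B + C + 1" using k \<delta> B C by auto
      have "absv (c * (d - e k b)) < (B + C + 1) * \<delta>" unfolding absv_mult
        using k c B C by (intro mult_strict_mono) auto
      moreover have "absv ((c - e k a) * e k b) < \<delta> * (B + C + 1)" unfolding absv_mult
        using k c B C \<delta> by (intro mult_strict_mono') auto
      ultimately have "absv (c * (d - e k b) + (c - e k a) * e k b) < \<epsilon>"
        using \<delta> by (intro absv_add_less) (auto simp: mult.commute)
      then show "absv (c * d - e k (a * b)) < \<epsilon>" by (simp add: e_mult algebra_simps)
    qed
  qed (use \<delta> in auto)
qed

lemma near_poly:
  assumes "\<epsilon> > 0"
  shows "\<exists>\<delta>>0. \<forall>\<phi> c. \<phi> 0 = 0 \<longrightarrow> (\<forall>i. near \<delta> (\<phi> (coeff q i)) (coeff q i)) \<longrightarrow> near \<delta> c x \<longrightarrow>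
    near \<epsilon> (poly (map_poly \<phi> q) c) (poly q x)"
  using assms
proof (induction q arbitrary: \<epsilon>)
  case 0
  then show ?case by (intro exI[of _ 1]) (auto simp: near_def)
next
  case (pCons a q)
  obtain \<delta>1 where 1: "\<delta>1 > 0" "\<And>c d. near \<delta>1 c x \<Longrightarrow> near \<delta>1 d (poly q x) \<Longrightarrow> near \<epsilon> (c * d) (x * poly q x)"
    using near_mult[OF pCons.prems] by blast
  obtain \<delta>2 where 2: "\<delta>2 > 0" "\<And>\<phi> c. \<phi> 0 = 0 \<Longrightarrow> (\<forall>i. near \<delta>2 (\<phi> (coeff q i)) (coeff q i)) \<Longrightarrow> near \<delta>2 c x \<Longrightarrow>
    near \<delta>1 (poly (map_poly \<phi> q) c) (poly q x)"
    using pCons.IH[OF 1(1)] by blast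
  define \<delta> where "\<delta> = min \<epsilon> (min \<delta>1 \<delta>2)"
  have \<delta>: "\<delta> \<le> \<epsilon>" "\<delta> \<le> \<delta>1" "\<delta> \<le> \<delta>2" "\<delta> > 0" using 1 2 pCons.prems by (auto simp: \<delta>_def)
  show ?case
  proof (intro exI[of _ \<delta>] conjI allI impI)
    fix \<phi> :: "'r \<Rightarrow> 'k" and c
    assume 0: "\<phi> 0 = 0" and co: "\<forall>i. near \<delta> (\<phi> (coeff (pCons a q) i)) (coeff (pCons a q) i)" and c: "near \<delta> c x"
    have "near \<delta> (\<phi> a) a" using spec[OF co, of 0] by simp
    moreover have "near \<delta> (\<phi> (coeff q i)) (coeff q i)" for i using spec[OF co, of "Suc i"] by simp
    ultimately have "near \<epsilon> (\<phi> a + c * poly (map_poly \<phi> q) c) (a + x * poly q x)"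
      using 0 c near_mono \<delta> by (intro near_add 1(2) 2(2)) blast+
    moreover have "map_poly \<phi> (pCons a q) = pCons (\<phi> a) (map_poly \<phi> q)"
      by (rule poly_eqI) (auto simp: coeff_map_poly 0 coeff_pCons split: nat.splits)
    ultimately show "near \<epsilon> (poly (map_poly \<phi> (pCons a q)) c) (poly (pCons a q) x)" by simp
  qed (use \<delta> in auto)
qed

text \<open>By the ultrametric inequality, the absolute values along a Cauchy sequence that does not
  tend to 0 are eventually constant.\<close>

lemma not_null:
  assumes "a \<notin> null"
  shows "\<exists>b>0. \<forall>\<^sub>F k in sequentially. absv (e k a) \<ge> b"
proof -
  obtain \<epsilon> where \<epsilon>: "\<epsilon> > 0" "\<not> near \<epsilon> 0 a" using assms unfolding null_def by blast
  obtain N where N: "\<forall>k\<ge>N. \<forall>l\<ge>N. absv (e k a - e l a) < \<epsilon>" using Cauchy_e \<epsilon> by blast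
  obtain l where l: "l \<ge> N" "absv (e l a) \<ge> \<epsilon>"
    using \<epsilon>(2) unfolding near_def eventually_sequentially by (auto simp: not_less)
  have "absv (e k a) \<ge> \<epsilon>" if "k \<ge> N" for k
    using absv_eqI[of "e k a" "e l a"] N l that by fastforce
  then show ?thesis using \<epsilon> unfolding eventually_sequentially by blast
qed

lemma near_null:
  assumes "near \<epsilon> c a" "a \<in> null" "\<epsilon> > 0"
  shows "absv c < \<epsilon>"
proof -
  have "\<forall>\<^sub>F k in sequentially. absv (c - e k a) < \<epsilon> \<and> absv (0 - e k a) < \<epsilon>"
    using assms unfolding null_def near_def by (auto simp: eventually_conj_iff)
  then obtain k where "absv (c - e k a) < \<epsilon>" "absv (0 - e k a) < \<epsilon>"
    using eventually_happens by force
  then show ?thesis using absv_diff_less[of "c - e k a" \<epsilon> "0 - e k a"] by simp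
qed

lemma prime_ideal_null: "prime_ideal null"
  unfolding prime_ideal_def
proof (intro conjI ballI allI impI)
  show "0 \<in> null" unfolding null_def near_def by simp
  show "1 \<notin> null" unfolding null_def near_def by (auto simp: e_1 intro!: exI[of _ 1])
  show "a + b \<in> null" if "a \<in> null" "b \<in> null" for a b
    using that near_add[of _ 0 a 0 b] unfolding null_def by auto
  show "b * a \<in> null" if "a \<in> null" for a b
    unfolding null_def
  proof (intro CollectI allI impI)
    fix \<epsilon> :: real assume "\<epsilon> > 0"
    then obtain \<delta> where "\<delta> > 0" "\<And>c d. near \<delta> c b \<Longrightarrow> near \<delta> d a \<Longrightarrow> near \<epsilon> (c * d) (b * a)" using near_mult by blast
    moreover obtain c where "near \<delta> c b" using ex_near \<open>\<delta> > 0\<close> by blast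
    moreover have "near \<delta> 0 a" using that \<open>\<delta> > 0\<close> unfolding null_def by blast
    ultimately show "near \<epsilon> 0 (b * a)" by fastforce
  qed
  show "a \<in> null \<or> b \<in> null" if ab: "a * b \<in> null" for a b
  proof (rule ccontr)
    assume "\<not> (a \<in> null \<or> b \<in> null)"
    then obtain \<alpha> \<beta> where *: "\<alpha> > 0" "\<forall>\<^sub>F k in sequentially. absv (e k a) \<ge> \<alpha>" "\<beta> > 0"
      "\<forall>\<^sub>F k in sequentially. absv (e k b) \<ge> \<beta>" using not_null by metis
    moreover have "\<forall>\<^sub>F k in sequentially. absv (0 - e k (a * b)) < \<alpha> * \<beta>"
      using ab * unfolding null_def near_def by auto
    ultimately have "\<forall>\<^sub>F k in sequentially. absv (0 - e k (a * b)) < \<alpha> * \<beta> \<and> \<alpha> \<le> absv (e k a) \<and> \<beta> \<le> absv (e k b)"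
      by (auto simp: eventually_conj_iff)
    then obtain k where k: "absv (0 - e k (a * b)) < \<alpha> * \<beta> \<and> \<alpha> \<le> absv (e k a) \<and> \<beta> \<le> absv (e k b)"
      using eventually_happens by force
    then have "\<alpha> * \<beta> \<le> absv (e k a) * absv (e k b)" using * by (intro mult_mono) auto
    then show False using k by (simp add: e_mult absv_mult)
  qed
qed

text \<open>The limit on \<open>A\<close> can be approximated on finite sets by homomorphisms to the
  field that vanish on its kernel and are prescribed on \<open>B\<close>. With \<open>B\<close> the
  constants, such homomorphisms on the full Laurent ring are evaluations at points.\<close>

definition dense_homs :: "'r set \<Rightarrow> ('r \<Rightarrow> 'k) \<Rightarrow> 'r set \<Rightarrow> bool" where
  "dense_homs B \<psi> A \<longleftrightarrow> B \<subseteq> A \<and> (\<forall>H \<epsilon>. finite H \<longrightarrow> H \<subseteq> A \<longrightarrow> \<epsilon> > 0 \<longrightarrow>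
     (\<exists>\<phi>. hom_mod A null \<phi> \<and> (\<forall>b\<in>B. \<phi> b = \<psi> b) \<and> (\<forall>h\<in>H. near \<epsilon> (\<phi> h) h)))"

text \<open>Roots of the minimal polynomial depend continuously on its coefficients, so a homomorphism
  close to the limit extends to one close to the limit.\<close>

lemma dense_homs_adjoin:
  assumes A: "subring A" and dense: "dense_homs B \<psi> A"
  shows "dense_homs B \<psi> (adjoin A x)"
  unfolding dense_homs_def
proof (intro conjI allI impI)
  have BA: "B \<subseteq> A" using dense unfolding dense_homs_def by blast
  then show "B \<subseteq> adjoin A x" using subring_adjoin(2)[OF A] by (rule order_trans)
  fix H :: "'r set" and \<epsilon> :: real
  assume H: "finite H" "H \<subseteq> adjoin A x" and \<epsilon>: "\<epsilon> > 0"
  have "\<forall>h\<in>H. \<exists>q. poly_over A q \<and> poly q x = h" using H(2) unfolding adjoin_def by blast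
  then obtain q where q: "\<And>h. h \<in> H \<Longrightarrow> poly_over A (q h)" "\<And>h. h \<in> H \<Longrightarrow> poly (q h) x = h" by metis
  have "\<exists>\<delta>>0. \<forall>h\<in>H. \<forall>\<phi> c. \<phi> 0 = 0 \<longrightarrow> (\<forall>i. near \<delta> (\<phi> (coeff (q h) i)) (coeff (q h) i)) \<longrightarrow> near \<delta> c x \<longrightarrow>
    near \<epsilon> (poly (map_poly \<phi> (q h)) c) (poly (q h) x)"
    using H(1)
  proof (induction H rule: finite_induct)
    case empty
    then show ?case by (intro exI[of _ 1]) auto
  next
    case (insert h H)
    then obtain \<delta>1 where 1: "\<delta>1 > 0" "\<forall>h\<in>H. \<forall>\<phi> c. \<phi> 0 = 0 \<longrightarrow> (\<forall>i. near \<delta>1 (\<phi> (coeff (q h) i)) (coeff (q h) i)) \<longrightarrow>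
      near \<delta>1 c x \<longrightarrow> near \<epsilon> (poly (map_poly \<phi> (q h)) c) (poly (q h) x)" by blast
    obtain \<delta>2 where 2: "\<delta>2 > 0" "\<forall>\<phi> c. \<phi> 0 = 0 \<longrightarrow> (\<forall>i. near \<delta>2 (\<phi> (coeff (q h) i)) (coeff (q h) i)) \<longrightarrow>
      near \<delta>2 c x \<longrightarrow> near \<epsilon> (poly (map_poly \<phi> (q h)) c) (poly (q h) x)" using near_poly[OF \<epsilon>] by blast
    show ?case
    proof (intro exI[of _ "min \<delta>1 \<delta>2"] conjI ballI allI impI)
      fix h' \<phi> c
      assume *: "h' \<in> insert h H" "\<phi> 0 = 0" "\<forall>i. near (min \<delta>1 \<delta>2) (\<phi> (coeff (q h') i)) (coeff (q h') i)"
        "near (min \<delta>1 \<delta>2) c x"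
      have "near \<delta>1 (\<phi> (coeff (q h') i)) (coeff (q h') i)" "near \<delta>2 (\<phi> (coeff (q h') i)) (coeff (q h') i)" for i
        using spec[OF *(3), of i] near_mono by (meson min.cobounded1 min.cobounded2)+
      moreover have "near \<delta>1 c x" "near \<delta>2 c x"
        using *(4) near_mono by (meson min.cobounded1 min.cobounded2)+
      ultimately show "near \<epsilon> (poly (map_poly \<phi> (q h')) c) (poly (q h') x)"
        using *(1,2) 1(2) 2(2) by blast
    qed (use 1 2 in auto)
  qed
  then obtain \<delta> where \<delta>: "\<delta> > 0" "\<And>h \<phi> c. h \<in> H \<Longrightarrow> \<phi> 0 = 0 \<Longrightarrow> (\<And>i. near \<delta> (\<phi> (coeff (q h) i)) (coeff (q h) i)) \<Longrightarrow>
    near \<delta> c x \<Longrightarrow> near \<epsilon> (poly (map_poly \<phi> (q h)) c) (poly (q h) x)" by blast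
  define coeffs_of where "coeffs_of q = coeff q ` {..degree q}" for q :: "'r poly"
  have near_coeffs: "near \<theta> (\<phi> (coeff q i)) (coeff q i)"
    if "\<forall>h\<in>coeffs_of q. near \<theta> (\<phi> h) h" "\<phi> 0 = 0" "\<theta> > 0" for \<theta> \<phi> i and q :: "'r poly"
  proof (cases "i \<le> degree q")
    case True
    then show ?thesis using that unfolding coeffs_of_def by blast
  next
    case False
    then show ?thesis using that by (simp add: coeff_eq_0 near_def)
  qed
  have coeffs_of: "finite (coeffs_of q)" "poly_over A q \<Longrightarrow> coeffs_of q \<subseteq> A" for q
    unfolding coeffs_of_def poly_over_def by auto
  define H' where "H' = (\<Union>h\<in>H. coeffs_of (q h))"
  have H': "finite H'" "H' \<subseteq> A" unfolding H'_def using H coeffs_of q by auto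
  have conclude: "\<exists>\<phi>. hom_mod (adjoin A x) null \<phi> \<and> (\<forall>b\<in>B. \<phi> b = \<psi> b) \<and> (\<forall>h\<in>H. near \<epsilon> (\<phi> h) h)"
    if \<phi>: "hom_mod A null \<phi>" "\<forall>b\<in>B. \<phi> b = \<psi> b" and n: "\<forall>h\<in>H'. near \<delta> (\<phi> h) h" and c: "near \<delta> c x"
      and rel: "\<And>q. poly_over A q \<Longrightarrow> poly q x \<in> null \<Longrightarrow> poly (map_poly \<phi> q) c = 0" for \<phi> c
  proof -
    obtain \<phi>' where \<phi>': "hom_mod (adjoin A x) null \<phi>'"
      "\<And>q. poly_over A q \<Longrightarrow> \<phi>' (poly q x) = poly (map_poly \<phi> q) c" "\<And>a. a \<in> A \<Longrightarrow> \<phi>' a = \<phi> a"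
      using hom_mod_extend[where x = x and c = c, OF A prime_ideal_null \<phi>(1) rel] by blast
    have "near \<epsilon> (\<phi>' h) h" if "h \<in> H" for h
    proof -
      have "near \<epsilon> (poly (map_poly \<phi> (q h)) c) (poly (q h) x)"
        using that n hom_modD(1)[OF \<phi>(1)] \<delta>(1) c unfolding H'_def by (intro \<delta>(2) near_coeffs) auto
      then show ?thesis using \<phi>'(2) q that by metis
    qed
    moreover have "\<forall>b\<in>B. \<phi>' b = \<psi> b" using \<phi>'(3) \<phi>(2) BA by auto
    ultimately show ?thesis using \<phi>' by blast
  qed
  from transcendental_or_min_poly[OF A prime_ideal_null]
  show "\<exists>\<phi>. hom_mod (adjoin A x) null \<phi> \<and> (\<forall>b\<in>B. \<phi> b = \<psi> b) \<and> (\<forall>h\<in>H. near \<epsilon> (\<phi> h) h)"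
  proof
    \<comment> \<open>No relation restricts the value of \<open>x\<close>, so every approximation
      \<open>c\<close> of its limit is allowed.\<close>
    assume t: "transcendental_mod A null x"
    obtain \<phi> where \<phi>: "hom_mod A null \<phi>" "\<forall>b\<in>B. \<phi> b = \<psi> b" "\<forall>h\<in>H'. near \<delta> (\<phi> h) h"
      using dense H' \<delta>(1) unfolding dense_homs_def by blast
    obtain c where "near \<delta> c x" using ex_near \<delta>(1) by blast
    then show ?thesis using conclude[OF \<phi>] transcendental_relations[OF \<phi>(1) t] by blast
  next
    assume "\<exists>G. min_poly_mod A null x G"
    then obtain G where G: "min_poly_mod A null x G" by blast
    then have GA: "poly_over A G" "poly G x \<in> null" "lead_coeff G \<notin> null" unfolding min_poly_mod_def by auto
    obtain b where b: "b > 0" "\<forall>\<^sub>F k in sequentially. absv (e k (lead_coeff G)) \<ge> b"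
      using not_null[OF GA(3)] by blast
    \<comment> \<open>If the image of \<open>G\<close> under \<open>\<phi>\<close> has a value below
      \<open>\<eta>\<close> at \<open>c\<close> and a leading coefficient of size at least
      \<open>b\<close>, then \<open>root_near\<close> gives a root at distance less than
      \<open>\<delta>\<close>, because \<open>\<eta> / b = \<delta> ^ degree G\<close>.\<close>
    define \<eta> where "\<eta> = \<delta> ^ degree G * b"
    have "\<eta> > 0" using \<delta> b by (simp add: \<eta>_def)
    obtain \<theta> where \<theta>: "\<theta> > 0" "\<And>\<phi> c. \<phi> 0 = 0 \<Longrightarrow> (\<And>i. near \<theta> (\<phi> (coeff G i)) (coeff G i)) \<Longrightarrow> near \<theta> c x \<Longrightarrow>
      near \<eta> (poly (map_poly \<phi> G) c) (poly G x)" using near_poly[OF \<open>\<eta> > 0\<close>] by blast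
    define \<epsilon>' where "\<epsilon>' = min b (min \<theta> \<delta>)"
    have \<epsilon>': "\<epsilon>' > 0" "\<epsilon>' \<le> b" "\<epsilon>' \<le> \<theta>" "\<epsilon>' \<le> \<delta>" using b \<theta> \<delta> by (auto simp: \<epsilon>'_def)
    have "finite (H' \<union> coeffs_of G)" "H' \<union> coeffs_of G \<subseteq> A" using H' coeffs_of GA by auto
    then obtain \<phi> where \<phi>: "hom_mod A null \<phi>" "\<forall>b\<in>B. \<phi> b = \<psi> b" "\<forall>h\<in>H' \<union> coeffs_of G. near \<epsilon>' (\<phi> h) h"
      using dense \<epsilon>'(1) unfolding dense_homs_def by blast
    obtain c where c: "near \<epsilon>' c x" using ex_near \<epsilon>'(1) by blast
    have "near \<eta> (poly (map_poly \<phi> G) c) (poly G x)"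
    proof (rule \<theta>(2))
      show "near \<theta> (\<phi> (coeff G i)) (coeff G i)" for i
        using \<phi> hom_modD(1)[OF \<phi>(1)] \<epsilon>'(1,3) by (intro near_mono[OF near_coeffs]) auto
    qed (use c \<epsilon>' near_mono hom_modD(1)[OF \<phi>(1)] in auto)
    then have small: "absv (poly (map_poly \<phi> G) c) < \<eta>" using near_null GA \<open>\<eta> > 0\<close> by blast
    have lead: "absv (\<phi> (lead_coeff G)) \<ge> b"
    proof -
      have "near b (\<phi> (lead_coeff G)) (lead_coeff G)"
        using \<phi> hom_modD(1)[OF \<phi>(1)] \<epsilon>'(1,2) by (intro near_mono[OF near_coeffs]) auto
      then have "\<forall>\<^sub>F k in sequentially. absv (\<phi> (lead_coeff G) - e k (lead_coeff G)) < b \<and> absv (e k (lead_coeff G)) \<ge> b"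
        using b unfolding near_def by (auto simp: eventually_conj_iff)
      then obtain k where "absv (\<phi> (lead_coeff G) - e k (lead_coeff G)) < b \<and> absv (e k (lead_coeff G)) \<ge> b"
        using eventually_happens by force
      then show ?thesis using absv_eqI[of "\<phi> (lead_coeff G)" "e k (lead_coeff G)"] by auto
    qed
    then have nz: "\<phi> (lead_coeff G) \<noteq> 0" using b by auto
    note deg = min_poly_mod_root[OF prime_ideal_null G \<phi>(1) nz]
    obtain r where r: "poly (map_poly \<phi> G) r = 0"
      "absv (c - r) ^ degree G \<le> absv (poly (map_poly \<phi> G) c) / absv (lead_coeff (map_poly \<phi> G))"
      using root_near[of "map_poly \<phi> G" c] deg by auto
    have "lead_coeff (map_poly \<phi> G) = \<phi> (lead_coeff G)"
      by (simp add: deg coeff_map_poly hom_modD(1)[OF \<phi>(1)])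
    then have "absv (c - r) ^ degree G \<le> absv (poly (map_poly \<phi> G) c) / absv (\<phi> (lead_coeff G))" using r(2) by simp
    also have "\<dots> \<le> absv (poly (map_poly \<phi> G) c) / b" using lead b by (intro divide_left_mono mult_pos_pos) (auto simp: nz)
    also have "\<dots> < \<eta> / b" using small b by (simp add: divide_strict_right_mono)
    also have "\<dots> = \<delta> ^ degree G" using b by (simp add: \<eta>_def)
    finally have "absv (c - r) < \<delta>" using \<delta>(1) by (meson less_eq_real_def power_less_imp_less_base)
    moreover have "near \<delta> c x" using c \<epsilon>' near_mono by blast
    ultimately have "near \<delta> r x" using near_shift absv_commute by metis
    moreover have "\<forall>h\<in>H'. near \<delta> (\<phi> h) h" using \<phi>(3) \<epsilon>'(4) near_mono by blast
    ultimately show ?thesis using conclude[OF \<phi>(1,2)] min_poly_relations[OF A prime_ideal_null \<phi>(1) G nz r(1)] by blast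
  qed
qed

lemma dense_homs_adjoin_list:
  "subring A \<Longrightarrow> dense_homs B \<psi> A \<Longrightarrow> dense_homs B \<psi> (adjoin_list A xs)"
  by (induction xs arbitrary: A) (auto simp: dense_homs_adjoin subring_adjoin(1))

end

section \<open>Laurent polynomials on the torus\<close>

definition mon :: "'k::field ^ 'n::finite \<Rightarrow> int ^ 'n \<Rightarrow> 'k" where
  "mon x u = (\<Prod>i\<in>UNIV. x $ i powi (u $ i))"

definition idot :: "int ^ 'n::finite \<Rightarrow> 'k::comm_ring_1 ^ 'n \<Rightarrow> 'k" where
  "idot u y = (\<Sum>i\<in>UNIV. of_int (u $ i) * y $ i)"

text \<open>Linear extension of a function on monomials. Evaluation and the derivative
  \<open>Dlog\<close> both have this form, so additivity and the splitting into single terms are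
  shown once.\<close>

definition lin :: "(int ^ 'n::finite \<Rightarrow> 'k::field) \<Rightarrow> ('n, 'k) laurent \<Rightarrow> 'k" where
  "lin F p = (\<Sum>u\<in>Poly_Mapping.keys p. Poly_Mapping.lookup p u * F u)"

text \<open>The derivative of \<open>p\<close> at \<open>x\<close> in the direction \<open>(x\<^sub>i \<eta>\<^sub>i)\<^sub>i\<close>.\<close>

definition Dlog :: "'k::field ^ 'n::finite \<Rightarrow> 'k ^ 'n \<Rightarrow> ('n, 'k) laurent \<Rightarrow> 'k" where
  "Dlog x \<eta> = lin (\<lambda>u. mon x u * idot u \<eta>)"

lemma leval_lin: "leval p x = lin (mon x) p"
  by (simp add: leval_def lin_def mon_def)

lemma lin_superset:
  assumes "finite S" "Poly_Mapping.keys p \<subseteq> S"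
  shows "lin F p = (\<Sum>u\<in>S. Poly_Mapping.lookup p u * F u)"
  unfolding lin_def using assms
  by (intro sum.mono_neutral_left) (auto simp: in_keys_iff)

lemma lin_0 [simp]: "lin F 0 = 0"
  by (simp add: lin_def)

lemma lin_add: "lin F (p + q) = lin F p + lin F q"
proof -
  let ?S = "Poly_Mapping.keys p \<union> Poly_Mapping.keys q"
  have "lin F (p + q) = (\<Sum>u\<in>?S. Poly_Mapping.lookup (p + q) u * F u)"
    using keys_add[of p q] by (intro lin_superset) auto
  also have "\<dots> = (\<Sum>u\<in>?S. Poly_Mapping.lookup p u * F u) + (\<Sum>u\<in>?S. Poly_Mapping.lookup q u * F u)"
    by (simp add: lookup_add distrib_right sum.distrib)
  finally show ?thesis using lin_superset[of ?S p F] lin_superset[of ?S q F] by simp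
qed

lemma lin_single [simp]: "lin F (Poly_Mapping.single u c) = c * F u"
  by (simp add: lin_def)

lemma lin_sum: "lin F (\<Sum>i\<in>I. g i) = (\<Sum>i\<in>I. lin F (g i))"
  by (induction I rule: infinite_finite_induct) (auto simp: lin_add)

lemma lin_minus: "lin F (- p) = - lin F p"
  by (simp add: lin_def sum_negf)

lemma lin_diff: "lin F (p - q) = lin F p - lin F q"
  using lin_add[of F p "- q"] by (simp add: lin_minus)

lemma laurent_sum:
  fixes p :: "('n::finite, 'k::field) laurent"
  shows "p = (\<Sum>u\<in>Poly_Mapping.keys p. Poly_Mapping.single u (Poly_Mapping.lookup p u))"
proof (rule poly_mapping_eqI)
  fix k
  have "(\<Sum>u\<in>Poly_Mapping.keys p. if u = k then Poly_Mapping.lookup p u else 0) = Poly_Mapping.lookup p k"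
    by (subst sum.delta) (auto simp: in_keys_iff)
  then show "Poly_Mapping.lookup p k = Poly_Mapping.lookup (\<Sum>u\<in>Poly_Mapping.keys p. Poly_Mapping.single u (Poly_Mapping.lookup p u)) k"
    by (simp add: lookup_sum lookup_single when_def)
qed

lemma laurent_induct [case_names zero single add]:
  fixes p :: "('n::finite, 'k::field) laurent"
  assumes "P 0" "\<And>u c. P (Poly_Mapping.single u c)" "\<And>p q. P p \<Longrightarrow> P q \<Longrightarrow> P (p + q)"
  shows "P p"
proof -
  have "P (\<Sum>u\<in>S. Poly_Mapping.single u (g u))" if "finite S" for S and g :: "int ^ 'n \<Rightarrow> 'k"
    using that by (induction S rule: finite_induct) (auto intro: assms)
  then have "P (\<Sum>u\<in>Poly_Mapping.keys p. Poly_Mapping.single u (Poly_Mapping.lookup p u))" by simp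
  then show ?thesis using laurent_sum[of p] by simp
qed

lemma torus_nz [simp]: "x \<in> torus \<Longrightarrow> x $ i \<noteq> 0"
  by (simp add: torus_def)

lemma mon_nz [simp]: "x \<in> torus \<Longrightarrow> mon x u \<noteq> 0"
  by (simp add: mon_def)

lemma mon_add: "x \<in> torus \<Longrightarrow> mon x (u + v) = mon x u * mon x v"
  by (simp add: mon_def power_int_add prod.distrib)

lemma mon_0 [simp]: "mon x 0 = 1"
  by (simp add: mon_def)

lemma mon_axis: "mon x (axis i m) = x $ i powi m"
proof -
  have "mon x (axis i m) = (\<Prod>j\<in>UNIV. if j = i then x $ j powi m else 1)"
    unfolding mon_def by (intro prod.cong) (auto simp: axis_def)
  then show ?thesis by simp
qed

lemma mon_minus: "x \<in> torus \<Longrightarrow> mon x (- u) = inverse (mon x u)"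
  using mon_add[of x u "- u"] by (simp add: field_simps)

lemma idot_add: "idot (u + v) y = idot u y + idot v y"
  by (simp add: idot_def distrib_right sum.distrib)

lemma idot_0 [simp]: "idot 0 y = 0"
  by (simp add: idot_def)

lemma idot_add_right: "idot u (x + y) = idot u x + idot u y"
  by (simp add: idot_def distrib_left sum.distrib)

lemma idot_diff_right: "idot u (x - y) = idot u x - idot u y"
  by (simp add: idot_def right_diff_distrib sum_subtractf)

lemma idot_scale_right: "idot u (c *s y) = c * idot u y"
  by (simp add: idot_def sum_distrib_left mult.left_commute)

lemma idot_axis: "idot (axis i m) y = of_int m * y $ i"
proof -
  have "idot (axis i m) y = (\<Sum>j\<in>UNIV. if j = i then of_int m * y $ j else 0)"
    unfolding idot_def by (intro sum.cong) (auto simp: axis_def)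
  then show ?thesis by simp
qed

lemma idot_minus: "idot (- u) y = - idot u y"
  by (simp add: idot_def sum_negf)

lemma leval_mult: "x \<in> torus \<Longrightarrow> leval (p * q) x = leval p x * leval q x"
  unfolding leval_lin
proof (induction p rule: laurent_induct)
  case (single u c)
  then show ?case
  proof (induction q rule: laurent_induct)
    case (single v d)
    then show ?case by (simp add: mult_single mon_add)
  qed (auto simp: distrib_left lin_add)
qed (auto simp: distrib_right lin_add)

lemma leval_add: "leval (p + q) x = leval p x + leval q x"
  and leval_diff: "leval (p - q) x = leval p x - leval q x"
  and leval_sum: "leval (\<Sum>i\<in>I. g i) x = (\<Sum>i\<in>I. leval (g i) x)"
  and leval_single: "leval (Poly_Mapping.single u c) x = c * mon x u"
  and leval_0 [simp]: "leval 0 x = 0"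
  and leval_1 [simp]: "leval 1 x = 1"
proof -
  show "leval 1 x = 1" by (simp add: leval_def)
qed (auto simp: leval_lin lin_add lin_diff lin_sum)

lemma leval_prod: "x \<in> torus \<Longrightarrow> leval (\<Prod>i\<in>I. g i) x = (\<Prod>i\<in>I. leval (g i) x)"
  by (induction I rule: infinite_finite_induct) (auto simp: leval_mult)

lemma Dlog_add: "Dlog x \<eta> (p + q) = Dlog x \<eta> p + Dlog x \<eta> q"
  and Dlog_diff: "Dlog x \<eta> (p - q) = Dlog x \<eta> p - Dlog x \<eta> q"
  and Dlog_sum: "Dlog x \<eta> (\<Sum>i\<in>I. g i) = (\<Sum>i\<in>I. Dlog x \<eta> (g i))"
  and Dlog_single: "Dlog x \<eta> (Poly_Mapping.single u c) = c * (mon x u * idot u \<eta>)"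
  and Dlog_0 [simp]: "Dlog x \<eta> 0 = 0"
  by (auto simp: Dlog_def lin_add lin_diff lin_sum)

lemma Dlog_mult: "x \<in> torus \<Longrightarrow> Dlog x \<eta> (p * q) = leval p x * Dlog x \<eta> q + Dlog x \<eta> p * leval q x"
proof (induction p rule: laurent_induct)
  case (single u c)
  then show ?case
  proof (induction q rule: laurent_induct)
    case (single v d)
    then show ?case by (simp add: mult_single Dlog_single leval_single mon_add idot_add algebra_simps)
  qed (auto simp: distrib_left distrib_right Dlog_add leval_add)
qed (auto simp: distrib_right distrib_left Dlog_add leval_add)

lemma sum_lderiv:
  fixes x :: "'k::field ^ 'n::finite"
  assumes "x \<in> torus"
  shows "(\<Sum>j\<in>UNIV. leval (lderiv j p) x * (x $ j * \<eta> $ j)) = Dlog x \<eta> p"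
proof -
  have m: "mon x (u - axis j 1) * x $ j = mon x u" for u j
    using mon_add[OF assms, of "u - axis j 1" "axis j 1"] by (simp add: mon_axis)
  have "leval (lderiv j p) x * (x $ j * \<eta> $ j) =
      (\<Sum>u\<in>Poly_Mapping.keys p. Poly_Mapping.lookup p u * (mon x u * (of_int (u $ j) * \<eta> $ j)))" for j
    unfolding lderiv_def leval_sum leval_single sum_distrib_right
    by (intro sum.cong refl) (subst m [of _ j, symmetric], simp add: mult_ac)
  then have "(\<Sum>j\<in>UNIV. leval (lderiv j p) x * (x $ j * \<eta> $ j)) =
      (\<Sum>j\<in>UNIV. \<Sum>u\<in>Poly_Mapping.keys p. Poly_Mapping.lookup p u * (mon x u * (of_int (u $ j) * \<eta> $ j)))"
    by simp
  also have "\<dots> = Dlog x \<eta> p"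
    unfolding Dlog_def lin_def idot_def by (subst sum.swap) (simp add: sum_distrib_left)
  finally show ?thesis .
qed

lemma torus_functionsD: "p \<in> torus_functions \<Longrightarrow> u \<in> Poly_Mapping.keys p \<Longrightarrow> (\<Sum>i\<in>UNIV. u $ i) = 0"
  unfolding torus_functions_def char_lattice_def by blast

lemma torus_functionsI: "(\<And>u. u \<in> Poly_Mapping.keys p \<Longrightarrow> (\<Sum>i\<in>UNIV. u $ i) = 0) \<Longrightarrow> p \<in> torus_functions"
  unfolding torus_functions_def char_lattice_def by blast

lemma torus_functions_mult:
  assumes "p \<in> torus_functions" "q \<in> torus_functions"
  shows "p * q \<in> torus_functions"
proof (rule torus_functionsI)
  fix u assume "u \<in> Poly_Mapping.keys (p * q)"
  then obtain a b where "u = a + b" "a \<in> Poly_Mapping.keys p" "b \<in> Poly_Mapping.keys q"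
    using keys_mult[of p q] by blast
  then show "(\<Sum>i\<in>UNIV. u $ i) = 0"
    using torus_functionsD[OF assms(1)] torus_functionsD[OF assms(2)] by (simp add: sum.distrib)
qed

lemma torus_functions_diff:
  assumes "p \<in> torus_functions" "q \<in> torus_functions"
  shows "p - q \<in> torus_functions"
proof (rule torus_functionsI)
  fix u assume "u \<in> Poly_Mapping.keys (p - q)"
  then have "u \<in> Poly_Mapping.keys p \<or> u \<in> Poly_Mapping.keys q" by (auto simp: in_keys_iff lookup_minus)
  then show "(\<Sum>i\<in>UNIV. u $ i) = 0"
    using torus_functionsD[OF assms(1)] torus_functionsD[OF assms(2)] by blast
qed

lemma torus_functions_single: "u \<in> char_lattice \<Longrightarrow> Poly_Mapping.single u c \<in> torus_functions"
  unfolding torus_functions_def by simp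

lemma zero_char_lattice: "0 \<in> char_lattice"
  by (simp add: char_lattice_def)

lemma torus_functions_1: "1 \<in> torus_functions"
  using torus_functions_single[OF zero_char_lattice, of 1] by simp

lemma torus_functions_prod: "(\<And>i. i \<in> I \<Longrightarrow> g i \<in> torus_functions) \<Longrightarrow> prod g I \<in> torus_functions"
  by (induction I rule: infinite_finite_induct) (auto simp: torus_functions_1 torus_functions_mult)

lemma keys_single_mult:
  assumes "a \<noteq> (0::'k::field)"
  shows "Poly_Mapping.lookup (Poly_Mapping.single u a * p) (u + m) = a * Poly_Mapping.lookup p m"
    "Poly_Mapping.keys (Poly_Mapping.single (u::int^'n) a * p) = (+) u ` Poly_Mapping.keys p"
proof -
  have *: "Poly_Mapping.lookup (Poly_Mapping.single u a * p) (u + m) = a * Poly_Mapping.lookup p m" for m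
  proof (induction p rule: laurent_induct)
    case (single v c)
    then show ?case by (auto simp: mult_single lookup_single when_def)
  qed (auto simp: distrib_left lookup_add)
  show "Poly_Mapping.lookup (Poly_Mapping.single u a * p) (u + m) = a * Poly_Mapping.lookup p m" by (rule *)
  show "Poly_Mapping.keys (Poly_Mapping.single u a * p) = (+) u ` Poly_Mapping.keys p"
  proof (intro equalityI subsetI)
    fix w assume "w \<in> Poly_Mapping.keys (Poly_Mapping.single u a * p)"
    then have "w - u \<in> Poly_Mapping.keys p" using *[of "w - u"] assms by (auto simp: in_keys_iff)
    then show "w \<in> (+) u ` Poly_Mapping.keys p" by (intro image_eqI[of _ _ "w - u"]) auto
  qed (use * assms in \<open>auto simp: in_keys_iff\<close>)
qed

section \<open>Tangent spaces of complete intersections\<close>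

text \<open>Clearing denominators by a monomial divisible by all variables turns a function on the torus that
  vanishes on \<open>X\<close> into a polynomial that also vanishes on the boundary.\<close>

lemma tangent_space_torus:
  fixes X :: "('k::field ^ 'n::finite) set"
  assumes ci: "torus_complete_intersection I f (X \<inter> torus)" and f: "\<And>i. i \<in> I \<Longrightarrow> f i \<in> torus_functions"
    and P: "P \<in> X" "P \<in> torus"
  shows "tangent_space X P = {y. \<forall>i\<in>I. Dlog P (\<chi> j. y $ j / P $ j) (f i) = 0}"
    and "y \<in> tangent_space X P \<Longrightarrow> h \<in> torus_functions \<Longrightarrow> (\<And>x. x \<in> X \<inter> torus \<Longrightarrow> leval h x = 0) \<Longrightarrow>
      Dlog P (\<chi> j. y $ j / P $ j) h = 0"
proof -
  have T: "(\<Sum>i\<in>UNIV. leval (lderiv i p) P * y $ i) = Dlog P (\<chi> j. y $ j / P $ j) p" for y p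
    using sum_lderiv[OF P(2), of p "\<chi> j. y $ j / P $ j"] P(2) by simp
  have X: "X \<inter> torus = torus \<inter> (\<Inter>i\<in>I. torus_zeros (f i))"
    and gen: "\<And>h. h \<in> torus_functions \<Longrightarrow> (\<forall>x\<in>X \<inter> torus. leval h x = 0) \<Longrightarrow>
        \<exists>q. (\<forall>i\<in>I. q i \<in> torus_functions) \<and> h = (\<Sum>i\<in>I. q i * f i)"
    using ci unfolding torus_complete_intersection_def by auto
  have fX: "leval (f i) x = 0" if "i \<in> I" "x \<in> X" "x \<in> torus" for i x
    using X that unfolding torus_zeros_def by blast
  have 1: "Dlog P (\<chi> j. y $ j / P $ j) (f i) = 0" if y: "y \<in> tangent_space X P" and i: "i \<in> I" for y i
  proof -
    define \<eta> where "\<eta> = (\<chi> j. y $ j / P $ j)"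
    \<comment> \<open>Large enough to raise all exponents of \<open>f i\<close> to at least 1, so
      that the resulting polynomial vanishes wherever some coordinate does.\<close>
    define N where "N = 1 + (\<Sum>u\<in>Poly_Mapping.keys (f i). \<Sum>l\<in>UNIV. \<bar>u $ l\<bar>)"
    have N: "u $ l + N \<ge> 1" if "u \<in> Poly_Mapping.keys (f i)" for u l
    proof -
      have "\<bar>u $ l\<bar> \<le> (\<Sum>l\<in>UNIV. \<bar>u $ l\<bar>)" by (intro member_le_sum) auto
      also have "\<dots> \<le> (\<Sum>u\<in>Poly_Mapping.keys (f i). \<Sum>l\<in>UNIV. \<bar>u $ l\<bar>)"
        using that by (intro member_le_sum[of u]) (auto simp: sum_nonneg)
      finally show ?thesis unfolding N_def by linarith
    qed
    define s where "s = (\<chi> l::'n. N)"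
    define g where "g = Poly_Mapping.single s 1 * f i"
    have kg: "Poly_Mapping.keys g = (+) s ` Poly_Mapping.keys (f i)" unfolding g_def by (rule keys_single_mult) simp
    have kpos: "u $ l \<ge> 1" if "u \<in> Poly_Mapping.keys g" for u l
      using that N kg by (auto simp: s_def add.commute)
    have "homogeneous_poly g" unfolding homogeneous_poly_def
    proof (intro exI[of _ "N * int CARD('n)"] ballI conjI allI)
      fix u assume u: "u \<in> Poly_Mapping.keys g"
      then show "0 \<le> u $ l" for l using kpos[of u l] by simp
      obtain m where "m \<in> Poly_Mapping.keys (f i)" "u = s + m" using u kg by blast
      moreover have "(\<Sum>l\<in>UNIV. m $ l) = 0"
        using f[OF i] \<open>m \<in> _\<close> unfolding torus_functions_def char_lattice_def by blast
      ultimately show "(\<Sum>l\<in>UNIV. u $ l) = N * int CARD('n)" by (simp add: s_def sum.distrib)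
    qed
    moreover have "leval g x = 0" if x: "x \<in> X" for x
    proof (cases "x \<in> torus")
      case True
      then show ?thesis using fX[OF i x] by (simp add: g_def leval_mult)
    next
      case False
      then obtain l where l: "x $ l = 0" unfolding torus_def by blast
      then have "x $ l powi (u $ l) = 0" if "u \<in> Poly_Mapping.keys g" for u
        using kpos[OF that, of l] by (simp add: power_int_0_left_if)
      then have "(\<Prod>l\<in>UNIV. x $ l powi (u $ l)) = 0" if "u \<in> Poly_Mapping.keys g" for u
        using that by (intro prod_zero) auto
      then show ?thesis unfolding leval_def by (intro sum.neutral) simp
    qed
    ultimately have "(\<Sum>i\<in>UNIV. leval (lderiv i g) P * y $ i) = 0" using y unfolding tangent_space_def by blast
    then have "Dlog P \<eta> g = 0" unfolding T \<eta>_def .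
    then have "mon P s * Dlog P \<eta> (f i) = 0"
      unfolding g_def Dlog_mult[OF P(2)] using fX[OF i P] by (simp add: leval_single)
    then show ?thesis using P(2) by (simp add: \<eta>_def)
  qed
  \<comment> \<open>By the product rule, \<open>q i * f i\<close> contributes only
    \<open>leval (q i) P * Dlog P \<eta> (f i)\<close>, as \<open>f i\<close> vanishes at
    \<open>P\<close>.\<close>
  have 2: "Dlog P \<eta> h = 0" if \<eta>: "\<forall>i\<in>I. Dlog P \<eta> (f i) = 0" and h: "h \<in> torus_functions"
    "\<forall>x\<in>X \<inter> torus. leval h x = 0" for \<eta> h
  proof -
    obtain q where "h = (\<Sum>i\<in>I. q i * f i)" using gen[OF h] by blast
    then show ?thesis using \<eta> fX P by (simp add: Dlog_sum Dlog_mult)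
  qed
  have 3: "y \<in> tangent_space X P" if y: "\<forall>i\<in>I. Dlog P (\<chi> j. y $ j / P $ j) (f i) = 0" for y
    unfolding tangent_space_def
  proof (intro CollectI allI impI)
    fix p :: "('n, 'k) laurent"
    assume p: "homogeneous_poly p \<and> (\<forall>x\<in>X. leval p x = 0)"
    then obtain d where d: "\<And>u. u \<in> Poly_Mapping.keys p \<Longrightarrow> (\<Sum>i\<in>UNIV. u $ i) = d" unfolding homogeneous_poly_def by blast
    obtain i0 :: 'n where True by blast
    \<comment> \<open>Dividing a form of degree \<open>d\<close> by the \<open>d\<close>-th power of
      one variable gives a function on the torus, to which the previous step applies.\<close>
    define s where "s = axis i0 (- d)"
    have s: "(\<Sum>i\<in>UNIV. s $ i) = - d" unfolding s_def axis_def by simp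
    define h where "h = Poly_Mapping.single s 1 * p"
    have "h \<in> torus_functions"
      unfolding torus_functions_def char_lattice_def h_def
      using keys_single_mult(2)[of 1 s p] d s by (auto simp: sum.distrib)
    moreover have "\<forall>x\<in>X \<inter> torus. leval h x = 0" using p by (auto simp: h_def leval_mult)
    ultimately have "Dlog P (\<chi> j. y $ j / P $ j) h = 0" using 2[OF y] by blast
    then have "Dlog P (\<chi> j. y $ j / P $ j) p = 0"
      using p P unfolding h_def by (simp add: Dlog_mult leval_single)
    then show "(\<Sum>i\<in>UNIV. leval (lderiv i p) P * y $ i) = 0" unfolding T .
  qed
  show "tangent_space X P = {y. \<forall>i\<in>I. Dlog P (\<chi> j. y $ j / P $ j) (f i) = 0}" using 1 3 by blast
  show "Dlog P (\<chi> j. y $ j / P $ j) h = 0"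
    if "y \<in> tangent_space X P" "h \<in> torus_functions" "\<And>x. x \<in> X \<inter> torus \<Longrightarrow> leval h x = 0"
    using 2[of _ h] 1[OF that(1)] that(2,3) by blast
qed

section \<open>Homomorphisms on the ring of Laurent polynomials\<close>

definition cst :: "'k::field \<Rightarrow> ('n::finite, 'k) laurent" where
  "cst c = Poly_Mapping.single 0 c"

definition var :: "'n::finite \<Rightarrow> int \<Rightarrow> ('n, 'k::field) laurent" where
  "var i m = Poly_Mapping.single (axis i m) 1"

text \<open>A list, because generators are adjoined one at a time; its order is irrelevant. The
  inverses of the variables are included since constants and variables alone generate only
  polynomials.\<close>

definition laurent_gens :: "('n::finite, 'k::field) laurent list" where
  "laurent_gens = (SOME xs. set xs = {var i m | i m. m \<in> {1, -1}})"

lemma cst_simps: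
  "cst 0 = 0" "cst 1 = 1" "cst (a + b) = cst a + cst b" "cst (a * b) = cst a * cst b" "cst (- a) = - cst a"
  by (simp_all add: cst_def single_add mult_single single_uminus)

lemma leval_cst [simp]: "leval (cst c) x = c"
  by (simp add: cst_def leval_single)

lemma axis_add: "axis i m + axis i m' = (axis i (m + m') :: int ^ 'n::finite)"
  by (simp add: vec_eq_iff axis_def)

lemma axis_0: "axis i 0 = (0 :: int ^ 'n::finite)"
  by (simp add: vec_eq_iff axis_def)

lemma var_add: "var i m * var i m' = (var i (m + m') :: ('n::finite, 'k::field) laurent)"
  by (simp add: var_def mult_single axis_add)

lemma var_0: "var i 0 = (1 :: ('n::finite, 'k::field) laurent)"
  by (simp add: var_def axis_0)

lemma var_power: "var i m ^ k = (var i (int k * m) :: ('n::finite, 'k::field) laurent)"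
  by (induction k) (simp_all add: var_0 var_add algebra_simps)

lemma single_prod_var: "Poly_Mapping.single u c = cst c * (\<Prod>i\<in>UNIV. var i (u $ i))"
  for u :: "int ^ 'n::finite" and c :: "'k::field"
proof -
  have "(\<Prod>i\<in>J. var i (u $ i)) = (Poly_Mapping.single (\<Sum>i\<in>J. axis i (u $ i)) 1 :: ('n, 'k) laurent)" for J
    by (induction J rule: infinite_finite_induct) (simp_all add: var_def mult_single)
  moreover have "(\<Sum>i\<in>UNIV. axis i (u $ i)) = u"
    by (simp add: vec_eq_iff axis_def)
  ultimately show ?thesis by (simp add: cst_def mult_single)
qed

lemma subring_prod: "subring A \<Longrightarrow> (\<And>i. i \<in> I \<Longrightarrow> g i \<in> A) \<Longrightarrow> prod g I \<in> A"
  by (induction I rule: infinite_finite_induct) (auto simp: subringD)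

lemma laurent_generated:
  fixes A :: "('n::finite, 'k::field) laurent set"
  assumes A: "subring A" and c: "\<And>c. cst c \<in> A" and v: "\<And>i. var i 1 \<in> A" "\<And>i. var i (-1) \<in> A"
  shows "A = UNIV"
proof -
  have "p \<in> A" for p
  proof (induction p rule: laurent_induct)
    case (single u c)
    have "(var i m :: ('n, 'k) laurent) \<in> A" for i m
    proof (cases "m \<ge> 0")
      case True
      then have "(var i m :: ('n, 'k) laurent) = var i 1 ^ nat m" by (simp add: var_power)
      then show ?thesis using subring_power[OF A v(1)] by metis
    next
      case False
      then have "(var i m :: ('n, 'k) laurent) = var i (- 1) ^ nat (- m)" by (simp add: var_power)
      then show ?thesis using subring_power[OF A v(2)] by metis
    qed
    then have "cst c * (\<Prod>i\<in>UNIV. var i (u $ i)) \<in> A" by (intro subringD(4)[OF A] subring_prod[OF A] c)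
    then show ?case by (simp only: single_prod_var)
  qed (use subringD[OF A] in auto)
  then show ?thesis by blast
qed

lemma set_laurent_gens:
  "set (laurent_gens :: ('n::finite, 'k::field) laurent list) = {var i m | i m. m \<in> {1, -1}}"
proof -
  have "{var i m | i m. m \<in> {1, -1}} = (\<lambda>(i, m). var i m :: ('n, 'k) laurent) ` (UNIV \<times> {1, -1})" by auto
  then have "finite {var i m :: ('n, 'k) laurent | i m. m \<in> {1, -1}}" by simp
  then show ?thesis unfolding laurent_gens_def by (rule someI_ex[OF finite_list])
qed

lemma adjoin_laurent_gens:
  fixes A :: "('n::finite, 'k::field) laurent set"
  assumes A: "subring A" and c: "\<And>c. cst c \<in> A"
  shows "adjoin_list A laurent_gens = UNIV"
proof -
  note * = subring_adjoin_list[OF A, of laurent_gens]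
  show ?thesis
  proof (rule laurent_generated)
    show "subring (adjoin_list A laurent_gens)" using * by blast
    show "cst c \<in> adjoin_list A laurent_gens" for c using * c by blast
    show "var i 1 \<in> adjoin_list A laurent_gens" "var i (-1) \<in> adjoin_list A laurent_gens" for i
      using * set_laurent_gens by blast+
  qed
qed

text \<open>The variables are units, so their images are nonzero and form a point of the torus. A
  homomorphism fixing the constants is determined by this point.\<close>

lemma hom_is_leval:
  fixes \<phi> :: "('n::finite, 'k::field) laurent \<Rightarrow> 'k"
  assumes \<phi>: "hom_mod UNIV p \<phi>" and c: "\<And>c. \<phi> (cst c) = c"
  defines "P \<equiv> \<chi> i. \<phi> (var i 1)"
  shows "P \<in> torus" "leval h P = \<phi> h"
proof -
  note hom = hom_modD(2-4)[OF \<phi>, simplified]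
  have inv: "\<phi> (var i m) * \<phi> (var i (- m)) = 1" for i m
    using hom(3)[of "var i m" "var i (- m)"] by (simp add: var_add var_0 hom(1))
  have "P $ i \<noteq> 0" for i using inv[of i 1] by (auto simp: P_def)
  then show P: "P \<in> torus" unfolding torus_def by blast
  have pow: "\<phi> (var i (int k)) = P $ i ^ k" for i k
  proof (induction k)
    case (Suc k)
    have "var i (int (Suc k)) = (var i 1 * var i (int k) :: ('n, 'k) laurent)" by (simp add: var_add)
    then show ?case using Suc by (simp add: hom(3) P_def)
  qed (simp add: var_0 hom(1))
  have var: "\<phi> (var i m) = P $ i powi m" for i m
  proof (cases "m \<ge> 0")
    case True
    then show ?thesis using pow[of i "nat m"] by (simp add: power_int_def)
  next
    case False
    then have "\<phi> (var i m) * P $ i ^ nat (- m) = 1" using inv[of i m] pow[of i "nat (- m)"] by simp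
    then have "\<phi> (var i m) = inverse (P $ i ^ nat (- m))" by (metis inverse_inverse_eq inverse_unique mult.commute)
    then show ?thesis using False by (simp add: power_int_def power_inverse)
  qed
  have prod: "\<phi> (\<Prod>i\<in>J. g i) = (\<Prod>i\<in>J. \<phi> (g i))" for J g
    by (induction J rule: infinite_finite_induct) (auto simp: hom)
  show "leval h P = \<phi> h"
  proof (induction h rule: laurent_induct)
    case zero
    then show ?case using hom_modD(1)[OF \<phi>] by simp
  next
    case (single u c)
    then show ?case unfolding leval_single by (subst single_prod_var[of u c]) (simp add: hom(3) c prod var mon_def)
  next
    case (add p q)
    then show ?case by (simp add: leval_add hom(2))
  qed
qed

section \<open>Prime ideals avoiding a multiplicative set\<close>

definition ideal :: "'r::comm_ring_1 set \<Rightarrow> bool" where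
  "ideal I \<longleftrightarrow> 0 \<in> I \<and> (\<forall>a\<in>I. \<forall>b\<in>I. a + b \<in> I) \<and> (\<forall>a\<in>I. \<forall>b. b * a \<in> I)"

text \<open>Krull's argument: an ideal that is maximal among those containing \<open>I\<close> and
  missing \<open>S\<close> is prime.\<close>

lemma ex_prime_ideal_avoiding:
  fixes I S :: "'r::comm_ring_1 set"
  assumes I: "ideal I" and S: "1 \<in> S" "\<And>a b. a \<in> S \<Longrightarrow> b \<in> S \<Longrightarrow> a * b \<in> S" and "I \<inter> S = {}"
  shows "\<exists>p. prime_ideal p \<and> I \<subseteq> p \<and> p \<inter> S = {}"
proof -
  define \<I> where "\<I> = {J. ideal J \<and> I \<subseteq> J \<and> J \<inter> S = {}}"
  have "\<exists>M\<in>\<I>. \<forall>J\<in>\<I>. M \<subseteq> J \<longrightarrow> J = M"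
  proof (rule subset_Zorn_nonempty)
    show "\<I> \<noteq> {}" unfolding \<I>_def using assms by blast
    fix C assume C: "C \<noteq> {}" "subset.chain \<I> C"
    then have sub: "C \<subseteq> \<I>" and ch: "\<And>J K. J \<in> C \<Longrightarrow> K \<in> C \<Longrightarrow> J \<subseteq> K \<or> K \<subseteq> J"
      unfolding subset.chain_def by auto
    have "ideal (\<Union>C)" unfolding ideal_def
    proof (intro conjI ballI allI)
      show "0 \<in> \<Union>C" using C(1) sub unfolding \<I>_def ideal_def by blast
      show "b * a \<in> \<Union>C" if "a \<in> \<Union>C" for a b using that sub unfolding \<I>_def ideal_def by blast
      show "a + b \<in> \<Union>C" if ab: "a \<in> \<Union>C" "b \<in> \<Union>C" for a b
      proof -
        obtain J K where "J \<in> C" "K \<in> C" "a \<in> J" "b \<in> K" using ab by blast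
        then obtain M where "M \<in> C" "a \<in> M" "b \<in> M" using ch by blast
        then show ?thesis using sub unfolding \<I>_def ideal_def by blast
      qed
    qed
    then show "\<Union>C \<in> \<I>" using C(1) sub unfolding \<I>_def by blast
  qed
  then obtain M where M: "M \<in> \<I>" "\<And>J. J \<in> \<I> \<Longrightarrow> M \<subseteq> J \<Longrightarrow> J = M" by blast
  have Mi: "0 \<in> M" "\<And>a b. a \<in> M \<Longrightarrow> b \<in> M \<Longrightarrow> a + b \<in> M" "\<And>a b. a \<in> M \<Longrightarrow> b * a \<in> M"
    using M(1) unfolding \<I>_def ideal_def by auto
  have meets: "\<exists>m\<in>M. \<exists>r. m + r * a \<in> S" if a: "a \<notin> M" for a
  proof (rule ccontr)
    assume no: "\<not> (\<exists>m\<in>M. \<exists>r. m + r * a \<in> S)"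
    define J where "J = {m + r * a | m r. m \<in> M}"
    have "ideal J" unfolding ideal_def
    proof (intro conjI ballI allI)
      show "0 \<in> J" unfolding J_def using Mi(1) by (intro CollectI exI[of _ 0]) auto
      fix x y assume "x \<in> J"
      then obtain m r where x: "x = m + r * a" "m \<in> M" unfolding J_def by blast
      have "y * x = y * m + (y * r) * a" by (simp add: x algebra_simps)
      then show "y * x \<in> J" unfolding J_def using Mi(3) x(2) by blast
      assume "y \<in> J"
      then obtain m' r' where y: "y = m' + r' * a" "m' \<in> M" unfolding J_def by blast
      have "x + y = (m + m') + (r + r') * a" by (simp add: x y algebra_simps)
      then show "x + y \<in> J" unfolding J_def using Mi(2) x(2) y(2) by blast
    qed
    moreover have MJ: "M \<subseteq> J"
    proof
      fix m assume "m \<in> M"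
      then show "m \<in> J" unfolding J_def by (intro CollectI exI[of _ m] exI[of _ 0]) auto
    qed
    moreover have "J \<inter> S = {}" using no unfolding J_def by blast
    ultimately have "J = M" using M unfolding \<I>_def by blast
    moreover have "a \<in> J" unfolding J_def using Mi(1) by (intro CollectI exI[of _ 0] exI[of _ 1]) auto
    ultimately show False using a by blast
  qed
  have "prime_ideal M" unfolding prime_ideal_def
  proof (intro conjI ballI allI impI)
    show "1 \<notin> M" using S(1) M(1) unfolding \<I>_def by blast
    fix a b assume ab: "a * b \<in> M"
    show "a \<in> M \<or> b \<in> M"
    proof (rule ccontr)
      assume "\<not> (a \<in> M \<or> b \<in> M)"
      then obtain m r m' r' where *: "m \<in> M" "m + r * a \<in> S" "m' \<in> M" "m' + r' * b \<in> S" using meets by blast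
      \<comment> \<open>Two elements of \<open>S\<close>, each in the ideal generated by
        \<open>M\<close> and one of the factors, multiply to an element of \<open>S\<close> that
        lies in \<open>M\<close>.\<close>
      have "(m + r * a) * (m' + r' * b) = (m' + r' * b) * m + (r * a) * m' + (r * r') * (a * b)"
        by (simp add: algebra_simps)
      also have "\<dots> \<in> M" by (intro Mi(2) Mi(3) * ab)
      finally show False using S(2)[OF *(2,4)] M(1) unfolding \<I>_def by blast
    qed
  qed (use Mi in auto)
  then show ?thesis using M(1) unfolding \<I>_def by blast
qed

section \<open>Values of a function on a subvariety of the torus\<close>

lemma map_poly_cst:
  fixes p q :: "'k::field poly"
  defines "C \<equiv> (cst :: 'k \<Rightarrow> ('n::finite, 'k) laurent)"
  shows "map_poly C (p + q) = map_poly C p + map_poly C q" "map_poly C (p * q) = map_poly C p * map_poly C q"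
    "map_poly C (- p) = - map_poly C p" "map_poly C (pCons c p) = pCons (C c) (map_poly C p)"
proof -
  have C0: "C 0 = 0" by (simp add: C_def cst_simps)
  have cC: "coeff (map_poly C p) n = C (coeff p n)" for p n by (rule coeff_map_poly) (rule C0)
  have sum: "C (\<Sum>i\<in>I. g i) = (\<Sum>i\<in>I. C (g i))" for I :: "nat set" and g :: "nat \<Rightarrow> 'k"
    by (induction I rule: infinite_finite_induct) (simp_all add: C_def cst_simps)
  show "map_poly C (p + q) = map_poly C p + map_poly C q"
    by (rule poly_eqI) (simp only: cC coeff_add, simp only: C_def cst_simps)
  show "map_poly C (p * q) = map_poly C p * map_poly C q"
    by (rule poly_eqI) (simp only: cC coeff_mult sum, simp only: C_def cst_simps)
  show "map_poly C (- p) = - map_poly C p"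
    by (rule poly_eqI) (simp only: cC coeff_minus, simp only: C_def cst_simps)
  show "map_poly C (pCons c p) = pCons (C c) (map_poly C p)"
    by (rule poly_eqI) (simp add: coeff_map_poly C0 coeff_pCons split: nat.split)
qed

text \<open>Either \<open>\<theta>\<close> is algebraic over the constants in the coordinate ring, and then it has finitely many
  values, or \<open>t \<mapsto> \<theta> = t\<close> defines homomorphisms on \<open>K[\<theta>]\<close>, almost all of which extend.\<close>

lemma finite_or_cofinite_values:
  fixes F :: "('n::finite, 'k::{alg_closed_field, field_char_0}) laurent set"
  defines "Z \<equiv> {x \<in> torus. \<forall>f\<in>F. leval f x = 0}"
  shows "finite ((\<lambda>x. leval \<theta> x) ` Z) \<or> (\<exists>a. a \<noteq> 0 \<and> (\<forall>t. poly a t \<noteq> 0 \<longrightarrow> (\<exists>x\<in>Z. leval \<theta> x = t)))"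
proof -
  define ev where "ev g = poly (map_poly cst g) \<theta>" for g :: "'k poly"
  have ev: "ev (g + h) = ev g + ev h" "ev (g * h) = ev g * ev h" "ev (- g) = - ev g"
    "ev 0 = 0" "ev (pCons c g) = cst c + \<theta> * ev g" for g h c
    by (simp_all add: ev_def map_poly_cst)
  have ev': "ev [:c:] = cst c" "ev [:0, 1:] = \<theta>" "ev 1 = 1" for c
    by (simp_all add: ev one_pCons cst_simps)
  note ev = ev(1-3) ev'(1,2) ev(4) ev'(3) ev(5)
  have leval_ev: "leval (ev g) x = poly g (leval \<theta> x)" if x: "x \<in> torus" for g x
  proof (induction g)
    case (pCons c g)
    then show ?case using x by (simp add: ev(8) leval_add leval_mult)
  qed (simp add: ev)
  define I where "I = {h. \<forall>x\<in>Z. leval h x = 0}"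
  show ?thesis
  proof (cases "\<exists>g. g \<noteq> 0 \<and> ev g \<in> I")
    case True
    then obtain g where g: "g \<noteq> 0" "ev g \<in> I" by blast
    have "(\<lambda>x. leval \<theta> x) ` Z \<subseteq> {t. poly g t = 0}"
      using g(2) leval_ev unfolding I_def Z_def by force
    then show ?thesis using poly_roots_finite[OF g(1)] finite_subset by blast
  next
    case False
    then have none: "\<And>g. ev g \<in> I \<Longrightarrow> g = 0" by blast
    \<comment> \<open>The nonzero elements of the ring generated by \<open>\<theta>\<close> over the
      constants. A prime ideal missing them leaves \<open>\<theta>\<close> transcendental, so that
      \<open>\<theta>\<close> may be sent to any \<open>t\<close>.\<close>
    define S where "S = ev ` {g. g \<noteq> 0}"
    have "\<exists>p. prime_ideal p \<and> I \<subseteq> p \<and> p \<inter> S = {}"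
    proof (rule ex_prime_ideal_avoiding)
      show "ideal I" unfolding ideal_def I_def Z_def by (auto simp: leval_add leval_mult)
      have "ev 1 \<in> S" unfolding S_def by (rule imageI) simp
      then show "1 \<in> S" by (simp only: ev(7))
      show "a * b \<in> S" if "a \<in> S" "b \<in> S" for a b
      proof -
        obtain g h where gh: "g \<noteq> 0" "a = ev g" "h \<noteq> 0" "b = ev h" using \<open>a \<in> S\<close> \<open>b \<in> S\<close> unfolding S_def by blast
        then have "a * b = ev (g * h)" "g * h \<noteq> 0" using ev(2) by auto
        then show ?thesis unfolding S_def by blast
      qed
      show "I \<inter> S = {}" using none unfolding S_def by blast
    qed
    then obtain p where p: "prime_ideal p" "I \<subseteq> p" "p \<inter> S = {}" by blast
    define A where "A = range ev"
    have A: "subring A" unfolding subring_def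
    proof (intro conjI ballI)
      show "0 \<in> A" "1 \<in> A" unfolding A_def using ev(6,7) by (metis rangeI)+
      fix a assume "a \<in> A"
      then obtain g where g: "a = ev g" unfolding A_def by (rule rangeE)
      show "- a \<in> A" unfolding A_def g ev(3) [symmetric] by (rule rangeI)
      fix b assume "b \<in> A"
      then obtain h where h: "b = ev h" unfolding A_def by (rule rangeE)
      show "a + b \<in> A" "a * b \<in> A" unfolding A_def g h ev(1,2) [symmetric] by (rule rangeI)+
    qed
    have "g = h" if "ev g = ev h" for g h
    proof -
      have "ev (g + - h) = 0" using that by (simp add: ev del: add_uminus_conv_diff)
      then have "ev (g + - h) \<in> I" unfolding I_def by simp
      then have "g + - h = 0" by (rule none)
      then show ?thesis by simp
    qed
    then have inj: "inj ev" by (rule injI)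
    \<comment> \<open>With \<open>b = 1\<close> only the existence of an extension is asked for. The
      element \<open>a\<close> is a polynomial in \<open>\<theta>\<close> whose zeros are the only
      values that might be missed.\<close>
    have "\<exists>a\<in>A. a \<notin> p \<and> (\<forall>\<phi> :: ('n, 'k) laurent \<Rightarrow> 'k. hom_mod A p \<phi> \<and> \<phi> a \<noteq> 0 \<longrightarrow>
      (\<exists>\<phi>'. hom_mod (adjoin_list A laurent_gens) p \<phi>' \<and> \<phi>' 1 \<noteq> 0 \<and> (\<forall>a\<in>A. \<phi>' a = \<phi> a)))"
    proof (rule hom_mod_extend_list[OF A p(1)])
      show "1 \<notin> p" using p(1) by (rule prime_idealD)
      show "1 \<in> adjoin_list A laurent_gens" using subring_adjoin_list[OF A] subringD(2) by blast
    qed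
    then obtain a where a: "a \<in> A" "a \<notin> p" and ext: "\<And>\<phi> :: ('n, 'k) laurent \<Rightarrow> 'k. hom_mod A p \<phi> \<Longrightarrow> \<phi> a \<noteq> 0 \<Longrightarrow>
      \<exists>\<phi>'. hom_mod (adjoin_list A laurent_gens) p \<phi>' \<and> (\<forall>a\<in>A. \<phi>' a = \<phi> a)" by blast
    have cA: "cst c \<in> A" for c unfolding A_def using ev(4) by (metis rangeI)
    obtain g0 where g0: "a = ev g0" using a(1) unfolding A_def by blast
    have "g0 \<noteq> 0" using a(2) prime_idealD(1)[OF p(1)] by (auto simp: g0 ev)
    moreover have "\<exists>x\<in>Z. leval \<theta> x = t" if t: "poly g0 t \<noteq> 0" for t
    proof -
      define \<phi> where "\<phi> h = poly (inv ev h) t" for h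
      have \<phi>: "\<phi> (ev g) = poly g t" for g using inj by (simp add: \<phi>_def)
      have "hom_mod A p \<phi>" unfolding hom_mod_def
      proof (intro conjI ballI)
        show "\<phi> 0 = 0" "\<phi> 1 = 1" using \<phi>[of 0] \<phi>[of 1] by (simp_all add: ev)
        fix a b assume "a \<in> A" "b \<in> A"
        then obtain g h where gh: "a = ev g" "b = ev h" unfolding A_def by blast
        show "\<phi> (a + b) = \<phi> a + \<phi> b" "\<phi> (a * b) = \<phi> a * \<phi> b" unfolding gh
          using \<phi>[of "g + h"] \<phi>[of "g * h"] by (simp_all add: \<phi> ev)
      next
        fix a assume "a \<in> A \<inter> p"
        then obtain g where g: "a = ev g" "ev g \<in> p" unfolding A_def by blast
        then have "g = 0" using p(3) unfolding S_def by blast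
        then show "\<phi> a = 0" by (simp add: g \<phi>)
      qed
      moreover have "\<phi> a \<noteq> 0" using t by (simp add: g0 \<phi>)
      ultimately obtain \<phi>' where \<phi>': "hom_mod UNIV p \<phi>'" "\<And>a. a \<in> A \<Longrightarrow> \<phi>' a = \<phi> a"
        using ext[of \<phi>] adjoin_laurent_gens[OF A cA] by auto
      have c: "\<phi>' (cst c) = c" for c using \<phi>'(2)[OF cA, of c] \<phi>[of "[:c:]"] by (simp add: ev)
      define P where "P = (\<chi> i. \<phi>' (var i 1))"
      note P = hom_is_leval[OF \<phi>'(1) c, folded P_def]
      have "\<forall>f\<in>F. leval f P = 0"
      proof
        fix f assume "f \<in> F"
        then have "f \<in> p" using p(2) unfolding I_def Z_def by blast
        then show "leval f P = 0" using P(2) hom_modD(5)[OF \<phi>'(1)] by simp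
      qed
      then have "P \<in> Z" using P(1) unfolding Z_def by blast
      moreover have "\<theta> \<in> A" unfolding A_def using ev(5) by (metis rangeI)
      then have "leval \<theta> P = t" using P(2) \<phi>'(2) \<phi>[of "[:0, 1:]", unfolded ev(5)] by simp
      ultimately show ?thesis by blast
    qed
    ultimately show ?thesis by blast
  qed
qed

section \<open>Lifting approximate solutions\<close>

context valued_field
begin

definition cauchy :: "(nat \<Rightarrow> 'k) \<Rightarrow> bool" where
  "cauchy s \<longleftrightarrow> (\<forall>\<epsilon>>0. \<exists>N. \<forall>k\<ge>N. \<forall>l\<ge>N. absv (s k - s l) < \<epsilon>) \<and> (\<exists>B>0. \<forall>k. absv (s k) \<le> B)"

lemma cauchy_const: "cauchy (\<lambda>k. c)"
proof -
  have "absv c + 1 > 0" by (rule add_nonneg_pos) auto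
  then have "\<exists>B>0. \<forall>k::nat. absv c \<le> B" by (intro exI[of _ "absv c + 1"]) simp
  then show ?thesis unfolding cauchy_def by simp
qed

lemma cauchy_add:
  assumes "cauchy s" "cauchy t"
  shows "cauchy (\<lambda>k. s k + t k)"
  unfolding cauchy_def
proof (intro conjI allI impI)
  fix \<epsilon> :: real assume "\<epsilon> > 0"
  then obtain N M where "\<forall>k\<ge>N. \<forall>l\<ge>N. absv (s k - s l) < \<epsilon>" "\<forall>k\<ge>M. \<forall>l\<ge>M. absv (t k - t l) < \<epsilon>"
    using assms unfolding cauchy_def by meson
  then have "\<forall>k\<ge>max N M. \<forall>l\<ge>max N M. absv ((s k - s l) + (t k - t l)) < \<epsilon>"
    using absv_add_less by simp
  then show "\<exists>N. \<forall>k\<ge>N. \<forall>l\<ge>N. absv (s k + t k - (s l + t l)) < \<epsilon>"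
    by (intro exI[of _ "max N M"]) (simp add: add_diff_add)
next
  obtain B C where BC: "B > 0" "\<forall>k. absv (s k) \<le> B" "C > 0" "\<forall>k. absv (t k) \<le> C"
    using assms unfolding cauchy_def by blast
  have "absv (s k + t k) \<le> max B C" for k
  proof (rule absv_add_le)
    show "absv (s k) \<le> max B C" "absv (t k) \<le> max B C" using BC(2,4) le_max_iff_disj by blast+
  qed
  then show "\<exists>B>0. \<forall>k. absv (s k + t k) \<le> B" using BC(1) by (intro exI[of _ "max B C"]) auto
qed

lemma cauchy_mult:
  assumes "cauchy s" "cauchy t"
  shows "cauchy (\<lambda>k. s k * t k)"
proof -
  obtain B C where BC: "B > 0" "\<And>k. absv (s k) \<le> B" "C > 0" "\<And>k. absv (t k) \<le> C"
    using assms unfolding cauchy_def by blast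
  show ?thesis unfolding cauchy_def
  proof (intro conjI allI impI)
    show "\<exists>B>0. \<forall>k. absv (s k * t k) \<le> B"
      using BC by (intro exI[of _ "B * C"]) (auto simp: absv_mult intro!: mult_mono)
    fix \<epsilon> :: real assume "\<epsilon> > 0"
    then have "\<epsilon> / B > 0" "\<epsilon> / C > 0" using BC by auto
    then obtain N M where NM: "\<And>k l. k \<ge> N \<Longrightarrow> l \<ge> N \<Longrightarrow> absv (s k - s l) < \<epsilon> / C"
      "\<And>k l. k \<ge> M \<Longrightarrow> l \<ge> M \<Longrightarrow> absv (t k - t l) < \<epsilon> / B"
      using assms unfolding cauchy_def by meson
    have "absv (s k * t k - s l * t l) < \<epsilon>" if "k \<ge> max N M" "l \<ge> max N M" for k l
    proof -
      have "absv (s k * (t k - t l)) \<le> B * absv (t k - t l)"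
        unfolding absv_mult using BC by (intro mult_right_mono) auto
      also have "\<dots> < \<epsilon>" using NM(2)[of k l] that BC by (simp add: pos_less_divide_eq mult.commute)
      finally have 1: "absv (s k * (t k - t l)) < \<epsilon>" .
      have "absv ((s k - s l) * t l) \<le> absv (s k - s l) * C"
        unfolding absv_mult using BC by (intro mult_left_mono) auto
      also have "\<dots> < \<epsilon>" using NM(1)[of k l] that BC by (simp add: pos_less_divide_eq mult.commute)
      finally have "absv (s k * (t k - t l) + (s k - s l) * t l) < \<epsilon>" by (rule absv_add_less[OF 1])
      then show ?thesis by (simp add: algebra_simps)
    qed
    then show "\<exists>N. \<forall>k\<ge>N. \<forall>l\<ge>N. absv (s k * t k - s l * t l) < \<epsilon>" by blast
  qed
qed

lemma cauchy_inverse: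
  assumes "cauchy s" "a > 0" "\<And>k. absv (s k) = a"
  shows "cauchy (\<lambda>k. inverse (s k))"
  unfolding cauchy_def
proof (intro conjI allI impI)
  show "\<exists>B>0. \<forall>k. absv (inverse (s k)) \<le> B" using assms by (intro exI[of _ "inverse a"]) (auto simp: absv_inverse)
  fix \<epsilon> :: real assume "\<epsilon> > 0"
  then have "\<epsilon> * (a * a) > 0" using assms by simp
  then obtain N where N: "\<And>k l. k \<ge> N \<Longrightarrow> l \<ge> N \<Longrightarrow> absv (s k - s l) < \<epsilon> * (a * a)"
    using assms(1) unfolding cauchy_def by meson
  have nz: "s k \<noteq> 0" for k using assms(2) assms(3)[of k] by auto
  have "absv (inverse (s k) - inverse (s l)) < \<epsilon>" if "k \<ge> N" "l \<ge> N" for k l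
  proof -
    have "inverse (s k) - inverse (s l) = (s l - s k) / (s k * s l)" using nz[of k] nz[of l] by (simp add: field_simps)
    then have "absv (inverse (s k) - inverse (s l)) = absv (s l - s k) / (a * a)"
      by (simp add: absv_divide absv_mult assms(3))
    also have "\<dots> < \<epsilon>" using N[of l k] that assms(2) by (simp add: pos_divide_less_eq)
    finally show ?thesis .
  qed
  then show "\<exists>N. \<forall>k\<ge>N. \<forall>l\<ge>N. absv (inverse (s k) - inverse (s l)) < \<epsilon>" by blast
qed

lemma cauchy_prod: "(\<And>i. i \<in> I \<Longrightarrow> cauchy (s i)) \<Longrightarrow> cauchy (\<lambda>k. \<Prod>i\<in>I. s i k)"
  by (induction I rule: infinite_finite_induct) (auto intro: cauchy_const cauchy_mult)

lemma cauchy_power: "cauchy s \<Longrightarrow> cauchy (\<lambda>k. s k ^ n)"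
  by (induction n) (auto intro: cauchy_const cauchy_mult)

lemma cauchy_powi:
  assumes "cauchy s" "a > 0" "\<And>k. absv (s k) = a"
  shows "cauchy (\<lambda>k. s k powi m)"
proof (cases "m \<ge> 0")
  case True
  then show ?thesis using assms by (simp add: power_int_def cauchy_power)
next
  case False
  then show ?thesis using cauchy_power[OF cauchy_inverse[OF assms]] by (simp add: power_int_def)
qed

text \<open>Evaluations at the \<open>z k\<close> form a Cauchy sequence of homomorphisms with
  \<open>F\<close> in the kernel of the limit. A homomorphism to the field that kills this kernel is
  evaluation at an exact zero; if it is close to the limit on the variables, the absolute values of
  the coordinates are right, although the zero need not be a limit of the
  \<open>z k\<close>.\<close>

lemma lift_approximate_zero:
  fixes z :: "nat \<Rightarrow> 'k ^ 'n::finite" and F :: "('n, 'k) laurent set"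
  assumes a: "\<And>i. a i > 0" "\<And>k i. absv (z k $ i) = a i"
    and cz: "\<And>i. cauchy (\<lambda>k. z k $ i)"
    and F: "\<And>f \<epsilon>. f \<in> F \<Longrightarrow> \<epsilon> > 0 \<Longrightarrow> \<forall>\<^sub>F k in sequentially. absv (leval f (z k)) < \<epsilon>"
  shows "\<exists>P\<in>torus. (\<forall>i. absv (P $ i) = a i) \<and> (\<forall>f\<in>F. leval f P = 0)"
proof -
  have nz: "z k $ i \<noteq> 0" for k i using a(1)[of i] a(2)[of k i] by auto
  then have tor: "z k \<in> torus" for k unfolding torus_def by blast
  have ch: "cauchy (\<lambda>k. leval h (z k))" for h
  proof (induction h rule: laurent_induct)
    case (single u c)
    show ?case unfolding leval_single mon_def
      using a by (intro cauchy_mult cauchy_const cauchy_prod cauchy_powi[OF cz]) auto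
  qed (auto simp: leval_add intro: cauchy_const cauchy_add)
  interpret C: cauchy_homs val "\<lambda>k h. leval h (z k)"
  proof unfold_locales
    show "\<exists>N. \<forall>k\<ge>N. \<forall>l\<ge>N. absv (leval h (z k) - leval h (z l)) < \<epsilon>" if "\<epsilon> > 0" for \<epsilon> h
      using ch[of h] that unfolding cauchy_def by blast
  qed (auto simp: leval_add leval_mult tor)
  \<comment> \<open>Used only on the constants, where it is the identity.\<close>
  define \<psi> where "\<psi> h = leval h (z 0)" for h
  define A where "A = range (cst :: 'k \<Rightarrow> ('n, 'k) laurent)"
  have A: "subring A" unfolding subring_def
  proof (intro conjI ballI)
    show "0 \<in> A" "1 \<in> A" unfolding A_def using cst_simps(1,2) by (metis rangeI)+
    fix a assume "a \<in> A"
    then obtain g where g: "a = cst g" unfolding A_def by (rule rangeE)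
    show "- a \<in> A" unfolding A_def g cst_simps(5) [symmetric] by (rule rangeI)
    fix b assume "b \<in> A"
    then obtain h where h: "b = cst h" unfolding A_def by (rule rangeE)
    show "a + b \<in> A" "a * b \<in> A" unfolding A_def g h cst_simps(3,4) [symmetric] by (rule rangeI)+
  qed
  have cA: "cst c \<in> A" for c unfolding A_def by blast
  have \<psi>: "\<psi> (cst c) = c" for c by (simp add: \<psi>_def)
  have "hom_mod A C.null \<psi>" unfolding hom_mod_def
  proof (intro conjI ballI)
    fix h assume "h \<in> A \<inter> C.null"
    then obtain c where c: "h = cst c" "\<forall>\<epsilon>>0. C.near \<epsilon> 0 (cst c)" unfolding A_def C.null_def by blast
    have "c = 0"
    proof (rule ccontr)
      assume "c \<noteq> 0"
      then have "C.near (absv c) 0 (cst c)" using c(2) by simp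
      then show False unfolding C.near_def by simp
    qed
    then show "\<psi> h = 0" by (simp add: c \<psi>)
  qed (auto simp: \<psi>_def leval_add leval_mult tor)
  moreover have "C.near \<epsilon> (\<psi> h) h" if "h \<in> A" "\<epsilon> > 0" for h \<epsilon>
    using that unfolding A_def C.near_def by (auto simp: \<psi>)
  ultimately have "C.dense_homs A \<psi> A" unfolding C.dense_homs_def by blast
  then have "C.dense_homs A \<psi> UNIV"
    using C.dense_homs_adjoin_list[OF A, of A \<psi> laurent_gens] adjoin_laurent_gens[OF A cA] by simp
  \<comment> \<open>Approximating each variable better than the smallest \<open>a i\<close> forces
    the right absolute values by \<open>absv_eqI\<close>.\<close>
  moreover define m where "m = Min (range a)"
  have m: "m > 0" "m \<le> a i" for i unfolding m_def using a(1) by (auto simp: Min_gr_iff)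
  moreover have "finite ((\<lambda>i. var i 1) ` UNIV :: ('n, 'k) laurent set)" by simp
  ultimately obtain \<phi> where \<phi>: "hom_mod UNIV C.null \<phi>" "\<forall>h\<in>A. \<phi> h = \<psi> h"
    "\<forall>h\<in>(\<lambda>i. var i 1) ` UNIV. C.near m (\<phi> h) h"
    unfolding C.dense_homs_def by (metis subset_UNIV)
  have c: "\<phi> (cst c) = c" for c using \<phi>(2) cA \<psi> by metis
  define P where "P = (\<chi> i. \<phi> (var i 1))"
  note P = hom_is_leval[OF \<phi>(1) c, folded P_def]
  have "absv (P $ i) = a i" for i
  proof -
    have "C.near m (P $ i) (var i 1)" using \<phi>(3) by (auto simp: P_def)
    then obtain k where "absv (P $ i - leval (var i 1) (z k)) < m"
      unfolding C.near_def using eventually_happens by force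
    then have "absv (P $ i - z k $ i) < absv (z k $ i)"
      using m(2)[of i] a(2)[of k i] by (simp add: var_def leval_single mon_axis)
    then show ?thesis using absv_eqI a(2) by metis
  qed
  moreover have "leval f P = 0" if "f \<in> F" for f
  proof -
    have "f \<in> C.null" unfolding C.null_def C.near_def using F[OF that] by simp
    then show ?thesis using P(2) hom_modD(5)[OF \<phi>(1)] by simp
  qed
  ultimately show ?thesis using P(1) by blast
qed

end

section \<open>Integral dual bases\<close>

lemma common_denominator:
  fixes S :: "rat set"
  assumes "finite S"
  shows "\<exists>D::int. D \<noteq> 0 \<and> (\<forall>x\<in>S. \<exists>m::int. of_int D * x = of_int m)"
  using assms
proof (induction S rule: finite_induct)
  case empty
  then show ?case by (intro exI[of _ 1]) auto
next
  case (insert x S)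
  then obtain D :: int where D: "D \<noteq> 0" "\<forall>x\<in>S. \<exists>m::int. of_int D * x = of_int m" by blast
  obtain a b :: int where ab: "x = of_int a / of_int b" "b \<noteq> 0"
    using quotient_of_div[of x "fst (quotient_of x)" "snd (quotient_of x)"] quotient_of_denom_pos'[of x] by auto
  show ?case
  proof (rule exI[of _ "D * b"], intro conjI ballI)
    show "D * b \<noteq> 0" using D ab by simp
    fix z assume "z \<in> insert x S"
    show "\<exists>m::int. of_int (D * b) * z = of_int m"
    proof (cases "z = x")
      case True
      then show ?thesis using ab by (intro exI[of _ "D * a"]) simp
    next
      case False
      then obtain m :: int where "of_int D * z = of_int m" using D \<open>z \<in> insert x S\<close> by blast
      then show ?thesis by (intro exI[of _ "b * m"]) (simp add: mult_ac)
    qed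
  qed
qed

definition rvec :: "int ^ 'n::finite \<Rightarrow> real ^ 'n" where
  "rvec u = (\<chi> i. real_of_int (u $ i))"

definition qvec :: "int ^ 'n::finite \<Rightarrow> rat ^ 'n" where
  "qvec u = (\<chi> i. rat_of_int (u $ i))"

text \<open>Extend the \<open>v i\<close> by two vectors to a basis and take the dual basis:
  \<open>y\<close> belongs to the \<open>v i\<close> and \<open>w\<close> to one of the new vectors.
  The third identity expands the identity matrix; it confines whatever is annihilated by the
  \<open>v i\<close> to the span of \<open>1\<close> and \<open>w\<close>.\<close>

lemma rational_duality:
  fixes v :: "nat \<Rightarrow> int ^ 'n::finite"
  assumes I: "finite I" "card I + 2 = CARD('n)"
    and indep: "\<And>c. (\<Sum>i\<in>I. c i *\<^sub>R rvec (v i)) = 0 \<Longrightarrow> \<forall>i\<in>I. c i = 0"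
    and sum0: "\<And>i. i \<in> I \<Longrightarrow> (\<Sum>p\<in>UNIV. v i $ p) = 0"
  shows "\<exists>(y :: nat \<Rightarrow> rat ^ 'n) g h w.
    (\<forall>i\<in>I. \<forall>k\<in>I. (\<Sum>p\<in>UNIV. of_int (v i $ p) * y k $ p) = (if i = k then 1 else 0)) \<and>
    (\<forall>i\<in>I. (\<Sum>p\<in>UNIV. of_int (v i $ p) * w $ p) = 0) \<and>
    (\<forall>p q. (\<Sum>k\<in>I. of_int (v k $ p) * y k $ q) + g $ p + h $ p * w $ q = (if p = q then 1 else 0)) \<and>
    (\<exists>p q. w $ p \<noteq> w $ q)"
proof -
  define V where "V i = qvec (v i)" for i
  have rel: "\<forall>i\<in>I. c i = 0" if "(\<Sum>i\<in>I. c i *s V i) = 0" for c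
  proof -
    have "(\<Sum>i\<in>I. real_of_rat (c i) *\<^sub>R rvec (v i)) = 0"
    proof (subst vec_eq_iff, intro allI)
      fix p
      have "(\<Sum>i\<in>I. c i * of_int (v i $ p)) = 0"
        using arg_cong[OF that, of "\<lambda>x. x $ p"] by (simp add: V_def qvec_def)
      then have "real_of_rat (\<Sum>i\<in>I. c i * of_int (v i $ p)) = 0" by simp
      then show "(\<Sum>i\<in>I. real_of_rat (c i) *\<^sub>R rvec (v i)) $ p = 0 $ p"
        by (simp add: rvec_def of_rat_sum of_rat_mult)
    qed
    then show ?thesis using indep[of "\<lambda>i. real_of_rat (c i)"] by simp
  qed
  have inj: "inj_on V I"
  proof (rule inj_onI, rule ccontr)
    fix i k assume ik: "i \<in> I" "k \<in> I" "V i = V k" "i \<noteq> k"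
    define c where "c j = (if j = i then 1 else if j = k then -1 else (0::rat))" for j
    have "(\<Sum>j\<in>I. c j *s V j) = (\<Sum>j\<in>{i, k}. c j *s V j)"
      using ik I(1) by (intro sum.mono_neutral_right) (auto simp: c_def)
    also have "\<dots> = 0" using ik by (simp add: c_def)
    finally have "\<forall>j\<in>I. c j = 0" by (rule rel)
    then have "c i = 0" using ik(1) by blast
    then show False by (simp add: c_def)
  qed
  define B0 where "B0 = V ` I"
  have fB0: "finite B0" and cB0: "card B0 = card I" using inj I by (auto simp: B0_def card_image)
  have "vec.independent B0"
  proof (rule ccontr)
    assume "\<not> vec.independent B0"
    then obtain u where u: "\<exists>b\<in>B0. u b \<noteq> 0" "(\<Sum>b\<in>B0. u b *s b) = 0" using vec.dependent_finite[OF fB0] by blast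
    have "(\<Sum>i\<in>I. u (V i) *s V i) = 0" using u(2) inj by (simp add: B0_def sum.reindex)
    then have "\<forall>i\<in>I. u (V i) = 0" by (rule rel)
    then show False using u(1) by (simp add: B0_def)
  qed
  define B where "B = vec.extend_basis B0"
  have B: "B0 \<subseteq> B" "vec.independent B" "vec.span B = UNIV"
    unfolding B_def using vec.extend_basis_superset vec.independent_extend_basis vec.span_extend_basis \<open>vec.independent B0\<close> by blast+
  have fB: "finite B" using B(2) by (rule vec.finiteI_independent)
  have "card B = CARD('n)" using vec.dim_eq_card[of B UNIV] B by (simp add: vec.dim_UNIV card_cart_basis vec_dim_card)
  then have "card (B - B0) = 2" using I cB0 card_Diff_subset[OF fB0 B(1)] by simp
  then obtain b1' b2' where bb: "B - B0 = {b1', b2'}" "b1' \<noteq> b2'" by (meson card_2_iff)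
  \<comment> \<open>The dual basis, read off from the coordinates of the unit vectors with respect
    to \<open>B\<close>.\<close>
  define Y where "Y b = (\<chi> q. vec.representation B (axis q 1) b)" for b
  have ax: "(\<Sum>b\<in>B. Y b $ q * b $ p) = (if p = q then 1 else 0)" for p q
  proof -
    have "(\<Sum>b\<in>B. vec.representation B (axis q 1) b *s b) = axis q 1"
      using B fB by (intro vec.sum_representation_eq) auto
    then have "(\<Sum>b\<in>B. vec.representation B (axis q 1) b *s b) $ p = axis q 1 $ p" by simp
    then show ?thesis by (simp add: Y_def axis_def)
  qed
  have expand: "z $ q = (\<Sum>b\<in>B. (\<Sum>p\<in>UNIV. z $ p * b $ p) * Y b $ q)" for z :: "rat ^ 'n" and q
  proof -
    have "(\<Sum>b\<in>B. (\<Sum>p\<in>UNIV. z $ p * b $ p) * Y b $ q) = (\<Sum>b\<in>B. \<Sum>p\<in>UNIV. z $ p * (Y b $ q * b $ p))"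
      by (simp add: sum_distrib_left sum_distrib_right mult_ac)
    also have "\<dots> = (\<Sum>p\<in>UNIV. \<Sum>b\<in>B. z $ p * (Y b $ q * b $ p))" by (rule sum.swap)
    also have "\<dots> = (\<Sum>p\<in>UNIV. z $ p * (if p = q then 1 else 0))"
      by (simp add: ax flip: sum_distrib_left)
    also have "\<dots> = z $ q" by (simp add: if_distrib cong: if_cong)
    finally show ?thesis by simp
  qed
  have dual: "(\<Sum>p\<in>UNIV. c $ p * Y b $ p) = (if c = b then 1 else 0)" if cb: "c \<in> B" "b \<in> B" for b c
  proof -
    define R where "R = (\<lambda>b. \<Sum>p\<in>UNIV. c $ p * Y b $ p)"
    have "(\<Sum>b\<in>B. R b *s b) = c"
    proof (subst vec_eq_iff, intro allI)
      fix q
      have "(\<Sum>b\<in>B. R b * b $ q) = (\<Sum>b\<in>B. \<Sum>p\<in>UNIV. c $ p * (Y b $ p * b $ q))"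
        by (simp add: R_def sum_distrib_left sum_distrib_right mult_ac)
      also have "\<dots> = (\<Sum>p\<in>UNIV. \<Sum>b\<in>B. c $ p * (Y b $ p * b $ q))" by (rule sum.swap)
      also have "\<dots> = (\<Sum>p\<in>UNIV. c $ p * (if q = p then 1 else 0))"
        by (simp add: ax flip: sum_distrib_left)
      also have "\<dots> = c $ q" by (simp add: if_distrib cong: if_cong)
      finally show "(\<Sum>b\<in>B. R b *s b) $ q = c $ q" by simp
    qed
    moreover have "(\<Sum>b\<in>B. (if c = b then 1 else 0) *s b) = (\<Sum>b\<in>B. if b = c then c else 0)"
      by (intro sum.cong) auto
    ultimately have 1: "(\<Sum>b\<in>B. (R b - (if c = b then 1 else 0)) *s b) = 0"
      using cb fB by (simp add: vec.scale_left_diff_distrib sum_subtractf)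
    have "R b - (if c = b then 1 else 0) = 0"
    proof (rule ccontr)
      assume "R b - (if c = b then 1 else 0) \<noteq> 0"
      then have "vec.dependent B"
        unfolding vec.dependent_finite[OF fB] using 1 cb(2)
        by (intro exI[of _ "\<lambda>b. R b - (if c = b then 1 else 0)"] conjI bexI[of _ b]) auto
      then show False using B(2) by blast
    qed
    then show ?thesis by (simp add: R_def)
  qed
  define \<sigma> where "\<sigma> b = (\<Sum>p\<in>UNIV. b $ p)" for b :: "rat ^ 'n"
  have \<sigma>V: "\<sigma> (V i) = 0" if "i \<in> I" for i
  proof -
    have "rat_of_int (\<Sum>p\<in>UNIV. v i $ p) = 0" using sum0[OF that] by simp
    then show ?thesis by (simp add: \<sigma>_def V_def qvec_def)
  qed
  have split: "(\<Sum>b\<in>B. G b) = (\<Sum>k\<in>I. G (V k)) + G b1' + G b2'" for G :: "rat ^ 'n \<Rightarrow> rat"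
  proof -
    have "B = B0 \<union> {b1', b2'}" "B0 \<inter> {b1', b2'} = {}" using B(1) bb by auto
    moreover from this(2) have "sum G (B0 \<union> {b1', b2'}) = sum G B0 + sum G {b1', b2'}"
      by (intro sum.union_disjoint fB0) auto
    ultimately have "(\<Sum>b\<in>B. G b) = (\<Sum>b\<in>B0. G b) + (\<Sum>b\<in>{b1', b2'}. G b)" by metis
    then show ?thesis using bb(2) inj by (simp add: B0_def sum.reindex)
  qed
  \<comment> \<open>The \<open>v i\<close> have coordinate sum 0, so the all-ones vector involves
    only the dual vectors of the two new basis vectors. This later expresses \<open>Y b1\<close>
    through \<open>1\<close> and \<open>w\<close>.\<close>
  have one: "1 = \<sigma> b1' * Y b1' $ q + \<sigma> b2' * Y b2' $ q" for q
    using expand[of 1 q] by (simp add: split \<sigma>V flip: \<sigma>_def)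
  \<comment> \<open>Order the two new vectors so that \<open>\<sigma> b1\<close> may be divided
    by.\<close>
  obtain b1 b2 where b12: "{b1, b2} = {b1', b2'}" "b1 \<noteq> b2" "\<sigma> b1 \<noteq> 0"
  proof (cases "\<sigma> b1' = 0")
    case True
    then have "\<sigma> b2' \<noteq> 0" using one[of undefined] by auto
    then show ?thesis using that[of b2' b1'] bb(2) by blast
  next
    case False
    then show ?thesis using that[of b1' b2'] bb(2) by blast
  qed
  have split: "(\<Sum>b\<in>B. G b) = (\<Sum>k\<in>I. G (V k)) + G b1 + G b2" for G :: "rat ^ 'n \<Rightarrow> rat"
    using split[of G] b12(1,2) by (auto simp: doubleton_eq_iff)
  have one: "1 = \<sigma> b1 * Y b1 $ q + \<sigma> b2 * Y b2 $ q" for q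
    using one[of q] b12(1,2) by (auto simp: doubleton_eq_iff)
  have bB: "b1 \<in> B" "b2 \<in> B" "b1 \<notin> B0" "b2 \<notin> B0" using bb b12 by auto
  have VB: "V i \<in> B" "V i \<in> B0" if "i \<in> I" for i using that B(1) by (auto simp: B0_def)
  define w where "w = Y b2"
  define g where "g = (\<chi> p. b1 $ p / \<sigma> b1)"
  define h where "h = (\<chi> p. b2 $ p - \<sigma> b2 * b1 $ p / \<sigma> b1)"
  have Y1: "Y b1 $ q = (1 - \<sigma> b2 * w $ q) / \<sigma> b1" for q
    using one[of q] b12(3) by (simp add: w_def field_simps)
  have Vp: "V i $ p = of_int (v i $ p)" for i p by (simp add: V_def qvec_def)
  have A1: "(\<Sum>p\<in>UNIV. of_int (v i $ p) * Y (V k) $ p) = (if i = k then 1 else 0)" if "i \<in> I" "k \<in> I" for i k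
    using dual[of "V i" "V k"] VB that inj by (auto simp: Vp inj_on_eq_iff)
  have A2: "(\<Sum>p\<in>UNIV. of_int (v i $ p) * w $ p) = 0" if "i \<in> I" for i
  proof -
    have "V i \<noteq> b2" using VB(2)[OF that] bB(4) by metis
    then show ?thesis using dual[of "V i" b2] VB(1)[OF that] bB by (simp add: w_def Vp)
  qed
  have A3: "(\<Sum>k\<in>I. of_int (v k $ p) * Y (V k) $ q) + g $ p + h $ p * w $ q = (if p = q then 1 else 0)" for p q
  proof -
    have "g $ p + h $ p * w $ q = Y b1 $ q * b1 $ p + Y b2 $ q * b2 $ p"
      using b12(3) unfolding Y1 g_def h_def w_def by (simp add: field_simps)
    then show ?thesis using ax[of q p] by (simp add: split Vp mult.commute)
  qed
  \<comment> \<open>A constant \<open>w\<close> would pair with every \<open>b\<close> to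
    \<open>\<sigma> b\<close> times that constant. Pairing to 0 with \<open>b1\<close>, where
    \<open>\<sigma> b1\<close> is nonzero, it would vanish, against its pairing 1 with
    \<open>b2\<close>.\<close>
  have A4: "\<exists>p q. w $ p \<noteq> w $ q"
  proof (rule ccontr)
    assume "\<not> (\<exists>p q. w $ p \<noteq> w $ q)"
    then have c: "w $ p = w $ undefined" for p by blast
    have "(\<Sum>p\<in>UNIV. b $ p * w $ p) = \<sigma> b * w $ undefined" for b
      by (subst c) (simp add: \<sigma>_def sum_distrib_right)
    then have "\<sigma> b1 * w $ undefined = 0" "\<sigma> b2 * w $ undefined = 1"
      using dual[of b1 b2] dual[of b2 b2] bB b12(2) by (auto simp: w_def)
    then show False using b12(3) by simp
  qed
  show ?thesis
    by (rule exI[of _ "\<lambda>k. Y (V k)"], rule exI[of _ g], rule exI[of _ h], rule exI[of _ w])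
      (use A1 A2 A3 A4 in blast)
qed

lemma integral_duality:
  fixes v :: "nat \<Rightarrow> int ^ 'n::finite"
  assumes I: "finite I" "card I + 2 = CARD('n)"
    and indep: "\<And>c. (\<Sum>i\<in>I. c i *\<^sub>R rvec (v i)) = 0 \<Longrightarrow> \<forall>i\<in>I. c i = 0"
    and sum0: "\<And>i. i \<in> I \<Longrightarrow> (\<Sum>p\<in>UNIV. v i $ p) = 0"
  shows "\<exists>(y :: nat \<Rightarrow> int ^ 'n) g h w D. D > 0 \<and>
    (\<forall>i\<in>I. \<forall>k\<in>I. (\<Sum>p\<in>UNIV. v i $ p * y k $ p) = (if i = k then D else 0)) \<and>
    (\<forall>i\<in>I. (\<Sum>p\<in>UNIV. v i $ p * w $ p) = 0) \<and>
    (\<forall>p q. (\<Sum>k\<in>I. v k $ p * y k $ q) + g $ p + h $ p * w $ q = (if p = q then D else 0)) \<and>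
    (\<exists>p q. w $ p \<noteq> w $ q)"
proof -
  obtain y :: "nat \<Rightarrow> rat ^ 'n" and g h w where
    1: "\<forall>i\<in>I. \<forall>k\<in>I. (\<Sum>p\<in>UNIV. of_int (v i $ p) * y k $ p) = (if i = k then 1 else 0)" and
    2: "\<forall>i\<in>I. (\<Sum>p\<in>UNIV. of_int (v i $ p) * w $ p) = 0" and
    3: "\<forall>p q. (\<Sum>k\<in>I. of_int (v k $ p) * y k $ q) + g $ p + h $ p * w $ q = (if p = q then 1 else 0)" and
    4: "\<exists>p q. w $ p \<noteq> w $ q"
    using rational_duality[where v = v, OF I indep sum0] by blast
  define S where "S = (\<Union>k\<in>I. range (($) (y k))) \<union> range (($) g) \<union> range (($) h) \<union> range (($) w)"
  have "finite S" unfolding S_def using I by auto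
  then obtain d :: int where d: "d \<noteq> 0" "\<forall>x\<in>S. \<exists>m::int. of_int d * x = of_int m" using common_denominator by blast
  define num where "num x = \<lfloor>of_int d * x\<rfloor>" for x :: rat
  have num: "of_int (num x) = of_int d * x" if "x \<in> S" for x using d(2) that by (metis floor_of_int num_def)
  have nS: "of_int (num (y k $ p)) = of_int d * y k $ p" if "k \<in> I" for k p
    using that by (intro num) (auto simp: S_def intro!: bexI[of _ k])
  have nS': "of_int (num (g $ p)) = of_int d * g $ p"
    "of_int (num (h $ p)) = of_int d * h $ p" "of_int (num (w $ p)) = of_int d * w $ p" for p
    by (rule num, simp add: S_def)+
  have int_eqI: "rat_of_int a = rat_of_int b \<Longrightarrow> a = b" for a b by simp
  \<comment> \<open>\<open>y\<close> and \<open>g\<close> are scaled by \<open>d\<close> twice,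
    \<open>h\<close> and \<open>w\<close> once each, so that every term of the third identity
    acquires the factor \<open>d * d\<close>, which is positive as a square.\<close>
  define y' where "y' = (\<lambda>k. \<chi> p. d * num (y k $ p))"
  define g' where "g' = (\<chi> p. d * num (g $ p))"
  define h' where "h' = (\<chi> p. num (h $ p))"
  define w' where "w' = (\<chi> p. num (w $ p))"
  have A0: "d * d > 0" using d not_square_less_zero[of d] by (metis linorder_neqE_linordered_idom mult_eq_0_iff)
  have A1: "(\<Sum>p\<in>UNIV. v i $ p * y' k $ p) = (if i = k then d * d else 0)" if "i \<in> I" "k \<in> I" for i k
  proof (rule int_eqI)
    have "rat_of_int (\<Sum>p\<in>UNIV. v i $ p * y' k $ p) = of_int (d * d) * (\<Sum>p\<in>UNIV. of_int (v i $ p) * y k $ p)"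
      using that by (simp add: nS sum_distrib_left mult_ac y'_def)
    then show "rat_of_int (\<Sum>p\<in>UNIV. v i $ p * y' k $ p) = of_int (if i = k then d * d else 0)"
      using 1 that by simp
  qed
  have A2: "(\<Sum>p\<in>UNIV. v i $ p * w' $ p) = 0" if "i \<in> I" for i
  proof -
    have "rat_of_int (\<Sum>p\<in>UNIV. v i $ p * w' $ p) = of_int d * (\<Sum>p\<in>UNIV. of_int (v i $ p) * w $ p)"
      by (simp add: nS' sum_distrib_left mult_ac w'_def)
    then have "rat_of_int (\<Sum>p\<in>UNIV. v i $ p * w' $ p) = 0" using 2 that by simp
    then show ?thesis by (simp only: of_int_eq_0_iff)
  qed
  have A3: "(\<Sum>k\<in>I. v k $ p * y' k $ q) + g' $ p + h' $ p * w' $ q = (if p = q then d * d else 0)" for p q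
  proof (rule int_eqI)
    have "rat_of_int ((\<Sum>k\<in>I. v k $ p * y' k $ q) + g' $ p + h' $ p * w' $ q) =
      of_int (d * d) * ((\<Sum>k\<in>I. of_int (v k $ p) * y k $ q) + g $ p + h $ p * w $ q)"
      by (simp add: nS nS' sum_distrib_left algebra_simps y'_def g'_def h'_def w'_def)
    then show "rat_of_int ((\<Sum>k\<in>I. v k $ p * y' k $ q) + g' $ p + h' $ p * w' $ q) = of_int (if p = q then d * d else 0)"
      using 3 by simp
  qed
  have A4: "\<exists>p q. w' $ p \<noteq> w' $ q"
  proof -
    obtain p q where "w $ p \<noteq> w $ q" using 4 by blast
    then have "rat_of_int (num (w $ p)) \<noteq> rat_of_int (num (w $ q))" using d(1) by (simp add: nS')
    then show ?thesis by (auto simp: w'_def)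
  qed
  show ?thesis
    by (rule exI[of _ y'], rule exI[of _ g'], rule exI[of _ h'], rule exI[of _ w'], rule exI[of _ "d * d"])
      (use A0 A1 A2 A3 A4 in blast)
qed


section \<open>Edges of tropical complete intersections\<close>

context valued_field
begin

lemma term_val_vl: "term_val val p w u = vl (Poly_Mapping.lookup p u) + rvec u \<bullet> w"
  by (simp add: term_val_def vl_def inner_vec_def rvec_def)

lemma rvec_char_lattice: "u \<in> char_lattice \<Longrightarrow> rvec u \<bullet> 1 = 0"
proof -
  assume "u \<in> char_lattice"
  then have "real_of_int (\<Sum>i\<in>UNIV. u $ i) = 0" by (simp add: char_lattice_def)
  then show ?thesis by (simp add: inner_vec_def rvec_def)
qed

lemma rvec_add: "rvec (u + v) = rvec u + rvec v"
  by (simp add: rvec_def vec_eq_iff)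

lemma vl_mon:
  assumes "x \<in> torus"
  shows "vl (mon x u) = rvec u \<bullet> trop_pt val x"
proof -
  have "vl (mon x u) = (\<Sum>i\<in>UNIV. of_int (u $ i) * vl (x $ i))"
    using assms by (simp add: mon_def vl_prod vl_powi)
  then show ?thesis by (simp add: inner_vec_def rvec_def trop_pt_def vl_def)
qed

lemma term_val_single_mult:
  assumes "a \<noteq> 0" "m \<in> Poly_Mapping.keys p"
  shows "term_val val (Poly_Mapping.single u a * p) w (u + m) = (vl a + rvec u \<bullet> w) + term_val val p w m"
  using assms by (simp add: term_val_vl keys_single_mult(1) vl_mult in_keys_iff rvec_add inner_add_left)

lemma min_terms_single_mult:
  assumes a: "a \<noteq> 0"
  shows "min_terms val (Poly_Mapping.single u a * p) w = (+) u ` min_terms val p w"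
  unfolding min_terms_def keys_single_mult(2)[OF a]
  using term_val_single_mult[OF a, of _ p u w] by force

text \<open>A unique minimal term stays unique on a neighbourhood, and at a zero of \<open>p\<close>
  tropicalizing there it could not cancel. The neighbourhood takes care of the closure in
  \<open>trop\<close>.\<close>

lemma min_terms_trop:
  assumes p: "p \<in> torus_functions" and w: "w \<in> trop val (torus_zeros p)"
  shows "min_terms val p w \<noteq> {u}"
proof
  assume u: "min_terms val p w = {u}"
  have uk: "u \<in> Poly_Mapping.keys p" using u unfolding min_terms_def by blast
  define U where "U = (\<Inter>m\<in>Poly_Mapping.keys p - {u}. {w'. term_val val p w' u < term_val val p w' m})"
  have "open U" unfolding U_def term_val_vl
    by (intro open_INT finite_Diff finite_keys ballI open_Collect_less continuous_intros)
  moreover have "w \<in> U"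
    unfolding U_def
  proof (intro INT_I CollectI, rule ccontr)
    fix m assume m: "m \<in> Poly_Mapping.keys p - {u}" "\<not> term_val val p w u < term_val val p w m"
    have "u \<in> min_terms val p w" using u by blast
    then have "term_val val p w u \<le> term_val val p w u'" if "u' \<in> Poly_Mapping.keys p" for u'
      using that unfolding min_terms_def by blast
    then have "m \<in> min_terms val p w" using m unfolding min_terms_def
      by (auto simp: not_less intro: order_trans)
    then show False using u m by blast
  qed
  ultimately obtain w' where "w' \<in> U" "w' \<in> {trop_pt val x + c *\<^sub>R 1 | x c. x \<in> torus_zeros p \<inter> torus}"
    using w unfolding trop_def by (meson closure_iff_nhds_not_empty disjoint_iff subset_refl)
  then obtain x c where x: "trop_pt val x + c *\<^sub>R 1 \<in> U" "x \<in> torus" "leval p x = 0"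
    unfolding torus_zeros_def by blast
  define T where "T m = Poly_Mapping.lookup p m * mon x m" for m
  have Tnz: "T m \<noteq> 0" if "m \<in> Poly_Mapping.keys p" for m using that x(2) by (simp add: T_def in_keys_iff)
  have vT: "term_val val p (trop_pt val x + c *\<^sub>R 1) m = vl (T m)" if m: "m \<in> Poly_Mapping.keys p" for m
  proof -
    have "m \<in> char_lattice" using m p unfolding torus_functions_def by blast
    then show ?thesis using m x(2)
      by (simp add: term_val_vl T_def in_keys_iff vl_mult vl_mon inner_add_right rvec_char_lattice)
  qed
  have "absv (T m) < absv (T u)" if "m \<in> Poly_Mapping.keys p - {u}" for m
  proof -
    have "vl (T u) < vl (T m)" using x(1) that uk unfolding U_def by (auto simp: vT)
    then show ?thesis using Tnz that uk by (simp add: absv_def)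
  qed
  then have "absv (\<Sum>m\<in>Poly_Mapping.keys p - {u}. T m) < absv (T u)"
    using Tnz[OF uk] by (intro absv_sum_less) auto
  moreover have "(\<Sum>m\<in>Poly_Mapping.keys p - {u}. T m) + T u = 0"
    using x(3) uk by (simp add: leval_lin lin_def T_def sum.remove[of _ u] add.commute)
  ultimately have "absv 0 = absv (T u)" using absv_add_eq by metis
  then show False using Tnz[OF uk] by simp
qed

lemma min_terms_nonempty:
  assumes "p \<noteq> 0"
  shows "min_terms val p w \<noteq> {}"
proof -
  have "finite (term_val val p w ` Poly_Mapping.keys p)" "term_val val p w ` Poly_Mapping.keys p \<noteq> {}"
    using assms by auto
  then obtain u where "u \<in> Poly_Mapping.keys p" "term_val val p w u = Min (term_val val p w ` Poly_Mapping.keys p)"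
    using Min_in by (metis imageE)
  then have "u \<in> min_terms val p w" unfolding min_terms_def by simp
  then show ?thesis by blast
qed

lemma convex_cell:
  fixes p :: "('n::finite, 'k) laurent"
  shows "convex {w'. min_terms val p w \<subseteq> min_terms val p w'}"
proof (rule convexI)
  fix x y :: "real ^ 'n" and s t :: real
  assume x: "x \<in> {w'. min_terms val p w \<subseteq> min_terms val p w'}" and y: "y \<in> {w'. min_terms val p w \<subseteq> min_terms val p w'}"
    and st: "0 \<le> s" "0 \<le> t" "s + t = 1"
  have aff: "term_val val p (s *\<^sub>R x + t *\<^sub>R y) u = s * term_val val p x u + t * term_val val p y u" for u
  proof -
    have "vl (Poly_Mapping.lookup p u) = (s + t) * vl (Poly_Mapping.lookup p u)" using st by simp
    then show ?thesis unfolding term_val_vl by (simp add: inner_add_right algebra_simps)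
  qed
  show "s *\<^sub>R x + t *\<^sub>R y \<in> {w'. min_terms val p w \<subseteq> min_terms val p w'}"
  proof (intro CollectI subsetI)
    fix u assume "u \<in> min_terms val p w"
    then have ux: "u \<in> min_terms val p x" and uy: "u \<in> min_terms val p y" using x y by auto
    then show "u \<in> min_terms val p (s *\<^sub>R x + t *\<^sub>R y)"
      unfolding min_terms_def aff using st by (auto intro!: add_mono mult_left_mono)
  qed
qed

end

text \<open>All that is used about the edge: its equations and inequalities in terms of normalized
  \<open>F i\<close>, strictness in the relative interior, and independence of the exponents.
  Dependent \<open>v i\<close> would leave at least three free directions, each of which can be
  followed inside \<open>E\<close> from a relatively interior point, although \<open>E\<close> has
  dimension 2 in \<open>real ^ 'n\<close>.\<close>

lemma (in valued_field) edge_polyhedron: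
  fixes f :: "nat \<Rightarrow> ('n::finite, 'k) laurent"
  assumes I: "finite I" "card I + 2 = CARD('n)"
    and f: "\<And>i. i \<in> I \<Longrightarrow> torus_hypersurface_eq (f i)"
    and E: "E \<in> trop_ci_edges val I f"
    and v: "\<And>i. i \<in> I \<Longrightarrow> edge_exponent val (f i) E (v i)"
  obtains F where "\<And>i. i \<in> I \<Longrightarrow> \<exists>a u. a \<noteq> 0 \<and> u \<in> char_lattice \<and> F i = Poly_Mapping.single u a * f i"
    "\<And>i. i \<in> I \<Longrightarrow> F i \<in> torus_functions \<and> Poly_Mapping.lookup (F i) 0 = 1 \<and> v i \<noteq> 0 \<and> v i \<in> Poly_Mapping.keys (F i)"
    "E = {x. \<forall>i\<in>I. term_val val (F i) x (v i) = 0 \<and> (\<forall>m\<in>Poly_Mapping.keys (F i). 0 \<le> term_val val (F i) x m)}"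
    "rel_interior E \<noteq> {}" "convex E"
    "\<And>x i m. x \<in> rel_interior E \<Longrightarrow> i \<in> I \<Longrightarrow> m \<in> Poly_Mapping.keys (F i) \<Longrightarrow> m \<noteq> 0 \<Longrightarrow> m \<noteq> v i \<Longrightarrow>
      0 < term_val val (F i) x m"
    "\<And>c. (\<Sum>i\<in>I. c i *\<^sub>R rvec (v i)) = 0 \<Longrightarrow> \<forall>i\<in>I. c i = 0"
proof -
  have fT: "f i \<in> torus_functions" "f i \<noteq> 0" if "i \<in> I" for i
    using f[OF that] unfolding torus_hypersurface_eq_def by auto
  obtain C where C: "\<And>i. i \<in> I \<Longrightarrow> C i \<in> trop_cells val (f i)" "E = (\<Inter>i\<in>I. C i)" "E \<noteq> {}" "aff_dim E = 2"
    using E unfolding trop_ci_edges_def trop_ci_cells_def by auto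
  have "\<forall>i\<in>I. \<exists>w. w \<in> trop val (torus_zeros (f i)) \<and> C i = {w'. min_terms val (f i) w \<subseteq> min_terms val (f i) w'}"
    using C(1) unfolding trop_cells_def by blast
  then obtain wc where wc: "\<And>i. i \<in> I \<Longrightarrow> wc i \<in> trop val (torus_zeros (f i))"
    "\<And>i. i \<in> I \<Longrightarrow> C i = {w'. min_terms val (f i) (wc i) \<subseteq> min_terms val (f i) w'}" by metis
  have convE: "convex E" unfolding C(2) using wc(2) by (intro convex_INT) (auto simp: convex_cell)
  then have "rel_interior E \<noteq> {}" using C(3) rel_interior_eq_empty by blast
  then obtain w0 where w0: "w0 \<in> rel_interior E" by blast
  then have w0E: "w0 \<in> E" using rel_interior_subset by blast
  have "\<forall>i\<in>I. \<exists>a u. a \<noteq> 0 \<and> u \<in> char_lattice \<and> Poly_Mapping.lookup (Poly_Mapping.single u a * f i) 0 = 1 \<and>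
        (\<forall>w\<in>rel_interior E. min_terms val (Poly_Mapping.single u a * f i) w = {0, v i})"
    using v unfolding edge_exponent_def by blast
  then obtain a u where au: "\<And>i. i \<in> I \<Longrightarrow> a i \<noteq> 0" "\<And>i. i \<in> I \<Longrightarrow> u i \<in> char_lattice"
    "\<And>i. i \<in> I \<Longrightarrow> Poly_Mapping.lookup (Poly_Mapping.single (u i) (a i) * f i) 0 = 1"
    "\<And>i w. i \<in> I \<Longrightarrow> w \<in> rel_interior E \<Longrightarrow> min_terms val (Poly_Mapping.single (u i) (a i) * f i) w = {0, v i}"
    by metis
  define F where "F i = Poly_Mapping.single (u i) (a i) * f i" for i
  have F1: "\<exists>a u. a \<noteq> 0 \<and> u \<in> char_lattice \<and> F i = Poly_Mapping.single u a * f i" if "i \<in> I" for i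
    using au that F_def by blast
  have mt: "min_terms val (F i) w = (+) (u i) ` min_terms val (f i) w" if "i \<in> I" for i w
    unfolding F_def by (rule min_terms_single_mult[OF au(1)[OF that]])
  have F0: "Poly_Mapping.lookup (F i) 0 = 1" if "i \<in> I" for i using au(3) that by (simp add: F_def)
  have Fmin: "min_terms val (F i) w = {0, v i}" if "i \<in> I" "w \<in> rel_interior E" for i w using au(4) that by (simp add: F_def)
  have v0: "v i \<noteq> 0" if "i \<in> I" for i using v[OF that] unfolding edge_exponent_def by blast
  have vk: "v i \<in> Poly_Mapping.keys (F i)" if "i \<in> I" for i
    using Fmin[OF that w0] unfolding min_terms_def by blast
  have zk: "0 \<in> Poly_Mapping.keys (F i)" if "i \<in> I" for i using F0[OF that] by (simp add: in_keys_iff)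
  have FT: "F i \<in> torus_functions" if "i \<in> I" for i
    unfolding F_def using that au fT by (intro torus_functions_mult torus_functions_single) auto
  have t0: "term_val val (F i) x 0 = 0" if "i \<in> I" for i x
    using F0[OF that] by (simp add: term_val_vl rvec_def inner_vec_def)
  have mono: "{w'. min_terms val (f i) w \<subseteq> min_terms val (f i) w'} = {w'. min_terms val (F i) w \<subseteq> min_terms val (F i) w'}"
    if "i \<in> I" for i w
    unfolding mt[OF that] by (auto simp: inj_image_subset_iff)
  \<comment> \<open>The terms defining the cell are among \<open>0\<close> and \<open>v i\<close>,
    the minimal ones in the relative interior of \<open>E\<close>, and by
    \<open>min_terms_trop\<close> there are at least two of them.\<close>
  have CF: "C i = {x. {0, v i} \<subseteq> min_terms val (F i) x}" if i: "i \<in> I" for i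
  proof -
    have "w0 \<in> C i" using w0E C(2) i by blast
    then have sub: "min_terms val (F i) (wc i) \<subseteq> {0, v i}"
      using wc(2)[OF i] mono[OF i] Fmin[OF i w0] by blast
    have "min_terms val (F i) (wc i) \<noteq> {}" using mt[OF i] min_terms_nonempty[OF fT(2)[OF i]] by simp
    moreover have "min_terms val (F i) (wc i) \<noteq> {z}" for z
    proof
      assume "min_terms val (F i) (wc i) = {z}"
      then have "(+) (u i) ` min_terms val (f i) (wc i) = (+) (u i) ` {z - u i}" using mt[OF i] by simp
      then have "min_terms val (f i) (wc i) = {z - u i}" by (simp only: inj_image_eq_iff[OF inj_on_add])
      then show False using min_terms_trop[OF fT(1)[OF i] wc(1)[OF i]] by blast
    qed
    ultimately have "min_terms val (F i) (wc i) = {0, v i}" using sub by blast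
    then show ?thesis using wc(2)[OF i] mono[OF i] by simp
  qed
  have two: "{0, v i} \<subseteq> min_terms val (F i) x \<longleftrightarrow>
      term_val val (F i) x (v i) = 0 \<and> (\<forall>m\<in>Poly_Mapping.keys (F i). 0 \<le> term_val val (F i) x m)" if i: "i \<in> I" for i x
    unfolding min_terms_def using vk[OF i] zk[OF i] t0[OF i, of x] by fastforce
  have Eeq: "E = {x. \<forall>i\<in>I. term_val val (F i) x (v i) = 0 \<and> (\<forall>m\<in>Poly_Mapping.keys (F i). 0 \<le> term_val val (F i) x m)}"
    unfolding C(2) using CF two by auto
  have strict: "0 < term_val val (F i) x m" if "x \<in> rel_interior E" "i \<in> I" "m \<in> Poly_Mapping.keys (F i)" "m \<noteq> 0" "m \<noteq> v i" for x i m
  proof (rule ccontr)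
    assume "\<not> 0 < term_val val (F i) x m"
    moreover have "0 \<in> min_terms val (F i) x" using Fmin that by blast
    ultimately have "m \<in> min_terms val (F i) x" using that t0[OF that(2), of x] unfolding min_terms_def by force
    then show False using Fmin that by blast
  qed
  have indep: "\<forall>i\<in>I. c i = 0" if c: "(\<Sum>i\<in>I. c i *\<^sub>R rvec (v i)) = 0" for c
  proof (rule ccontr)
    assume "\<not> (\<forall>i\<in>I. c i = 0)"
    then obtain k where k: "k \<in> I" "c k \<noteq> 0" by blast
    define R where "R = span ((\<lambda>i. rvec (v i)) ` (I - {k}))"
    have "(\<Sum>i\<in>I - {k}. c i *\<^sub>R rvec (v i)) + c k *\<^sub>R rvec (v k) = 0"
      using c k I by (simp add: sum.remove[of _ k] add.commute)
    then have "c k *\<^sub>R rvec (v k) = - (\<Sum>i\<in>I - {k}. c i *\<^sub>R rvec (v i))" by (simp add: eq_neg_iff_add_eq_0 add.commute)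
    then have "rvec (v k) = (1 / c k) *\<^sub>R (- (\<Sum>i\<in>I - {k}. c i *\<^sub>R rvec (v i)))"
      using k by (metis scaleR_one scaleR_scaleR nonzero_divide_eq_eq times_divide_eq_left mult_1)
    moreover have "(1 / c k) *\<^sub>R (- (\<Sum>i\<in>I - {k}. c i *\<^sub>R rvec (v i))) \<in> R"
      unfolding R_def by (intro span_scale span_neg span_sum span_base imageI)
    ultimately have vkR: "rvec (v k) \<in> R" by simp
    have inR: "rvec (v i) \<in> R" if "i \<in> I" for i
      using vkR that by (cases "i = k") (auto simp: R_def intro!: span_base)
    have dR: "dim R \<le> card I - 1"
    proof -
      have "dim R \<le> card ((\<lambda>i. rvec (v i)) ` (I - {k}))" unfolding R_def using I by (intro dim_le_card) auto
      also have "\<dots> \<le> card (I - {k})" using I by (intro card_image_le) auto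
      finally show ?thesis using I k by simp
    qed
    have subR: "subspace R" by (simp add: R_def)
    have "dim {y \<in> UNIV. \<forall>x\<in>R. orthogonal x y} + dim R = dim (UNIV :: (real ^ 'n) set)"
      using subR by (intro dim_subspace_orthogonal_to_vectors) auto
    then have "3 \<le> dim {y. \<forall>x\<in>R. orthogonal x y}" using dR I k card_gt_0_iff[of I] by auto
    moreover have "{y. \<forall>x\<in>R. orthogonal x y} \<subseteq> span ((\<lambda>x. x - w0) ` E)"
    proof
      \<comment> \<open>From \<open>w0\<close> one can move a little in every direction orthogonal
        to the \<open>v i\<close>: the two minimal terms are unchanged, and the others, strictly
        positive at \<open>w0\<close>, stay positive.\<close>
      fix d assume d: "d \<in> {y. \<forall>x\<in>R. orthogonal x y}"
      then have dv: "rvec (v i) \<bullet> d = 0" if "i \<in> I" for i using inR[OF that] by (simp add: orthogonal_def)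
      have tv: "term_val val (F i) (w0 + \<epsilon> *\<^sub>R d) m = term_val val (F i) w0 m + \<epsilon> * (rvec m \<bullet> d)" for i m \<epsilon>
        by (simp add: term_val_vl inner_add_right)
      have "\<forall>\<^sub>F \<epsilon> in at_right 0. \<forall>i\<in>I. \<forall>m\<in>Poly_Mapping.keys (F i) - {0, v i}. 0 < term_val val (F i) (w0 + \<epsilon> *\<^sub>R d) m"
      proof (intro eventually_ball_finite I finite_Diff finite_keys ballI)
        fix i m assume im: "i \<in> I" "m \<in> Poly_Mapping.keys (F i) - {0, v i}"
        then have pos: "0 < term_val val (F i) w0 m" using strict[OF w0] by blast
        have "((\<lambda>\<epsilon>. term_val val (F i) w0 m + \<epsilon> * (rvec m \<bullet> d)) \<longlongrightarrow> term_val val (F i) w0 m + 0 * (rvec m \<bullet> d)) (at_right 0)"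
          by (intro tendsto_intros)
        then have "((\<lambda>\<epsilon>. term_val val (F i) (w0 + \<epsilon> *\<^sub>R d) m) \<longlongrightarrow> term_val val (F i) w0 m) (at_right 0)" unfolding tv by simp
        then show "\<forall>\<^sub>F \<epsilon> in at_right 0. 0 < term_val val (F i) (w0 + \<epsilon> *\<^sub>R d) m" using pos order_tendstoD(1) by blast
      qed
      then obtain b where b: "b > 0" "\<And>\<epsilon>. 0 < \<epsilon> \<Longrightarrow> \<epsilon> < b \<Longrightarrow>
        \<forall>i\<in>I. \<forall>m\<in>Poly_Mapping.keys (F i) - {0, v i}. 0 < term_val val (F i) (w0 + \<epsilon> *\<^sub>R d) m"
        unfolding eventually_at_right_field by auto
      define \<epsilon> where "\<epsilon> = b / 2"
      have \<epsilon>: "0 < \<epsilon>" "\<epsilon> < b" using b by (auto simp: \<epsilon>_def)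
      have "w0 + \<epsilon> *\<^sub>R d \<in> E" unfolding Eeq
      proof (intro CollectI ballI conjI)
        fix i assume i: "i \<in> I"
        have z: "term_val val (F i) w0 (v i) = 0" using w0E i unfolding Eeq by blast
        show v0: "term_val val (F i) (w0 + \<epsilon> *\<^sub>R d) (v i) = 0" unfolding tv z dv[OF i] by simp
        fix m assume m: "m \<in> Poly_Mapping.keys (F i)"
        show "0 \<le> term_val val (F i) (w0 + \<epsilon> *\<^sub>R d) m"
        proof (cases "m = 0 \<or> m = v i")
          case True
          then show ?thesis using v0 t0[OF i] by auto
        next
          case False
          then have "0 < term_val val (F i) (w0 + \<epsilon> *\<^sub>R d) m" using b(2)[OF \<epsilon>] i m by blast
          then show ?thesis by simp
        qed
      qed
      then have "\<epsilon> *\<^sub>R d \<in> (\<lambda>x. x - w0) ` E" by (intro image_eqI[of _ _ "w0 + \<epsilon> *\<^sub>R d"]) auto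
      then have "(1 / \<epsilon>) *\<^sub>R (\<epsilon> *\<^sub>R d) \<in> span ((\<lambda>x. x - w0) ` E)" by (intro span_scale span_base)
      then show "d \<in> span ((\<lambda>x. x - w0) ` E)" using \<epsilon> by simp
    qed
    then have "dim {y. \<forall>x\<in>R. orthogonal x y} \<le> dim (span ((\<lambda>x. x - w0) ` E))" by (rule dim_subset)
    then have "dim {y. \<forall>x\<in>R. orthogonal x y} \<le> dim ((\<lambda>x. x - w0) ` E)" by (simp only: dim_span)
    moreover have "int (dim ((\<lambda>x. x - w0) ` E)) = aff_dim E"
    proof -
      have "0 \<in> affine hull ((\<lambda>x. x - w0) ` E)" using w0E by (intro hull_inc) (auto intro: image_eqI[of _ _ w0])
      then have "aff_dim ((\<lambda>x. x - w0) ` E) = int (dim ((\<lambda>x. x - w0) ` E))" by (rule aff_dim_zero)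
      then show ?thesis using aff_dim_translation_eq_subtract[of w0 E] by simp
    qed
    ultimately show False using C(4) by simp
  qed
  have F2: "F i \<in> torus_functions \<and> Poly_Mapping.lookup (F i) 0 = 1 \<and> v i \<noteq> 0 \<and> v i \<in> Poly_Mapping.keys (F i)"
    if "i \<in> I" for i using FT F0 v0 vk that by blast
  show thesis
    by (rule that[OF F1 F2 Eeq \<open>rel_interior E \<noteq> {}\<close> convE strict indep])
qed

section \<open>Points over an edge\<close>

text \<open>The setting after normalization, with the data of \<open>integral_duality\<close>: the
  \<open>y k\<close> are cocharacters dual to the \<open>v i\<close> up to the factor
  \<open>D\<close>, and \<open>w\<close> is the cocharacter along the edge.\<close>

locale tropical_edge = valued_field val for val :: "'k::{alg_closed_field, field_char_0} \<Rightarrow> ereal" +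
  fixes I :: "nat set" and F :: "nat \<Rightarrow> ('n::finite, 'k) laurent" and v y :: "nat \<Rightarrow> int ^ 'n"
    and g h w :: "int ^ 'n" and D :: int
  assumes fI: "finite I"
    and F_torus: "i \<in> I \<Longrightarrow> F i \<in> torus_functions" and F_0: "i \<in> I \<Longrightarrow> Poly_Mapping.lookup (F i) 0 = 1"
    and v_nz: "i \<in> I \<Longrightarrow> v i \<noteq> 0" and v_key: "i \<in> I \<Longrightarrow> v i \<in> Poly_Mapping.keys (F i)"
    and D_pos: "D > 0"
    and vy: "i \<in> I \<Longrightarrow> k \<in> I \<Longrightarrow> (\<Sum>p\<in>UNIV. v i $ p * y k $ p) = (if i = k then D else 0)"
    and vw: "i \<in> I \<Longrightarrow> (\<Sum>p\<in>UNIV. v i $ p * w $ p) = 0"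
    and compl: "(\<Sum>k\<in>I. v k $ p * y k $ q) + g $ p + h $ p * w $ q = (if p = q then D else 0)"
    and w_nonconst: "\<exists>p q. w $ p \<noteq> w $ q"
begin

definition other_keys :: "nat \<Rightarrow> (int ^ 'n) set" where
  "other_keys i = Poly_Mapping.keys (F i) - {0, v i}"

text \<open>The relative interior of the edge in terms of its inequalities; the two inclusions are
  \<open>ri_inner\<close> and \<open>inner_ri\<close>.\<close>

definition inner_pt :: "real ^ 'n \<Rightarrow> bool" where
  "inner_pt \<alpha> \<longleftrightarrow> (\<forall>i\<in>I. term_val val (F i) \<alpha> (v i) = 0 \<and> (\<forall>m\<in>other_keys i. 0 < term_val val (F i) \<alpha> m))"

lemma v_sum: "i \<in> I \<Longrightarrow> (\<Sum>p\<in>UNIV. v i $ p) = 0"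
  using torus_functionsD F_torus v_key by blast

lemma lin_F: "i \<in> I \<Longrightarrow> lin G (F i) = G 0 + Poly_Mapping.lookup (F i) (v i) * G (v i) +
    (\<Sum>m\<in>other_keys i. Poly_Mapping.lookup (F i) m * G m)"
proof -
  assume i: "i \<in> I"
  have "0 \<in> Poly_Mapping.keys (F i)" using F_0[OF i] by (simp add: in_keys_iff)
  then have "lin G (F i) = Poly_Mapping.lookup (F i) 0 * G 0 + (\<Sum>m\<in>Poly_Mapping.keys (F i) - {0}. Poly_Mapping.lookup (F i) m * G m)"
    unfolding lin_def by (intro sum.remove) auto
  also have "(\<Sum>m\<in>Poly_Mapping.keys (F i) - {0}. Poly_Mapping.lookup (F i) m * G m) = Poly_Mapping.lookup (F i) (v i) * G (v i) +
    (\<Sum>m\<in>Poly_Mapping.keys (F i) - {0} - {v i}. Poly_Mapping.lookup (F i) m * G m)"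
    using v_key[OF i] v_nz[OF i] by (intro sum.remove) auto
  also have "Poly_Mapping.keys (F i) - {0} - {v i} = other_keys i" by (auto simp: other_keys_def)
  finally show ?thesis using F_0[OF i] by (simp add: add.assoc)
qed

text \<open>The points \<open>x\<close> over \<open>\<alpha>\<close> with vanishing binomial parts of all \<open>F i\<close> are perturbed along the
  cocharacters \<open>y k\<close> dual to the \<open>v i\<close>.\<close>

lemma mon_prod_powi:
  assumes "\<And>k. k \<in> J \<Longrightarrow> d k \<noteq> 0"
  shows "mon (\<chi> q. \<Prod>k\<in>J. (d k :: 'k) powi (y k $ q)) m = (\<Prod>k\<in>J. d k powi (\<Sum>q\<in>UNIV. m $ q * y k $ q))"
proof -
  have pow: "d powi (\<Sum>q\<in>Q. a q) = (\<Prod>q\<in>Q. d powi a q)" if "d \<noteq> 0" for d :: 'k and a :: "'n \<Rightarrow> int" and Q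
    using that by (induction Q rule: infinite_finite_induct) (auto simp: power_int_add)
  have prodpow: "(\<Prod>k\<in>J. f k) powi a = (\<Prod>k\<in>J. f k powi a)" for f :: "nat \<Rightarrow> 'k" and a
    by (induction J rule: infinite_finite_induct) (auto simp: power_int_mult_distrib)
  have "mon (\<chi> q. \<Prod>k\<in>J. d k powi (y k $ q)) m = (\<Prod>q\<in>UNIV. \<Prod>k\<in>J. d k powi (m $ q * y k $ q))"
    by (simp add: mon_def prodpow flip: power_int_mult) (simp add: power_int_mult mult.commute)
  also have "\<dots> = (\<Prod>k\<in>J. \<Prod>q\<in>UNIV. d k powi (m $ q * y k $ q))" by (rule prod.swap)
  also have "\<dots> = (\<Prod>k\<in>J. d k powi (\<Sum>q\<in>UNIV. m $ q * y k $ q))" using assms by (simp add: pow)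
  finally show ?thesis .
qed

lemma mon_times: "mon (\<chi> q. a $ q * b $ q) m = mon a m * mon b m"
  by (simp add: mon_def power_int_mult_distrib prod.distrib)

section \<open>Lipschitz functions on a polydisc around 1\<close>

definition Bset :: "real \<Rightarrow> (nat \<Rightarrow> 'k) set" where
  "Bset \<delta> = {u. \<forall>k\<in>I. absv (u k - 1) \<le> \<delta>}"

text \<open>One constant bounds both the values and the Lipschitz quotient. By the ultrametric
  inequality this pair of bounds is stable under sums and multiplicative under products, so Laurent
  monomials have constant 1 and a term inherits the size of its coefficient.\<close>

definition Lip :: "real \<Rightarrow> real \<Rightarrow> ((nat \<Rightarrow> 'k) \<Rightarrow> 'k) \<Rightarrow> bool" where
  "Lip \<delta> a \<phi> \<longleftrightarrow> (\<forall>u\<in>Bset \<delta>. absv (\<phi> u) \<le> a \<and>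
     (\<forall>u'\<in>Bset \<delta>. \<forall>r\<ge>0. (\<forall>k\<in>I. absv (u k - u' k) \<le> r) \<longrightarrow> absv (\<phi> u - \<phi> u') \<le> a * r))"

lemma unit_absv: "absv (x - 1) \<le> \<delta> \<Longrightarrow> \<delta> < 1 \<Longrightarrow> absv x = 1"
  using absv_eqI[of x 1] by simp

lemma Lip_const: "Lip \<delta> (absv c) (\<lambda>u. c)"
  by (simp add: Lip_def)

lemma Lip_var: "\<delta> < 1 \<Longrightarrow> k \<in> I \<Longrightarrow> Lip \<delta> 1 (\<lambda>u. u k)"
proof -
  assume \<delta>: "\<delta> < 1" "k \<in> I"
  have "absv (u k) = 1" if "u \<in> Bset \<delta>" for u using \<delta> that unit_absv unfolding Bset_def by blast
  then show ?thesis using \<delta>(2) by (simp add: Lip_def)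
qed

lemma Lip_inverse: "\<delta> < 1 \<Longrightarrow> k \<in> I \<Longrightarrow> Lip \<delta> 1 (\<lambda>u. inverse (u k))"
  unfolding Lip_def
proof (intro ballI conjI allI impI)
  assume \<delta>: "\<delta> < 1" "k \<in> I"
  fix u assume "u \<in> Bset \<delta>"
  then have u: "absv (u k) = 1" using \<delta> unit_absv unfolding Bset_def by blast
  then show "absv (inverse (u k)) \<le> 1" by (simp add: absv_inverse)
  fix u' r assume "u' \<in> Bset \<delta>" and r: "0 \<le> r" "\<forall>k\<in>I. absv (u k - u' k) \<le> r"
  then have u': "absv (u' k) = 1" using \<delta> unit_absv unfolding Bset_def by blast
  have nz: "u k \<noteq> 0" "u' k \<noteq> 0" using u u' by auto
  then have "inverse (u k) - inverse (u' k) = (u' k - u k) / (u k * u' k)" by (simp add: field_simps)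
  then have "absv (inverse (u k) - inverse (u' k)) = absv (u k - u' k)"
    using u u' by (simp add: absv_divide absv_mult absv_commute)
  then show "absv (inverse (u k) - inverse (u' k)) \<le> 1 * r" using r \<delta> by simp
qed

lemma Lip_mult:
  assumes "Lip \<delta> a \<phi>" "Lip \<delta> b \<psi>"
  shows "Lip \<delta> (a * b) (\<lambda>u. \<phi> u * \<psi> u)"
  unfolding Lip_def
proof (intro ballI conjI allI impI)
  fix u assume u: "u \<in> Bset \<delta>"
  then have au: "absv (\<phi> u) \<le> a" "absv (\<psi> u) \<le> b" using assms unfolding Lip_def by blast+
  then have nn: "0 \<le> a" "0 \<le> b" using absv_nonneg order_trans by blast+
  show "absv (\<phi> u * \<psi> u) \<le> a * b" using au nn by (simp add: absv_mult mult_mono)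
  fix u' r assume u': "u' \<in> Bset \<delta>" and r: "0 \<le> (r::real)" "\<forall>k\<in>I. absv (u k - u' k) \<le> r"
  then have d: "absv (\<phi> u - \<phi> u') \<le> a * r" "absv (\<psi> u - \<psi> u') \<le> b * r" "absv (\<psi> u') \<le> b"
    using assms u unfolding Lip_def by blast+
  have "absv (\<phi> u * (\<psi> u - \<psi> u')) \<le> a * (b * r)" unfolding absv_mult using au d nn r by (intro mult_mono) auto
  moreover have "absv ((\<phi> u - \<phi> u') * \<psi> u') \<le> (a * r) * b" unfolding absv_mult using au d nn r by (intro mult_mono) auto
  ultimately have "absv (\<phi> u * (\<psi> u - \<psi> u') + (\<phi> u - \<phi> u') * \<psi> u') \<le> a * b * r"
    by (intro absv_add_le) (auto simp: mult_ac)
  then show "absv (\<phi> u * \<psi> u - \<phi> u' * \<psi> u') \<le> a * b * r" by (simp add: algebra_simps)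
qed

lemma Lip_power: "Lip \<delta> 1 \<phi> \<Longrightarrow> Lip \<delta> 1 (\<lambda>u. \<phi> u ^ n)"
proof (induction n)
  case 0
  then show ?case using Lip_const[of \<delta> 1] by simp
next
  case (Suc n)
  then show ?case using Lip_mult[of \<delta> 1 \<phi> 1 "\<lambda>u. \<phi> u ^ n"] by simp
qed

lemma Lip_powi: "\<delta> < 1 \<Longrightarrow> k \<in> I \<Longrightarrow> Lip \<delta> 1 (\<lambda>u. u k powi m)"
  unfolding power_int_def by (cases "m \<ge> 0") (auto intro: Lip_power Lip_var Lip_inverse)

lemma Lip_prod: "(\<And>k. k \<in> J \<Longrightarrow> Lip \<delta> 1 (\<phi> k)) \<Longrightarrow> Lip \<delta> 1 (\<lambda>u. \<Prod>k\<in>J. \<phi> k u)"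
proof (induction J rule: infinite_finite_induct)
  case (insert x J)
  then show ?case using Lip_mult[of \<delta> 1 "\<phi> x" 1 "\<lambda>u. \<Prod>k\<in>J. \<phi> k u"] by simp
qed (use Lip_const[of \<delta> 1] in simp_all)

lemma Lip_mono:
  assumes "Lip \<delta> a \<phi>" "a \<le> b"
  shows "Lip \<delta> b \<phi>"
  unfolding Lip_def
proof (intro ballI conjI allI impI)
  fix u assume u: "u \<in> Bset \<delta>"
  then show "absv (\<phi> u) \<le> b" using assms unfolding Lip_def by force
  fix u' r assume u': "u' \<in> Bset \<delta>" and r: "0 \<le> (r::real)" "\<forall>k\<in>I. absv (u k - u' k) \<le> r"
  then have "absv (\<phi> u - \<phi> u') \<le> a * r" using assms(1) u unfolding Lip_def by blast
  also have "\<dots> \<le> b * r" using assms(2) r by (simp add: mult_right_mono)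
  finally show "absv (\<phi> u - \<phi> u') \<le> b * r" .
qed

lemma Lip_sum:
  assumes "a \<ge> 0" "\<And>m. m \<in> M \<Longrightarrow> Lip \<delta> a (\<phi> m)"
  shows "Lip \<delta> a (\<lambda>u. \<Sum>m\<in>M. \<phi> m u)"
  unfolding Lip_def
proof (intro ballI conjI allI impI)
  fix u assume u: "u \<in> Bset \<delta>"
  then show "absv (\<Sum>m\<in>M. \<phi> m u) \<le> a" using assms unfolding Lip_def by (intro absv_sum_le) blast+
  fix u' r assume u': "u' \<in> Bset \<delta>" and r: "0 \<le> (r::real)" "\<forall>k\<in>I. absv (u k - u' k) \<le> r"
  have "absv (\<Sum>m\<in>M. \<phi> m u - \<phi> m u') \<le> a * r"
  proof (rule absv_sum_le)
    show "0 \<le> a * r" using assms r by simp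
    show "absv (\<phi> m u - \<phi> m u') \<le> a * r" if "m \<in> M" for m
      using assms(2)[OF that] u u' r unfolding Lip_def by blast
  qed
  then show "absv ((\<Sum>m\<in>M. \<phi> m u) - (\<Sum>m\<in>M. \<phi> m u')) \<le> a * r" by (simp add: sum_subtractf)
qed

section \<open>Newton iteration for the perturbed binomial system\<close>

lemma near_one_mult: "absv (a - 1) \<le> \<delta> \<Longrightarrow> absv (b - 1) \<le> \<delta> \<Longrightarrow> \<delta> < 1 \<Longrightarrow> absv (a * b - 1) \<le> \<delta>"
proof -
  assume *: "absv (a - 1) \<le> \<delta>" "absv (b - 1) \<le> \<delta>" "\<delta> < 1"
  have "absv (a * (b - 1)) \<le> \<delta>" using * unit_absv[of a \<delta>] by (simp add: absv_mult)
  then have "absv (a * (b - 1) + (a - 1)) \<le> \<delta>" using *(1) by (rule absv_add_le)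
  then show ?thesis by (simp add: algebra_simps)
qed

lemma near_one_power: "0 \<le> \<delta> \<Longrightarrow> absv (a - 1) \<le> \<delta> \<Longrightarrow> \<delta> < 1 \<Longrightarrow> absv (a ^ n - 1) \<le> \<delta>"
  by (induction n) (auto intro: near_one_mult)

lemma absv_of_nat: "n > 0 \<Longrightarrow> absv (of_nat n) = 1"
  using absv_of_int[of "int n"] by simp

text \<open>The map is the Newton step for \<open>a^N = 1\<close> with the derivative frozen at 1.
  In \<open>a^N - b^N = (a - b) * S\<close> the factor \<open>S\<close> is a sum of \<open>N\<close>
  products close to 1, hence close to \<open>N\<close>, which has absolute value 1.\<close>

lemma newton_power_contraction:
  fixes N :: nat
  assumes N: "N > 0" and \<delta>: "0 \<le> \<delta>" "\<delta> < 1" and a: "absv (a - 1) \<le> \<delta>" and b: "absv (b - 1) \<le> \<delta>"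
  shows "absv ((a + (1 - a ^ N) / of_nat N) - (b + (1 - b ^ N) / of_nat N)) \<le> \<delta> * absv (a - b)"
proof -
  define S where "S = (\<Sum>i<N. b ^ (N - Suc i) * a ^ i)"
  have "a ^ N - b ^ N = (a - b) * S" unfolding S_def by (rule power_diff_sumr2)
  have N1: "absv (of_nat N) = 1" using N by (simp add: absv_of_nat)
  have "absv (\<Sum>i<N. b ^ (N - Suc i) * a ^ i - 1) \<le> \<delta>"
    using \<delta> a b by (intro absv_sum_le near_one_mult near_one_power) auto
  then have S: "absv (S - of_nat N) \<le> \<delta>" by (simp add: S_def sum_subtractf)
  have nN: "(of_nat N :: 'k) \<noteq> 0" using N by simp
  have "(a + (1 - a ^ N) / of_nat N) - (b + (1 - b ^ N) / of_nat N) = (a - b) - (a ^ N - b ^ N) / of_nat N"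
    by (simp add: diff_divide_distrib)
  also have "\<dots> = (a - b) * (of_nat N - S) / of_nat N"
    unfolding \<open>a ^ N - b ^ N = (a - b) * S\<close> using nN by (simp add: field_simps)
  finally have "absv ((a + (1 - a ^ N) / of_nat N) - (b + (1 - b ^ N) / of_nat N)) = absv (a - b) * absv (S - of_nat N)"
    by (simp add: absv_divide absv_mult N1 absv_commute)
  also have "\<dots> \<le> absv (a - b) * \<delta>" using S by (intro mult_left_mono) auto
  finally show ?thesis by (simp add: mult.commute)
qed

text \<open>Perturbing \<open>z0\<close> by powers of unknowns \<open>u k\<close> along the
  \<open>y k\<close> decouples the leading parts: \<open>F i\<close> becomes
  \<open>1 - u i ^ N\<close> plus terms of absolute value less than 1. Frozen Newton steps in all
  unknowns at once then contract.\<close>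

lemma lift_binomial_zero:
  assumes z0: "z0 \<in> torus" and \<alpha>: "inner_pt (trop_pt val z0)"
    and bin: "\<And>i. i \<in> I \<Longrightarrow> Poly_Mapping.lookup (F i) (v i) * mon z0 (v i) = -1"
  shows "\<exists>P\<in>torus. trop_pt val P = trop_pt val z0 \<and> (\<forall>i\<in>I. leval (F i) P = 0)"
proof -
  define c where "c i m = Poly_Mapping.lookup (F i) m * mon z0 m" for i m
  define N where "N = nat D"
  have N: "N > 0" "int N = D" using D_pos by (auto simp: N_def)
  \<comment> \<open>The largest absolute value of a term besides the two leading ones. The entry 1/2
    keeps \<open>\<delta>\<close> positive and the maximum meaningful if there are no such
    terms.\<close>
  define \<delta> where "\<delta> = Max (insert (1/2) (\<Union>i\<in>I. (\<lambda>m. absv (c i m)) ` other_keys i))"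
  have fin: "finite (insert (1/2) (\<Union>i\<in>I. (\<lambda>m. absv (c i m)) ` other_keys i))"
    using fI by (auto simp: other_keys_def)
  have c1: "absv (c i m) < 1" if "i \<in> I" "m \<in> other_keys i" for i m
  proof -
    have m: "Poly_Mapping.lookup (F i) m \<noteq> 0" using that(2) by (simp add: other_keys_def in_keys_iff)
    have "0 < term_val val (F i) (trop_pt val z0) m" using \<alpha> that unfolding inner_pt_def by blast
    then have "0 < vl (c i m)" unfolding c_def term_val_vl using m z0 by (simp add: vl_mult vl_mon)
    then show ?thesis using m z0 by (simp add: absv_def c_def)
  qed
  have \<delta>: "0 < \<delta>" "\<delta> < 1"
  proof -
    have "1/2 \<le> \<delta>" unfolding \<delta>_def using fin by (intro Max_ge) auto
    then show "0 < \<delta>" by simp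
    show "\<delta> < 1" unfolding \<delta>_def using fin c1 by (subst Max_less_iff) auto
  qed
  have c\<delta>: "absv (c i m) \<le> \<delta>" if "i \<in> I" "m \<in> other_keys i" for i m
    unfolding \<delta>_def using fin that by (intro Max_ge) auto
  define Z where "Z u = (\<chi> q. z0 $ q * (\<Prod>k\<in>I. u k powi (y k $ q)))" for u :: "nat \<Rightarrow> 'k"
  define G where "G i u = (\<Sum>m\<in>other_keys i. c i m * (\<Prod>k\<in>I. u k powi (\<Sum>q\<in>UNIV. m $ q * y k $ q)))" for i u
  have Bu: "absv (u k) = 1" if "u \<in> Bset \<delta>" "k \<in> I" for u k
    using that unit_absv[of "u k" \<delta>] \<delta> unfolding Bset_def by blast
  have Bnz: "u k \<noteq> 0" if "u \<in> Bset \<delta>" "k \<in> I" for u k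
    using Bu[OF that] by auto
  have Zmon: "mon (Z u) m = mon z0 m * (\<Prod>k\<in>I. u k powi (\<Sum>q\<in>UNIV. m $ q * y k $ q))" if "u \<in> Bset \<delta>" for u m
    using mon_times[of z0 "\<chi> q. \<Prod>k\<in>I. u k powi (y k $ q)" m] mon_prod_powi[of I u m] Bnz[OF that]
    by (simp add: Z_def)
  have FZ: "leval (F i) (Z u) = 1 - u i ^ N + G i u" if i: "i \<in> I" and u: "u \<in> Bset \<delta>" for i u
  proof -
    have "(\<Prod>k\<in>I. u k powi (\<Sum>q\<in>UNIV. v i $ q * y k $ q)) = (\<Prod>k\<in>I. if i = k then u k powi D else 1)"
      using vy i by (intro prod.cong) auto
    also have "\<dots> = u i ^ N" using i fI N by (simp add: prod.delta power_int_def N_def)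
    finally have "Poly_Mapping.lookup (F i) (v i) * mon (Z u) (v i) = - (u i ^ N)"
      using bin[OF i] by (simp add: Zmon[OF u] flip: mult.assoc)
    moreover have "(\<Sum>m\<in>other_keys i. Poly_Mapping.lookup (F i) m * mon (Z u) m) = G i u"
      by (simp add: G_def c_def Zmon[OF u] mult.assoc)
    ultimately show ?thesis by (simp add: leval_lin lin_F[OF i])
  qed
  have LG: "Lip \<delta> \<delta> (G i)" if "i \<in> I" for i
    unfolding G_def
  proof (rule Lip_sum)
    fix m assume m: "m \<in> other_keys i"
    have "Lip \<delta> 1 (\<lambda>u. \<Prod>k\<in>I. u k powi (\<Sum>q\<in>UNIV. m $ q * y k $ q))" using \<delta> by (intro Lip_prod Lip_powi)
    then have "Lip \<delta> (absv (c i m) * 1) (\<lambda>u. c i m * (\<Prod>k\<in>I. u k powi (\<Sum>q\<in>UNIV. m $ q * y k $ q)))"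
      by (intro Lip_mult Lip_const)
    then show "Lip \<delta> \<delta> (\<lambda>u. c i m * (\<Prod>k\<in>I. u k powi (\<Sum>q\<in>UNIV. m $ q * y k $ q)))"
      by (rule Lip_mono) (use c\<delta>[OF that m] in simp)
  qed (use \<delta> in simp)
  have N1: "absv (of_nat N) = 1" using N by (simp add: absv_of_nat)
  have nN: "(of_nat N :: 'k) \<noteq> 0" using N by simp
  define \<Phi> where "\<Phi> u k = u k + leval (F k) (Z u) / of_nat N" for u k
  have \<Phi>: "\<Phi> u k = (u k + (1 - u k ^ N) / of_nat N) + G k u / of_nat N" if "u \<in> Bset \<delta>" "k \<in> I" for u k
    by (simp add: \<Phi>_def FZ[OF that(2,1)] add_divide_distrib)
  have \<Phi>d: "absv (\<Phi> u k - \<Phi> u' k) \<le> \<delta> * r"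
    if u: "u \<in> Bset \<delta>" "u' \<in> Bset \<delta>" and k: "k \<in> I" and r: "0 \<le> r" "\<forall>j\<in>I. absv (u j - u' j) \<le> r" for u u' k r
  proof -
    have "absv ((u k + (1 - u k ^ N) / of_nat N) - (u' k + (1 - u' k ^ N) / of_nat N)) \<le> \<delta> * absv (u k - u' k)"
      using u k \<delta> N unfolding Bset_def by (intro newton_power_contraction) auto
    also have "\<dots> \<le> \<delta> * r" using r k \<delta> by (intro mult_left_mono) auto
    finally have 1: "absv ((u k + (1 - u k ^ N) / of_nat N) - (u' k + (1 - u' k ^ N) / of_nat N)) \<le> \<delta> * r" .
    have "absv (G k u - G k u') \<le> \<delta> * r" using LG[OF k] u r unfolding Lip_def by blast
    then have "absv ((G k u - G k u') / of_nat N) \<le> \<delta> * r" by (simp add: absv_divide N1)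
    from absv_add_le[OF 1 this] show ?thesis
      unfolding \<Phi>[OF u(1) k] \<Phi>[OF u(2) k] by (simp add: diff_divide_distrib algebra_simps)
  qed
  have one: "(\<lambda>k. 1) \<in> Bset \<delta>" using \<delta> by (simp add: Bset_def)
  have \<Phi>B: "\<Phi> u \<in> Bset \<delta>" if u: "u \<in> Bset \<delta>" for u
    unfolding Bset_def
  proof (intro CollectI ballI)
    fix k assume k: "k \<in> I"
    have "absv ((u k + (1 - u k ^ N) / of_nat N) - (1 + (1 - 1 ^ N) / of_nat N)) \<le> \<delta> * absv (u k - 1)"
      using u k \<delta> N unfolding Bset_def by (intro newton_power_contraction) auto
    also have "\<dots> \<le> 1 * \<delta>" using u k \<delta> unfolding Bset_def by (intro mult_mono) auto
    finally have 1: "absv ((u k + (1 - u k ^ N) / of_nat N) - 1) \<le> \<delta>" by simp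
    have "absv (G k u) \<le> \<delta>" using LG[OF k] u unfolding Lip_def by blast
    then have "absv (G k u / of_nat N) \<le> \<delta>" by (simp add: absv_divide N1)
    from absv_add_le[OF 1 this] show "absv (\<Phi> u k - 1) \<le> \<delta>" unfolding \<Phi>[OF u k] by (simp add: algebra_simps)
  qed
  define U where "U j = (\<Phi> ^^ j) (\<lambda>k. 1)" for j
  have U: "U j \<in> Bset \<delta>" for j unfolding U_def by (induction j) (auto simp: one \<Phi>B)
  have US: "U (Suc j) = \<Phi> (U j)" for j by (simp add: U_def)
  have step: "\<forall>k\<in>I. absv (U (Suc j) k - U j k) \<le> \<delta> ^ Suc j" for j
  proof (induction j)
    case 0
    then show ?case using U[of 1] unfolding Bset_def by (simp add: U_def)
  next
    case (Suc j)
    show ?case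
    proof
      fix k assume k: "k \<in> I"
      have "absv (\<Phi> (U (Suc j)) k - \<Phi> (U j) k) \<le> \<delta> * \<delta> ^ Suc j"
        using Suc \<delta> by (intro \<Phi>d U k) auto
      then show "absv (U (Suc (Suc j)) k - U (Suc j) k) \<le> \<delta> ^ Suc (Suc j)" by (simp add: US)
    qed
  qed
  have far: "absv (U (j + d) k - U j k) \<le> \<delta> ^ j" if k: "k \<in> I" for j d k
  proof (induction d)
    case (Suc d)
    have "absv (U (Suc (j + d)) k - U (j + d) k) \<le> \<delta> ^ Suc (j + d)" using step k by blast
    also have "\<dots> \<le> \<delta> ^ j" using \<delta> by (intro power_decreasing) auto
    finally show ?case using absv_add_le[OF _ Suc, of "U (Suc (j + d)) k - U (j + d) k"] by simp
  qed (use \<delta> in simp)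
  have far2: "absv (U i k - U j k) \<le> \<delta> ^ M" if k: "k \<in> I" and "i \<ge> M" "j \<ge> M" for i j k M
  proof -
    have *: "absv (U i k - U M k) \<le> \<delta> ^ M" if "i \<ge> M" for i using far[OF k, of M "i - M"] that by simp
    show ?thesis using absv_diff_le[OF *[OF that(2)] *[OF that(3)]] by simp
  qed
  have small: "\<exists>M. \<delta> ^ M < \<epsilon>" if "\<epsilon> > 0" for \<epsilon> using real_arch_pow_inv[OF that \<delta>(2)] .
  define z where "z j = Z (U j)" for j
  have za: "absv (z j $ q) = absv (z0 $ q)" for j q
    using Bu[OF U] by (simp add: z_def Z_def absv_mult absv_prod absv_powi)
  have LZ: "Lip \<delta> (absv (z0 $ q) * 1) (\<lambda>u. z0 $ q * (\<Prod>k\<in>I. u k powi (y k $ q)))" for q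
    using \<delta> by (intro Lip_mult Lip_const Lip_prod Lip_powi)
  have cz: "cauchy (\<lambda>j. z j $ q)" for q
    unfolding cauchy_def
  proof (intro conjI allI impI)
    show "\<exists>B>0. \<forall>k. absv (z k $ q) \<le> B" using z0 by (intro exI[of _ "absv (z0 $ q)"]) (simp add: za)
    fix \<epsilon> :: real assume "\<epsilon> > 0"
    then have "\<epsilon> / absv (z0 $ q) > 0" using z0 by simp
    then obtain M where M: "\<delta> ^ M < \<epsilon> / absv (z0 $ q)" using small by blast
    have "absv (z i $ q - z j $ q) < \<epsilon>" if "i \<ge> M" "j \<ge> M" for i j
    proof -
      have "absv (z i $ q - z j $ q) \<le> absv (z0 $ q) * 1 * \<delta> ^ M"
        using LZ[of q] U[of i] U[of j] far2[of _ M i j] that \<delta> unfolding Lip_def z_def Z_def by simp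
      also have "\<dots> < \<epsilon>" using M z0 by (simp add: pos_less_divide_eq mult.commute)
      finally show ?thesis .
    qed
    then show "\<exists>M. \<forall>i\<ge>M. \<forall>j\<ge>M. absv (z i $ q - z j $ q) < \<epsilon>" by blast
  qed
  \<comment> \<open>The value of \<open>F i\<close> at an iterate is \<open>N\<close> times the next
    step, so the iterates are approximate zeros.\<close>
  have Fz: "absv (leval (F i) (z j)) \<le> \<delta> ^ Suc j" if i: "i \<in> I" for i j
  proof -
    have "leval (F i) (z j) = of_nat N * (U (Suc j) i - U j i)"
      using nN by (simp add: US \<Phi>_def z_def)
    then show ?thesis using step i by (simp add: absv_mult N1)
  qed
  have "\<exists>P\<in>torus. (\<forall>q. absv (P $ q) = absv (z0 $ q)) \<and> (\<forall>f\<in>F ` I. leval f P = 0)"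
  proof (rule lift_approximate_zero[OF _ za cz])
    show "0 < absv (z0 $ q)" for q using z0 by simp
    fix f and \<epsilon> :: real assume f: "f \<in> F ` I" and \<epsilon>: "\<epsilon> > 0"
    obtain M where M: "\<delta> ^ M < \<epsilon>" using small[OF \<epsilon>] by blast
    show "\<forall>\<^sub>F k in sequentially. absv (leval f (z k)) < \<epsilon>"
      unfolding eventually_sequentially
    proof (intro exI[of _ M] allI impI)
      fix j assume "j \<ge> M"
      then have "\<delta> ^ Suc j \<le> \<delta> ^ M" using \<delta> by (intro power_decreasing) auto
      moreover obtain i where "i \<in> I" "f = F i" using f by blast
      ultimately show "absv (leval f (z j)) < \<epsilon>" using Fz[of i j] M by simp
    qed
  qed
  then obtain P where P: "P \<in> torus" "\<And>q. absv (P $ q) = absv (z0 $ q)" "\<forall>i\<in>I. leval (F i) P = 0" by auto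
  have "trop_pt val P = trop_pt val z0"
  proof (subst vec_eq_iff, intro allI)
    fix q
    have "vl (P $ q) = vl (z0 $ q)" using P z0 vl_eq_iff_absv[of "P $ q" "z0 $ q"] by simp
    then show "trop_pt val P $ q = trop_pt val z0 $ q" by (simp add: trop_pt_def vl_def)
  qed
  then show ?thesis using P by blast
qed

text \<open>Pairing the identity \<open>compl\<close> with \<open>d\<close> expresses
  \<open>D\<close> times \<open>d\<close> through the pairings with the \<open>v k\<close>, which
  vanish, and multiples of \<open>1\<close> and \<open>w\<close>.\<close>

lemma real_kernel:
  assumes "\<And>i. i \<in> I \<Longrightarrow> rvec (v i) \<bullet> d = 0"
  shows "\<exists>s t. d = s *\<^sub>R 1 + t *\<^sub>R rvec w"
proof -
  have *: "real_of_int D * d $ q = (rvec g \<bullet> d) + (rvec h \<bullet> d) * real_of_int (w $ q)" for q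
  proof -
    have "real_of_int D * d $ q = (\<Sum>p\<in>UNIV. real_of_int (if p = q then D else 0) * d $ p)"
      by (simp add: if_distrib if_distribR cong: if_cong)
    also have "\<dots> = (\<Sum>p\<in>UNIV. real_of_int ((\<Sum>k\<in>I. v k $ p * y k $ q) + g $ p + h $ p * w $ q) * d $ p)"
      by (simp only: compl)
    also have "\<dots> = (\<Sum>p\<in>UNIV. \<Sum>k\<in>I. real_of_int (v k $ p) * real_of_int (y k $ q) * d $ p) +
        (\<Sum>p\<in>UNIV. real_of_int (g $ p) * d $ p) + (\<Sum>p\<in>UNIV. real_of_int (h $ p) * real_of_int (w $ q) * d $ p)"
      by (simp only: of_int_add of_int_sum of_int_mult distrib_right sum.distrib sum_distrib_right)
    also have "(\<Sum>p\<in>UNIV. \<Sum>k\<in>I. real_of_int (v k $ p) * real_of_int (y k $ q) * d $ p) =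
        (\<Sum>k\<in>I. (rvec (v k) \<bullet> d) * real_of_int (y k $ q))"
      by (subst sum.swap) (simp add: inner_vec_def rvec_def sum_distrib_left sum_distrib_right mult_ac)
    also have "(\<Sum>p\<in>UNIV. real_of_int (g $ p) * d $ p) = rvec g \<bullet> d"
      by (simp add: inner_vec_def rvec_def)
    also have "(\<Sum>p\<in>UNIV. real_of_int (h $ p) * real_of_int (w $ q) * d $ p) = (rvec h \<bullet> d) * real_of_int (w $ q)"
      by (simp add: inner_vec_def rvec_def sum_distrib_left sum_distrib_right mult_ac)
    finally show ?thesis using assms by simp
  qed
  have "d = ((rvec g \<bullet> d) / D) *\<^sub>R 1 + ((rvec h \<bullet> d) / D) *\<^sub>R rvec w"
    using * D_pos by (simp add: vec_eq_iff rvec_def field_simps)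
  then show ?thesis by blast
qed

section \<open>Density of the liftable points of the edge\<close>

lemma rvec_vw: "i \<in> I \<Longrightarrow> rvec (v i) \<bullet> rvec w = 0"
proof -
  assume "i \<in> I"
  then have "real_of_int (\<Sum>p\<in>UNIV. v i $ p * w $ p) = 0" using vw by simp
  then show ?thesis by (simp add: inner_vec_def rvec_def)
qed

text \<open>Along the cocharacters \<open>y k\<close> the binomial system splits into separate
  equations for \<open>D\<close>-th powers, which are solved by taking roots.\<close>

lemma ex_binomial_zero:
  "\<exists>z\<in>torus. \<forall>i\<in>I. Poly_Mapping.lookup (F i) (v i) * mon z (v i) = -1"
proof -
  define N where "N = nat D"
  have N: "N > 0" "int N = D" using D_pos by (auto simp: N_def)
  have "\<exists>d. d ^ N = - inverse (Poly_Mapping.lookup (F i) (v i))" for i using ex_root N by blast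
  then obtain d where d: "\<And>i. d i ^ N = - inverse (Poly_Mapping.lookup (F i) (v i))" by metis
  have nz: "d i \<noteq> 0" if "i \<in> I" for i
    using d[of i] v_key[OF that] N by (metis in_keys_iff inverse_nonzero_iff_nonzero neg_equal_0_iff_equal power_0_left power_eq_0_iff)
  define z where "z = (\<chi> q. \<Prod>k\<in>I. d k powi (y k $ q))"
  have "z \<in> torus" unfolding torus_def z_def using fI nz by simp
  moreover have "Poly_Mapping.lookup (F i) (v i) * mon z (v i) = -1" if i: "i \<in> I" for i
  proof -
    have "mon z (v i) = (\<Prod>k\<in>I. d k powi (\<Sum>q\<in>UNIV. v i $ q * y k $ q))"
      unfolding z_def by (rule mon_prod_powi[OF nz])
    also have "\<dots> = (\<Prod>k\<in>I. if i = k then d k powi D else 1)" using vy i by (intro prod.cong) auto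
    also have "\<dots> = d i ^ N" using i fI N by (simp add: prod.delta power_int_def N_def)
    finally show ?thesis using d[of i] v_key[OF i] by (simp add: in_keys_iff)
  qed
  ultimately show ?thesis by blast
qed

lemma inner_pt_shift:
  assumes \<alpha>: "inner_pt \<alpha>"
  shows "\<exists>b>0. \<forall>s. \<bar>s\<bar> < b \<longrightarrow> inner_pt (\<alpha> + s *\<^sub>R rvec w)"
proof -
  have shift: "term_val val p (a + c *\<^sub>R 1 + t *\<^sub>R rvec w) m = term_val val p a m + t * (rvec m \<bullet> rvec w)"
    if "m \<in> char_lattice" for p a c t m
    using that by (simp add: term_val_vl inner_add_right rvec_char_lattice)
  have vcl: "v i \<in> char_lattice" if "i \<in> I" for i using v_sum[OF that] by (simp add: char_lattice_def)
  have kcl: "m \<in> char_lattice" if "i \<in> I" "m \<in> other_keys i" for i m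
    using that F_torus unfolding torus_functions_def other_keys_def by blast
  have "\<forall>\<^sub>F s in nhds 0. \<forall>i\<in>I. \<forall>m\<in>other_keys i. 0 < term_val val (F i) \<alpha> m + s * (rvec m \<bullet> rvec w)"
  proof (intro eventually_ball_finite fI ballI)
    fix i m assume im: "i \<in> I" "m \<in> other_keys i"
    have "((\<lambda>s. term_val val (F i) \<alpha> m + s * (rvec m \<bullet> rvec w)) \<longlongrightarrow> term_val val (F i) \<alpha> m + 0 * (rvec m \<bullet> rvec w)) (nhds 0)"
      by (intro tendsto_intros filterlim_ident)
    moreover have "0 < term_val val (F i) \<alpha> m" using \<alpha> im unfolding inner_pt_def by blast
    ultimately show "\<forall>\<^sub>F s in nhds 0. 0 < term_val val (F i) \<alpha> m + s * (rvec m \<bullet> rvec w)"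
      using order_tendstoD(1) by fastforce
  qed (auto simp: other_keys_def)
  then obtain b where b: "b > 0" "\<And>s. dist s 0 < b \<Longrightarrow> \<forall>i\<in>I. \<forall>m\<in>other_keys i. 0 < term_val val (F i) \<alpha> m + s * (rvec m \<bullet> rvec w)"
    unfolding eventually_nhds_metric by blast
  show ?thesis
  proof (intro exI[of _ b] conjI allI impI)
    fix s assume s: "\<bar>s\<bar> < b"
    show "inner_pt (\<alpha> + s *\<^sub>R rvec w)" unfolding inner_pt_def
    proof (intro ballI conjI)
      fix i assume i: "i \<in> I"
      show "term_val val (F i) (\<alpha> + s *\<^sub>R rvec w) (v i) = 0"
        using shift[OF vcl[OF i], of "F i" \<alpha> 0 s] \<alpha> i rvec_vw[OF i] unfolding inner_pt_def by simp
      show "0 < term_val val (F i) (\<alpha> + s *\<^sub>R rvec w) m" if "m \<in> other_keys i" for m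
        using shift[OF kcl[OF i that], of "F i" \<alpha> 0 s] b(2)[of s] s i that by simp
    qed
  qed (rule b(1))
qed

text \<open>A zero of the binomial parts tropicalizes to the affine plane of the edge. Multiplying
  its coordinates by \<open>\<mu>\<close> to the powers \<open>w $ q\<close> keeps it a zero and
  moves it along the edge by \<open>vl \<mu>\<close>; as values are dense, it can be brought close
  to \<open>\<alpha>\<close>, where \<open>lift_binomial_zero\<close> applies.\<close>

lemma points_dense:
  assumes \<alpha>: "inner_pt \<alpha>" and "e > 0"
  shows "\<exists>P\<in>torus. \<exists>s c. \<bar>s\<bar> < e \<and> trop_pt val P = \<alpha> + s *\<^sub>R rvec w + c *\<^sub>R 1 \<and>
    inner_pt (\<alpha> + s *\<^sub>R rvec w) \<and> (\<forall>i\<in>I. leval (F i) P = 0)"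
proof -
  obtain \<zeta> where \<zeta>: "\<zeta> \<in> torus" "\<And>i. i \<in> I \<Longrightarrow> Poly_Mapping.lookup (F i) (v i) * mon \<zeta> (v i) = -1"
    using ex_binomial_zero by blast
  have shift: "term_val val p (a + c *\<^sub>R 1 + t *\<^sub>R rvec w) m = term_val val p a m + t * (rvec m \<bullet> rvec w)"
    if "m \<in> char_lattice" for p a c t m
    using that by (simp add: term_val_vl inner_add_right rvec_char_lattice)
  have vcl: "v i \<in> char_lattice" if "i \<in> I" for i using v_sum[OF that] by (simp add: char_lattice_def)
  have kcl: "m \<in> char_lattice" if "i \<in> I" "m \<in> other_keys i" for i m
    using that F_torus unfolding torus_functions_def other_keys_def by blast
  have "rvec (v i) \<bullet> (\<alpha> - trop_pt val \<zeta>) = 0" if i: "i \<in> I" for i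
  proof -
    have c: "Poly_Mapping.lookup (F i) (v i) \<noteq> 0" using v_key[OF i] by (simp add: in_keys_iff)
    have "vl (-1) = 0" using vl_of_int[of "-1"] by simp
    then have "vl (Poly_Mapping.lookup (F i) (v i)) + rvec (v i) \<bullet> trop_pt val \<zeta> = 0"
      using \<zeta>(2)[OF i] c \<zeta>(1) vl_mult[of "Poly_Mapping.lookup (F i) (v i)" "mon \<zeta> (v i)"] by (simp add: vl_mon)
    moreover have "term_val val (F i) \<alpha> (v i) = 0" using \<alpha> i unfolding inner_pt_def by blast
    ultimately show ?thesis by (simp add: term_val_vl inner_diff_right)
  qed
  then obtain s t where st: "\<alpha> - trop_pt val \<zeta> = s *\<^sub>R 1 + t *\<^sub>R rvec w" using real_kernel by blast
  have "\<exists>b>0. \<forall>s. \<bar>s\<bar> < b \<longrightarrow> inner_pt (\<alpha> + s *\<^sub>R rvec w)" by (rule inner_pt_shift[OF \<alpha>])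
  then obtain b where b: "b > 0" "\<And>s. \<bar>s\<bar> < b \<Longrightarrow> inner_pt (\<alpha> + s *\<^sub>R rvec w)" by blast
  define b' where "b' = min b e"
  have b': "b' > 0" using b assms by (simp add: b'_def)
  obtain \<nu> where \<nu>: "\<nu> \<noteq> 0" "0 < vl \<nu>" "vl \<nu> < b'" using ex_vl_small[OF b'] by blast
  define m where "m = \<lfloor>t / vl \<nu>\<rfloor>"
  define \<mu> where "\<mu> = \<nu> powi m"
  have \<mu>: "\<mu> \<noteq> 0" "vl \<mu> = of_int m * vl \<nu>" using \<nu> by (auto simp: \<mu>_def vl_powi)
  have "of_int m \<le> t / vl \<nu>" "t / vl \<nu> < of_int m + 1" unfolding m_def by linarith+
  then have "of_int m * vl \<nu> \<le> t" "t < of_int m * vl \<nu> + vl \<nu>" using \<nu> by (auto simp: field_simps)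
  then have close: "\<bar>vl \<mu> - t\<bar> < b'" using \<mu> \<nu> by simp
  define z where "z = (\<chi> q. \<zeta> $ q * \<mu> powi (w $ q))"
  have z: "z \<in> torus" unfolding torus_def z_def using \<zeta>(1) \<mu> by simp
  have tz: "trop_pt val z = \<alpha> + (vl \<mu> - t) *\<^sub>R rvec w + (- s) *\<^sub>R 1"
  proof -
    have "trop_pt val z $ q = trop_pt val \<zeta> $ q + vl \<mu> * real_of_int (w $ q)" for q
    proof -
      have "vl (\<zeta> $ q * \<mu> powi (w $ q)) = vl (\<zeta> $ q) + vl \<mu> * real_of_int (w $ q)"
        using \<zeta>(1) \<mu> by (simp add: vl_mult vl_powi)
      then show ?thesis by (simp add: trop_pt_def z_def vl_def)
    qed
    then have "trop_pt val z = trop_pt val \<zeta> + vl \<mu> *\<^sub>R rvec w" by (simp add: vec_eq_iff rvec_def)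
    then show ?thesis using st by (simp add: algebra_simps)
  qed
  have inner: "inner_pt (\<alpha> + (vl \<mu> - t) *\<^sub>R rvec w)" using b(2) close by (simp add: b'_def)
  have "inner_pt (trop_pt val z)" unfolding inner_pt_def tz
  proof (intro ballI conjI)
    fix i assume i: "i \<in> I"
    have *: "term_val val (F i) (\<alpha> + (vl \<mu> - t) *\<^sub>R rvec w + (- s) *\<^sub>R 1) m = term_val val (F i) (\<alpha> + (vl \<mu> - t) *\<^sub>R rvec w) m"
      if "m \<in> char_lattice" for m using shift[OF that, of "F i" "\<alpha> + (vl \<mu> - t) *\<^sub>R rvec w" "- s" 0] by simp
    show "term_val val (F i) (\<alpha> + (vl \<mu> - t) *\<^sub>R rvec w + (- s) *\<^sub>R 1) (v i) = 0"
      unfolding *[OF vcl[OF i]] using inner i unfolding inner_pt_def by blast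
    show "0 < term_val val (F i) (\<alpha> + (vl \<mu> - t) *\<^sub>R rvec w + (- s) *\<^sub>R 1) m" if "m \<in> other_keys i" for m
      unfolding *[OF kcl[OF i that]] using inner i that unfolding inner_pt_def by blast
  qed
  moreover have "Poly_Mapping.lookup (F i) (v i) * mon z (v i) = -1" if i: "i \<in> I" for i
  proof -
    have "mon (\<chi> q. \<mu> powi (w $ q)) (v i) = \<mu> powi (\<Sum>q\<in>UNIV. v i $ q * w $ q)"
    proof -
      have pow: "\<mu> powi (\<Sum>q\<in>Q. a q) = (\<Prod>q\<in>Q. \<mu> powi a q)" for a :: "'n \<Rightarrow> int" and Q
        using \<mu> by (induction Q rule: infinite_finite_induct) (auto simp: power_int_add)
      show ?thesis unfolding pow mon_def by (simp add: mult.commute flip: power_int_mult)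
    qed
    then have "mon z (v i) = mon \<zeta> (v i)"
      using mon_times[of \<zeta> "\<chi> q. \<mu> powi (w $ q)" "v i"] vw[OF i] by (simp add: z_def)
    then show ?thesis using \<zeta>(2)[OF i] by simp
  qed
  ultimately obtain P where P: "P \<in> torus" "trop_pt val P = trop_pt val z" "\<forall>i\<in>I. leval (F i) P = 0"
    using lift_binomial_zero[OF z] by blast
  show ?thesis
  proof (intro bexI[OF _ P(1)] exI conjI)
    show "\<bar>vl \<mu> - t\<bar> < e" using close by (simp add: b'_def)
    show "trop_pt val P = \<alpha> + (vl \<mu> - t) *\<^sub>R rvec w + (- s) *\<^sub>R 1" using P(2) tz by simp
  qed (use inner P in auto)
qed

end

section \<open>Tangent lines over an edge\<close>

context tropical_edge
begin

abbreviation kw :: "'k ^ 'n" where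
  "kw \<equiv> \<chi> q. of_int (w $ q)"

lemma idot_1: "idot m 1 = of_int (\<Sum>p\<in>UNIV. m $ p)"
  by (simp add: idot_def)

lemma compl_idot: "of_int D * \<eta> $ q = (\<Sum>k\<in>I. idot (v k) \<eta> * of_int (y k $ q)) + idot g \<eta> + idot h \<eta> * of_int (w $ q)"
  for \<eta> :: "'k ^ 'n"
proof -
  have "of_int D * \<eta> $ q = (\<Sum>p\<in>UNIV. of_int (if p = q then D else 0) * \<eta> $ p)"
    by (simp add: if_distrib if_distribR cong: if_cong)
  also have "\<dots> = (\<Sum>p\<in>UNIV. of_int ((\<Sum>k\<in>I. v k $ p * y k $ q) + g $ p + h $ p * w $ q) * \<eta> $ p)"
    by (simp only: compl)
  also have "\<dots> = (\<Sum>p\<in>UNIV. \<Sum>k\<in>I. of_int (v k $ p) * of_int (y k $ q) * \<eta> $ p) +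
      (\<Sum>p\<in>UNIV. of_int (g $ p) * \<eta> $ p) + (\<Sum>p\<in>UNIV. of_int (h $ p) * of_int (w $ q) * \<eta> $ p)"
    by (simp only: of_int_add of_int_sum of_int_mult distrib_right sum.distrib sum_distrib_right)
  also have "(\<Sum>p\<in>UNIV. \<Sum>k\<in>I. of_int (v k $ p) * of_int (y k $ q) * \<eta> $ p) =
      (\<Sum>k\<in>I. idot (v k) \<eta> * of_int (y k $ q))"
    by (subst sum.swap) (simp add: idot_def sum_distrib_left sum_distrib_right mult_ac)
  also have "(\<Sum>p\<in>UNIV. of_int (g $ p) * \<eta> $ p) = idot g \<eta>"
    by (simp add: idot_def)
  also have "(\<Sum>p\<in>UNIV. of_int (h $ p) * of_int (w $ q) * \<eta> $ p) = idot h \<eta> * of_int (w $ q)"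
    by (simp add: idot_def sum_distrib_left sum_distrib_right mult_ac)
  finally show ?thesis .
qed

text \<open>For the inclusion from right to left, pairing \<open>compl\<close> in its second index
  with \<open>l\<close> removes \<open>g\<close> and \<open>h\<close> and leaves \<open>l\<close> as
  a combination of the \<open>v k\<close> with coefficients \<open>idot (y k) l / D\<close>.\<close>

lemma row_span_eq: "row_span I v = {l :: 'k ^ 'n. idot 1 l = 0 \<and> idot w l = 0}"
proof (intro equalityI subsetI)
  fix l :: "'k ^ 'n"
  assume "l \<in> row_span I v"
  then show "l \<in> {l. idot 1 l = 0 \<and> idot w l = 0}"
    unfolding row_span_def
  proof (induction rule: vec.span_induct_alt)
    case base
    then show ?case by (simp add: idot_def)
  next
    case (step c x y)
    then obtain i where i: "i \<in> I" "x = (\<chi> j. of_int (v i $ j))" by blast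
    have "idot 1 x = (of_int (\<Sum>p\<in>UNIV. v i $ p) :: 'k)" by (simp add: i idot_def)
    moreover have "idot w x = (of_int (\<Sum>p\<in>UNIV. v i $ p * w $ p) :: 'k)" by (simp add: i idot_def mult.commute)
    ultimately show ?case using step by (simp add: idot_add_right idot_scale_right v_sum[OF i(1)] vw[OF i(1)])
  qed
next
  fix l :: "'k ^ 'n"
  assume l: "l \<in> {l. idot 1 l = 0 \<and> idot w l = 0}"
  have Dk: "(of_int D :: 'k) \<noteq> 0" using D_pos by simp
  have "l = (\<Sum>k\<in>I. (idot (y k) l / of_int D) *s (\<chi> j. of_int (v k $ j)))"
  proof (subst vec_eq_iff, intro allI)
    fix p
    have "of_int D * l $ p = (\<Sum>q\<in>UNIV. of_int (if p = q then D else 0) * l $ q)"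
      by (simp add: if_distrib if_distribR cong: if_cong)
    also have "\<dots> = (\<Sum>q\<in>UNIV. of_int ((\<Sum>k\<in>I. v k $ p * y k $ q) + g $ p + h $ p * w $ q) * l $ q)"
      by (simp only: compl)
    also have "\<dots> = (\<Sum>q\<in>UNIV. \<Sum>k\<in>I. of_int (v k $ p) * of_int (y k $ q) * l $ q) +
        (\<Sum>q\<in>UNIV. of_int (g $ p) * l $ q) + (\<Sum>q\<in>UNIV. of_int (h $ p) * of_int (w $ q) * l $ q)"
      by (simp only: of_int_add of_int_sum of_int_mult distrib_right sum.distrib sum_distrib_right)
    also have "(\<Sum>q\<in>UNIV. \<Sum>k\<in>I. of_int (v k $ p) * of_int (y k $ q) * l $ q) =
        (\<Sum>k\<in>I. idot (y k) l * of_int (v k $ p))"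
      by (subst sum.swap) (simp add: idot_def sum_distrib_left sum_distrib_right mult_ac)
    also have "(\<Sum>q\<in>UNIV. of_int (g $ p) * l $ q) = of_int (g $ p) * idot 1 l"
      by (simp add: idot_def sum_distrib_left)
    also have "(\<Sum>q\<in>UNIV. of_int (h $ p) * of_int (w $ q) * l $ q) = of_int (h $ p) * idot w l"
      by (simp add: idot_def sum_distrib_left mult_ac)
    finally have "of_int D * l $ p = (\<Sum>k\<in>I. idot (y k) l * of_int (v k $ p))" using l by simp
    then have "l $ p = (\<Sum>k\<in>I. idot (y k) l * of_int (v k $ p)) / of_int D"
      using Dk by (simp add: eq_divide_eq mult.commute)
    then show "l $ p = (\<Sum>k\<in>I. (idot (y k) l / of_int D) *s (\<chi> j. of_int (v k $ j))) $ p"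
      by (simp add: sum_divide_distrib)
  qed
  also have "\<dots> \<in> row_span I v"
    unfolding row_span_def by (intro vec.span_sum vec.span_scale vec.span_base imageI)
  finally show "l \<in> row_span I v" .
qed

lemma orth_compl_eq: "orth_compl (row_span I v) = {x. \<exists>s t. x = (\<chi> q. s + t * (of_int (w $ q) :: 'k))}"
proof (intro equalityI subsetI)
  fix x :: "'k ^ 'n"
  assume x: "x \<in> orth_compl (row_span I v)"
  have "idot (v k) x = 0" if "k \<in> I" for k
  proof -
    have "(\<chi> j. of_int (v k $ j)) \<in> (row_span I v :: ('k ^ 'n) set)"
      unfolding row_span_def using that by (intro vec.span_base imageI)
    then have "(\<Sum>j\<in>UNIV. (\<chi> j. of_int (v k $ j)) $ j * x $ j) = 0" using x unfolding orth_compl_def by blast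
    then show ?thesis by (simp add: idot_def)
  qed
  then have "of_int D * x $ q = idot g x + idot h x * of_int (w $ q)" for q using compl_idot[of x q] by simp
  moreover have Dk: "(of_int D :: 'k) \<noteq> 0" using D_pos by simp
  ultimately have "x = (\<chi> q. idot g x / of_int D + idot h x / of_int D * of_int (w $ q))"
    by (simp add: vec_eq_iff field_simps)
  then show "x \<in> {x. \<exists>s t. x = (\<chi> q. s + t * of_int (w $ q))}" by blast
next
  fix x :: "'k ^ 'n"
  assume "x \<in> {x. \<exists>s t. x = (\<chi> q. s + t * of_int (w $ q))}"
  then obtain s t where x: "x = (\<chi> q. s + t * of_int (w $ q))" by blast
  have "(\<Sum>j\<in>UNIV. l $ j * x $ j) = 0" if l: "l \<in> row_span I v" for l
  proof -
    have "(\<Sum>j\<in>UNIV. l $ j * x $ j) = s * idot 1 l + t * idot w l"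
      by (simp add: x idot_def distrib_left sum.distrib sum_distrib_left mult_ac)
    then show ?thesis using l unfolding row_span_eq by simp
  qed
  then show "x \<in> orth_compl (row_span I v)" unfolding orth_compl_def by blast
qed

text \<open>Over an inner point, the logarithmic derivatives of the \<open>F i\<close> are small perturbations of the
  \<open>v i\<close> up to units, so that their kernel is a small perturbation of the span of \<open>1\<close> and \<open>w\<close>.\<close>

lemma tangent_directions:
  assumes P: "P \<in> torus" and \<alpha>: "inner_pt (trop_pt val P)"
  shows "\<exists>\<eta>. (\<forall>q. absv (\<eta> $ q - of_int (w $ q)) < 1) \<and>
    {\<zeta>. \<forall>i\<in>I. Dlog P \<zeta> (F i) = 0} = {\<zeta>. \<exists>a b. \<zeta> = (\<chi> q. a + b * \<eta> $ q)}"
proof -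
  define c where "c i m = Poly_Mapping.lookup (F i) m * mon P m" for i m
  have cv: "absv (c i (v i)) = 1" if i: "i \<in> I" for i
  proof -
    have "Poly_Mapping.lookup (F i) (v i) \<noteq> 0" using v_key[OF i] by (simp add: in_keys_iff)
    moreover have "term_val val (F i) (trop_pt val P) (v i) = 0" using \<alpha> i unfolding inner_pt_def by blast
    ultimately show ?thesis using P by (simp add: c_def absv_def vl_mult vl_mon term_val_vl)
  qed
  have c1: "absv (c i m) < 1" if "i \<in> I" "m \<in> other_keys i" for i m
  proof -
    have m: "Poly_Mapping.lookup (F i) m \<noteq> 0" using that(2) by (simp add: other_keys_def in_keys_iff)
    have "0 < term_val val (F i) (trop_pt val P) m" using \<alpha> that unfolding inner_pt_def by blast
    then have "0 < vl (c i m)" unfolding c_def term_val_vl using m P by (simp add: vl_mult vl_mon)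
    then show ?thesis using m P by (simp add: absv_def c_def)
  qed
  \<comment> \<open>Divided by the coefficient \<open>c i (v i)\<close> of absolute value 1, the
    derivative of \<open>F i\<close> is \<open>idot (v i)\<close> plus this form, whose coefficients
    have absolute value less than 1.\<close>
  define ep where "ep i \<eta> = (\<Sum>m\<in>other_keys i. c i m / c i (v i) * idot m \<eta>)" for i and \<eta> :: "'k ^ 'n"
  have cnz: "c i (v i) \<noteq> 0" if "i \<in> I" for i using cv[OF that] by auto
  have Dl: "Dlog P \<eta> (F i) = c i (v i) * (idot (v i) \<eta> + ep i \<eta>)" if i: "i \<in> I" for i \<eta>
    unfolding Dlog_def lin_F[OF i] using cnz[OF i]
    by (simp add: c_def ep_def distrib_left sum_distrib_left mult.assoc)
  have ker: "{\<zeta>. \<forall>i\<in>I. Dlog P \<zeta> (F i) = 0} = {\<zeta>. \<forall>i\<in>I. idot (v i) \<zeta> + ep i \<zeta> = 0}"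
    using Dl cnz by auto
  have idot_le: "absv (idot m \<eta>) \<le> M" if "\<And>q. absv (\<eta> $ q) \<le> M" "0 \<le> M" for m \<eta> M
    unfolding idot_def
  proof (rule absv_sum_le)
    show "absv (of_int (m $ q) * \<eta> $ q) \<le> M" for q
      using mult_mono[OF absv_of_int_le that(1)[of q]] by (simp add: absv_mult)
  qed (rule that)
  have ep_less: "absv (ep i \<eta>) < M" if "i \<in> I" "\<And>q. absv (\<eta> $ q) \<le> M" "0 < M" for i \<eta> M
    unfolding ep_def
  proof (rule absv_sum_less)
    fix m assume m: "m \<in> other_keys i"
    have "absv (c i m / c i (v i) * idot m \<eta>) = absv (c i m) * absv (idot m \<eta>)"
      by (simp add: absv_mult absv_divide cv[OF that(1)])
    also have "\<dots> \<le> absv (c i m) * M" using idot_le[OF that(2)] that(3) by (intro mult_left_mono) auto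
    also have "\<dots> < M" using c1[OF that(1) m] that(3) by simp
    finally show "absv (c i m / c i (v i) * idot m \<eta>) < M" .
  qed (rule that)
  define err where "err \<eta> q = (\<Sum>k\<in>I. ep k \<eta> * of_int (y k $ q))" for \<eta> q
  have err_less: "absv (err \<eta> q) < M" if "\<And>q. absv (\<eta> $ q) \<le> M" "0 < M" for \<eta> q M
    unfolding err_def
  proof (rule absv_sum_less)
    fix k assume k: "k \<in> I"
    have "absv (ep k \<eta> * of_int (y k $ q)) \<le> absv (ep k \<eta>) * 1"
      unfolding absv_mult by (intro mult_left_mono absv_of_int_le) auto
    also have "\<dots> < M" using ep_less[OF k that] by simp
    finally show "absv (ep k \<eta> * of_int (y k $ q)) < M" .
  qed (rule that)
  \<comment> \<open>A perturbation of multiplication by \<open>D\<close> for which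
    \<open>compl\<close> holds with the perturbed forms in place of \<open>idot (v k)\<close>. It
    thus maps their common kernel into the span of \<open>1\<close> and \<open>w\<close>, and the
    error is too small to destroy injectivity.\<close>
  define \<Psi> where "\<Psi> \<eta> = (\<chi> q. of_int D * \<eta> $ q + err \<eta> q)" for \<eta>
  have \<Psi>: "\<Psi> \<eta> $ q = (\<Sum>k\<in>I. (idot (v k) \<eta> + ep k \<eta>) * of_int (y k $ q)) + idot g \<eta> + idot h \<eta> * of_int (w $ q)" for \<eta> q
    by (simp add: \<Psi>_def err_def compl_idot distrib_right sum.distrib algebra_simps)
  have D1: "absv (of_int D) = 1" using D_pos by (simp add: absv_of_int)
  have lin\<Psi>: "Vector_Spaces.linear (*s) (*s) \<Psi>"
  proof (rule Vector_Spaces.linear.intro[OF vec.vector_space_axioms vec.vector_space_axioms], unfold_locales)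
    show "\<Psi> (a + b) = \<Psi> a + \<Psi> b" for a b
      by (simp add: \<Psi>_def vec_eq_iff err_def ep_def idot_add_right distrib_left distrib_right sum.distrib)
    show "\<Psi> (r *s a) = r *s \<Psi> a" for r a
      by (simp add: \<Psi>_def vec_eq_iff err_def ep_def idot_scale_right distrib_left sum_distrib_left sum_distrib_right mult_ac)
  qed
  have small: "\<eta> = 0" if "\<Psi> \<eta> = 0" for \<eta>
  proof (rule ccontr)
    assume "\<eta> \<noteq> 0"
    then obtain q0 where q0: "\<eta> $ q0 \<noteq> 0" by (auto simp: vec_eq_iff)
    define M where "M = Max (range (\<lambda>q. absv (\<eta> $ q)))"
    have le: "absv (\<eta> $ q) \<le> M" for q unfolding M_def by (intro Max_ge) auto
    have M: "0 < M" using le[of q0] q0 by (meson absv_pos_iff less_le_trans)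
    have "M \<in> range (\<lambda>q. absv (\<eta> $ q))" unfolding M_def by (intro Max_in) auto
    then obtain q where q: "M = absv (\<eta> $ q)" by blast
    have "of_int D * \<eta> $ q + err \<eta> q = 0" using that by (simp add: \<Psi>_def vec_eq_iff)
    then have "of_int D * \<eta> $ q = - err \<eta> q" by (simp add: eq_neg_iff_add_eq_0)
    then have "absv (of_int D * \<eta> $ q) = absv (err \<eta> q)" by simp
    then show False using err_less[OF le M, of q] q by (simp add: absv_mult D1)
  qed
  have \<Psi>_diff: "\<Psi> (a - b) = \<Psi> a - \<Psi> b" for a b
    by (simp add: \<Psi>_def vec_eq_iff err_def ep_def idot_diff_right right_diff_distrib left_diff_distrib sum_subtractf)
  have "inj \<Psi>"
  proof (rule injI)
    fix a b assume "\<Psi> a = \<Psi> b"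
    then have "\<Psi> (a - b) = 0" using \<Psi>_diff by simp
    then have "a - b = 0" by (rule small)
    then show "a = b" by simp
  qed
  then have "surj \<Psi>" using vec.linear_inj_imp_surj[OF lin\<Psi>] by blast
  then obtain \<eta> where \<eta>: "\<Psi> \<eta> = (\<chi> q. of_int D * of_int (w $ q))" by (metis surjD)
  have near: "absv (\<eta> $ q - of_int (w $ q)) < 1" for q
  proof -
    define M where "M = Max (range (\<lambda>q. absv (\<eta> $ q)))"
    have le: "absv (\<eta> $ q) \<le> M" for q unfolding M_def by (intro Max_ge) auto
    have eq: "of_int D * (\<eta> $ q - of_int (w $ q)) = - err \<eta> q" for q
      using \<eta> by (simp add: \<Psi>_def vec_eq_iff right_diff_distrib) (metis add_diff_cancel_left' minus_diff_eq)
    have d: "absv (\<eta> $ q - of_int (w $ q)) = absv (err \<eta> q)" for q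
      using arg_cong[OF eq[of q], of absv] by (simp add: absv_mult D1)
    \<comment> \<open>If the largest coordinate of \<open>\<eta>\<close> had size above 1, both
      \<open>w\<close> and \<open>\<eta> - w\<close> would be smaller there, although they add up to
      \<open>\<eta>\<close>.\<close>
    have "M \<le> 1"
    proof (rule ccontr)
      assume M: "\<not> M \<le> 1"
      have "M \<in> range (\<lambda>q. absv (\<eta> $ q))" unfolding M_def by (intro Max_in) auto
      then obtain q where q: "M = absv (\<eta> $ q)" by blast
      have "absv (\<eta> $ q - of_int (w $ q)) < M" unfolding d using M by (intro err_less le) auto
      moreover have "absv (of_int (w $ q)) < M" using absv_of_int_le[of "w $ q"] M by simp
      ultimately have "absv ((\<eta> $ q - of_int (w $ q)) + of_int (w $ q)) < M" by (rule absv_add_less)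
      then show False using q by simp
    qed
    then have "absv (\<eta> $ q) \<le> 1" for q using le order_trans by blast
    then show ?thesis unfolding d by (intro err_less) auto
  qed
  \<comment> \<open>Pairing with \<open>v i\<close> recovers the perturbed form from
    \<open>\<Psi>\<close>, because \<open>v i\<close> is dual to the \<open>y k\<close> and
    annihilates \<open>1\<close> and \<open>w\<close>.\<close>
  have contract: "(\<Sum>q\<in>UNIV. of_int (v i $ q) * \<Psi> \<zeta> $ q) = of_int D * (idot (v i) \<zeta> + ep i \<zeta>)" if i: "i \<in> I" for i \<zeta>
  proof -
    have "(\<Sum>q\<in>UNIV. of_int (v i $ q) * \<Psi> \<zeta> $ q) =
      (\<Sum>q\<in>UNIV. \<Sum>k\<in>I. (idot (v k) \<zeta> + ep k \<zeta>) * (of_int (v i $ q) * of_int (y k $ q))) +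
      (\<Sum>q\<in>UNIV. of_int (v i $ q)) * idot g \<zeta> + idot h \<zeta> * (\<Sum>q\<in>UNIV. of_int (v i $ q) * of_int (w $ q))"
      unfolding \<Psi> by (simp add: distrib_left sum.distrib sum_distrib_left sum_distrib_right mult_ac)
    also have "(\<Sum>q\<in>UNIV. \<Sum>k\<in>I. (idot (v k) \<zeta> + ep k \<zeta>) * (of_int (v i $ q) * of_int (y k $ q))) =
      (\<Sum>k\<in>I. (idot (v k) \<zeta> + ep k \<zeta>) * of_int (\<Sum>q\<in>UNIV. v i $ q * y k $ q))"
      by (subst sum.swap) (simp add: sum_distrib_left)
    also have "\<dots> = (\<Sum>k\<in>I. if i = k then (idot (v k) \<zeta> + ep k \<zeta>) * of_int D else 0)"
      using vy i by (intro sum.cong) auto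
    also have "\<dots> = of_int D * (idot (v i) \<zeta> + ep i \<zeta>)" using i fI by (simp add: mult.commute)
    also have "(\<Sum>q\<in>UNIV. of_int (v i $ q)) = (of_int (\<Sum>q\<in>UNIV. v i $ q) :: 'k)" by simp
    also have "(\<Sum>q\<in>UNIV. of_int (v i $ q) * of_int (w $ q)) = (of_int (\<Sum>q\<in>UNIV. v i $ q * w $ q) :: 'k)" by simp
    finally show ?thesis by (simp only: v_sum[OF i] vw[OF i]) simp
  qed
  have Dk: "(of_int D :: 'k) \<noteq> 0" using D_pos by simp
  have \<eta>ker: "idot (v i) \<eta> + ep i \<eta> = 0" if i: "i \<in> I" for i
  proof -
    have "(\<Sum>q\<in>UNIV. of_int (v i $ q) * \<Psi> \<eta> $ q) = of_int D * of_int (\<Sum>q\<in>UNIV. v i $ q * w $ q)"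
      by (simp add: \<eta> sum_distrib_left mult_ac)
    then show ?thesis using contract[OF i, of \<eta>] vw[OF i] Dk by simp
  qed
  \<comment> \<open>Exponents of total degree 0 kill the all-ones vector, which corresponds to
    \<open>P\<close> as a vector of its own tangent space.\<close>
  have m1: "idot m (1 :: 'k ^ 'n) = 0" if "i \<in> I" "m \<in> Poly_Mapping.keys (F i)" for i m
    using torus_functionsD[OF F_torus that(2)] that(1) by (simp add: idot_1)
  have ep1: "ep i 1 = 0" if "i \<in> I" for i
    unfolding ep_def using m1[OF that] by (intro sum.neutral) (auto simp: other_keys_def)
  have v1: "idot (v i) (1 :: 'k ^ 'n) = 0" if "i \<in> I" for i using m1[OF that v_key[OF that]] .
  have ep_add: "ep i (a + b) = ep i a + ep i b" for i a b
    by (simp add: ep_def idot_add_right distrib_left sum.distrib)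
  have ep_scale: "ep i (r *s b) = r * ep i b" for i r b
    by (simp add: ep_def idot_scale_right sum_distrib_left mult_ac)
  have form: "(\<chi> q. a + b * \<eta> $ q) = a *s 1 + b *s \<eta>" for a b by (simp add: vec_eq_iff)
  have \<Psi>1: "\<Psi> 1 = (\<chi> q. of_int D)"
    using ep1 by (simp add: \<Psi>_def vec_eq_iff err_def)
  have "{\<zeta>. \<forall>i\<in>I. idot (v i) \<zeta> + ep i \<zeta> = 0} = {\<zeta>. \<exists>a b. \<zeta> = (\<chi> q. a + b * \<eta> $ q)}"
  proof (intro equalityI subsetI)
    fix \<zeta> assume "\<zeta> \<in> {\<zeta>. \<forall>i\<in>I. idot (v i) \<zeta> + ep i \<zeta> = 0}"
    then have \<zeta>: "\<Psi> \<zeta> $ q = idot g \<zeta> + idot h \<zeta> * of_int (w $ q)" for q by (simp add: \<Psi>)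
    define a b where "a = idot g \<zeta> / of_int D" and "b = idot h \<zeta> / of_int D"
    have "\<Psi> (a *s 1 + b *s \<eta>) = a *s \<Psi> 1 + b *s \<Psi> \<eta>"
      using lin\<Psi> by (simp add: Vector_Spaces.linear_iff)
    also have "\<dots> = \<Psi> \<zeta>" using Dk by (simp add: \<Psi>1 \<eta> vec_eq_iff \<zeta> a_def b_def)
    finally have "a *s 1 + b *s \<eta> = \<zeta>" using \<open>inj \<Psi>\<close> by (simp add: inj_eq)
    then show "\<zeta> \<in> {\<zeta>. \<exists>a b. \<zeta> = (\<chi> q. a + b * \<eta> $ q)}" unfolding form by blast
  next
    fix \<zeta> assume "\<zeta> \<in> {\<zeta>. \<exists>a b. \<zeta> = (\<chi> q. a + b * \<eta> $ q)}"
    then obtain a b where \<zeta>: "\<zeta> = a *s 1 + b *s \<eta>" unfolding form by blast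
    have "idot (v i) \<zeta> + ep i \<zeta> = b * (idot (v i) \<eta> + ep i \<eta>)" if i: "i \<in> I" for i
      unfolding \<zeta> ep_add ep_scale idot_add_right idot_scale_right using ep1[OF i] v1[OF i]
      by (simp add: distrib_left)
    then show "\<zeta> \<in> {\<zeta>. \<forall>i\<in>I. idot (v i) \<zeta> + ep i \<zeta> = 0}" using \<eta>ker by simp
  qed
  then show ?thesis unfolding ker using near by blast
qed

end

section \<open>Closedness of sums of polyhedra\<close>

text \<open>Inequalities with positive \<open>q\<close> bound \<open>t\<close> from below and those
  with negative \<open>q\<close> from above. The products compare every lower bound with every upper
  bound without dividing.\<close>

lemma fourier_motzkin:
  fixes K :: "(real \<times> real) set"
  assumes "finite K"
  shows "(\<exists>t. \<forall>(b, q)\<in>K. 0 \<le> b + t * q) \<longleftrightarrow>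
    (\<forall>(b, q)\<in>K. q = 0 \<longrightarrow> 0 \<le> b) \<and> (\<forall>(b, q)\<in>K. \<forall>(b', q')\<in>K. 0 < q \<longrightarrow> q' < 0 \<longrightarrow> 0 \<le> b * (- q') + b' * q)"
    (is "?L \<longleftrightarrow> ?R")
proof
  assume ?L
  then obtain t where t: "\<And>b q. (b, q) \<in> K \<Longrightarrow> 0 \<le> b + t * q" by blast
  have "0 \<le> b * (- q') + b' * q" if "(b, q) \<in> K" "(b', q') \<in> K" "0 < q" "q' < 0" for b q b' q'
  proof -
    have "0 \<le> (b + t * q) * (- q') + (b' + t * q') * q"
      using that(3,4) by (intro add_nonneg_nonneg mult_nonneg_nonneg t[OF that(1)] t[OF that(2)]) auto
    then show ?thesis by (simp add: algebra_simps)
  qed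
  moreover have "0 \<le> b" if "(b, q) \<in> K" "q = 0" for b q using t[OF that(1)] that(2) by simp
  ultimately show ?R by blast
next
  assume R: ?R
  then have R0: "\<And>b q. (b, q) \<in> K \<Longrightarrow> q = 0 \<Longrightarrow> 0 \<le> b"
    and R1: "\<And>b q b' q'. (b, q) \<in> K \<Longrightarrow> (b', q') \<in> K \<Longrightarrow> 0 < q \<Longrightarrow> q' < 0 \<Longrightarrow> 0 \<le> b * (- q') + b' * q"
    by blast+
  define lo where "lo = {- b / q | b q. (b, q) \<in> K \<and> 0 < q}"
  define up where "up = {- b / q | b q. (b, q) \<in> K \<and> q < 0}"
  have "lo \<subseteq> (\<lambda>(b, q). - b / q) ` K" "up \<subseteq> (\<lambda>(b, q). - b / q) ` K"
    unfolding lo_def up_def by force+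
  then have fin: "finite lo" "finite up" using finite_subset finite_imageI[OF assms] by blast+
  have lu: "x \<le> z" if xz: "x \<in> lo" "z \<in> up" for x z
  proof -
    obtain b q b' q' where *: "(b, q) \<in> K" "0 < q" "x = - b / q" "(b', q') \<in> K" "q' < 0" "z = - b' / q'"
      using xz unfolding lo_def up_def by blast
    have "- b * (- q') \<le> b' * q" using R1[OF *(1,4,2,5)] by linarith
    then have "- b \<le> b' * q / (- q')" using *(5) pos_le_divide_eq[of "- q'" "- b" "b' * q"] by simp
    also have "\<dots> = (- b' / q') * q" by simp
    finally show ?thesis unfolding *(3,6) using *(2) by (simp only: pos_divide_le_eq)
  qed
  obtain t where t: "\<And>x. x \<in> lo \<Longrightarrow> x \<le> t" "\<And>z. z \<in> up \<Longrightarrow> t \<le> z"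
  proof (cases "lo = {}")
    case True
    show thesis
    proof (cases "up = {}")
      case True
      then show thesis using that \<open>lo = {}\<close> by blast
    next
      case False
      then show thesis using that[of "Min up"] \<open>lo = {}\<close> fin by simp
    qed
  next
    case False
    then have "Max lo \<in> lo" using fin by simp
    then show thesis using that[of "Max lo"] fin lu by simp
  qed
  have "0 \<le> b + t * q" if K: "(b, q) \<in> K" for b q
  proof -
    consider "q = 0" | "0 < q" | "q < 0" by linarith
    then show ?thesis
    proof cases
      case 1
      then show ?thesis using R0[OF K] by simp
    next
      case 2
      then have "- b / q \<in> lo" using K unfolding lo_def by blast
      then have "- b / q \<le> t" by (rule t)
      then have "- b \<le> t * q" using 2 by (simp only: pos_divide_le_eq)
      then show ?thesis by simp
    next
      case 3
      then have "- b / q \<in> up" using K unfolding up_def by blast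
      then have "t \<le> - b / q" by (rule t)
      then have "- b \<le> t * q" using 3 by (simp only: neg_le_divide_eq)
      then show ?thesis by simp
    qed
  qed
  then show ?L by blast
qed

text \<open>Projecting a closed set along an unbounded parameter need not give a closed set. Here it
  does, because elimination leaves finitely many weak inequalities between continuous
  functions.\<close>

lemma closed_elimination:
  fixes K :: "(('a::topological_space \<Rightarrow> real) \<times> real) set"
  assumes K: "finite K" and cont: "\<And>b q. (b, q) \<in> K \<Longrightarrow> continuous_on UNIV b"
  shows "closed {\<gamma>. \<exists>t. \<forall>(b, q)\<in>K. 0 \<le> b \<gamma> + t * q}"
proof -
  have "(\<exists>t. \<forall>(b, q)\<in>K. 0 \<le> b \<gamma> + t * q) \<longleftrightarrow> (\<forall>(b, q)\<in>K. q = 0 \<longrightarrow> 0 \<le> b \<gamma>) \<and>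
    (\<forall>(b, q)\<in>K. \<forall>(b', q')\<in>K. 0 < q \<longrightarrow> q' < 0 \<longrightarrow> 0 \<le> b \<gamma> * (- q') + b' \<gamma> * q)" for \<gamma>
    using fourier_motzkin[of "(\<lambda>(b, q). (b \<gamma>, q)) ` K"] K by (simp add: case_prod_unfold)
  then have "{\<gamma>. \<exists>t. \<forall>(b, q)\<in>K. 0 \<le> b \<gamma> + t * q} =
    (\<Inter>k\<in>{k\<in>K. snd k = 0}. {\<gamma>. 0 \<le> fst k \<gamma>}) \<inter>
    (\<Inter>k\<in>{k\<in>K. 0 < snd k}. \<Inter>l\<in>{l\<in>K. snd l < 0}. {\<gamma>. 0 \<le> fst k \<gamma> * (- snd l) + fst l \<gamma> * snd k})"
    by (auto simp: case_prod_unfold)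
  also have "closed \<dots>"
  proof -
    have c: "continuous_on UNIV (fst k)" if "k \<in> K" for k using cont[of "fst k" "snd k"] that by simp
    show ?thesis
    proof (intro closed_Int closed_INT ballI)
      fix k assume "k \<in> {k\<in>K. snd k = 0}"
      then show "closed {\<gamma>. 0 \<le> fst k \<gamma>}" using c[of k] by (intro closed_Collect_le continuous_intros) auto
    next
      fix k l assume "k \<in> {k\<in>K. 0 < snd k}" "l \<in> {l\<in>K. snd l < 0}"
      then show "closed {\<gamma>. 0 \<le> fst k \<gamma> * (- snd l) + fst l \<gamma> * snd k}"
        using c[of k] c[of l] by (intro closed_Collect_le continuous_intros) auto
    qed
  qed
  finally show ?thesis .
qed

section \<open>Finite unions of polyhedral cones\<close>

definition polycone :: "'a::real_inner set \<Rightarrow> bool" where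
  "polycone B \<longleftrightarrow> (\<exists>C. finite C \<and> (\<forall>S\<in>C. finite S) \<and> B = {x. \<exists>S\<in>C. \<forall>a\<in>S. 0 \<le> a \<bullet> x})"

lemma polycone_halfspace: "polycone {x. 0 \<le> a \<bullet> x}"
  unfolding polycone_def by (intro exI[of _ "{{a}}"]) auto

lemma polycone_UNIV: "polycone UNIV"
  unfolding polycone_def by (intro exI[of _ "{{}}"]) auto

lemma polycone_empty: "polycone {}"
  unfolding polycone_def by (intro exI[of _ "{}"]) auto

lemma polycone_Un:
  assumes "polycone A" "polycone B"
  shows "polycone (A \<union> B)"
proof -
  obtain C D where "finite C" "\<forall>S\<in>C. finite S" "A = {x. \<exists>S\<in>C. \<forall>a\<in>S. 0 \<le> a \<bullet> x}"
    "finite D" "\<forall>S\<in>D. finite S" "B = {x. \<exists>S\<in>D. \<forall>a\<in>S. 0 \<le> a \<bullet> x}"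
    using assms unfolding polycone_def by blast
  then show ?thesis unfolding polycone_def by (intro exI[of _ "C \<union> D"]) auto
qed

lemma polycone_Int:
  assumes "polycone A" "polycone B"
  shows "polycone (A \<inter> B)"
proof -
  obtain C D where *: "finite C" "\<forall>S\<in>C. finite S" "A = {x. \<exists>S\<in>C. \<forall>a\<in>S. 0 \<le> a \<bullet> x}"
    "finite D" "\<forall>S\<in>D. finite S" "B = {x. \<exists>S\<in>D. \<forall>a\<in>S. 0 \<le> a \<bullet> x}"
    using assms unfolding polycone_def by blast
  define G where "G = (\<lambda>(S, T). S \<union> T) ` (C \<times> D)"
  have "A \<inter> B = {x. \<exists>S\<in>G. \<forall>a\<in>S. 0 \<le> a \<bullet> x}"
  proof (intro set_eqI iffI)
    fix x assume "x \<in> A \<inter> B"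
    then obtain S T where ST: "S \<in> C" "\<forall>a\<in>S. 0 \<le> a \<bullet> x" "T \<in> D" "\<forall>a\<in>T. 0 \<le> a \<bullet> x" using * by blast
    then have "S \<union> T \<in> G" unfolding G_def by force
    moreover have "\<forall>a\<in>S \<union> T. 0 \<le> a \<bullet> x" using ST by blast
    ultimately show "x \<in> {x. \<exists>S\<in>G. \<forall>a\<in>S. 0 \<le> a \<bullet> x}" by blast
  next
    fix x assume "x \<in> {x. \<exists>S\<in>G. \<forall>a\<in>S. 0 \<le> a \<bullet> x}"
    then show "x \<in> A \<inter> B" unfolding G_def * by blast
  qed
  moreover have "finite G" "\<forall>S\<in>G. finite S" unfolding G_def using * by auto
  ultimately show ?thesis unfolding polycone_def by blast
qed

lemma polycone_INT: "finite J \<Longrightarrow> (\<And>j. j \<in> J \<Longrightarrow> polycone (A j)) \<Longrightarrow> polycone (\<Inter>j\<in>J. A j)"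
proof (induction J rule: finite_induct)
  case (insert x J)
  then show ?case unfolding INT_insert by (intro polycone_Int) simp_all
qed (simp add: polycone_UNIV)

lemma polycone_UN: "finite J \<Longrightarrow> (\<And>j. j \<in> J \<Longrightarrow> polycone (A j)) \<Longrightarrow> polycone (\<Union>j\<in>J. A j)"
proof (induction J rule: finite_induct)
  case (insert x J)
  then show ?case unfolding UN_insert by (intro polycone_Un) simp_all
qed (simp add: polycone_empty)

lemma polycone_le:
  fixes i j :: "'n::finite"
  shows "polycone {x :: real ^ 'n. x $ i \<le> x $ j}"
proof -
  have "{x :: real ^ 'n. x $ i \<le> x $ j} = {x. 0 \<le> (axis j 1 - axis i 1) \<bullet> x}"
    by (simp add: inner_diff_left inner_axis')
  then show ?thesis by (simp only: polycone_halfspace)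
qed

lemma polycone_eq:
  fixes i j :: "'n::finite"
  shows "polycone {x :: real ^ 'n. x $ i = x $ j}"
proof -
  have "{x :: real ^ 'n. x $ i = x $ j} = {x. x $ i \<le> x $ j} \<inter> {x. x $ j \<le> x $ i}" by auto
  then show ?thesis by (simp only: polycone_Int[OF polycone_le polycone_le])
qed

text \<open>Up to multiples of \<open>1\<close>, under which \<open>B\<close> and \<open>E\<close>
  are invariant, a point of \<open>E\<close> depends on the single parameter \<open>t\<close>. So
  closedness of the sum is an elimination of one variable.\<close>

lemma closed_polycone_sweep:
  fixes B :: "(real ^ 'n::finite) set"
  assumes B: "polycone B" and B1: "\<And>x s. x \<in> B \<Longrightarrow> x + s *\<^sub>R 1 \<in> B"
    and KE: "finite KE" "E = {x. \<forall>(\<beta>, a)\<in>KE. 0 \<le> \<beta> + a \<bullet> x}" "\<And>\<beta> a. (\<beta>, a) \<in> KE \<Longrightarrow> a \<bullet> 1 = 0"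
    and E: "\<And>e. e \<in> E \<Longrightarrow> \<exists>s t. e = w0 + s *\<^sub>R 1 + t *\<^sub>R u"
  shows "closed {\<gamma>. \<exists>e\<in>E. \<gamma> + \<sigma> *\<^sub>R e \<in> B}"
proof -
  obtain C where C: "finite C" "\<And>S. S \<in> C \<Longrightarrow> finite S" "B = {x. \<exists>S\<in>C. \<forall>a\<in>S. 0 \<le> a \<bullet> x}"
    using B unfolding polycone_def by blast
  \<comment> \<open>The inequalities for \<open>w0 + t u\<close> to lie in \<open>E\<close>,
    followed by those for \<open>\<gamma> + \<sigma> (w0 + t u)\<close> to lie in the cone of
    \<open>S\<close>; all are affine in \<open>t\<close>.\<close>
  define K where "K S = (\<lambda>(\<beta>, a). ((\<lambda>\<gamma>::real ^ 'n. \<beta> + a \<bullet> w0), a \<bullet> u)) ` KE \<union>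
    (\<lambda>a. ((\<lambda>\<gamma>. a \<bullet> (\<gamma> + \<sigma> *\<^sub>R w0)), \<sigma> * (a \<bullet> u))) ` S" for S
  have Kt: "(\<forall>(b, q)\<in>K S. 0 \<le> b \<gamma> + t * q) \<longleftrightarrow> w0 + t *\<^sub>R u \<in> E \<and> (\<forall>a\<in>S. 0 \<le> a \<bullet> (\<gamma> + \<sigma> *\<^sub>R (w0 + t *\<^sub>R u)))" for S \<gamma> t
  proof -
    have 1: "a \<bullet> (\<gamma> + \<sigma> *\<^sub>R (w0 + t *\<^sub>R u)) = a \<bullet> (\<gamma> + \<sigma> *\<^sub>R w0) + t * (\<sigma> * (a \<bullet> u))" for a
      by (simp add: inner_add_right algebra_simps)
    have 2: "\<beta> + a \<bullet> (w0 + t *\<^sub>R u) = \<beta> + a \<bullet> w0 + t * (a \<bullet> u)" for \<beta> a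
      by (simp add: inner_add_right)
    show ?thesis unfolding K_def KE(2) ball_Un 1 by (simp add: 2 case_prod_unfold)
  qed
  have sub: "w0 + t *\<^sub>R u \<in> E" if "w0 + s *\<^sub>R 1 + t *\<^sub>R u \<in> E" for s t
  proof -
    have "a \<bullet> (w0 + s *\<^sub>R 1 + t *\<^sub>R u) = a \<bullet> (w0 + t *\<^sub>R u)" if "(\<beta>, a) \<in> KE" for \<beta> a
      using KE(3)[OF that] by (simp add: inner_add_right)
    then show ?thesis using that unfolding KE(2) by fastforce
  qed
  have "{\<gamma>. \<exists>e\<in>E. \<gamma> + \<sigma> *\<^sub>R e \<in> B} = (\<Union>S\<in>C. {\<gamma>. \<exists>t. \<forall>(b, q)\<in>K S. 0 \<le> b \<gamma> + t * q})"
  proof (intro set_eqI iffI)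
    fix \<gamma> assume "\<gamma> \<in> {\<gamma>. \<exists>e\<in>E. \<gamma> + \<sigma> *\<^sub>R e \<in> B}"
    then obtain e where e: "e \<in> E" "\<gamma> + \<sigma> *\<^sub>R e \<in> B" by blast
    obtain s t where st: "e = w0 + s *\<^sub>R 1 + t *\<^sub>R u" using E[OF e(1)] by blast
    have eq: "\<gamma> + \<sigma> *\<^sub>R e + (- \<sigma> * s) *\<^sub>R 1 = \<gamma> + \<sigma> *\<^sub>R (w0 + t *\<^sub>R u)"
      unfolding st by (simp add: algebra_simps)
    have "\<gamma> + \<sigma> *\<^sub>R (w0 + t *\<^sub>R u) \<in> B" unfolding eq [symmetric] by (rule B1[OF e(2)])
    then obtain S where S: "S \<in> C" "\<forall>a\<in>S. 0 \<le> a \<bullet> (\<gamma> + \<sigma> *\<^sub>R (w0 + t *\<^sub>R u))" unfolding C(3) by blast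
    have "w0 + t *\<^sub>R u \<in> E" using sub e(1) st by blast
    then have "\<forall>(b, q)\<in>K S. 0 \<le> b \<gamma> + t * q" using Kt S(2) by blast
    then show "\<gamma> \<in> (\<Union>S\<in>C. {\<gamma>. \<exists>t. \<forall>(b, q)\<in>K S. 0 \<le> b \<gamma> + t * q})" using S(1) by blast
  next
    fix \<gamma> assume "\<gamma> \<in> (\<Union>S\<in>C. {\<gamma>. \<exists>t. \<forall>(b, q)\<in>K S. 0 \<le> b \<gamma> + t * q})"
    then obtain S t where S: "S \<in> C" "\<forall>(b, q)\<in>K S. 0 \<le> b \<gamma> + t * q" by blast
    then have "w0 + t *\<^sub>R u \<in> E" "\<gamma> + \<sigma> *\<^sub>R (w0 + t *\<^sub>R u) \<in> B" using Kt[of S \<gamma> t] unfolding C(3) by blast+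
    then show "\<gamma> \<in> {\<gamma>. \<exists>e\<in>E. \<gamma> + \<sigma> *\<^sub>R e \<in> B}" by blast
  qed
  also have "closed \<dots>"
  proof (intro closed_UN C(1) ballI closed_elimination)
    fix S assume S: "S \<in> C"
    show "finite (K S)" unfolding K_def using KE(1) C(2)[OF S] by blast
    fix b q assume "(b, q) \<in> K S"
    then show "continuous_on UNIV b" unfolding K_def by (auto intro!: continuous_intros)
  qed
  finally show ?thesis .
qed

section \<open>Tropicalizations of the linear spaces\<close>

definition min_twice :: "'a set \<Rightarrow> ('a \<Rightarrow> real) \<Rightarrow> bool" where
  "min_twice A g \<longleftrightarrow> (\<exists>a\<in>A. \<exists>b\<in>A. a \<noteq> b \<and> g a = g b \<and> (\<forall>c\<in>A. g a \<le> g c))"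

text \<open>The tropical prevarieties defined by the circuits of \<open>{l. \<Sum> l\<^sub>i = 0, \<Sum> w\<^sub>i l\<^sub>i = 0}\<close> and of its
  orthogonal complement, spanned by \<open>1\<close> and \<open>w\<close>.\<close>

definition Bdual :: "int ^ 'n::finite \<Rightarrow> (real ^ 'n) set" where
  "Bdual w = {\<delta>. \<forall>j. min_twice {i. w $ i \<noteq> w $ j} (\<lambda>i. \<delta> $ i)}"

definition Btan :: "int ^ 'n::finite \<Rightarrow> (real ^ 'n) set" where
  "Btan w = {x. (\<forall>i j. w $ i = w $ j \<longrightarrow> x $ i = x $ j) \<and>
     (\<forall>i j k. w $ i \<noteq> w $ j \<longrightarrow> w $ i \<noteq> w $ k \<longrightarrow> w $ j \<noteq> w $ k \<longrightarrow> min_twice {i, j, k} (\<lambda>i. x $ i))}"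

lemma min_twiceE:
  assumes "min_twice A g"
  obtains a b where "a \<in> A" "b \<in> A" "a \<noteq> b" "g a = g b" "\<forall>c\<in>A. g a \<le> g c"
proof -
  obtain a where a: "a \<in> A" "\<exists>b\<in>A. a \<noteq> b \<and> g a = g b \<and> (\<forall>c\<in>A. g a \<le> g c)"
    using assms unfolding min_twice_def by (rule bexE)
  from a(2) obtain b where b: "b \<in> A" "a \<noteq> b \<and> g a = g b \<and> (\<forall>c\<in>A. g a \<le> g c)" by (rule bexE)
  show thesis
    by (rule that[OF a(1) b(1) conjunct1[OF b(2)] conjunct1[OF conjunct2[OF b(2)]] conjunct2[OF conjunct2[OF b(2)]]])
qed

lemma min_twiceI:
  "a \<in> A \<Longrightarrow> b \<in> A \<Longrightarrow> a \<noteq> b \<Longrightarrow> g a = g b \<Longrightarrow> (\<And>c. c \<in> A \<Longrightarrow> g a \<le> g c) \<Longrightarrow> min_twice A g"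
  unfolding min_twice_def by (rule bexI[of _ a], rule bexI[of _ b]) simp_all

lemma min_twice_shift: "min_twice A (\<lambda>i. g i + c) \<longleftrightarrow> min_twice A g"
  by (simp add: min_twice_def)

lemma min_twice_cong: "(\<And>i. i \<in> A \<Longrightarrow> g i = g' i) \<Longrightarrow> min_twice A g \<longleftrightarrow> min_twice A g'"
  unfolding min_twice_def by (intro bex_cong conj_cong ball_cong refl) auto

lemma min_twice_eq_UN:
  "{x :: real ^ 'n::finite. min_twice A (\<lambda>i. x $ i)} =
      (\<Union>a\<in>A. \<Union>b\<in>A - {a}. {x. x $ a = x $ b} \<inter> (\<Inter>c\<in>A. {x. x $ a \<le> x $ c}))"
proof (intro set_eqI iffI)
  fix x :: "real ^ 'n"
  assume "x \<in> {x. min_twice A (\<lambda>i. x $ i)}"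
  then have "min_twice A (\<lambda>i. x $ i)" by (rule CollectD)
  then obtain a b where "a \<in> A" "b \<in> A" "a \<noteq> b" "x $ a = x $ b" "\<forall>c\<in>A. x $ a \<le> x $ c"
    by (rule min_twiceE)
  then show "x \<in> (\<Union>a\<in>A. \<Union>b\<in>A - {a}. {x. x $ a = x $ b} \<inter> (\<Inter>c\<in>A. {x. x $ a \<le> x $ c}))"
    by (intro UN_I[of a] UN_I[of b]) auto
next
  fix x :: "real ^ 'n"
  assume "x \<in> (\<Union>a\<in>A. \<Union>b\<in>A - {a}. {x. x $ a = x $ b} \<inter> (\<Inter>c\<in>A. {x. x $ a \<le> x $ c}))"
  then obtain a where a: "a \<in> A" "x \<in> (\<Union>b\<in>A - {a}. {x. x $ a = x $ b} \<inter> (\<Inter>c\<in>A. {x. x $ a \<le> x $ c}))"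
    by (rule UN_E)
  from a(2) obtain b where b: "b \<in> A - {a}" "x \<in> {x. x $ a = x $ b} \<inter> (\<Inter>c\<in>A. {x. x $ a \<le> x $ c})"
    by (rule UN_E)
  have "b \<in> A" "a \<noteq> b" using b(1) by auto
  moreover have "x $ a = x $ b" "\<forall>c\<in>A. x $ a \<le> x $ c" using b(2) by blast+
  moreover note a(1)
  ultimately show "x \<in> {x. min_twice A (\<lambda>i. x $ i)}" by (intro CollectI min_twiceI[of a _ b]) auto
qed

lemma Bdual_eq_INT: "Bdual w = (\<Inter>j. {\<delta>. min_twice {i. w $ i \<noteq> w $ j} (\<lambda>i. \<delta> $ i)})"
  by (auto simp: Bdual_def)

lemma Btan_eq_INT:
  "Btan w = (\<Inter>i. \<Inter>j\<in>{j. w $ i = w $ j}. {x. x $ i = x $ j}) \<inter>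
    (\<Inter>i. \<Inter>j\<in>{j. w $ i \<noteq> w $ j}. \<Inter>k\<in>{k. w $ i \<noteq> w $ k \<and> w $ j \<noteq> w $ k}. {x. min_twice {i, j, k} (\<lambda>i. x $ i)})"
  by (auto simp: Btan_def)

lemma closed_polycone: "polycone B \<Longrightarrow> closed B"
  for B :: "'a::real_inner set"
  unfolding polycone_def
  by (auto simp: Collect_bex_eq Collect_ball_eq intro!: closed_UN closed_INT closed_Collect_le continuous_intros)

lemma polycone_min_twice:
  fixes A :: "'n::finite set"
  shows "polycone {x :: real ^ 'n. min_twice A (\<lambda>i. x $ i)}"
  unfolding min_twice_eq_UN
  by (intro polycone_UN polycone_INT polycone_Int polycone_eq polycone_le finite)

lemma polycone_Bdual: "polycone (Bdual w)"
  unfolding Bdual_eq_INT by (intro polycone_INT polycone_min_twice finite)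

lemma polycone_Btan: "polycone (Btan w)"
  unfolding Btan_eq_INT
  by (intro polycone_Int polycone_INT polycone_eq polycone_min_twice finite)

text \<open>From \<open>\<delta> \<in> Bdual w\<close> one only uses that through every index \<open>i\<close> there is a circuit
  of the linear space whose other members have values at most \<open>\<delta> $ i\<close>.\<close>

definition circuit_through :: "int ^ 'n::finite \<Rightarrow> real ^ 'n \<Rightarrow> 'n \<Rightarrow> bool" where
  "circuit_through w \<delta> i \<longleftrightarrow> (\<exists>j. j \<noteq> i \<and> w $ j = w $ i \<and> \<delta> $ j \<le> \<delta> $ i) \<or>
     (\<exists>j k. w $ j \<noteq> w $ i \<and> w $ k \<noteq> w $ i \<and> w $ j \<noteq> w $ k \<and> \<delta> $ j \<le> \<delta> $ i \<and> \<delta> $ k \<le> \<delta> $ i)"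

lemma min_twice_other:
  assumes "min_twice A g" "i \<in> A"
  obtains l where "l \<in> A" "l \<noteq> i" "g l \<le> g i"
proof -
  obtain a b where ab: "a \<in> A" "b \<in> A" "a \<noteq> b" "g a = g b" "\<forall>c\<in>A. g a \<le> g c"
    using assms(1) by (rule min_twiceE)
  show thesis
  proof (cases "a = i")
    case True
    then show thesis using that[of b] ab assms(2) by auto
  next
    case False
    then show thesis using that[of a] ab assms(2) by auto
  qed
qed

text \<open>The condition at \<open>i\<close> gives two minima \<open>a\<close>, \<open>b\<close>
  outside the level set of \<open>w\<close> through \<open>i\<close>. The condition at
  \<open>a\<close> gives an \<open>l\<close> off the level set of \<open>a\<close> whose value is at
  most that of \<open>i\<close>. Then \<open>i, l\<close> form a two-term circuit or
  \<open>i, a, l\<close> a three-term one.\<close>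

lemma Bdual_circuit:
  assumes \<delta>: "\<delta> \<in> Bdual w"
  shows "circuit_through w \<delta> i"
proof -
  have B: "min_twice {l. w $ l \<noteq> w $ j} (\<lambda>l. \<delta> $ l)" for j using \<delta> unfolding Bdual_def by blast
  obtain a b where "a \<in> {l. w $ l \<noteq> w $ i}" "b \<in> {l. w $ l \<noteq> w $ i}" "a \<noteq> b" "\<delta> $ a = \<delta> $ b"
    "\<forall>c\<in>{l. w $ l \<noteq> w $ i}. \<delta> $ a \<le> \<delta> $ c"
    using B[of i] by (rule min_twiceE)
  then have ab: "w $ a \<noteq> w $ i" "w $ b \<noteq> w $ i" "a \<noteq> b" "\<delta> $ a = \<delta> $ b"
    "\<And>c. w $ c \<noteq> w $ i \<Longrightarrow> \<delta> $ a \<le> \<delta> $ c" by simp_all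
  have "i \<in> {l. w $ l \<noteq> w $ a}" using ab(1) by simp
  then obtain l where "l \<in> {l. w $ l \<noteq> w $ a}" "l \<noteq> i" "\<delta> $ l \<le> \<delta> $ i"
    by (rule min_twice_other[OF B[of a]])
  then have l: "w $ l \<noteq> w $ a" "l \<noteq> i" "\<delta> $ l \<le> \<delta> $ i" by simp_all
  show ?thesis
  proof (cases "w $ l = w $ i")
    case True
    then show ?thesis using l unfolding circuit_through_def by blast
  next
    case False
    then have "\<delta> $ a \<le> \<delta> $ i" using ab(5)[of l] l by linarith
    then show ?thesis using False ab l unfolding circuit_through_def by blast
  qed
qed

context valued_field
begin

definition trop_vals :: "('k ^ 'n::finite) set \<Rightarrow> (real ^ 'n) set" where
  "trop_vals Y = {trop_pt val x + c *\<^sub>R 1 | x c. x \<in> Y \<inter> torus}"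

lemma trop_trop_vals: "trop val Y = closure (trop_vals Y)"
  by (simp add: trop_def trop_vals_def)

lemma trop_pt_vl: "trop_pt val x $ i = vl (x $ i)"
  by (simp add: trop_pt_def vl_def)

text \<open>A summand of strictly smallest valuation would determine the absolute value of the
  sum.\<close>

lemma sum_zero_min_twice:
  assumes fin: "finite A" and A: "A \<noteq> {}" and nz: "\<And>i. i \<in> A \<Longrightarrow> (z i :: 'k) \<noteq> 0" and sum: "(\<Sum>i\<in>A. z i) = 0"
  shows "min_twice A (\<lambda>i. vl (z i))"
proof -
  define m where "m = Min ((\<lambda>i. vl (z i)) ` A)"
  have "m \<in> (\<lambda>i. vl (z i)) ` A" unfolding m_def using fin A by (intro Min_in) auto
  then obtain a where a: "a \<in> A" "m = vl (z a)" by blast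
  have le: "vl (z a) \<le> vl (z i)" if "i \<in> A" for i using fin that unfolding a(2) [symmetric] m_def by (intro Min_le) auto
  show ?thesis
  proof (rule ccontr)
    assume no: "\<not> min_twice A (\<lambda>i. vl (z i))"
    have "absv (z i) < absv (z a)" if "i \<in> A - {a}" for i
    proof -
      have "vl (z a) \<noteq> vl (z i)"
      proof
        assume "vl (z a) = vl (z i)"
        then have "min_twice A (\<lambda>i. vl (z i))" using that a(1) le by (intro min_twiceI[of a _ i]) auto
        then show False using no by blast
      qed
      then have "vl (z a) < vl (z i)" using le[of i] that by simp
      then show ?thesis using nz a(1) that by (simp add: absv_def)
    qed
    then have "absv (\<Sum>i\<in>A - {a}. z i) < absv (z a)" using nz[OF a(1)] by (intro absv_sum_less) auto
    moreover have "(\<Sum>i\<in>A - {a}. z i) + z a = 0" using sum fin a(1) by (simp add: sum.remove[of _ a] add.commute)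
    ultimately have "absv 0 = absv (z a)" using absv_add_eq by metis
    then show False using nz[OF a(1)] by simp
  qed
qed

lemma vl_int_mult: "m \<noteq> 0 \<Longrightarrow> x \<noteq> 0 \<Longrightarrow> vl (of_int m * x) = vl x"
  by (simp add: vl_mult)

text \<open>For every \<open>j\<close> the form with coefficients \<open>w $ i - w $ j\<close>
  vanishes on the space, and its nonzero coefficients, being integers, do not affect
  valuations.\<close>

lemma trop_vals_dual_subset:
  fixes w :: "int ^ 'n::finite"
  assumes w: "\<exists>p q. w $ p \<noteq> w $ q"
  shows "trop_vals {l :: 'k ^ 'n. idot 1 l = 0 \<and> idot w l = 0} \<subseteq> Bdual w"
proof
  fix \<delta> assume "\<delta> \<in> trop_vals {l :: 'k ^ 'n. idot 1 l = 0 \<and> idot w l = 0}"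
  then obtain x :: "'k ^ 'n" and c where x: "\<delta> = trop_pt val x + c *\<^sub>R 1" "idot 1 x = 0" "idot w x = 0" "x \<in> torus"
    unfolding trop_vals_def by blast
  have "min_twice {i. w $ i \<noteq> w $ j} (\<lambda>i. \<delta> $ i)" for j
  proof -
    have "(\<Sum>i\<in>UNIV. of_int (w $ i - w $ j) * x $ i) = idot w x - of_int (w $ j) * idot 1 x"
      by (simp add: idot_def left_diff_distrib sum_subtractf sum_distrib_left)
    then have "(\<Sum>i\<in>UNIV. of_int (w $ i - w $ j) * x $ i) = 0" using x by simp
    moreover have "(\<Sum>i\<in>UNIV. of_int (w $ i - w $ j) * x $ i) = (\<Sum>i\<in>{i. w $ i \<noteq> w $ j}. of_int (w $ i - w $ j) * x $ i)"
      by (intro sum.mono_neutral_right) auto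
    ultimately have s: "(\<Sum>i\<in>{i. w $ i \<noteq> w $ j}. of_int (w $ i - w $ j) * x $ i) = 0" by simp
    obtain p q where "w $ p \<noteq> w $ q" using w by blast
    then have "p \<in> {i. w $ i \<noteq> w $ j} \<or> q \<in> {i. w $ i \<noteq> w $ j}" by auto
    then have ne: "{i. w $ i \<noteq> w $ j} \<noteq> {}" by blast
    have nz: "of_int (w $ i - w $ j) * x $ i \<noteq> 0" if "i \<in> {i. w $ i \<noteq> w $ j}" for i
      using x(4) that by simp
    have "min_twice {i. w $ i \<noteq> w $ j} (\<lambda>i. vl (of_int (w $ i - w $ j) * x $ i))"
      by (rule sum_zero_min_twice[OF _ ne nz s]) auto
    moreover have "vl (of_int (w $ i - w $ j) * x $ i) = vl (x $ i)" if "i \<in> {i. w $ i \<noteq> w $ j}" for i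
      using x(4) that by (intro vl_int_mult) auto
    ultimately have "min_twice {i. w $ i \<noteq> w $ j} (\<lambda>i. vl (x $ i))" by (rule min_twice_cong[THEN iffD1, rotated]) auto
    then show ?thesis by (simp add: x(1) trop_pt_vl min_twice_shift)
  qed
  then show "\<delta> \<in> Bdual w" by (simp add: Bdual_def)
qed

lemma trop_vals_tan_subset:
  fixes w :: "int ^ 'n::finite"
  shows "trop_vals {x :: 'k ^ 'n. \<exists>s t. x = (\<chi> q. s + t * of_int (w $ q))} \<subseteq> Btan w"
proof
  fix \<delta> assume "\<delta> \<in> trop_vals {x :: 'k ^ 'n. \<exists>s t. x = (\<chi> q. s + t * of_int (w $ q))}"
  then obtain x :: "'k ^ 'n" and c s t where x: "\<delta> = trop_pt val x + c *\<^sub>R 1" "x = (\<chi> q. s + t * of_int (w $ q))" "x \<in> torus"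
    unfolding trop_vals_def by blast
  show "\<delta> \<in> Btan w" unfolding Btan_def
  proof (intro CollectI conjI allI impI)
    show "\<delta> $ i = \<delta> $ j" if "w $ i = w $ j" for i j using that by (simp add: x(1,2) trop_pt_vl)
    fix i j k assume d: "w $ i \<noteq> w $ j" "w $ i \<noteq> w $ k" "w $ j \<noteq> w $ k"
    then have ne: "i \<noteq> j" "i \<noteq> k" "j \<noteq> k" by auto
    \<comment> \<open>The three-term linear relation among the coordinates of \<open>x\<close>. Its
      coefficients are nonzero integers, so the summands have the valuations of the
      coordinates.\<close>
    define z where "z l = (if l = i then of_int (w $ j - w $ k) else if l = j then of_int (w $ k - w $ i) else of_int (w $ i - w $ j)) * x $ l" for l
    have "(\<Sum>l\<in>{i, j, k}. z l) = 0" using ne by (simp add: z_def x(2) algebra_simps)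
    moreover have "z l \<noteq> 0" if "l \<in> {i, j, k}" for l using that d x(3) by (auto simp: z_def)
    ultimately have "min_twice {i, j, k} (\<lambda>l. vl (z l))" by (intro sum_zero_min_twice) auto
    moreover have "vl (z l) = vl (x $ l)" if "l \<in> {i, j, k}" for l
    proof -
      have xn: "x $ l \<noteq> 0" for l using x(3) by simp
      show ?thesis using that d ne unfolding z_def by (auto simp: vl_int_mult[OF _ xn] simp del: of_int_diff)
    qed
    ultimately have "min_twice {i, j, k} (\<lambda>l. vl (x $ l))" by (rule min_twice_cong[THEN iffD1, rotated]) auto
    then show "min_twice {i, j, k} (\<lambda>l. \<delta> $ l)" by (simp add: x(1) trop_pt_vl min_twice_shift)
  qed
qed

text \<open>The reduction of a polynomial over the residue field has finitely many roots.\<close>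

lemma finite_small_values:
  fixes p :: "'k poly"
  assumes "p \<noteq> 0" "\<And>i. absv (coeff p i) \<le> 1" "\<exists>i. absv (coeff p i) = 1"
  shows "finite {N::nat. absv (poly p (of_nat N)) < 1}"
  using assms
proof (induction "degree p" arbitrary: p rule: less_induct)
  case less
  show ?case
  proof (cases "{N::nat. absv (poly p (of_nat N)) < 1} = {}")
    case True
    then show ?thesis by (metis finite.emptyI)
  next
    case False
    then obtain N :: nat where N: "absv (poly p (of_nat N)) < 1" by blast
    \<comment> \<open>Dividing by the linear factor at \<open>N\<close>, where \<open>p\<close> is
      small, keeps the coefficients bounded by 1 and keeps one of absolute value 1.\<close>
    define q where "q = synthetic_div p (of_nat N)"
    have p: "p = [:- of_nat N, 1:] * q + [:poly p (of_nat N):]"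
      using synthetic_div_correct'[of "of_nat N" p] by (simp add: q_def)
    have cN: "absv (of_nat N) \<le> 1" using absv_of_int_le[of "int N"] by simp
    have cp: "coeff p i = (case i of 0 \<Rightarrow> poly p (of_nat N) - of_nat N * coeff q 0 | Suc j \<Rightarrow> coeff q j - of_nat N * coeff q (Suc j))" for i
      by (subst p) (simp add: coeff_pCons algebra_simps split: nat.split)
    have q1: "absv (coeff q i) \<le> 1" for i
    proof (cases "i \<le> degree q")
      case True
      then show ?thesis
      proof (induction i rule: inc_induct)
        case base
        have "coeff p (Suc (degree q)) = lead_coeff q" by (simp add: cp coeff_eq_0)
        then show ?case using less.prems(2)[of "Suc (degree q)"] by simp
      next
        case (step j)
        have e: "coeff q j = coeff p (Suc j) + of_nat N * coeff q (Suc j)" by (simp add: cp)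
        have "absv (of_nat N * coeff q (Suc j)) \<le> 1" unfolding absv_mult using step cN by (intro mult_le_one) auto
        then show ?case unfolding e by (intro absv_add_le less.prems(2))
      qed
    qed (simp add: coeff_eq_0)
    have ex: "\<exists>i. absv (coeff q i) = 1"
    proof (rule ccontr)
      assume "\<not> ?thesis"
      then have q2: "absv (coeff q i) < 1" for i using q1 by (meson less_le)
      have *: "absv (of_nat N * coeff q i) < 1" for i
        using mult_mono[OF cN order_refl, of "absv (coeff q i)"] q2[of i] by (simp add: absv_mult)
      have "absv (coeff p i) < 1" for i unfolding cp using N * q2 by (cases i) (auto intro: absv_diff_less)
      then show False using less.prems(3) by (metis less_irrefl)
    qed
    then have q0: "q \<noteq> 0" by auto
    have dp: "degree p \<noteq> 0"
    proof
      assume "degree p = 0"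
      then have "q = 0" by (simp add: q_def synthetic_div_eq_0_iff)
      then show False using q0 by blast
    qed
    then have "degree q < degree p" by (simp add: q_def degree_synthetic_div)
    then have fin: "finite {N::nat. absv (poly q (of_nat N)) < 1}" using less.hyps q0 q1 ex by blast
    have "{M::nat. absv (poly p (of_nat M)) < 1} \<subseteq> insert N {M::nat. absv (poly q (of_nat M)) < 1}"
    proof
      fix M :: nat assume M: "M \<in> {M::nat. absv (poly p (of_nat M)) < 1}"
      show "M \<in> insert N {M::nat. absv (poly q (of_nat M)) < 1}"
      proof (cases "M = N")
        case False
        have "poly p (of_nat M) = (of_nat M - of_nat N) * poly q (of_nat M) + poly p (of_nat N)"
          by (subst p) (simp add: algebra_simps)
        then have "absv ((of_nat M - of_nat N) * poly q (of_nat M)) < 1"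
          using absv_diff_less[of "poly p (of_nat M)" 1 "poly p (of_nat N)"] M N by simp
        \<comment> \<open>Distinct natural numbers are at distance 1, so every other small value of
          \<open>p\<close> comes from a small value of \<open>q\<close>.\<close>
        moreover have "absv (of_nat M - of_nat N) = 1"
          using absv_of_int[of "int M - int N"] False by simp
        ultimately show ?thesis by (simp add: absv_mult)
      qed simp
    qed
    then show ?thesis using fin finite_subset by blast
  qed
qed

text \<open>The coefficients are powers of one generic natural number \<open>N\<close>. Divided by
  \<open>y l $ l\<close>, coordinate \<open>l\<close> is a polynomial in \<open>N\<close> with
  coefficients bounded by 1 and one coefficient equal to 1, so only finitely many \<open>N\<close>
  cause cancellation.\<close>

lemma generic_combination:
  fixes y :: "'n::finite \<Rightarrow> 'k ^ 'n" and a :: "'n \<Rightarrow> real"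
  assumes a: "\<And>i. a i > 0" and diag: "\<And>i. absv (y i $ i) = a i" and le: "\<And>i l. absv (y i $ l) \<le> a l"
  shows "\<exists>c. \<forall>l. absv (\<Sum>i\<in>UNIV. c i * y i $ l) = a l"
proof -
  obtain e :: "'n \<Rightarrow> nat" where e: "bij_betw e UNIV {0..<CARD('n)}"
    using ex_bij_betw_finite_nat[of "UNIV :: 'n set"] by auto
  then have inj: "inj e" by (simp add: bij_betw_def)
  define p where "p l = (\<Sum>i\<in>UNIV. monom (y i $ l / y l $ l) (e i))" for l
  have nz: "y l $ l \<noteq> 0" for l using diag[of l] a[of l] by auto
  have cp: "coeff (p l) j = (\<Sum>i\<in>UNIV. if e i = j then y i $ l / y l $ l else 0)" for l j
    by (simp add: p_def coeff_sum)
  have cpe: "coeff (p l) (e i) = y i $ l / y l $ l" for l i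
    unfolding cp using inj by (simp add: inj_eq)
  have c1: "absv (coeff (p l) j) \<le> 1" for l j
    unfolding cp
    by (rule absv_sum_le) (use le a in \<open>auto simp: absv_divide diag\<close>)
  have c2: "absv (coeff (p l) (e l)) = 1" for l using cpe[of l l] nz by simp
  have "finite {N::nat. absv (poly (p l) (of_nat N)) < 1}" for l
  proof (rule finite_small_values)
    show "p l \<noteq> 0" using c2[of l] by auto
  qed (use c1 c2 in auto)
  then have "finite (\<Union>l. {N::nat. absv (poly (p l) (of_nat N)) < 1})" by simp
  then obtain N :: nat where N: "N \<notin> (\<Union>l. {N::nat. absv (poly (p l) (of_nat N)) < 1})"
    using ex_new_if_finite infinite_UNIV_nat by blast
  have cN: "absv (of_nat N) \<le> 1" using absv_of_int_le[of "int N"] by simp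
  have "absv (\<Sum>i\<in>UNIV. of_nat N ^ e i * y i $ l) = a l" for l
  proof -
    have eq: "(\<Sum>i\<in>UNIV. of_nat N ^ e i * y i $ l) = y l $ l * poly (p l) (of_nat N)"
      using nz by (simp add: p_def poly_sum poly_monom sum_distrib_left mult.commute)
    have "absv (\<Sum>i\<in>UNIV. of_nat N ^ e i * y i $ l) \<le> a l"
    proof (rule absv_sum_le)
      fix i
      have "absv (of_nat N ^ e i * y i $ l) \<le> 1 * a l"
        unfolding absv_mult absv_power using cN le a by (intro mult_mono power_le_one) auto
      then show "absv (of_nat N ^ e i * y i $ l) \<le> a l" by simp
    qed (use a[of l] in simp)
    moreover have "absv (poly (p l) (of_nat N)) \<ge> 1" using N by (auto simp: not_less)
    then have "absv (y l $ l * poly (p l) (of_nat N)) \<ge> a l"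
      unfolding absv_mult diag using a[of l] by simp
    ultimately show ?thesis unfolding eq by simp
  qed
  then show ?thesis by (intro exI[of _ "\<lambda>i. of_nat N ^ e i"]) simp
qed

text \<open>A real number need not be a value, so \<open>\<rho>\<close> rounds down to multiples of
  a small value. Monotonicity is recorded because circuits are chosen by comparing coordinates, and
  these comparisons have to survive the rounding.\<close>

lemma approximate_valuations:
  assumes "e > 0"
  obtains \<rho> :: "real \<Rightarrow> 'k" where "\<And>r. \<rho> r \<noteq> 0" "\<And>r. \<bar>vl (\<rho> r) - r\<bar> < e" "\<And>r s. r \<le> s \<Longrightarrow> vl (\<rho> r) \<le> vl (\<rho> s)"
proof -
  obtain \<mu> where \<mu>: "\<mu> \<noteq> 0" "0 < vl \<mu>" "vl \<mu> < e" using ex_vl_small[OF assms] by blast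
  define \<rho> where "\<rho> r = \<mu> powi \<lfloor>r / vl \<mu>\<rfloor>" for r
  have v: "vl (\<rho> r) = of_int \<lfloor>r / vl \<mu>\<rfloor> * vl \<mu>" for r using \<mu> by (simp add: \<rho>_def vl_powi)
  show thesis
  proof (rule that[of \<rho>])
    show "\<rho> r \<noteq> 0" for r using \<mu> by (simp add: \<rho>_def)
    show "\<bar>vl (\<rho> r) - r\<bar> < e" for r
    proof -
      define m where "m = \<lfloor>r / vl \<mu>\<rfloor>"
      have "of_int m \<le> r / vl \<mu>" "r / vl \<mu> < of_int m + 1" unfolding m_def by linarith+
      then have "of_int m * vl \<mu> \<le> r" "r < of_int m * vl \<mu> + vl \<mu>" using \<mu> by (auto simp: field_simps)
      then show ?thesis using \<mu> by (simp add: v flip: m_def)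
    qed
    show "vl (\<rho> r) \<le> vl (\<rho> s)" if "r \<le> s" for r s
    proof -
      have "r / vl \<mu> \<le> s / vl \<mu>" using that \<mu> by (simp add: divide_right_mono)
      then have "\<lfloor>r / vl \<mu>\<rfloor> \<le> \<lfloor>s / vl \<mu>\<rfloor>" by (rule floor_mono)
      then show ?thesis unfolding v using \<mu> by (intro mult_right_mono) auto
    qed
  qed
qed

text \<open>For every \<open>i\<close> a circuit through \<open>i\<close> supports a vector of the
  space with the prescribed size at \<open>i\<close> and at most the prescribed size elsewhere. A
  generic combination has the prescribed size everywhere.\<close>

lemma Bdual_subset_trop:
  fixes w :: "int ^ 'n::finite"
  shows "Bdual w \<subseteq> closure (trop_vals {l :: 'k ^ 'n. idot 1 l = 0 \<and> idot w l = 0})"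
proof
  fix \<delta> assume \<delta>: "\<delta> \<in> Bdual w"
  show "\<delta> \<in> closure (trop_vals {l :: 'k ^ 'n. idot 1 l = 0 \<and> idot w l = 0})"
    unfolding closure_approachable
  proof (intro allI impI)
    fix e :: real assume "e > 0"
    define e' where "e' = e / CARD('n)"
    have e': "e' > 0" using \<open>e > 0\<close> by (simp add: e'_def)
    obtain \<rho> :: "real \<Rightarrow> 'k" where \<rho>: "\<And>r. \<rho> r \<noteq> 0" "\<And>r. \<bar>vl (\<rho> r) - r\<bar> < e'" "\<And>r s. r \<le> s \<Longrightarrow> vl (\<rho> r) \<le> vl (\<rho> s)"
      using approximate_valuations[OF e'] by blast
    define a where "a i = absv (\<rho> (\<delta> $ i))" for i
    have a: "a i > 0" for i using \<rho>(1) by (simp add: a_def)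
    have amono: "a i \<le> a j" if "\<delta> $ j \<le> \<delta> $ i" for i j
      using \<rho>(1) \<rho>(3)[OF that] by (simp add: a_def absv_def)
    have "\<exists>z :: 'k ^ 'n. idot 1 z = 0 \<and> idot w z = 0 \<and> absv (z $ i) = a i \<and> (\<forall>l. absv (z $ l) \<le> a l)" for i
    proof -
      have "circuit_through w \<delta> i" by (rule Bdual_circuit[OF \<delta>])
      then consider j where "j \<noteq> i" "w $ j = w $ i" "\<delta> $ j \<le> \<delta> $ i"
        | j k where "w $ j \<noteq> w $ i" "w $ k \<noteq> w $ i" "w $ j \<noteq> w $ k" "\<delta> $ j \<le> \<delta> $ i" "\<delta> $ k \<le> \<delta> $ i"
        unfolding circuit_through_def by blast
      then show ?thesis
      proof cases
        case (1 j)
        define z :: "'k ^ 'n" where "z = axis i (\<rho> (\<delta> $ i)) + axis j (- \<rho> (\<delta> $ i))"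
        have idz: "idot m z = of_int (m $ i - m $ j) * \<rho> (\<delta> $ i)" for m
        proof -
          have s: "idot m (axis p r) = of_int (m $ p) * r" for p and r :: 'k
          proof -
            have "idot m (axis p r) = (\<Sum>q\<in>UNIV. if q = p then of_int (m $ q) * r else 0)"
              unfolding idot_def by (intro sum.cong) (auto simp: axis_def)
            then show ?thesis by simp
          qed
          show ?thesis unfolding z_def idot_add_right s by (simp add: algebra_simps)
        qed
        have "idot 1 z = 0" "idot w z = 0" using 1 by (simp_all add: idz)
        moreover have "absv (z $ i) = a i" using 1 by (simp add: z_def axis_def a_def)
        moreover have "absv (z $ l) \<le> a l" for l
          using 1 amono[OF 1(3)] a[of l] by (cases "l = i"; cases "l = j") (auto simp: z_def axis_def a_def less_imp_le)
        ultimately show ?thesis by blast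
      next
        case (2 j k)
        then have ne: "i \<noteq> j" "i \<noteq> k" "j \<noteq> k" by auto
        define r where "r = \<rho> (\<delta> $ i)"
        \<comment> \<open>The coefficients are, up to sign, the 2 by 2 minors of the rows
          \<open>1\<close> and \<open>w\<close> in the columns \<open>i\<close>, \<open>j\<close>,
          \<open>k\<close>.\<close>
        define z :: "'k ^ 'n" where "z = axis i (of_int (w $ j - w $ k) * r) + axis j (of_int (w $ k - w $ i) * r) +
            axis k (of_int (w $ i - w $ j) * r)"
        have idz: "idot m z = (of_int (m $ i * (w $ j - w $ k) + m $ j * (w $ k - w $ i) + m $ k * (w $ i - w $ j))) * r" for m
        proof -
          have s: "idot m (axis p r) = of_int (m $ p) * r" for p and r :: 'k
          proof -
            have "idot m (axis p r) = (\<Sum>q\<in>UNIV. if q = p then of_int (m $ q) * r else 0)"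
              unfolding idot_def by (intro sum.cong) (auto simp: axis_def)
            then show ?thesis by simp
          qed
          show ?thesis unfolding z_def idot_add_right s by (simp add: algebra_simps)
        qed
        have "idot 1 z = 0" by (simp add: idz)
        moreover have "idot w z = 0" unfolding idz by (simp add: algebra_simps)
        moreover have "absv (z $ i) = a i" "absv (z $ j) = a i" "absv (z $ k) = a i"
          using ne 2 by (simp_all add: z_def axis_def absv_mult absv_of_int a_def r_def del: of_int_diff)
        moreover have "z $ l = 0" if "l \<noteq> i" "l \<noteq> j" "l \<noteq> k" for l using that by (simp add: z_def axis_def)
        moreover have "absv (z $ l) \<le> a l" for l
        proof -
          consider "l = i" | "l = j" | "l = k" | "l \<noteq> i" "l \<noteq> j" "l \<noteq> k" by blast
          then show ?thesis
          proof cases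
            case 1
            then show ?thesis using calculation(3) by simp
          next
            case 2
            then show ?thesis using calculation(4) amono \<open>\<delta> $ j \<le> \<delta> $ i\<close> by simp
          next
            case 3
            then show ?thesis using calculation(5) amono \<open>\<delta> $ k \<le> \<delta> $ i\<close> by simp
          next
            case 4
            then show ?thesis using calculation(6) a[of l] by simp
          qed
        qed
        ultimately show ?thesis by blast
      qed
    qed
    then obtain z :: "'n \<Rightarrow> 'k ^ 'n" where z: "\<And>i. idot 1 (z i) = 0" "\<And>i. idot w (z i) = 0" "\<And>i. absv (z i $ i) = a i"
      "\<And>i l. absv (z i $ l) \<le> a l" by metis
    obtain c where c: "\<And>l. absv (\<Sum>i\<in>UNIV. c i * z i $ l) = a l"
      using generic_combination[OF a z(3,4)] by blast
    define x where "x = (\<chi> l. \<Sum>i\<in>UNIV. c i * z i $ l)"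
    have xl: "absv (x $ l) = a l" for l using c by (simp add: x_def)
    have xnz: "x $ l \<noteq> 0" for l using xl[of l] a[of l] by auto
    have idx: "idot m x = (\<Sum>i\<in>UNIV. c i * idot m (z i))" for m
      unfolding idot_def x_def by (simp add: sum_distrib_left mult_ac) (rule sum.swap)
    have "x \<in> {l. idot 1 l = 0 \<and> idot w l = 0} \<inter> torus"
      using xnz unfolding torus_def by (simp add: idx z)
    then have "trop_pt val x + 0 *\<^sub>R 1 \<in> trop_vals {l :: 'k ^ 'n. idot 1 l = 0 \<and> idot w l = 0}"
      unfolding trop_vals_def by blast
    moreover have "dist (trop_pt val x) \<delta> < e"
    proof -
      have "\<bar>(trop_pt val x - \<delta>) $ l\<bar> < e'" for l
      proof -
        have "vl (x $ l) = vl (\<rho> (\<delta> $ l))" using xl[of l] xnz \<rho>(1) by (simp add: vl_eq_iff_absv a_def)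
        then show ?thesis using \<rho>(2)[of "\<delta> $ l"] by (simp add: trop_pt_vl)
      qed
      then have "(\<Sum>l\<in>UNIV. \<bar>(trop_pt val x - \<delta>) $ l\<bar>) < (\<Sum>l\<in>(UNIV :: 'n set). e')" by (intro sum_strict_mono) auto
      also have "\<dots> = e" by (simp add: e'_def)
      finally show ?thesis using norm_le_l1_cart[of "trop_pt val x - \<delta>"] by (simp add: dist_norm)
    qed
    ultimately show "\<exists>y\<in>trop_vals {l :: 'k ^ 'n. idot 1 l = 0 \<and> idot w l = 0}. dist y \<delta> < e" by force
  qed
qed

text \<open>If \<open>\<delta>\<close> is not constant, the three-term conditions leave only one
  level set of \<open>w\<close> above the minimum \<open>m\<close>. Up to a factor \<open>M\<close>
  of valuation near \<open>m\<close>, the vector with coordinates \<open>H + w $ q - w $ a\<close>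
  realizes \<open>\<delta>\<close> approximately, where \<open>vl H\<close> is near the gap.\<close>

lemma Btan_subset_trop:
  fixes w :: "int ^ 'n::finite"
  shows "Btan w \<subseteq> closure (trop_vals {x :: 'k ^ 'n. \<exists>s t. x = (\<chi> q. s + t * of_int (w $ q))})"
proof
  fix \<delta> assume \<delta>: "\<delta> \<in> Btan w"
  have same: "\<delta> $ i = \<delta> $ j" if "w $ i = w $ j" for i j using \<delta> that unfolding Btan_def by blast
  have tri: "min_twice {i, j, k} (\<lambda>i. \<delta> $ i)" if "w $ i \<noteq> w $ j" "w $ i \<noteq> w $ k" "w $ j \<noteq> w $ k" for i j k
    using \<delta> that unfolding Btan_def by blast
  define m where "m = Min (range (\<lambda>i. \<delta> $ i))"
  have mle: "m \<le> \<delta> $ i" for i unfolding m_def by (intro Min_le) auto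
  obtain i0 where i0: "\<delta> $ i0 = m"
  proof -
    have "m \<in> range (\<lambda>i. \<delta> $ i)" unfolding m_def by (intro Min_in) auto
    then show thesis using that by blast
  qed
  show "\<delta> \<in> closure (trop_vals {x :: 'k ^ 'n. \<exists>s t. x = (\<chi> q. s + t * of_int (w $ q))})"
    unfolding closure_approachable
  proof (intro allI impI)
    fix e :: real assume "e > 0"
    define e' where "e' = e / CARD('n)"
    have e': "e' > 0" using \<open>e > 0\<close> by (simp add: e'_def)
    define e1 where "e1 = e' / 2"
    have e1: "e1 > 0" using e' by (simp add: e1_def)
    obtain \<rho> :: "real \<Rightarrow> 'k" where \<rho>: "\<And>r. \<rho> r \<noteq> 0" "\<And>r. \<bar>vl (\<rho> r) - r\<bar> < e1"
      "\<And>r s. r \<le> s \<Longrightarrow> vl (\<rho> r) \<le> vl (\<rho> s)"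
      using approximate_valuations[OF e1] by blast
    have "\<exists>s t :: 'k. \<forall>q. s + t * of_int (w $ q) \<noteq> 0 \<and> \<bar>vl (s + t * of_int (w $ q)) - \<delta> $ q\<bar> < e'"
    proof (cases "\<forall>i. \<delta> $ i = m")
      case True
      have "\<bar>vl (\<rho> m) - m\<bar> < e'" using \<rho>(2)[of m] e1 by (simp add: e1_def)
      then show ?thesis using True \<rho>(1) by (intro exI[of _ "\<rho> m"] exI[of _ 0]) auto
    next
      case False
      then obtain a where a: "\<delta> $ a \<noteq> m" by blast
      have gt: "m < \<delta> $ a" using mle[of a] a by simp
      have wa0: "w $ a \<noteq> w $ i0" using same a i0 by metis
      have others: "\<delta> $ i = m" if "w $ i \<noteq> w $ a" for i
      proof (cases "w $ i = w $ i0")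
        case True
        then show ?thesis using same i0 by metis
      next
        case False
        then have "min_twice {i, a, i0} (\<lambda>i. \<delta> $ i)" using tri that wa0 by blast
        then show ?thesis using i0 gt mle[of i] unfolding min_twice_def by force
      qed
      have ina: "\<delta> $ i = \<delta> $ a" if "w $ i = w $ a" for i using same that by blast
      \<comment> \<open>The second bound keeps \<open>vl H\<close> positive, so that
        \<open>H\<close> does not disturb the nonzero integers \<open>w $ q - w $ a\<close>.\<close>
      have e2: "min e1 (\<delta> $ a - m) > 0" using e1 gt by simp
      obtain \<rho>' :: "real \<Rightarrow> 'k" where \<rho>': "\<And>r. \<rho>' r \<noteq> 0" "\<And>r. \<bar>vl (\<rho>' r) - r\<bar> < min e1 (\<delta> $ a - m)"
        "\<And>r s. r \<le> s \<Longrightarrow> vl (\<rho>' r) \<le> vl (\<rho>' s)"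
        using approximate_valuations[OF e2] by blast
      define M H where "M = \<rho> m" and "H = \<rho>' (\<delta> $ a - m)"
      have nz: "H \<noteq> 0" "M \<noteq> 0" using \<rho>(1) \<rho>'(1) by (auto simp: H_def M_def)
      have vH: "\<bar>vl H - (\<delta> $ a - m)\<bar> < e1" "0 < vl H" using \<rho>'(2)[of "\<delta> $ a - m"] by (auto simp: H_def)
      have vM: "\<bar>vl M - m\<bar> < e1" using \<rho>(2) by (simp add: M_def)
      have H1: "absv H < 1" using vH(2) nz by (simp add: absv_def)
      have eq: "M * (H - of_int (w $ a)) + M * of_int (w $ q) = M * (H + of_int (w $ q - w $ a))" for q
        by (simp add: algebra_simps)
      have "M * (H + of_int (w $ q - w $ a)) \<noteq> 0 \<and> \<bar>vl (M * (H + of_int (w $ q - w $ a))) - \<delta> $ q\<bar> < e'" for q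
      proof (cases "w $ q = w $ a")
        case True
        have "\<bar>vl M + vl H - \<delta> $ a\<bar> < e1 + e1" using vH(1) vM by linarith
        then have "\<bar>vl M + vl H - \<delta> $ a\<bar> < e'" by (simp add: e1_def)
        then show ?thesis using nz ina[OF True] True by (simp add: vl_mult)
      next
        case False
        have "absv (H + of_int (w $ q - w $ a)) = 1"
          using absv_add_eq[of H "of_int (w $ q - w $ a)"] absv_of_int[of "w $ q - w $ a"] H1 False by simp
        moreover from this have "H + of_int (w $ q - w $ a) \<noteq> 0" by (metis absv_0 zero_neq_one)
        ultimately have "H + of_int (w $ q - w $ a) \<noteq> 0" "vl (H + of_int (w $ q - w $ a)) = 0"
          using vl_absv[of "H + of_int (w $ q - w $ a)"] by simp_all
        then show ?thesis using nz vM others[OF False] e1 by (simp add: vl_mult e1_def del: of_int_diff)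
      qed
      then show ?thesis unfolding eq [symmetric] by blast
    qed
    then obtain s t :: 'k where st: "\<And>q. s + t * of_int (w $ q) \<noteq> 0" "\<And>q. \<bar>vl (s + t * of_int (w $ q)) - \<delta> $ q\<bar> < e'" by blast
    define x :: "'k ^ 'n" where "x = (\<chi> q. s + t * of_int (w $ q))"
    have "x \<in> {x. \<exists>s t. x = (\<chi> q. s + t * of_int (w $ q))} \<inter> torus"
      using st(1) unfolding torus_def x_def by auto
    then have "trop_pt val x + 0 *\<^sub>R 1 \<in> trop_vals {x :: 'k ^ 'n. \<exists>s t. x = (\<chi> q. s + t * of_int (w $ q))}"
      unfolding trop_vals_def by blast
    moreover have "dist (trop_pt val x) \<delta> < e"
    proof -
      have "\<bar>(trop_pt val x - \<delta>) $ l\<bar> < e'" for l using st(2)[of l] by (simp add: trop_pt_vl x_def)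
      then have "(\<Sum>l\<in>UNIV. \<bar>(trop_pt val x - \<delta>) $ l\<bar>) < (\<Sum>l\<in>(UNIV :: 'n set). e')" by (intro sum_strict_mono) auto
      also have "\<dots> = e" by (simp add: e'_def)
      finally show ?thesis using norm_le_l1_cart[of "trop_pt val x - \<delta>"] by (simp add: dist_norm)
    qed
    ultimately show "\<exists>y\<in>trop_vals {x :: 'k ^ 'n. \<exists>s t. x = (\<chi> q. s + t * of_int (w $ q))}. dist y \<delta> < e" by force
  qed
qed

end

section \<open>Invariance under adding multiples of the all-ones vector\<close>

lemma min_twice_add_1: "min_twice A (($) (x + s *\<^sub>R 1)) \<longleftrightarrow> min_twice A (($) x)"
proof -
  have "($) (x + s *\<^sub>R 1) = (\<lambda>i. x $ i + s)" by (rule ext) simp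
  then show ?thesis by (simp only: min_twice_shift)
qed

lemma Bdual_shift: "x \<in> Bdual w \<Longrightarrow> x + s *\<^sub>R 1 \<in> Bdual w"
  unfolding Bdual_def mem_Collect_eq min_twice_add_1 .

lemma Btan_eqD: "x \<in> Btan w \<Longrightarrow> w $ i = w $ j \<Longrightarrow> x $ i = x $ j"
  unfolding Btan_def mem_Collect_eq by (drule conjunct1, drule spec, drule spec, drule mp)

lemma Btan_min_twiceD:
  "x \<in> Btan w \<Longrightarrow> w $ i \<noteq> w $ j \<Longrightarrow> w $ i \<noteq> w $ k \<Longrightarrow> w $ j \<noteq> w $ k \<Longrightarrow> min_twice {i, j, k} (($) x)"
  unfolding Btan_def mem_Collect_eq by (drule conjunct2) iprover

lemma BtanI:
  assumes "\<And>i j. w $ i = w $ j \<Longrightarrow> x $ i = x $ j"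
    and "\<And>i j k. w $ i \<noteq> w $ j \<Longrightarrow> w $ i \<noteq> w $ k \<Longrightarrow> w $ j \<noteq> w $ k \<Longrightarrow> min_twice {i, j, k} (($) x)"
  shows "x \<in> Btan w"
  unfolding Btan_def mem_Collect_eq by (intro conjI allI impI) (erule assms, rule assms(2))

lemma Btan_shift:
  assumes "x \<in> Btan w"
  shows "x + s *\<^sub>R 1 \<in> Btan w"
proof (rule BtanI)
  show "(x + s *\<^sub>R 1) $ i = (x + s *\<^sub>R 1) $ j" if "w $ i = w $ j" for i j
    using Btan_eqD[OF assms that] by simp
  show "min_twice {i, j, k} (($) (x + s *\<^sub>R 1))"
    if "w $ i \<noteq> w $ j" "w $ i \<noteq> w $ k" "w $ j \<noteq> w $ k" for i j k
    unfolding min_twice_add_1 by (rule Btan_min_twiceD[OF assms that])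
qed

section \<open>Contributions of the points of an edge\<close>

text \<open>Some term is finite, so the infinite ones cannot attain the minimum.\<close>

lemma min_attained_twice_iff:
  assumes BA: "B \<subseteq> A" and B: "B \<noteq> {}" and fin: "\<And>i. i \<in> B \<Longrightarrow> G i = ereal (H i)"
    and inf: "\<And>i. i \<in> A \<Longrightarrow> i \<notin> B \<Longrightarrow> G i = \<infinity>"
  shows "min_attained_twice A G \<longleftrightarrow> min_twice B H"
proof
  assume "min_attained_twice A G"
  then obtain a b where ab: "a \<in> A" "b \<in> A" "a \<noteq> b" "G a = G b" "\<forall>c\<in>A. G a \<le> G c"
    unfolding min_attained_twice_def by blast
  obtain c where c: "c \<in> B" using B by blast
  then have "G a \<le> ereal (H c)" using ab(5) BA fin by force
  then have "G a \<noteq> \<infinity>" by auto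
  then have "a \<in> B" "b \<in> B" using inf[OF ab(1)] inf[OF ab(2)] ab(4) by metis+
  note aB = this
  show "min_twice B H"
  proof (rule min_twiceI[OF aB ab(3)])
    show "H a = H b" using ab(4) fin aB by simp
    show "H a \<le> H c" if "c \<in> B" for c
    proof -
      have "G a \<le> G c" using ab(5) that BA by blast
      then show ?thesis using fin aB that by simp
    qed
  qed
next
  assume "min_twice B H"
  then obtain a b where ab: "a \<in> B" "b \<in> B" "a \<noteq> b" "H a = H b" "\<forall>c\<in>B. H a \<le> H c"
    by (rule min_twiceE)
  show "min_attained_twice A G" unfolding min_attained_twice_def
  proof (rule bexI[of _ a], rule bexI[of _ b], intro conjI ballI)
    show "G a = G b" using fin ab by simp
    show "G a \<le> G c" if "c \<in> A" for c
    proof (cases "c \<in> B")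
      case True
      then show ?thesis using ab fin by simp
    next
      case False
      then show ?thesis using inf that by simp
    qed
  qed (use ab BA in auto)
qed

locale curve_edge = tropical_edge val I F v y g h w D
  for val :: "'k::{alg_closed_field, field_char_0} \<Rightarrow> ereal" and I F v y g h and w :: "int ^ 'n::finite" and D +
  fixes X :: "('k ^ 'n) set" and f :: "nat \<Rightarrow> ('n, 'k) laurent" and E :: "(real ^ 'n) set"
  assumes ci: "torus_complete_intersection I f (X \<inter> torus)"
    and f_torus: "i \<in> I \<Longrightarrow> f i \<in> torus_functions"
    and F_f: "i \<in> I \<Longrightarrow> \<exists>a u. a \<noteq> 0 \<and> u \<in> char_lattice \<and> F i = Poly_Mapping.single u a * f i"
    and E_eq: "E = {x. \<forall>i\<in>I. term_val val (F i) x (v i) = 0 \<and> (\<forall>m\<in>Poly_Mapping.keys (F i). 0 \<le> term_val val (F i) x m)}"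
    and E_ri: "rel_interior E \<noteq> {}" and E_convex: "convex E"
    and E_strict: "x \<in> rel_interior E \<Longrightarrow> i \<in> I \<Longrightarrow> m \<in> Poly_Mapping.keys (F i) \<Longrightarrow> m \<noteq> 0 \<Longrightarrow> m \<noteq> v i \<Longrightarrow>
      0 < term_val val (F i) x m"
    and transversal: "card J = 2 \<Longrightarrow> direction_span E \<inter> coord_span (- J) = span {1} \<or>
           direction_span (trop val X) \<subseteq> coord_span (- J)"
begin

lemma F_zero_iff:
  assumes "P \<in> torus" "i \<in> I"
  shows "leval (F i) P = 0 \<longleftrightarrow> leval (f i) P = 0"
proof -
  obtain a u where "a \<noteq> 0" "F i = Poly_Mapping.single u a * f i" using F_f[OF assms(2)] by blast
  then show ?thesis using assms(1) by (simp add: leval_mult leval_single)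
qed

lemma X_torus: "X \<inter> torus = {x \<in> torus. \<forall>f\<in>F ` I. leval f x = 0}"
proof -
  have "X \<inter> torus = torus \<inter> (\<Inter>i\<in>I. torus_zeros (f i))" using ci unfolding torus_complete_intersection_def by blast
  also have "\<dots> = {x \<in> torus. \<forall>i\<in>I. leval (f i) x = 0}" unfolding torus_zeros_def by blast
  also have "\<dots> = {x \<in> torus. \<forall>f\<in>F ` I. leval f x = 0}" using F_zero_iff by blast
  finally show ?thesis .
qed

lemma ri_inner: "x \<in> rel_interior E \<Longrightarrow> inner_pt x"
  unfolding inner_pt_def other_keys_def
proof (intro ballI conjI)
  assume x: "x \<in> rel_interior E"
  fix i assume i: "i \<in> I"
  have "x \<in> E" using x rel_interior_subset by blast
  then show "term_val val (F i) x (v i) = 0" using i unfolding E_eq by blast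
  show "0 < term_val val (F i) x m" if "m \<in> Poly_Mapping.keys (F i) - {0, v i}" for m
    using E_strict[OF x i] that by blast
qed

lemma key_char_lattice: "i \<in> I \<Longrightarrow> m \<in> Poly_Mapping.keys (F i) \<Longrightarrow> m \<in> char_lattice"
  using torus_functionsD[OF F_torus] by (simp add: char_lattice_def)

lemma term_val_0: "i \<in> I \<Longrightarrow> term_val val (F i) x 0 = 0"
  using F_0 by (simp add: term_val_vl rvec_def inner_vec_def)

lemma inner_E: "inner_pt x \<Longrightarrow> x \<in> E"
  unfolding E_eq
proof (intro CollectI ballI conjI)
  assume x: "inner_pt x"
  fix i assume i: "i \<in> I"
  show z: "term_val val (F i) x (v i) = 0" using x i unfolding inner_pt_def by blast
  fix m assume "m \<in> Poly_Mapping.keys (F i)"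
  then consider "m = 0" | "m = v i" | "m \<in> other_keys i" unfolding other_keys_def by blast
  then show "0 \<le> term_val val (F i) x m"
  proof cases
    case 3
    then show ?thesis using x i unfolding inner_pt_def by force
  qed (use z term_val_0[OF i] in auto)
qed

text \<open>The strict inequalities define an open set, and the equations of \<open>E\<close>
  persist on its affine hull.\<close>

lemma inner_ri:
  assumes x: "inner_pt x"
  shows "x \<in> rel_interior E"
proof -
  define U where "U = (\<Inter>i\<in>I. \<Inter>m\<in>other_keys i. {z. 0 < term_val val (F i) z m})"
  have "open U" unfolding U_def term_val_vl other_keys_def
    by (intro open_INT fI finite_Diff finite_keys ballI open_Collect_less continuous_intros)
  moreover have "x \<in> U" using x unfolding U_def inner_pt_def by blast
  moreover have "U \<inter> affine hull E \<subseteq> E"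
  proof
    fix z assume z: "z \<in> U \<inter> affine hull E"
    define A where "A = (\<Inter>i\<in>I. {z. rvec (v i) \<bullet> z = - vl (Poly_Mapping.lookup (F i) (v i))})"
    have "affine A" unfolding A_def by (intro affine_Inter) (auto simp: affine_hyperplane)
    moreover have "E \<subseteq> A" unfolding A_def E_eq term_val_vl by (auto simp: add_eq_0_iff)
    ultimately have "affine hull E \<subseteq> A" by (simp add: hull_minimal)
    then have "z \<in> A" using z by blast
    then have "inner_pt z" using z unfolding inner_pt_def A_def U_def by (auto simp: term_val_vl)
    then show "z \<in> E" by (rule inner_E)
  qed
  ultimately show ?thesis unfolding rel_interior using inner_E[OF x] by blast
qed

lemma E_plane:
  assumes "w0 \<in> E" "e \<in> E"
  shows "\<exists>s t. e = w0 + s *\<^sub>R 1 + t *\<^sub>R rvec w"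
proof -
  have "rvec (v i) \<bullet> (e - w0) = 0" if i: "i \<in> I" for i
  proof -
    have "term_val val (F i) e (v i) = 0" "term_val val (F i) w0 (v i) = 0" using assms i unfolding E_eq by blast+
    then show ?thesis by (simp add: term_val_vl inner_diff_right)
  qed
  then obtain s t where "e - w0 = s *\<^sub>R 1 + t *\<^sub>R rvec w" using real_kernel by blast
  then have "e = w0 + s *\<^sub>R 1 + t *\<^sub>R rvec w" by (simp add: algebra_simps)
  then show ?thesis by blast
qed

lemma closed_contribution:
  assumes "polycone B" "\<And>x s. x \<in> B \<Longrightarrow> x + s *\<^sub>R 1 \<in> B"
  shows "closed {\<gamma>. \<exists>e\<in>E. \<gamma> + \<sigma> *\<^sub>R e \<in> B}"
proof -
  obtain w0 where w0: "w0 \<in> E" using E_ri rel_interior_subset by blast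
  \<comment> \<open>The inserted element reverses the inequality of the key \<open>v i\<close>, so
    that both together express the equation.\<close>
  define KE where "KE = (\<Union>i\<in>I. insert (- vl (Poly_Mapping.lookup (F i) (v i)), - rvec (v i))
    ((\<lambda>m. (vl (Poly_Mapping.lookup (F i) m), rvec m)) ` Poly_Mapping.keys (F i)))"
  show ?thesis
  proof (rule closed_polycone_sweep[OF assms, where KE = KE and u = "rvec w" and ?w0.0 = w0])
    show "finite KE" unfolding KE_def using fI by simp
    show "E = {x. \<forall>(\<beta>, a)\<in>KE. 0 \<le> \<beta> + a \<bullet> x}"
      unfolding E_eq KE_def term_val_vl
    proof (intro Collect_cong iffI)
      fix x
      assume *: "\<forall>i\<in>I. vl (Poly_Mapping.lookup (F i) (v i)) + rvec (v i) \<bullet> x = 0 \<and>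
        (\<forall>m\<in>Poly_Mapping.keys (F i). 0 \<le> vl (Poly_Mapping.lookup (F i) m) + rvec m \<bullet> x)"
      have "0 \<le> - vl (Poly_Mapping.lookup (F i) (v i)) + - rvec (v i) \<bullet> x" if "i \<in> I" for i
      proof -
        have "vl (Poly_Mapping.lookup (F i) (v i)) + rvec (v i) \<bullet> x = 0" using * that by blast
        then show ?thesis by simp
      qed
      then show "\<forall>(\<beta>, a)\<in>(\<Union>i\<in>I. insert (- vl (Poly_Mapping.lookup (F i) (v i)), - rvec (v i))
         ((\<lambda>m. (vl (Poly_Mapping.lookup (F i) m), rvec m)) ` Poly_Mapping.keys (F i))). 0 \<le> \<beta> + a \<bullet> x"
        using * by auto
    next
      fix x
      assume *: "\<forall>(\<beta>, a)\<in>(\<Union>i\<in>I. insert (- vl (Poly_Mapping.lookup (F i) (v i)), - rvec (v i))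
         ((\<lambda>m. (vl (Poly_Mapping.lookup (F i) m), rvec m)) ` Poly_Mapping.keys (F i))). 0 \<le> \<beta> + a \<bullet> x"
      show "\<forall>i\<in>I. vl (Poly_Mapping.lookup (F i) (v i)) + rvec (v i) \<bullet> x = 0 \<and>
        (\<forall>m\<in>Poly_Mapping.keys (F i). 0 \<le> vl (Poly_Mapping.lookup (F i) m) + rvec m \<bullet> x)"
      proof (intro ballI conjI)
        fix i assume i: "i \<in> I"
        have "0 \<le> - vl (Poly_Mapping.lookup (F i) (v i)) + - rvec (v i) \<bullet> x" using * i by auto
        moreover show k: "0 \<le> vl (Poly_Mapping.lookup (F i) m) + rvec m \<bullet> x" if "m \<in> Poly_Mapping.keys (F i)" for m
          using * i that by auto
        ultimately show "vl (Poly_Mapping.lookup (F i) (v i)) + rvec (v i) \<bullet> x = 0"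
          using k[OF v_key[OF i]] by simp
      qed
    qed
    fix \<beta> a assume "(\<beta>, a) \<in> KE"
    then obtain i m where "i \<in> I" "m \<in> Poly_Mapping.keys (F i)" "a = rvec m \<or> a = - rvec m"
      unfolding KE_def using v_key by blast
    then show "a \<bullet> 1 = 0" using rvec_char_lattice[OF key_char_lattice] by auto
  next
    show "\<exists>s t. e = w0 + s *\<^sub>R 1 + t *\<^sub>R rvec w" if "e \<in> E" for e by (rule E_plane[OF w0 that])
  qed
qed

lemma coord_span_pair:
  fixes i j :: 'n
  assumes "i \<noteq> j"
  shows "coord_span (- {i, j}) = {d. d $ i = d $ j}"
proof (intro equalityI subsetI)
  fix d assume d: "d \<in> coord_span (- {i, j})"
  have "subspace {d :: real ^ 'n. d $ i = d $ j}" by (auto simp: subspace_def)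
  moreover have "(\<lambda>i. axis i 1) ` (- {i, j}) \<union> {1} \<subseteq> {d :: real ^ 'n. d $ i = d $ j}" by (auto simp: axis_def)
  ultimately show "d \<in> {d. d $ i = d $ j}" using d span_minimal unfolding coord_span_def by blast
next
  fix d :: "real ^ 'n" assume d: "d \<in> {d. d $ i = d $ j}"
  have "d = (d $ i) *\<^sub>R 1 + (\<Sum>k\<in>- {i, j}. (d $ k - d $ i) *\<^sub>R axis k 1)"
  proof (subst vec_eq_iff, intro allI)
    fix q
    have "(\<Sum>k\<in>- {i, j}. (d $ k - d $ i) * (if k = q then 1 else 0)) = (if q \<in> - {i, j} then d $ q - d $ i else 0)"
      by (simp add: if_distrib cong: if_cong)
    then have "(\<Sum>k\<in>- {i, j}. (d $ k - d $ i) *\<^sub>R axis k 1) $ q = (if q \<in> - {i, j} then d $ q - d $ i else 0)"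
      by (simp add: axis_def eq_commute)
    then show "d $ q = ((d $ i) *\<^sub>R 1 + (\<Sum>k\<in>- {i, j}. (d $ k - d $ i) *\<^sub>R axis k 1)) $ q" using d by auto
  qed
  also have "\<dots> \<in> coord_span (- {i, j})"
    unfolding coord_span_def by (intro span_add span_scale span_sum span_base) auto
  finally show "d \<in> coord_span (- {i, j})" .
qed

section \<open>Pairs of coordinates with equal slopes\<close>

lemma rvec_w_direction: "rvec w \<in> direction_span E"
proof -
  obtain x where x: "x \<in> rel_interior E" using E_ri by blast
  obtain b where b: "b > 0" "\<And>s. \<bar>s\<bar> < b \<Longrightarrow> inner_pt (x + s *\<^sub>R rvec w)" using inner_pt_shift[OF ri_inner[OF x]] by blast
  have "inner_pt (x + (b / 2) *\<^sub>R rvec w)" using b by simp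
  then have "x + (b / 2) *\<^sub>R rvec w \<in> E" "x \<in> E" using inner_E ri_inner[OF x] by blast+
  then have "(x + (b / 2) *\<^sub>R rvec w) - x \<in> direction_span E" unfolding direction_span_def by (intro span_base) blast
  then have "(2 / b) *\<^sub>R ((x + (b / 2) *\<^sub>R rvec w) - x) \<in> direction_span E" unfolding direction_span_def by (rule span_scale)
  then show ?thesis using b(1) by simp
qed

lemma rvec_w_nonconst: "rvec w \<notin> span {1}"
proof
  assume "rvec w \<in> span {1}"
  then obtain c where "rvec w = c *\<^sub>R 1" unfolding span_singleton by blast
  then have "real_of_int (w $ p) = c" for p by (simp add: vec_eq_iff rvec_def)
  then have "w $ p = w $ q" for p q by (metis of_int_eq_iff)
  then show False using w_nonconst by blast
qed

lemma trop_pt_in_trop: "x \<in> X \<inter> torus \<Longrightarrow> trop_pt val x \<in> trop val X"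
proof -
  assume x: "x \<in> X \<inter> torus"
  have "trop_pt val x = trop_pt val x + 0 *\<^sub>R 1" by simp
  then have "trop_pt val x \<in> trop_vals X" unfolding trop_vals_def using x by blast
  then show ?thesis unfolding trop_trop_vals by (rule subsetD[OF closure_subset])
qed

text \<open>If \<open>w $ i = w $ j\<close>, then \<open>w\<close> lies in the direction space of
  \<open>E\<close> and in the coordinate space of the complement without being a multiple of
  \<open>1\<close>. So the first alternative of \<open>transversal\<close> fails, and the second one
  bounds all differences of points of the tropical curve.\<close>

lemma constant_ratio:
  assumes ij: "i \<noteq> j" "w $ i = w $ j" and x: "x \<in> X \<inter> torus" "x' \<in> X \<inter> torus"
  shows "vl (x $ i) - vl (x $ j) = vl (x' $ i) - vl (x' $ j)"
proof -
  have c: "card {i, j} = 2" using ij by simp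
  have "rvec w \<in> direction_span E \<inter> coord_span (- {i, j})"
    using rvec_w_direction ij unfolding coord_span_pair[OF ij(1)] by (simp add: rvec_def)
  then have "direction_span (trop val X) \<subseteq> coord_span (- {i, j})"
    using transversal[OF c] rvec_w_nonconst by blast
  moreover have "trop_pt val x - trop_pt val x' \<in> direction_span (trop val X)"
    unfolding direction_span_def using trop_pt_in_trop x by (intro span_base) blast
  ultimately have "trop_pt val x - trop_pt val x' \<in> {d. d $ i = d $ j}" unfolding coord_span_pair[OF ij(1)] by blast
  then show ?thesis by (simp add: trop_pt_vl)
qed

text \<open>If \<open>x\<^sub>i / x\<^sub>j\<close> has constant valuation on the curve, it has finitely many values, so its
  differential vanishes on all tangent lines.\<close>

lemma equal_slopes:
  assumes ij: "w $ i = w $ j" and P: "P \<in> X" "P \<in> torus" and y: "yy \<in> tangent_space X P"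
  shows "yy $ i / P $ i = yy $ j / P $ j"
proof (cases "i = j")
  case False
  define u where "u = (axis i 1 - axis j 1 :: int ^ 'n)"
  define \<theta> where "\<theta> = (Poly_Mapping.single u 1 :: ('n, 'k) laurent)"
  have uc: "u \<in> char_lattice" by (simp add: u_def char_lattice_def sum_subtractf axis_def)
  have mu: "mon x u = x $ i / x $ j" if "x \<in> torus" for x :: "'k ^ 'n"
    using mon_add[OF that, of "axis i 1" "- axis j 1"] mon_minus[OF that, of "axis j 1"]
    by (simp add: u_def mon_axis divide_inverse)
  have \<theta>: "leval \<theta> x = x $ i / x $ j" if "x \<in> torus" for x using mu[OF that] by (simp add: \<theta>_def leval_single)
  define Z where "Z = {x \<in> torus. \<forall>f\<in>F ` I. leval f x = 0}"
  have ZX: "Z = X \<inter> torus" unfolding Z_def using X_torus by simp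
  define \<kappa> where "\<kappa> = vl (P $ i) - vl (P $ j)"
  have vl\<theta>: "vl (leval \<theta> x) = \<kappa>" if x: "x \<in> Z" for x
  proof -
    have xt: "x \<in> torus" using x ZX by blast
    have "vl (x $ i / x $ j) = vl (x $ i) - vl (x $ j)"
      unfolding divide_inverse using xt by (simp add: vl_mult vl_inverse)
    moreover have "vl (x $ i) - vl (x $ j) = \<kappa>"
      unfolding \<kappa>_def using x P ZX by (intro constant_ratio False ij) blast+
    ultimately show ?thesis using \<theta>[OF xt] by simp
  qed
  \<comment> \<open>Powers of an element of positive valuation have distinct valuations, so a
    cofinite set of values would contain one of valuation different from
    \<open>\<kappa>\<close>.\<close>
  have "\<not> (\<exists>a. a \<noteq> 0 \<and> (\<forall>t. poly a t \<noteq> 0 \<longrightarrow> (\<exists>x\<in>Z. leval \<theta> x = t)))"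
  proof
    assume "\<exists>a. a \<noteq> 0 \<and> (\<forall>t. poly a t \<noteq> 0 \<longrightarrow> (\<exists>x\<in>Z. leval \<theta> x = t))"
    then obtain a :: "'k poly" where a: "a \<noteq> 0" "\<And>t. poly a t \<noteq> 0 \<Longrightarrow> \<exists>x\<in>Z. leval \<theta> x = t" by blast
    obtain \<mu> where \<mu>: "\<mu> \<noteq> 0" "0 < vl \<mu>" using ex_vl_small[of 1] by auto
    have inj: "inj (\<lambda>k::nat. \<mu> ^ k)"
    proof (rule injI)
      fix k l :: nat assume "\<mu> ^ k = \<mu> ^ l"
      then have "of_nat k * vl \<mu> = of_nat l * vl \<mu>" using vl_power[OF \<mu>(1)] by metis
      then show "k = l" using \<mu>(2) by simp
    qed
    have "finite {t. poly a t = 0}" using poly_roots_finite[OF a(1)] .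
    then have f1: "finite {k::nat. poly a (\<mu> ^ k) = 0}"
      using finite_vimageI[OF _ inj, of "{t. poly a t = 0}"] by (simp add: vimage_def)
    have "{k::nat. of_nat k * vl \<mu> = \<kappa>} \<subseteq> {nat \<lfloor>\<kappa> / vl \<mu>\<rfloor>}" using \<mu>(2) by auto
    then have "finite {k::nat. of_nat k * vl \<mu> = \<kappa>}" using finite_subset by blast
    then have "finite ({k::nat. poly a (\<mu> ^ k) = 0} \<union> {k::nat. of_nat k * vl \<mu> = \<kappa>})" using f1 by simp
    then obtain k :: nat where k: "k \<notin> {k::nat. poly a (\<mu> ^ k) = 0} \<union> {k::nat. of_nat k * vl \<mu> = \<kappa>}"
      using ex_new_if_finite infinite_UNIV_nat by blast
    then obtain x where x: "x \<in> Z" "leval \<theta> x = \<mu> ^ k" using a(2) by blast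
    then have "of_nat k * vl \<mu> = \<kappa>" using vl\<theta>[OF x(1)] vl_power[OF \<mu>(1), of k] by simp
    then show False using k by blast
  qed
  then have fin: "finite ((\<lambda>x. leval \<theta> x) ` Z)" using finite_or_cofinite_values[of \<theta> "F ` I"] unfolding Z_def by blast
  define S where "S = (\<lambda>x. leval \<theta> x) ` Z"
  have fS: "finite S" using fin by (simp add: S_def)
  \<comment> \<open>\<open>H\<close> vanishes on the curve because \<open>\<theta>\<close> takes
    only the values in \<open>S\<close>. At \<open>P\<close> exactly one factor vanishes, so the
    derivative of \<open>H\<close> is that of \<open>\<theta>\<close> times a nonzero
    number.\<close>
  define H where "H = (\<Prod>t\<in>S. \<theta> - cst t)"
  define t0 where "t0 = leval \<theta> P"
  have t0S: "t0 \<in> S" unfolding S_def t0_def using P ZX by blast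
  define \<zeta> where "\<zeta> = (\<chi> q. yy $ q / P $ q)"
  have HT: "H \<in> torus_functions"
    unfolding H_def \<theta>_def cst_def
    by (intro torus_functions_prod torus_functions_diff torus_functions_single uc zero_char_lattice)
  have HX: "leval H x = 0" if "x \<in> X \<inter> torus" for x
  proof -
    have xt: "x \<in> torus" "leval \<theta> x \<in> S" using that ZX unfolding S_def by blast+
    then show ?thesis using fS by (simp add: H_def leval_prod leval_diff prod_zero_iff)
  qed
  have D0: "Dlog P \<zeta> H = 0"
    unfolding \<zeta>_def using tangent_space_torus(2)[OF ci f_torus P y HT HX] by blast
  have "H = (\<theta> - cst t0) * (\<Prod>t\<in>S - {t0}. \<theta> - cst t)" unfolding H_def using fS t0S by (rule prod.remove)
  then have "Dlog P \<zeta> H = Dlog P \<zeta> (\<theta> - cst t0) * leval (\<Prod>t\<in>S - {t0}. \<theta> - cst t) P"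
    using P(2) by (simp add: Dlog_mult leval_diff t0_def)
  moreover have "leval (\<Prod>t\<in>S - {t0}. \<theta> - cst t) P \<noteq> 0"
    using P(2) fS by (simp add: leval_prod leval_diff prod_zero_iff t0_def)
  ultimately have "Dlog P \<zeta> (\<theta> - cst t0) = 0" using D0 by simp
  then have "mon P u * idot u \<zeta> = 0" by (simp add: Dlog_diff \<theta>_def cst_def Dlog_single)
  then have "idot u \<zeta> = 0" using P(2) by simp
  moreover have "idot u \<zeta> = \<zeta> $ i - \<zeta> $ j"
    using idot_add[of "axis i 1" "- axis j 1" \<zeta>] by (simp add: u_def idot_axis idot_minus)
  ultimately show ?thesis by (simp add: \<zeta>_def)
qed simp

lemma inner_pt_1: "inner_pt (x + c *\<^sub>R 1) \<longleftrightarrow> inner_pt x"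
proof -
  have "term_val val (F i) (x + c *\<^sub>R 1) m = term_val val (F i) x m" if "i \<in> I" "m \<in> Poly_Mapping.keys (F i)" for i m
    using rvec_char_lattice[OF key_char_lattice[OF that]] by (simp add: term_val_vl inner_add_right)
  then show ?thesis unfolding inner_pt_def other_keys_def using v_key by auto
qed

text \<open>As \<open>\<eta>\<close> reduces to \<open>w\<close>, its differences at distinct slopes
  have absolute value 1. For equal slopes reduction shows only that they are small; that they vanish
  is \<open>equal_slopes\<close> for the tangent vector with coordinates
  \<open>P $ q * \<eta> $ q\<close>.\<close>

lemma tangent_line:
  assumes P: "P \<in> X" "P \<in> torus" and \<alpha>: "inner_pt (trop_pt val P)"
  shows "\<exists>\<eta>. (\<forall>p q. w $ p = w $ q \<longrightarrow> \<eta> $ p = \<eta> $ q) \<and> (\<forall>p q. w $ p \<noteq> w $ q \<longrightarrow> absv (\<eta> $ p - \<eta> $ q) = 1) \<and>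
    tangent_space X P = {z. \<exists>a b. z = (\<chi> q. P $ q * (a + b * \<eta> $ q))}"
proof -
  obtain \<eta> where \<eta>: "\<And>q. absv (\<eta> $ q - of_int (w $ q)) < 1"
    "{\<zeta>. \<forall>i\<in>I. Dlog P \<zeta> (F i) = 0} = {\<zeta>. \<exists>a b. \<zeta> = (\<chi> q. a + b * \<eta> $ q)}"
    using tangent_directions[OF P(2) \<alpha>] by blast
  have DF: "Dlog P \<zeta> (F i) = 0 \<longleftrightarrow> Dlog P \<zeta> (f i) = 0" if i: "i \<in> I" for \<zeta> i
  proof -
    obtain a u where au: "a \<noteq> 0" "F i = Poly_Mapping.single u a * f i" using F_f[OF i] by blast
    have "leval (F i) P = 0" using P X_torus i by blast
    then have "leval (f i) P = 0" using F_zero_iff[OF P(2) i] by blast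
    then show ?thesis using P(2) au by (simp add: Dlog_mult leval_single)
  qed
  have "tangent_space X P = {z. \<forall>i\<in>I. Dlog P (\<chi> q. z $ q / P $ q) (f i) = 0}"
    by (rule tangent_space_torus(1)[OF ci f_torus P])
  also have "\<dots> = {z. (\<chi> q. z $ q / P $ q) \<in> {\<zeta>. \<forall>i\<in>I. Dlog P \<zeta> (F i) = 0}}" using DF by auto
  also have "\<dots> = {z. \<exists>a b. (\<chi> q. z $ q / P $ q) = (\<chi> q. a + b * \<eta> $ q)}" unfolding \<eta>(2) by simp
  also have "\<dots> = {z. \<exists>a b. z = (\<chi> q. P $ q * (a + b * \<eta> $ q))}"
    using P(2) by (simp add: vec_eq_iff divide_eq_eq mult.commute)
  finally have T: "tangent_space X P = {z. \<exists>a b. z = (\<chi> q. P $ q * (a + b * \<eta> $ q))}" .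
  have "(\<chi> q. P $ q * (0 + 1 * \<eta> $ q)) \<in> tangent_space X P" unfolding T by blast
  then have yT: "(\<chi> q. P $ q * (0 + 1 * \<eta> $ q)) \<in> tangent_space X P" .
  have eq: "\<eta> $ p = \<eta> $ q" if "w $ p = w $ q" for p q
    using equal_slopes[OF that P yT] P(2) by simp
  have ne: "absv (\<eta> $ p - \<eta> $ q) = 1" if "w $ p \<noteq> w $ q" for p q
  proof -
    have "absv ((\<eta> $ p - of_int (w $ p)) - (\<eta> $ q - of_int (w $ q))) < 1" by (intro absv_diff_less \<eta>(1))
    moreover have "absv (of_int (w $ p - w $ q)) = 1" using that by (intro absv_of_int) simp
    ultimately show ?thesis
      using absv_add_eq[of "(\<eta> $ p - of_int (w $ p)) - (\<eta> $ q - of_int (w $ q))" "of_int (w $ p - w $ q)"] by simp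
  qed
  show ?thesis
  proof (intro exI[of _ \<eta>] conjI allI impI)
    show "tangent_space X P = {z. \<exists>a b. z = (\<chi> q. P $ q * (a + b * \<eta> $ q))}" by (rule T)
  qed (fact eq ne)+
qed

end

text \<open>The factor \<open>d\<close> is the determinant of \<open>a\<close>, \<open>b\<close>
  with respect to \<open>P\<close> and the vector with coordinates
  \<open>P $ q * \<eta> $ q\<close>. If it were 0, all 2 by 2 minors of \<open>a\<close>,
  \<open>b\<close>, and with them those of the original basis, would vanish.\<close>

lemma plane_basis:
  fixes P \<eta> :: "'k::field ^ 'n::finite"
  assumes P: "P \<in> torus" and pq: "\<eta> $ p \<noteq> \<eta> $ q"
    and W: "W = {z. \<exists>a b. z = (\<chi> q. P $ q * (a + b * \<eta> $ q))}"
  shows "vec.dim W = 2" "\<exists>a b. is_basis2 a b W"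
    and "is_basis2 a b W \<Longrightarrow> \<exists>d. d \<noteq> 0 \<and> (\<forall>i j. pluecker a b $ (i, j) = d * (P $ i * P $ j * (\<eta> $ j - \<eta> $ i)))"
proof -
  have nz: "P $ i \<noteq> 0" for i using P unfolding torus_def by blast
  define z where "z = (\<chi> q. P $ q * \<eta> $ q)"
  have W2: "W = vec.span {P, z}"
  proof (intro equalityI subsetI)
    fix u assume "u \<in> W"
    then obtain a b where "u = (\<chi> q. P $ q * (a + b * \<eta> $ q))" unfolding W by blast
    then have "u = a *s P + b *s z" by (simp add: vec_eq_iff z_def algebra_simps)
    then show "u \<in> vec.span {P, z}" by (simp add: vec.span_add vec.span_scale vec.span_base)
  next
    fix u assume "u \<in> vec.span {P, z}"
    then obtain a where "u - a *s P \<in> vec.span {z}" unfolding vec.span_insert by blast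
    then obtain b where "u - a *s P = b *s z" unfolding vec.span_singleton by blast
    then have "u = a *s P + b *s z" by (simp add: algebra_simps)
    then have "u = (\<chi> q. P $ q * (a + b * \<eta> $ q))" by (simp add: vec_eq_iff z_def algebra_simps)
    then show "u \<in> W" unfolding W by blast
  qed
  have Pz: "P \<notin> vec.span {z}"
  proof
    assume "P \<in> vec.span {z}"
    then obtain k where "P = k *s z" unfolding vec.span_singleton by blast
    then have "P $ i = P $ i * (k * \<eta> $ i)" for i by (metis vector_smult_component z_def vec_lambda_beta mult.left_commute)
    then have "k * \<eta> $ i = 1" for i using nz[of i] by (metis mult_cancel_left1)
    then show False using pq by (metis mult_cancel_left zero_neq_one mult_zero_left)
  qed
  have z0: "z \<noteq> 0"
  proof
    assume "z = 0"
    then have "P $ i * \<eta> $ i = 0" for i by (simp add: z_def vec_eq_iff)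
    then show False using nz pq by (metis mult_eq_0_iff)
  qed
  have "vec.independent {z}" using z0 by (simp add: vec.dependent_single)
  then have ind: "vec.independent {P, z}" using Pz by (rule vec.independent_insertI[rotated])
  have Pnz: "P \<noteq> z" using Pz vec.span_base[of z "{z}"] by blast
  show "vec.dim W = 2" unfolding W2 using vec.dim_span_eq_card_independent[OF ind] Pnz by simp
  show "\<exists>a b. is_basis2 a b W" unfolding is_basis2_def W2 using ind Pnz by blast
  assume "is_basis2 a b W"
  then have ab: "vec.span {a, b} = W" unfolding is_basis2_def by blast
  then have "a \<in> W" "b \<in> W" using vec.span_base[of _ "{a, b}"] by auto
  then obtain a1 a2 b1 b2 where a: "a = (\<chi> q. P $ q * (a1 + a2 * \<eta> $ q))" and b: "b = (\<chi> q. P $ q * (b1 + b2 * \<eta> $ q))"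
    unfolding W by blast
  define d where "d = a1 * b2 - a2 * b1"
  have pl: "pluecker a b $ (i, j) = d * (P $ i * P $ j * (\<eta> $ j - \<eta> $ i))" for i j
    by (simp add: pluecker_def a b d_def) algebra
  have "\<exists>s t. u = s *s a + t *s b" if "u \<in> W" for u
  proof -
    have "u \<in> vec.span {a, b}" using ab that by simp
    then obtain s where "u - s *s a \<in> vec.span {b}" unfolding vec.span_insert by blast
    then obtain t where "u - s *s a = t *s b" unfolding vec.span_singleton by blast
    then have "u = s *s a + t *s b" by (simp add: algebra_simps)
    then show ?thesis by blast
  qed
  moreover have "P \<in> W" "z \<in> W" unfolding W2 by (simp_all add: vec.span_base)
  ultimately obtain s t s' t' where st: "P = s *s a + t *s b" "z = s' *s a + t' *s b" by blast
  have "d \<noteq> 0"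
  proof
    assume d0: "d = 0"
    have "a $ p * b $ q - a $ q * b $ p = 0" using pl[of p q] d0 by (simp add: pluecker_def)
    then have "P $ p * z $ q - P $ q * z $ p = 0"
      unfolding st vector_add_component vector_smult_component by algebra
    then have "P $ p * P $ q * (\<eta> $ q - \<eta> $ p) = 0" by (simp add: z_def algebra_simps)
    then show False using nz pq by simp
  qed
  then show "\<exists>d. d \<noteq> 0 \<and> (\<forall>i j. pluecker a b $ (i, j) = d * (P $ i * P $ j * (\<eta> $ j - \<eta> $ i)))" using pl by blast
qed

text \<open>The indices of the terms of a tropical three-term relation that are finite when \<open>w\<close> is the
  vector of slopes.\<close>

definition finite_terms :: "int ^ 'n \<Rightarrow> 'n set \<Rightarrow> 'n set" where
  "finite_terms w T = {k \<in> T. \<exists>p\<in>T - {k}. \<exists>q\<in>T - {k}. w $ p \<noteq> w $ q}"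

lemma finite_terms_distinct:
  "w $ i \<noteq> w $ j \<Longrightarrow> w $ i \<noteq> w $ k \<Longrightarrow> w $ j \<noteq> w $ k \<Longrightarrow> finite_terms w {i, j, k} = {i, j, k}"
  unfolding finite_terms_def by auto

lemma finite_terms_pair:
  "i \<noteq> j \<Longrightarrow> w $ i = w $ j \<Longrightarrow> w $ k \<noteq> w $ i \<Longrightarrow> finite_terms w {i, j, k} = {i, j}"
proof -
  assume "i \<noteq> j" and w: "w $ i = w $ j" "w $ k \<noteq> w $ i"
  then have ne: "k \<noteq> i" "k \<noteq> j" by metis+
  have "{i, j, k} - {i} = {j, k}" "{i, j, k} - {j} = {i, k}" "{i, j, k} - {k} = {i, j}" using \<open>i \<noteq> j\<close> ne by blast+
  then show ?thesis unfolding finite_terms_def using w ne by force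
qed

lemma min_twice_pair: "min_twice {i, j} g \<Longrightarrow> g i = g j"
  by (erule min_twiceE) auto

text \<open>In a triple with exactly two equal slopes only the terms at these two indices are
  finite, and the condition says that they agree; with three equal slopes no term is finite.
  Conversely, since \<open>w\<close> is not constant, any two indices of equal slope lie in a triple
  of the first kind.\<close>

lemma Btan_iff:
  assumes w: "\<exists>p q. w $ p \<noteq> w $ q"
  shows "x \<in> Btan w \<longleftrightarrow> (\<forall>T. card T = 3 \<longrightarrow> finite_terms w T = {} \<or> min_twice (finite_terms w T) (($) x))"
proof (intro iffI allI impI)
  fix T :: "'a set" assume x: "x \<in> Btan w" and "card T = 3"
  then obtain i j k where T: "T = {i, j, k}" "i \<noteq> j" "j \<noteq> k" "i \<noteq> k" unfolding card_3_iff by blast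
  have pair: "min_twice (finite_terms w {a, b, c}) (($) x)" if "a \<noteq> b" "w $ a = w $ b" "w $ c \<noteq> w $ a" for a b c
    unfolding finite_terms_pair[OF that] using that(1) Btan_eqD[OF x that(2)]
    by (intro min_twiceI[of a _ b]) auto
  consider "w $ i = w $ j \<and> w $ k = w $ i" | "w $ i = w $ j \<and> w $ k \<noteq> w $ i" | "w $ j = w $ k \<and> w $ i \<noteq> w $ j"
    | "w $ i = w $ k \<and> w $ j \<noteq> w $ i" | "w $ i \<noteq> w $ j \<and> w $ i \<noteq> w $ k \<and> w $ j \<noteq> w $ k" by argo
  then show "finite_terms w T = {} \<or> min_twice (finite_terms w T) (($) x)"
  proof cases
    case 1
    then show ?thesis unfolding T(1) finite_terms_def by auto
  next
    case 2
    then show ?thesis unfolding T(1) using pair[OF T(2)] by blast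
  next
    case 3
    have "T = {j, k, i}" using T(1) by blast
    then show ?thesis using pair[OF T(3)] 3 by blast
  next
    case 4
    have "T = {i, k, j}" using T(1) by blast
    then show ?thesis using pair[OF T(4)] 4 by blast
  next
    case 5
    then have "finite_terms w T = {i, j, k}" unfolding T(1) by (intro finite_terms_distinct) blast+
    moreover have "min_twice {i, j, k} (($) x)" by (rule Btan_min_twiceD[OF x]) (use 5 in blast)+
    ultimately show ?thesis by simp
  qed
next
  assume *: "\<forall>T. card T = 3 \<longrightarrow> finite_terms w T = {} \<or> min_twice (finite_terms w T) (($) x)"
  show "x \<in> Btan w"
  proof (rule BtanI)
    fix i j assume ij: "w $ i = w $ j"
    show "x $ i = x $ j"
    proof (cases "i = j")
      case False
      obtain k where k: "w $ k \<noteq> w $ i" using w by metis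
      then have "k \<noteq> i" "k \<noteq> j" using ij by metis+
      then have "card {i, j, k} = 3" using False by simp
      then have "min_twice {i, j} (($) x)" using * finite_terms_pair[OF False ij k] by fastforce
      then show ?thesis by (rule min_twice_pair)
    qed simp
  next
    fix i j k assume w: "w $ i \<noteq> w $ j" "w $ i \<noteq> w $ k" "w $ j \<noteq> w $ k"
    then have "i \<noteq> j" "i \<noteq> k" "j \<noteq> k" by blast+
    then have "card {i, j, k} = 3" by simp
    then show "min_twice {i, j, k} (($) x)" using * finite_terms_distinct[OF w] by fastforce
  qed
qed

section \<open>Tropical tangents over the edge\<close>

context curve_edge
begin

lemma tangent_valuations:
  assumes P: "P \<in> X" "P \<in> torus" and \<alpha>: "inner_pt (trop_pt val P)"
  shows "curve_smooth_point X P" "\<exists>a b. is_basis2 a b (tangent_space X P)"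
    and "is_basis2 a b (tangent_space X P) \<Longrightarrow> \<exists>\<delta>. \<forall>i j. val (pluecker a b $ (i, j)) =
      (if w $ i = w $ j then \<infinity> else ereal (\<delta> + trop_pt val P $ i + trop_pt val P $ j))"
proof -
  obtain \<eta> where \<eta>: "\<And>p q. w $ p = w $ q \<Longrightarrow> \<eta> $ p = \<eta> $ q" "\<And>p q. w $ p \<noteq> w $ q \<Longrightarrow> absv (\<eta> $ p - \<eta> $ q) = 1"
    and W: "tangent_space X P = {z. \<exists>a b. z = (\<chi> q. P $ q * (a + b * \<eta> $ q))}"
    using tangent_line[OF P \<alpha>] by (elim exE conjE) (rule that, iprover+)
  obtain p q where "w $ p \<noteq> w $ q" using w_nonconst by blast
  then have "absv (\<eta> $ p - \<eta> $ q) = 1" by (rule \<eta>(2))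
  then have pq: "\<eta> $ p \<noteq> \<eta> $ q" by auto
  note plane = plane_basis[OF P(2) pq W]
  show "curve_smooth_point X P" unfolding curve_smooth_point_def using P(1) plane(1) by simp
  show "\<exists>a b. is_basis2 a b (tangent_space X P)" by (rule plane(2))
  assume "is_basis2 a b (tangent_space X P)"
  then obtain d where d: "d \<noteq> 0" "\<And>i j. pluecker a b $ (i, j) = d * (P $ i * P $ j * (\<eta> $ j - \<eta> $ i))"
    using plane(3) by blast
  have "val (pluecker a b $ (i, j)) = (if w $ i = w $ j then \<infinity> else ereal (vl d + trop_pt val P $ i + trop_pt val P $ j))" for i j
  proof (cases "w $ i = w $ j")
    case True
    then show ?thesis using \<eta>(1)[OF True] by (simp add: d(2))
  next
    case False
    then have "absv (\<eta> $ j - \<eta> $ i) = 1" using \<eta>(2)[of j i] by simp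
    then have "\<eta> $ j - \<eta> $ i \<noteq> 0" "vl (\<eta> $ j - \<eta> $ i) = 0" using vl_absv[of "\<eta> $ j - \<eta> $ i"] by force+
    moreover have "P $ i \<noteq> 0" "P $ j \<noteq> 0" using P(2) unfolding torus_def by blast+
    ultimately show ?thesis using False d(1) unfolding d(2) by (simp add: val_vl vl_mult trop_pt_vl)
  qed
  then show "\<exists>\<delta>. \<forall>i j. val (pluecker a b $ (i, j)) =
      (if w $ i = w $ j then \<infinity> else ereal (\<delta> + trop_pt val P $ i + trop_pt val P $ j))" by blast
qed

lemma lifted_point:
  assumes "inner_pt \<alpha>" "e > 0"
  obtains P s c where "P \<in> X" "P \<in> torus" "\<bar>s\<bar> < e" "trop_pt val P = \<alpha> + s *\<^sub>R rvec w + c *\<^sub>R 1" "inner_pt (\<alpha> + s *\<^sub>R rvec w)"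
proof -
  obtain P s c where P: "P \<in> torus" "\<bar>s\<bar> < e" "trop_pt val P = \<alpha> + s *\<^sub>R rvec w + c *\<^sub>R 1"
    "inner_pt (\<alpha> + s *\<^sub>R rvec w)" "\<forall>i\<in>I. leval (F i) P = 0"
    using points_dense[OF assms] by blast
  then have "P \<in> X" using X_torus by blast
  then show thesis by (rule that[OF _ P(1-4)])
qed

text \<open>One point lifted from the edge suffices: its tangent line has a finite valuation at this
  coordinate.\<close>

lemma not_vanishing_pair:
  assumes "w $ i \<noteq> w $ j"
  shows "{i, j} \<notin> vanishing_pairs X"
proof
  assume "{i, j} \<in> vanishing_pairs X"
  then obtain i' j' where ij': "{i, j} = {i', j'}" "\<forall>p\<in>gauss_variety X. p $ (i', j') = 0"
    unfolding vanishing_pairs_def by blast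
  then have w': "w $ i' \<noteq> w $ j'" using assms by (auto simp: doubleton_eq_iff)
  obtain x where x: "inner_pt x" using E_ri ri_inner by blast
  obtain P s c where P: "P \<in> X" "P \<in> torus" "\<bar>s\<bar> < 1" "trop_pt val P = x + s *\<^sub>R rvec w + c *\<^sub>R 1" "inner_pt (x + s *\<^sub>R rvec w)"
    by (rule lifted_point[OF x zero_less_one])
  have in1: "inner_pt (trop_pt val P)" unfolding P(4) inner_pt_1 by (rule P(5))
  note tv = tangent_valuations[OF P(1,2) in1]
  obtain a b where ab: "is_basis2 a b (tangent_space X P)" using tv(2) by blast
  have "pluecker a b \<in> gauss_variety X" unfolding gauss_variety_def zariski_closure_def using tv(1) ab by blast
  then have inf: "val (pluecker a b $ (i', j')) = \<infinity>" using ij'(2) by simp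
  obtain \<delta> where "\<And>i j. val (pluecker a b $ (i, j)) =
      (if w $ i = w $ j then \<infinity> else ereal (\<delta> + trop_pt val P $ i + trop_pt val P $ j))"
    using tv(3)[OF ab] by blast
  from this[of i' j'] show False unfolding inf using w' by simp
qed

lemma tropical_tangentD:
  assumes \<beta>: "tropical_tangent val X \<alpha> \<beta>" and \<alpha>: "inner_pt \<alpha>"
  shows "\<exists>\<delta>. \<forall>i j. i \<noteq> j \<longrightarrow> {i, j} \<notin> vanishing_pairs X \<longrightarrow>
    \<beta> {i, j} = (if w $ i = w $ j then \<infinity> else ereal (\<delta> + \<alpha> $ i + \<alpha> $ j))"
proof -
  obtain P a b c where P: "curve_smooth_point X P" "P \<in> torus" "trop_pt val P = \<alpha> + c *\<^sub>R 1"
    and ab: "is_basis2 a b (tangent_space X P)"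
    and *: "\<And>i j. i \<noteq> j \<Longrightarrow> {i, j} \<notin> vanishing_pairs X \<Longrightarrow> \<beta> {i, j} = val (pluecker a b $ (i, j))"
    using \<beta> unfolding tropical_tangent_def by blast
  have PX: "P \<in> X" using P(1) unfolding curve_smooth_point_def by blast
  have "inner_pt (trop_pt val P)" unfolding P(3) inner_pt_1 by (rule \<alpha>)
  then obtain \<delta> where \<delta>: "\<And>i j. val (pluecker a b $ (i, j)) =
      (if w $ i = w $ j then \<infinity> else ereal (\<delta> + trop_pt val P $ i + trop_pt val P $ j))"
    using tangent_valuations(3)[OF PX P(2) _ ab] by blast
  \<comment> \<open>Each Pluecker coordinate contains two coordinates of \<open>P\<close>, so the
    shift \<open>c\<close> of the representative enters twice.\<close>
  have "\<beta> {i, j} = (if w $ i = w $ j then \<infinity> else ereal ((\<delta> + 2 * c) + \<alpha> $ i + \<alpha> $ j))"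
    if "i \<noteq> j" "{i, j} \<notin> vanishing_pairs X" for i j
    unfolding *[OF that] \<delta> P(3) by simp
  then show ?thesis by blast
qed

lemma ex_tropical_tangent:
  assumes P: "P \<in> X" "P \<in> torus" "trop_pt val P = \<alpha> + c *\<^sub>R 1" and \<alpha>: "inner_pt \<alpha>"
  shows "\<exists>\<beta>. tropical_tangent val X \<alpha> \<beta>"
proof -
  have "inner_pt (trop_pt val P)" unfolding P(3) inner_pt_1 by (rule \<alpha>)
  note tv = tangent_valuations[OF P(1,2) this]
  obtain a b where ab: "is_basis2 a b (tangent_space X P)" using tv(2) by blast
  obtain \<delta> where \<delta>: "\<And>i j. val (pluecker a b $ (i, j)) =
      (if w $ i = w $ j then \<infinity> else ereal (\<delta> + trop_pt val P $ i + trop_pt val P $ j))"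
    using tv(3)[OF ab] by blast
  \<comment> \<open>Tangents are indexed by unordered pairs, Pluecker coordinates by ordered ones;
    any choice of order is harmless because the valuations are symmetric.\<close>
  define r where "r S = (SOME ij. S = {fst ij, snd ij})" for S :: "'n set"
  define \<beta> where "\<beta> S = val (pluecker a b $ r S)" for S
  have "\<beta> {i, j} = val (pluecker a b $ (i, j))" for i j
  proof -
    have "{i, j} = {fst (r {i, j}), snd (r {i, j})}" unfolding r_def by (rule someI[of _ "(i, j)"]) simp
    then have "r {i, j} = (i, j) \<or> r {i, j} = (j, i)" by (cases "r {i, j}") (auto simp: doubleton_eq_iff)
    then show ?thesis unfolding \<beta>_def using \<delta>[of i j] \<delta>[of j i] by (auto simp: algebra_simps)
  qed
  then have "tropical_tangent val X \<alpha> \<beta>" unfolding tropical_tangent_def using tv(1) P(2,3) ab by blast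
  then show ?thesis by blast
qed

lemma dual_condition:
  assumes \<beta>: "tropical_tangent val X \<alpha> \<beta>" and \<alpha>: "inner_pt \<alpha>"
  shows "(\<forall>j. min_attained_twice {i. i \<noteq> j \<and> {i, j} \<notin> vanishing_pairs X} (\<lambda>i. \<beta> {i, j} + ereal (\<gamma> $ i)))
    \<longleftrightarrow> \<gamma> + 1 *\<^sub>R \<alpha> \<in> Bdual w"
proof -
  obtain \<delta> where \<delta>: "\<And>i j. i \<noteq> j \<Longrightarrow> {i, j} \<notin> vanishing_pairs X \<Longrightarrow>
    \<beta> {i, j} = (if w $ i = w $ j then \<infinity> else ereal (\<delta> + \<alpha> $ i + \<alpha> $ j))"
    using tropical_tangentD[OF assms] by blast
  have "min_attained_twice {i. i \<noteq> j \<and> {i, j} \<notin> vanishing_pairs X} (\<lambda>i. \<beta> {i, j} + ereal (\<gamma> $ i)) \<longleftrightarrow>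
    min_twice {i. w $ i \<noteq> w $ j} (($) (\<gamma> + 1 *\<^sub>R \<alpha>))" for j
  proof -
    \<comment> \<open>For fixed \<open>j\<close> the summand \<open>\<delta> + \<alpha> $ j\<close>
      is common to all finite terms, which leaves the coordinates of
      \<open>\<gamma> + \<alpha>\<close>.\<close>
    have "min_attained_twice {i. i \<noteq> j \<and> {i, j} \<notin> vanishing_pairs X} (\<lambda>i. \<beta> {i, j} + ereal (\<gamma> $ i)) \<longleftrightarrow>
      min_twice {i. w $ i \<noteq> w $ j} (\<lambda>i. (\<gamma> + 1 *\<^sub>R \<alpha>) $ i + (\<delta> + \<alpha> $ j))"
    proof (rule min_attained_twice_iff)
      show "{i. w $ i \<noteq> w $ j} \<subseteq> {i. i \<noteq> j \<and> {i, j} \<notin> vanishing_pairs X}"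
      proof (intro subsetI CollectI conjI)
        fix i assume "i \<in> {i. w $ i \<noteq> w $ j}"
        then have i: "w $ i \<noteq> w $ j" by (rule CollectD)
        then show "i \<noteq> j" by blast
        show "{i, j} \<notin> vanishing_pairs X" by (rule not_vanishing_pair[OF i])
      qed
      obtain p q where "w $ p \<noteq> w $ q" using w_nonconst by blast
      then have "w $ p \<noteq> w $ j \<or> w $ q \<noteq> w $ j" by metis
      then show "{i. w $ i \<noteq> w $ j} \<noteq> {}" by blast
      show "\<beta> {i, j} + ereal (\<gamma> $ i) = ereal ((\<gamma> + 1 *\<^sub>R \<alpha>) $ i + (\<delta> + \<alpha> $ j))" if "i \<in> {i. w $ i \<noteq> w $ j}" for i
      proof -
        have i: "w $ i \<noteq> w $ j" using that by (rule CollectD)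
        then have "i \<noteq> j" by blast
        then show ?thesis using \<delta>[OF _ not_vanishing_pair[OF i]] i by simp
      qed
      show "\<beta> {i, j} + ereal (\<gamma> $ i) = \<infinity>"
        if "i \<in> {i. i \<noteq> j \<and> {i, j} \<notin> vanishing_pairs X}" "i \<notin> {i. w $ i \<noteq> w $ j}" for i
        using that \<delta>[of i j] by simp
    qed
    then show ?thesis unfolding min_twice_shift .
  qed
  then show ?thesis unfolding Bdual_def mem_Collect_eq by simp
qed

lemma tangent_condition:
  assumes \<beta>: "tropical_tangent val X \<alpha> \<beta>" and \<alpha>: "inner_pt \<alpha>"
  shows "(\<forall>T. card T = 3 \<longrightarrow>
        (let A = {k \<in> T. T - {k} \<notin> vanishing_pairs X}; g = (\<lambda>k. \<beta> (T - {k}) + ereal (x $ k))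
         in (\<forall>k\<in>A. g k = \<infinity>) \<or> min_attained_twice A g))
    \<longleftrightarrow> x + (- 1) *\<^sub>R \<alpha> \<in> Btan w"
proof -
  obtain \<delta> where \<delta>: "\<And>i j. i \<noteq> j \<Longrightarrow> {i, j} \<notin> vanishing_pairs X \<Longrightarrow>
    \<beta> {i, j} = (if w $ i = w $ j then \<infinity> else ereal (\<delta> + \<alpha> $ i + \<alpha> $ j))"
    using tropical_tangentD[OF assms] by blast
  have "(let A = {k \<in> T. T - {k} \<notin> vanishing_pairs X}; g = (\<lambda>k. \<beta> (T - {k}) + ereal (x $ k))
         in (\<forall>k\<in>A. g k = \<infinity>) \<or> min_attained_twice A g) \<longleftrightarrow>
    finite_terms w T = {} \<or> min_twice (finite_terms w T) (($) (x + (- 1) *\<^sub>R \<alpha>))" if T: "card T = 3" for T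
  proof -
    define A where "A = {k \<in> T. T - {k} \<notin> vanishing_pairs X}"
    define g where "g k = \<beta> (T - {k}) + ereal (x $ k)" for k
    have pair: "\<exists>i j. i \<noteq> j \<and> T = {i, j, k} \<and> T - {k} = {i, j} \<and> k \<noteq> i \<and> k \<noteq> j" if k: "k \<in> T" for k
    proof -
      have "card (T - {k}) = 2" using k T by simp
      then obtain i j where "T - {k} = {i, j}" "i \<noteq> j" unfolding card_2_iff by blast
      then show ?thesis using k by blast
    qed
    \<comment> \<open>The term at \<open>k\<close> is
      \<open>\<delta> + \<alpha> $ i + \<alpha> $ j + x $ k\<close>. Adding and subtracting
      \<open>\<alpha> $ k\<close> isolates the sum of \<open>\<alpha>\<close> over \<open>T\<close>,
      which is common to all terms.\<close>
    have fin: "k \<in> A \<and> g k = ereal ((x + (- 1) *\<^sub>R \<alpha>) $ k + (\<delta> + sum (($) \<alpha>) T))" if kf: "k \<in> finite_terms w T" for k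
    proof -
      have "k \<in> T" using kf unfolding finite_terms_def by blast
      then obtain i j where ij: "i \<noteq> j" "T = {i, j, k}" "T - {k} = {i, j}" "k \<noteq> i" "k \<noteq> j" using pair by blast
      have w: "w $ i \<noteq> w $ j" 
      proof -
        obtain p q where "p \<in> T - {k}" "q \<in> T - {k}" "w $ p \<noteq> w $ q" using kf unfolding finite_terms_def by blast
        then show ?thesis unfolding ij(3) by force
      qed
      have S: "sum (($) \<alpha>) T = \<alpha> $ i + \<alpha> $ j + \<alpha> $ k" unfolding ij(2) using ij by simp
      have "T - {k} \<notin> vanishing_pairs X" unfolding ij(3) by (rule not_vanishing_pair[OF w])
      then have "k \<in> A" using \<open>k \<in> T\<close> unfolding A_def by blast
      moreover have "\<beta> (T - {k}) = ereal (\<delta> + \<alpha> $ i + \<alpha> $ j)"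
        unfolding ij(3) using \<delta>[OF ij(1) not_vanishing_pair[OF w]] w by simp
      ultimately show ?thesis unfolding g_def by (simp add: S)
    qed
    have inf: "g k = \<infinity>" if "k \<in> A" "k \<notin> finite_terms w T" for k
    proof -
      have k: "k \<in> T" "T - {k} \<notin> vanishing_pairs X" using that(1) unfolding A_def by blast+
      then obtain i j where ij: "i \<noteq> j" "T - {k} = {i, j}" using pair by blast
      have "i \<in> T - {k}" "j \<in> T - {k}" unfolding ij(2) by blast+
      then have "w $ i = w $ j" using that(2) k(1) unfolding finite_terms_def by blast
      then show ?thesis using \<delta>[OF ij(1)] k(2) unfolding g_def ij(2) by simp
    qed
    have "(\<forall>k\<in>A. g k = \<infinity>) \<or> min_attained_twice A g \<longleftrightarrow>
      finite_terms w T = {} \<or> min_twice (finite_terms w T) (($) (x + (- 1) *\<^sub>R \<alpha>))"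
    proof (cases "finite_terms w T = {}")
      case True
      then show ?thesis using inf by blast
    next
      case False
      then have "\<not> (\<forall>k\<in>A. g k = \<infinity>)" using fin by force
      moreover have "min_attained_twice A g \<longleftrightarrow>
        min_twice (finite_terms w T) (\<lambda>k. (x + (- 1) *\<^sub>R \<alpha>) $ k + (\<delta> + sum (($) \<alpha>) T))"
        by (rule min_attained_twice_iff) (use fin inf False in blast)+
      ultimately show ?thesis using False unfolding min_twice_shift by blast
    qed
    then show ?thesis unfolding Let_def A_def g_def .
  qed
  then show ?thesis unfolding Btan_iff[OF w_nonconst] by blast
qed

lemma dual_contribution_inner:
  assumes \<alpha>: "inner_pt \<alpha>"
  shows "dual_contribution val X \<alpha> \<subseteq> {\<gamma>. \<gamma> + 1 *\<^sub>R \<alpha> \<in> Bdual w}"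
    and "P \<in> X \<Longrightarrow> P \<in> torus \<Longrightarrow> trop_pt val P = \<alpha> + c *\<^sub>R 1 \<Longrightarrow>
      {\<gamma>. \<gamma> + 1 *\<^sub>R \<alpha> \<in> Bdual w} \<subseteq> dual_contribution val X \<alpha>"
proof -
  show "dual_contribution val X \<alpha> \<subseteq> {\<gamma>. \<gamma> + 1 *\<^sub>R \<alpha> \<in> Bdual w}"
    unfolding dual_contribution_def using dual_condition[OF _ \<alpha>] by blast
  assume "P \<in> X" "P \<in> torus" "trop_pt val P = \<alpha> + c *\<^sub>R 1"
  then obtain \<beta> where "tropical_tangent val X \<alpha> \<beta>" using ex_tropical_tangent \<alpha> by blast
  then show "{\<gamma>. \<gamma> + 1 *\<^sub>R \<alpha> \<in> Bdual w} \<subseteq> dual_contribution val X \<alpha>"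
    unfolding dual_contribution_def using dual_condition[OF _ \<alpha>] by blast
qed

lemma tangent_contribution_inner:
  assumes \<alpha>: "inner_pt \<alpha>"
  shows "tangent_contribution val X \<alpha> \<subseteq> {x. x + (- 1) *\<^sub>R \<alpha> \<in> Btan w}"
    and "P \<in> X \<Longrightarrow> P \<in> torus \<Longrightarrow> trop_pt val P = \<alpha> + c *\<^sub>R 1 \<Longrightarrow>
      {x. x + (- 1) *\<^sub>R \<alpha> \<in> Btan w} \<subseteq> tangent_contribution val X \<alpha>"
proof -
  show "tangent_contribution val X \<alpha> \<subseteq> {x. x + (- 1) *\<^sub>R \<alpha> \<in> Btan w}"
    unfolding tangent_contribution_def using tangent_condition[OF _ \<alpha>] by blast
  assume "P \<in> X" "P \<in> torus" "trop_pt val P = \<alpha> + c *\<^sub>R 1"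
  then obtain \<beta> where "tropical_tangent val X \<alpha> \<beta>" using ex_tropical_tangent \<alpha> by blast
  then show "{x. x + (- 1) *\<^sub>R \<alpha> \<in> Btan w} \<subseteq> tangent_contribution val X \<alpha>"
    unfolding tangent_contribution_def using tangent_condition[OF _ \<alpha>] by blast
qed

text \<open>Stated once for \<open>\<sigma> = 1\<close>, the dual variety, and
  \<open>\<sigma> = -1\<close>, the tangent surface. A point of \<open>E\<close> without a lift has
  no tropical tangent and contributes nothing, so elements belonging to it are approached from
  liftable points nearby.\<close>

lemma closure_contributions:
  assumes B: "polycone B" "\<And>x s. x \<in> B \<Longrightarrow> x + s *\<^sub>R 1 \<in> B" and \<sigma>: "\<bar>\<sigma>\<bar> = 1"
    and sub: "\<And>\<alpha>. inner_pt \<alpha> \<Longrightarrow> C \<alpha> \<subseteq> {\<gamma>. \<gamma> + \<sigma> *\<^sub>R \<alpha> \<in> B}"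
    and sup: "\<And>\<alpha> P c. inner_pt \<alpha> \<Longrightarrow> P \<in> X \<Longrightarrow> P \<in> torus \<Longrightarrow> trop_pt val P = \<alpha> + c *\<^sub>R 1 \<Longrightarrow>
      {\<gamma>. \<gamma> + \<sigma> *\<^sub>R \<alpha> \<in> B} \<subseteq> C \<alpha>"
  shows "closure (\<Union>\<alpha>\<in>rel_interior E. C \<alpha>) = {\<gamma>. \<exists>e\<in>E. \<gamma> + \<sigma> *\<^sub>R e \<in> B}"
proof (intro equalityI closure_minimal closed_contribution[OF B])
  show "(\<Union>\<alpha>\<in>rel_interior E. C \<alpha>) \<subseteq> {\<gamma>. \<exists>e\<in>E. \<gamma> + \<sigma> *\<^sub>R e \<in> B}"
  proof
    fix \<gamma> assume "\<gamma> \<in> (\<Union>\<alpha>\<in>rel_interior E. C \<alpha>)"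
    then obtain \<alpha> where \<alpha>: "\<alpha> \<in> rel_interior E" "\<gamma> \<in> C \<alpha>" by blast
    then have "\<gamma> + \<sigma> *\<^sub>R \<alpha> \<in> B" using sub[OF ri_inner] by blast
    then show "\<gamma> \<in> {\<gamma>. \<exists>e\<in>E. \<gamma> + \<sigma> *\<^sub>R e \<in> B}" using \<alpha>(1) rel_interior_subset by blast
  qed
  show "{\<gamma>. \<exists>e\<in>E. \<gamma> + \<sigma> *\<^sub>R e \<in> B} \<subseteq> closure (\<Union>\<alpha>\<in>rel_interior E. C \<alpha>)"
  proof
    fix \<gamma> assume "\<gamma> \<in> {\<gamma>. \<exists>e\<in>E. \<gamma> + \<sigma> *\<^sub>R e \<in> B}"
    then obtain e where e: "e \<in> E" "\<gamma> + \<sigma> *\<^sub>R e \<in> B" by blast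
    show "\<gamma> \<in> closure (\<Union>\<alpha>\<in>rel_interior E. C \<alpha>)" unfolding closure_approachable
    proof (intro allI impI)
      fix r :: real assume r: "r > 0"
      have "e \<in> closure (rel_interior E)"
        unfolding convex_closure_rel_interior[OF E_convex] using e(1) by (rule subsetD[OF closure_subset])
      then have "\<forall>\<epsilon>>0. \<exists>\<alpha>\<in>rel_interior E. dist \<alpha> e < \<epsilon>" unfolding closure_approachable .
      then obtain \<alpha> where \<alpha>: "\<alpha> \<in> rel_interior E" "dist \<alpha> e < r / 2" using half_gt_zero[OF r] by blast
      \<comment> \<open>Multiples of \<open>w\<close> by factors below \<open>b\<close> have length
        at most \<open>r / 2\<close>; the summand 1 keeps the denominator positive.\<close>
      define b where "b = r / (2 * (norm (rvec w) + 1))"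
      have b0: "b > 0" unfolding b_def using r by (simp add: add_nonneg_pos)
      have bw: "b * norm (rvec w) \<le> r / 2"
      proof -
        have "b * norm (rvec w) \<le> b * (norm (rvec w) + 1)" using b0 by simp
        also have "\<dots> = r / 2" unfolding b_def by (simp add: field_simps add_nonneg_eq_0_iff)
        finally show ?thesis .
      qed
      obtain P s c where P: "P \<in> X" "P \<in> torus" "\<bar>s\<bar> < b" "trop_pt val P = \<alpha> + s *\<^sub>R rvec w + c *\<^sub>R 1"
        "inner_pt (\<alpha> + s *\<^sub>R rvec w)"
        by (rule lifted_point[OF ri_inner[OF \<alpha>(1)] b0])
      define \<alpha>' where "\<alpha>' = \<alpha> + s *\<^sub>R rvec w"
      \<comment> \<open>This compensates the move from \<open>e\<close> to \<open>\<alpha>'\<close>,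
        so that the condition on \<open>B\<close> is unchanged.\<close>
      define \<gamma>' where "\<gamma>' = \<gamma> + \<sigma> *\<^sub>R (e - \<alpha>')"
      have "\<gamma>' + \<sigma> *\<^sub>R \<alpha>' = \<gamma> + \<sigma> *\<^sub>R e" by (simp add: \<gamma>'_def algebra_simps)
      then have "\<gamma>' \<in> C \<alpha>'" using sup[OF P(5,1,2,4)] e(2) unfolding \<alpha>'_def by force
      moreover have "\<alpha>' \<in> rel_interior E" unfolding \<alpha>'_def by (rule inner_ri[OF P(5)])
      moreover have "dist \<gamma>' \<gamma> < r"
      proof -
        have "dist \<gamma>' \<gamma> = norm (e - \<alpha>')" using \<sigma> by (simp add: \<gamma>'_def dist_norm)
        also have "\<dots> \<le> norm (e - \<alpha>) + norm (s *\<^sub>R rvec w)"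
          unfolding \<alpha>'_def using norm_triangle_ineq4[of "e - \<alpha>" "s *\<^sub>R rvec w"] by (simp add: algebra_simps)
        also have "norm (s *\<^sub>R rvec w) \<le> b * norm (rvec w)" using P(3) by (simp add: mult_right_mono)
        also have "norm (e - \<alpha>) < r / 2" using \<alpha>(2) by (simp add: dist_norm norm_minus_commute)
        finally show ?thesis using bw by simp
      qed
      ultimately show "\<exists>y\<in>\<Union>\<alpha>\<in>rel_interior E. C \<alpha>. dist y \<gamma> < r" by blast
    qed
  qed
qed

section \<open>Identification with the tropicalized linear spaces\<close>

lemma trop_row_span: "trop val (projectivization (row_span I v)) = Bdual w"
proof -
  have "trop_vals (projectivization (row_span I v)) = trop_vals (row_span I v)"
    unfolding trop_vals_def projectivization_def torus_def by force
  then show ?thesis unfolding trop_trop_vals row_span_eq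
    by (simp only:) (intro subset_antisym closure_minimal trop_vals_dual_subset[OF w_nonconst] Bdual_subset_trop
      closed_polycone[OF polycone_Bdual])
qed

lemma trop_orth_compl: "trop val (projectivization (orth_compl (row_span I v))) = Btan w"
proof -
  have "trop_vals (projectivization (orth_compl (row_span I v))) = trop_vals (orth_compl (row_span I v))"
    unfolding trop_vals_def projectivization_def torus_def by force
  then show ?thesis unfolding trop_trop_vals orth_compl_eq
    by (simp only:) (intro subset_antisym closure_minimal trop_vals_tan_subset Btan_subset_trop
      closed_polycone[OF polycone_Btan])
qed

lemma edge_dual_contribution_eq:
  "edge_dual_contribution val X E = {- e + t | e t. e \<in> E \<and> t \<in> trop val (projectivization (row_span I v))}"
proof -
  have "edge_dual_contribution val X E = {\<gamma>. \<exists>e\<in>E. \<gamma> + 1 *\<^sub>R e \<in> Bdual w}"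
    unfolding edge_dual_contribution_def
    by (rule closure_contributions[OF polycone_Bdual Bdual_shift _ dual_contribution_inner]) simp_all
  also have "\<dots> = {- e + t | e t. e \<in> E \<and> t \<in> Bdual w}"
  proof (intro equalityI subsetI)
    fix \<gamma> assume "\<gamma> \<in> {\<gamma>. \<exists>e\<in>E. \<gamma> + 1 *\<^sub>R e \<in> Bdual w}"
    then obtain e where e: "e \<in> E" "\<gamma> + 1 *\<^sub>R e \<in> Bdual w" by blast
    have "\<gamma> = - e + (\<gamma> + 1 *\<^sub>R e)" by simp
    then show "\<gamma> \<in> {- e + t | e t. e \<in> E \<and> t \<in> Bdual w}" using e by blast
  next
    fix \<gamma> assume "\<gamma> \<in> {- e + t | e t. e \<in> E \<and> t \<in> Bdual w}"
    then obtain e t where et: "\<gamma> = - e + t" "e \<in> E" "t \<in> Bdual w" by blast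
    then have "\<gamma> + 1 *\<^sub>R e \<in> Bdual w" by simp
    then show "\<gamma> \<in> {\<gamma>. \<exists>e\<in>E. \<gamma> + 1 *\<^sub>R e \<in> Bdual w}" using et(2) by blast
  qed
  finally show ?thesis unfolding trop_row_span .
qed

lemma edge_tangent_contribution_eq:
  "edge_tangent_contribution val X E = {e + t | e t. e \<in> E \<and> t \<in> trop val (projectivization (orth_compl (row_span I v)))}"
proof -
  have "edge_tangent_contribution val X E = {x. \<exists>e\<in>E. x + (- 1) *\<^sub>R e \<in> Btan w}"
    unfolding edge_tangent_contribution_def
    by (rule closure_contributions[OF polycone_Btan Btan_shift _ tangent_contribution_inner]) simp_all
  also have "\<dots> = {e + t | e t. e \<in> E \<and> t \<in> Btan w}"
  proof (intro equalityI subsetI)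
    fix x assume "x \<in> {x. \<exists>e\<in>E. x + (- 1) *\<^sub>R e \<in> Btan w}"
    then obtain e where e: "e \<in> E" "x + (- 1) *\<^sub>R e \<in> Btan w" by blast
    have "x = e + (x + (- 1) *\<^sub>R e)" by simp
    then show "x \<in> {e + t | e t. e \<in> E \<and> t \<in> Btan w}" using e by blast
  next
    fix x assume "x \<in> {e + t | e t. e \<in> E \<and> t \<in> Btan w}"
    then obtain e t where et: "x = e + t" "e \<in> E" "t \<in> Btan w" by blast
    then have "x + (- 1) *\<^sub>R e \<in> Btan w" by simp
    then show "x \<in> {x. \<exists>e\<in>E. x + (- 1) *\<^sub>R e \<in> Btan w}" using et(2) by blast
  qed
  finally show ?thesis unfolding trop_orth_compl .
qed

end

theorem proposition5p3p1:
  fixes val :: "'k::{alg_closed_field, field_char_0} \<Rightarrow> ereal"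
    and n :: nat
    and X :: "('k ^ 'n::finite) set"
    and f :: "nat \<Rightarrow> ('n, 'k) laurent"
    and E :: "(real ^ 'n) set"
    and v :: "nat \<Rightarrow> int ^ 'n"
    and L :: "('k ^ 'n) set"
  assumes "nonarch_valuation val"
    and "CARD('n) = n + 1" and "n \<ge> 1"
    and "proj_curve X"
    and "\<forall>i\<in>{1..<n}. torus_hypersurface_eq (f i)"
    and "torus_complete_intersection {1..<n} f (X \<inter> torus)"
    and "tropical_complete_intersection val {1..<n} f"
    and "\<forall>i\<in>{1..<n}. \<forall>C\<in>trop_codim_one_cells val (f i).
           \<forall>w\<in>rel_interior C. card (min_terms val (f i) w) = 3"
    and "E \<in> trop_ci_edges val {1..<n} f"
    and "\<forall>i\<in>{1..<n}. edge_exponent val (f i) E (v i)"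
    and "\<forall>J. card J = 2 \<longrightarrow>
           direction_span E \<inter> coord_span (- J) = span {1} \<or>
           direction_span (trop val X) \<subseteq> coord_span (- J)"
    and "L = row_span {1..<n} v"
  shows "edge_dual_contribution val X E
           = {- e + t | e t. e \<in> E \<and> t \<in> trop val (projectivization L)}
       \<and> edge_tangent_contribution val X E
           = {e + t | e t. e \<in> E \<and> t \<in> trop val (projectivization (orth_compl L))}"
proof -
  let ?I = "{1..<n}"
  interpret valued_field val by unfold_locales (rule assms(1))
  have I: "finite ?I" "card ?I + 2 = CARD('n)" using assms(2,3) by simp_all
  have f: "torus_hypersurface_eq (f i)" if "i \<in> ?I" for i using assms(5) that by (rule bspec)
  have v: "edge_exponent val (f i) E (v i)" if "i \<in> ?I" for i using assms(10) that by (rule bspec)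
  show ?thesis
  proof (rule edge_polyhedron[OF I f assms(9) v])
    fix F
    assume F: "\<And>i. i \<in> ?I \<Longrightarrow> \<exists>a u. a \<noteq> 0 \<and> u \<in> char_lattice \<and> F i = Poly_Mapping.single u a * f i"
      "\<And>i. i \<in> ?I \<Longrightarrow> F i \<in> torus_functions \<and> Poly_Mapping.lookup (F i) 0 = 1 \<and> v i \<noteq> 0 \<and> v i \<in> Poly_Mapping.keys (F i)"
      and E: "E = {x. \<forall>i\<in>?I. term_val val (F i) x (v i) = 0 \<and> (\<forall>m\<in>Poly_Mapping.keys (F i). 0 \<le> term_val val (F i) x m)}"
        "rel_interior E \<noteq> {}" "convex E"
        "\<And>x i m. x \<in> rel_interior E \<Longrightarrow> i \<in> ?I \<Longrightarrow> m \<in> Poly_Mapping.keys (F i) \<Longrightarrow> m \<noteq> 0 \<Longrightarrow> m \<noteq> v i \<Longrightarrow>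
          0 < term_val val (F i) x m"
      and indep: "\<And>c. (\<Sum>i\<in>?I. c i *\<^sub>R rvec (v i)) = 0 \<Longrightarrow> \<forall>i\<in>?I. c i = 0"
    have sum0: "(\<Sum>p\<in>UNIV. v i $ p) = 0" if "i \<in> ?I" for i
      using F(2)[OF that] torus_functionsD[of "F i" "v i"] by blast
    obtain y :: "nat \<Rightarrow> int ^ 'n" and g h w D where D: "D > 0"
      and yw: "\<forall>i\<in>?I. \<forall>k\<in>?I. (\<Sum>p\<in>UNIV. v i $ p * y k $ p) = (if i = k then D else 0)"
        "\<forall>i\<in>?I. (\<Sum>p\<in>UNIV. v i $ p * w $ p) = 0"
        "\<forall>p q. (\<Sum>k\<in>?I. v k $ p * y k $ q) + g $ p + h $ p * w $ q = (if p = q then D else 0)"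
        "\<exists>p q. w $ p \<noteq> w $ q"
      using integral_duality[where v = v, OF I indep sum0] by blast
    have F': "F i \<in> torus_functions" "Poly_Mapping.lookup (F i) 0 = 1" "v i \<noteq> 0" "v i \<in> Poly_Mapping.keys (F i)"
      if "i \<in> ?I" for i
      using F(2)[OF that] by blast+
    have fT: "f i \<in> torus_functions" if "i \<in> ?I" for i
      using f[OF that] unfolding torus_hypersurface_eq_def by blast
    have vy: "(\<Sum>p\<in>UNIV. v i $ p * y k $ p) = (if i = k then D else 0)" if "i \<in> ?I" "k \<in> ?I" for i k
      using yw(1) that by blast
    have vw: "(\<Sum>p\<in>UNIV. v i $ p * w $ p) = 0" if "i \<in> ?I" for i using yw(2) that by blast
    interpret curve_edge val ?I F v y g h w D X f E
      by unfold_locales (fact I(1) F' D vy vw yw(3)[rule_format] yw(4) assms(6) fT F(1) E assms(11)[rule_format])+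
    show ?thesis unfolding assms(12)
      by (intro conjI edge_dual_contribution_eq edge_tangent_contribution_eq)
  qed
qed

end
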